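(* Let $n\geq 2$ and let $a,b\in\mathbb{C}^{2n}$ be linearly independent vectors such that $J_n\bar a$ and $b$ are orthogonal. Let $\phi:\mathbf{SU}^*(2n)/\mathbf{Sp}(n)\to\mathbb{C}$ be the eigenfunction given by $$\phi(z\cdot\mathbf{Sp}(n))=\operatorname{trace}(ab^tzJ_nz^t).$$ Then the inverse image $\phi^{-1}(\{0\})$ is a complete minimal submanifold of $\mathbf{SU}^*(2n)/\mathbf{Sp}(n)$ of codimension two.
   Context: Let $J_n=\begin{pmatrix}0&I_n\\-I_n&0\end{pmatrix}$. Then $\mathbf{SU}^*(2n)=\{z\in\mathbf{SL}_{2n}(\mathbb{C}) : zJ_n=J_n\bar z\}$, equivalently the matrices of determinant $1$ of the block form $\begin{pmatrix}z&w\\-\bar w&\bar z\end{pmatrix}$. The quaternionic unitary group is $\mathbf{Sp}(n)=\mathbf{SU}^*(2n)\cap\mathbf{U}(2n)$, a maximal compact subgroup of $\mathbf{SU}^*(2n)$. Vectors are column vectors, $t$ is transpose without conjugation, and orthogonality in $\mathbb{C}^{2n}$ is with respect to the standard Hermitian inner product. Metric: $\mathbf{GL}_{2n}(\mathbb{C})$ carries the left-invariant Riemannian metric induced by the inner product $g(Z,W)=\operatorname{Re}\operatorname{trace}(ZW^* )$ on its Lie algebra $\mathbb{C}^{2n\times 2n}$, where $W^*$ is the conjugate transpose. $\mathbf{SU}^*(2n)$ carries the induced left-invariant metric, and $\mathbf{SU}^*(2n)/\mathbf{Sp}(n)$ carries the Riemannian metric for which the natural projection $\mathbf{SU}^*(2n)\to\mathbf{SU}^*(2n)/\mathbf{Sp}(n)$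 is a Riemannian submersion; it is a non-compact Riemannian symmetric space. Eigenfunction: on a Riemannian manifold $(M,g)$, with $g$ extended complex bilinearly to the complexified tangent bundle, let $\tau(\phi)=\operatorname{div}(\nabla\phi)$ be the Laplace-Beltrami operator and $\kappa(\phi,\psi)=g(\nabla\phi,\nabla\psi)$ the conformality operator. A function $\phi:M\to\mathbb{C}$ is an eigenfunction if there are $\lambda,\mu\in\mathbb{C}$ with $\tau(\phi)=\lambda\phi$ and $\kappa(\phi,\phi)=\mu\phi^2$. *)

theory Defs
  imports "HOL-Analysis.Analysis"
begin

section \<open>Smooth maps and tangent spaces on subsets of a Euclidean space\<close>

primrec Ck_on :: "nat \<Rightarrow> 'a::euclidean_space set \<Rightarrow> ('a \<Rightarrow> 'b::euclidean_space) \<Rightarrow> bool" where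
  "Ck_on 0 V f \<longleftrightarrow> continuous_on V f"
| "Ck_on (Suc k) V f \<longleftrightarrow>
     (\<forall>x\<in>V. f differentiable (at x)) \<and> (\<forall>v. Ck_on k V (\<lambda>x. frechet_derivative f (at x) v))"

text \<open>
  A map on an arbitrary subset of a Euclidean space is smooth if it locally extends to a
  \<open>C\<^sup>\<infinity>\<close> map on an open subset of the ambient space. This is used for embedded submanifolds
  (matrix groups, submanifolds seen in a chart), relatively open subsets of linear subspaces
  (images of charts) and intervals.
\<close>

definition smooth_on :: "'a::euclidean_space set \<Rightarrow> ('a \<Rightarrow> 'b::euclidean_space) \<Rightarrow> bool" where
  "smooth_on A f \<longleftrightarrow>
     (\<forall>x\<in>A. \<exists>V F. open V \<and> x \<in> V \<and> (\<forall>k. Ck_on k V F) \<and> (\<forall>y\<in>V \<inter> A. F y = f y))"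

definition tangent_space :: "'a::euclidean_space set \<Rightarrow> 'a \<Rightarrow> 'a set" where
  "tangent_space A x =
     {v. \<exists>\<gamma>. (\<forall>t::real. \<gamma> t \<in> A) \<and> \<gamma> 0 = x \<and> (\<gamma> has_vector_derivative v) (at 0)}"

text \<open>
  The derivative of a map on \<open>A\<close> at \<open>x\<close>. Only its values on \<open>tangent_space A x\<close> are
  determined, and only those are used below.
\<close>

abbreviation deriv_on :: "'a::euclidean_space set \<Rightarrow> ('a \<Rightarrow> 'b::euclidean_space) \<Rightarrow> 'a \<Rightarrow> 'a \<Rightarrow> 'b"
  where "deriv_on A f x \<equiv> frechet_derivative f (at x within A)"

text \<open>The trace over \<open>F\<close> of a bilinear map \<open>h\<close> with respect to the inner product \<open>q\<close> on \<open>F\<close>.\<close>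

definition orthonormal_basis :: "('e::euclidean_space \<Rightarrow> 'e \<Rightarrow> real) \<Rightarrow> 'e set \<Rightarrow> 'e set \<Rightarrow> bool" where
  "orthonormal_basis q F B \<longleftrightarrow>
     finite B \<and> B \<subseteq> F \<and> F \<subseteq> span B \<and> (\<forall>b\<in>B. \<forall>b'\<in>B. q b b' = (if b = b' then 1 else 0))"

definition metric_trace ::
  "('e::euclidean_space \<Rightarrow> 'e \<Rightarrow> real) \<Rightarrow> 'e set \<Rightarrow> ('e \<Rightarrow> 'e \<Rightarrow> 'b::real_vector) \<Rightarrow> 'b" where
  "metric_trace q F h = (\<Sum>b\<in>(SOME B. orthonormal_basis q F B). h b b)"


section \<open>Riemannian manifolds\<close>

text \<open>
  Charts are pairs \<open>(U, x)\<close> of a domain and a coordinate map, with values in a linear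
  subspace \<open>model M\<close> of a Euclidean space; its dimension is the dimension of the manifold.
  The field \<open>metric M c u\<close> is the coordinate expression of the metric in the chart \<open>c\<close> at the
  coordinate point \<open>u\<close>, an inner product on \<open>model M\<close>.
\<close>

type_synonym ('a, 'e) chart = "'a set \<times> ('a \<Rightarrow> 'e)"

record ('a, 'e) riemannian =
  points :: "'a set"
  model :: "'e set"
  charts :: "('a, 'e) chart set"
  metric :: "('a, 'e) chart \<Rightarrow> 'e \<Rightarrow> 'e \<Rightarrow> 'e \<Rightarrow> real"

text \<open>
  Pointwise objects at \<open>p\<close> are computed in an arbitrary chart around \<open>p\<close>; whether a tensor
  vanishes, and the values of scalars, do not depend on that choice.
\<close>

definition chart_at :: "('a, 'e) riemannian \<Rightarrow> 'a \<Rightarrow> ('a, 'e) chart" where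
  "chart_at M p = (SOME c. c \<in> charts M \<and> p \<in> fst c)"

definition in_chart :: "('a, 'e) chart \<Rightarrow> ('a \<Rightarrow> 'b) \<Rightarrow> 'e \<Rightarrow> 'b" where
  "in_chart c f u = f (inv_into (fst c) (snd c) u)"

definition smooth_function :: "('a, 'e::euclidean_space) riemannian \<Rightarrow> ('a \<Rightarrow> 'b::euclidean_space) \<Rightarrow> bool"
  where "smooth_function M f \<longleftrightarrow> (\<forall>c\<in>charts M. smooth_on (snd c ` fst c) (in_chart c f))"

text \<open>
  The Levi-Civita connection: \<open>christoffel M c u v w\<close> is the covariant derivative at \<open>u\<close> of the
  constant coordinate field \<open>w\<close> in the direction \<open>v\<close>, given by the Koszul formula.
\<close>

definition christoffel ::
  "('a, 'e::euclidean_space) riemannian \<Rightarrow> ('a, 'e) chart \<Rightarrow> 'e \<Rightarrow> 'e \<Rightarrow> 'e \<Rightarrow> 'e" where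
  "christoffel M c u v w = (THE k. k \<in> model M \<and> (\<forall>y\<in>model M.
     2 * metric M c u k y =
         deriv_on (model M) (\<lambda>u'. metric M c u' w y) u v
       + deriv_on (model M) (\<lambda>u'. metric M c u' v y) u w
       - deriv_on (model M) (\<lambda>u'. metric M c u' v w) u y))"

text \<open>
  The covariant derivative at \<open>u\<close> in the direction \<open>v\<close> of a vector field \<open>Y\<close> that is only
  defined along the subset \<open>A\<close> of the coordinate space, where \<open>v\<close> is tangent to \<open>A\<close>.
\<close>

definition cov_deriv ::
  "('a, 'e::euclidean_space) riemannian \<Rightarrow> ('a, 'e) chart \<Rightarrow> 'e set \<Rightarrow> ('e \<Rightarrow> 'e) \<Rightarrow> 'e \<Rightarrow> 'e \<Rightarrow> 'e"
  where "cov_deriv M c A Y u v = deriv_on A Y u v + christoffel M c u v (Y u)"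


section \<open>Laplace-Beltrami operator, conformality operator, eigenfunctions\<close>

definition gradient ::
  "('a, 'e::euclidean_space) riemannian \<Rightarrow> ('a, 'e) chart \<Rightarrow> ('a \<Rightarrow> real) \<Rightarrow> 'e \<Rightarrow> 'e" where
  "gradient M c f u = (THE w. w \<in> model M \<and>
     (\<forall>v\<in>model M. metric M c u w v = deriv_on (model M) (in_chart c f) u v))"

definition divergence ::
  "('a, 'e::euclidean_space) riemannian \<Rightarrow> ('a, 'e) chart \<Rightarrow> ('e \<Rightarrow> 'e) \<Rightarrow> 'e \<Rightarrow> real" where
  "divergence M c Y u =
     metric_trace (metric M c u) (model M) (\<lambda>v w. metric M c u (cov_deriv M c (model M) Y u v) w)"

definition laplacian_real :: "('a, 'e::euclidean_space) riemannian \<Rightarrow> ('a \<Rightarrow> real) \<Rightarrow> 'a \<Rightarrow> real" where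
  "laplacian_real M f p =
     (let c = chart_at M p in divergence M c (gradient M c f) (snd c p))"

definition conformality_real ::
  "('a, 'e::euclidean_space) riemannian \<Rightarrow> ('a \<Rightarrow> real) \<Rightarrow> ('a \<Rightarrow> real) \<Rightarrow> 'a \<Rightarrow> real" where
  "conformality_real M f h p =
     (let c = chart_at M p; u = snd c p in metric M c u (gradient M c f u) (gradient M c h u))"

text \<open>The complex linear, respectively complex bilinear, extensions to complex valued functions.\<close>

definition laplacian :: "('a, 'e::euclidean_space) riemannian \<Rightarrow> ('a \<Rightarrow> complex) \<Rightarrow> 'a \<Rightarrow> complex" where
  "laplacian M \<phi> p =
     Complex (laplacian_real M (\<lambda>q. Re (\<phi> q)) p) (laplacian_real M (\<lambda>q. Im (\<phi> q)) p)"

definition conformality ::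
  "('a, 'e::euclidean_space) riemannian \<Rightarrow> ('a \<Rightarrow> complex) \<Rightarrow> ('a \<Rightarrow> complex) \<Rightarrow> 'a \<Rightarrow> complex" where
  "conformality M \<phi> \<psi> p =
     (let \<kappa> = (\<lambda>f h. conformality_real M f h p);
          \<phi>1 = (\<lambda>q. Re (\<phi> q)); \<phi>2 = (\<lambda>q. Im (\<phi> q));
          \<psi>1 = (\<lambda>q. Re (\<psi> q)); \<psi>2 = (\<lambda>q. Im (\<psi> q))
      in Complex (\<kappa> \<phi>1 \<psi>1 - \<kappa> \<phi>2 \<psi>2) (\<kappa> \<phi>1 \<psi>2 + \<kappa> \<phi>2 \<psi>1))"

definition eigenfunction :: "('a, 'e::euclidean_space) riemannian \<Rightarrow> ('a \<Rightarrow> complex) \<Rightarrow> bool" where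
  "eigenfunction M \<phi> \<longleftrightarrow> smooth_function M \<phi> \<and>
     (\<exists>l \<mu>. \<forall>p\<in>points M. laplacian M \<phi> p = l * \<phi> p \<and> conformality M \<phi> \<phi> p = \<mu> * (\<phi> p)\<^sup>2)"


section \<open>Complete minimal submanifolds\<close>

text \<open>Embedded submanifolds of codimension \<open>k\<close>, by slice charts.\<close>

definition submanifold :: "('a, 'e::euclidean_space) riemannian \<Rightarrow> 'a set \<Rightarrow> nat \<Rightarrow> bool" where
  "submanifold M S k \<longleftrightarrow> S \<subseteq> points M \<and>
     (\<forall>p\<in>S. \<exists>(U, x)\<in>charts M. p \<in> U \<and>
        (\<exists>F. subspace F \<and> F \<subseteq> model M \<and> dim F + k = dim (model M) \<and> x ` (U \<inter> S) = x ` U \<inter> F))"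

text \<open>
  The second fundamental form of \<open>S\<close> at \<open>p\<close>, in coordinates: the normal part of the ambient
  covariant derivative in the direction \<open>v\<close> of a local tangent vector field \<open>Y\<close> of \<open>S\<close> with
  value \<open>w\<close> at \<open>p\<close>.
\<close>

definition second_fundamental_form ::
  "('a, 'e::euclidean_space) riemannian \<Rightarrow> 'a set \<Rightarrow> 'a \<Rightarrow> 'e \<Rightarrow> 'e \<Rightarrow> 'e" where
  "second_fundamental_form M S p v w =
     (let c = chart_at M p; u = snd c p; A = snd c ` (fst c \<inter> S); T = tangent_space A u in
      THE n. n \<in> model M \<and> (\<forall>y\<in>T. metric M c u n y = 0) \<and>
        (\<exists>V Y. open V \<and> u \<in> V \<and> smooth_on (V \<inter> A) Y \<and>
           (\<forall>q\<in>V \<inter> A. Y q \<in> tangent_space A q) \<and> Y u = w \<and>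
           cov_deriv M c A Y u v - n \<in> T))"

definition mean_curvature :: "('a, 'e::euclidean_space) riemannian \<Rightarrow> 'a set \<Rightarrow> 'a \<Rightarrow> 'e" where
  "mean_curvature M S p =
     (let c = chart_at M p; u = snd c p in
      metric_trace (metric M c u) (tangent_space (snd c ` (fst c \<inter> S)) u)
        (second_fundamental_form M S p))"

definition minimal_submanifold :: "('a, 'e::euclidean_space) riemannian \<Rightarrow> 'a set \<Rightarrow> nat \<Rightarrow> bool" where
  "minimal_submanifold M S k \<longleftrightarrow> submanifold M S k \<and> (\<forall>p\<in>S. mean_curvature M S p = 0)"

text \<open>
  Smooth curves in \<open>S\<close>. Since they are allowed to have zero velocity, they give the same
  distance as piecewise smooth curves.
\<close>

definition smooth_curve :: "('a, 'e::euclidean_space) riemannian \<Rightarrow> 'a set \<Rightarrow> (real \<Rightarrow> 'a) \<Rightarrow> bool" where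
  "smooth_curve M S \<gamma> \<longleftrightarrow> \<gamma> ` {0..1} \<subseteq> S \<and>
     (\<forall>(U, x)\<in>charts M. openin (top_of_set {0..1}) ({0..1} \<inter> \<gamma> -` U) \<and>
        smooth_on ({0..1} \<inter> \<gamma> -` U) (x \<circ> \<gamma>))"

definition speed :: "('a, 'e::euclidean_space) riemannian \<Rightarrow> (real \<Rightarrow> 'a) \<Rightarrow> real \<Rightarrow> real" where
  "speed M \<gamma> t =
     (let c = chart_at M (\<gamma> t); w = vector_derivative (snd c \<circ> \<gamma>) (at t within {0..1})
      in sqrt (metric M c (snd c (\<gamma> t)) w w))"

definition curve_length :: "('a, 'e::euclidean_space) riemannian \<Rightarrow> (real \<Rightarrow> 'a) \<Rightarrow> real" where
  "curve_length M \<gamma> = integral {0..1} (speed M \<gamma>)"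

text \<open>
  The Riemannian distance of \<open>S\<close> with its induced metric; it is infinite between points in
  different components.
\<close>

definition induced_dist :: "('a, 'e::euclidean_space) riemannian \<Rightarrow> 'a set \<Rightarrow> 'a \<Rightarrow> 'a \<Rightarrow> ereal" where
  "induced_dist M S p q =
     (INF \<gamma>\<in>{\<gamma>. smooth_curve M S \<gamma> \<and> \<gamma> 0 = p \<and> \<gamma> 1 = q}. ereal (curve_length M \<gamma>))"

definition complete_submanifold :: "('a, 'e::euclidean_space) riemannian \<Rightarrow> 'a set \<Rightarrow> bool" where
  "complete_submanifold M S \<longleftrightarrow>
     (\<forall>X. (\<forall>n::nat. X n \<in> S) \<and>
          (\<forall>\<epsilon>>0. \<exists>N. \<forall>m\<ge>N. \<forall>n\<ge>N. induced_dist M S (X m) (X n) < ereal \<epsilon>) \<longrightarrow>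
        (\<exists>l\<in>S. (\<lambda>n. induced_dist M S (X n) l) \<longlonglongrightarrow> 0))"


section \<open>The groups\<close>

text \<open>The index type \<open>'n + 'n\<close> gives the block decomposition of \<open>2n \<times> 2n\<close> matrices.\<close>

type_synonym 'n cvec = "complex ^ ('n + 'n)"
type_synonym 'n cmat = "complex ^ ('n + 'n) ^ ('n + 'n)"

definition J :: "'n::finite cmat" where
  "J = (\<chi> i j. case (i, j) of
          (Inl k, Inr l) \<Rightarrow> if k = l then 1 else 0
        | (Inr k, Inl l) \<Rightarrow> if k = l then - 1 else 0
        | _ \<Rightarrow> 0)"

definition cnj_vec :: "complex ^ 'm \<Rightarrow> complex ^ 'm" where
  "cnj_vec v = (\<chi> i. cnj (v $ i))"

definition ctranspose :: "complex ^ 'm ^ 'm \<Rightarrow> complex ^ 'm ^ 'm" where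
  "ctranspose A = transpose (map_matrix cnj A)"

definition hermitian_inner :: "complex ^ 'm \<Rightarrow> complex ^ 'm \<Rightarrow> complex" where
  "hermitian_inner v w = (\<Sum>i\<in>UNIV. v $ i * cnj (w $ i))"

definition outer :: "complex ^ 'm \<Rightarrow> complex ^ 'm \<Rightarrow> complex ^ 'm ^ 'm" where
  "outer a b = (\<chi> i j. a $ i * b $ j)"

definition SUstar :: "'n::finite cmat set" where
  "SUstar = {z. det z = 1 \<and> z ** J = J ** map_matrix cnj z}"

definition unitary_group :: "(complex ^ 'm ^ 'm) set" where
  "unitary_group = {z. z ** ctranspose z = mat 1 \<and> ctranspose z ** z = mat 1}"

definition Sp :: "'n::finite cmat set" where
  "Sp = SUstar \<inter> unitary_group"

definition coset :: "'n::finite cmat \<Rightarrow> 'n cmat set" where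
  "coset z = (\<lambda>k. z ** k) ` Sp"

text \<open>The left-invariant metric on the general linear group, at the point \<open>z\<close>.\<close>

definition gl_metric :: "complex ^ 'm ^ 'm \<Rightarrow> complex ^ 'm ^ 'm \<Rightarrow> complex ^ 'm ^ 'm \<Rightarrow> real" where
  "gl_metric z V W = Re (trace ((matrix_inv z ** V) ** ctranspose (matrix_inv z ** W)))"


section \<open>The quotient as a Riemannian manifold\<close>

text \<open>
  The orthogonal complement, in the tangent space of the group at \<open>z\<close>, of the tangent space
  of the fibre \<open>coset z\<close> through \<open>z\<close>.
\<close>

definition horizontal :: "'n::finite cmat \<Rightarrow> 'n cmat set" where
  "horizontal z =
     {V \<in> tangent_space SUstar z. \<forall>W\<in>tangent_space (coset z) z. gl_metric z V W = 0}"

text \<open>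
  The maximal atlas of the unique smooth structure on the quotient for which \<open>coset\<close> is a
  smooth submersion. The preimage of a set \<open>U\<close> of cosets under \<open>coset\<close> is \<open>\<Union>U\<close>. As model
  space we take the horizontal space at the identity, which is isomorphic to the tangent
  space of the quotient at the base point.
\<close>

definition quotient_charts :: "('n::finite cmat set, 'n cmat) chart set" where
  "quotient_charts = {(U, x).
     U \<subseteq> coset ` SUstar \<and> openin (top_of_set SUstar) (\<Union>U) \<and>
     inj_on x U \<and> openin (top_of_set (horizontal (mat 1))) (x ` U) \<and>
     smooth_on (\<Union>U) (x \<circ> coset) \<and>
     (\<forall>z\<in>\<Union>U. deriv_on SUstar (x \<circ> coset) z ` tangent_space SUstar z = horizontal (mat 1))}"

text \<open>
  The metric for which \<open>coset\<close> is a Riemannian submersion: at every point \<open>z\<close> of the fibre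
  over the point with coordinates \<open>u\<close>, the differential of \<open>coset\<close> restricts to an isometry on
  \<open>horizontal z\<close>. As \<open>gl_metric\<close> is invariant under right translation by unitary matrices,
  the result does not depend on the choice of \<open>z\<close>.
\<close>

definition horizontal_lift ::
  "('n::finite cmat set, 'n cmat) chart \<Rightarrow> 'n cmat \<Rightarrow> 'n cmat \<Rightarrow> 'n cmat" where
  "horizontal_lift c z v = (THE V. V \<in> horizontal z \<and> deriv_on SUstar (snd c \<circ> coset) z V = v)"

definition quotient_metric ::
  "('n::finite cmat set, 'n cmat) chart \<Rightarrow> 'n cmat \<Rightarrow> 'n cmat \<Rightarrow> 'n cmat \<Rightarrow> real" where
  "quotient_metric c u v w =
     (let z = (SOME z. z \<in> inv_into (fst c) (snd c) u)
      in gl_metric z (horizontal_lift c z v) (horizontal_lift c z w))"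

definition SUstar_mod_Sp :: "('n::finite cmat set, 'n cmat) riemannian" where
  "SUstar_mod_Sp =
     \<lparr> points = coset ` SUstar,
       model = horizontal (mat 1),
       charts = quotient_charts,
       metric = quotient_metric \<rparr>"


section \<open>The function \<open>z \<mapsto> trace (ab\<^sup>t z J z\<^sup>t)\<close> is constant on cosets\<close>

lemma map_matrix_cnj_mult: "map_matrix cnj (A ** B) = map_matrix cnj A ** map_matrix cnj B"
  by (simp add: vec_eq_iff matrix_matrix_mult_def)

lemma map_matrix_cnj_cnj [simp]: "map_matrix cnj (map_matrix cnj A) = A"
  by (simp add: vec_eq_iff)

lemma transpose_map_matrix_cnj: "transpose (map_matrix cnj A) = map_matrix cnj (transpose A)"
  by (simp add: vec_eq_iff transpose_def)

lemma Sp_preserves_J: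
  assumes "k \<in> Sp"
  shows "k ** J ** transpose k = J"
proof -
  have 1: "k ** J = J ** map_matrix cnj k" and 2: "k ** ctranspose k = mat 1"
    using assms by (auto simp: Sp_def SUstar_def unitary_group_def)
  have "map_matrix cnj (k ** ctranspose k) = map_matrix cnj (mat 1 :: 'a cmat)"
    by (simp add: 2)
  also have "map_matrix cnj (mat 1 :: 'a cmat) = mat 1"
    by (simp add: vec_eq_iff mat_def)
  finally have "map_matrix cnj k ** transpose k = mat 1"
    by (simp only: map_matrix_cnj_mult ctranspose_def transpose_map_matrix_cnj map_matrix_cnj_cnj)
  then show ?thesis
    by (metis 1 matrix_mul_assoc matrix_mul_rid)
qed

lemma mat_1_in_Sp: "(mat 1 :: 'n::finite cmat) \<in> Sp"
proof -
  have 1: "map_matrix cnj (mat 1 :: 'n cmat) = mat 1"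
    by (simp add: vec_eq_iff mat_def)
  then have "ctranspose (mat 1 :: 'n cmat) = mat 1"
    by (simp add: ctranspose_def transpose_mat)
  with 1 show ?thesis
    by (simp add: Sp_def SUstar_def unitary_group_def)
qed

lemma trace_coset_well_defined:
  fixes a b :: "'n::finite cvec"
  assumes "coset z = coset w"
  shows "trace (outer a b ** z ** J ** transpose z) = trace (outer a b ** w ** J ** transpose w)"
proof -
  have "z \<in> coset z"
    unfolding coset_def using mat_1_in_Sp by (metis image_eqI matrix_mul_rid)
  then obtain k where k: "k \<in> Sp" "z = w ** k"
    using assms by (auto simp: coset_def)
  have "z ** J ** transpose z = w ** (k ** J ** transpose k) ** transpose w"
    by (simp only: k matrix_transpose_mul matrix_mul_assoc)
  also have "\<dots> = w ** J ** transpose w"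
    by (simp only: Sp_preserves_J [OF k(1)])
  finally have "outer a b ** (z ** J ** transpose z) = outer a b ** (w ** J ** transpose w)"
    by (rule arg_cong)
  then show ?thesis
    by (simp only: matrix_mul_assoc)
qed

end

theory Submission
  imports Defs
begin

text \<open>
  The quotient is identified with the cone \<open>Pos\<close> of positive definite quaternionic Hermitian
  matrices of determinant one via \<open>z Sp(n) \<mapsto> P = z z\<^sup>*\<close>; the metric becomes
  \<open>Re tr (P\<^sup>-\<^sup>1 A P\<^sup>-\<^sup>1 B) / 4\<close> and the eigenfunction becomes the linear function
  \<open>\<phi> = tr (P L)\<close> with \<open>L = J a b\<^sup>t\<close>. At \<open>P = z z\<^sup>*\<close> everything is expressed through the rank-one matrix
  \<open>M = z\<^sup>* L z\<close>. Summing over an orthonormal basis of the trace-free Hermitian matrices \<open>X\<close> gives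
  \<open>\<Sum> tr (M X\<^sup>2) = k tr M\<close> and \<open>\<Sum> (tr (M X))\<^sup>2 = m (tr M)\<^sup>2\<close>, which are the eigenfunction equations.
  On the zero set \<open>tr M = 0\<close>, and the normal space is spanned by the real and imaginary parts of the
  projection \<open>G\<close> of \<open>M\<close>; orthogonality of \<open>J (cnj a)\<close> and \<open>b\<close> gives \<open>tr L = 0\<close> and independence gives \<open>G \<noteq> 0\<close>.
  The mean curvature is the trace over the tangent space of \<open>tr (M X\<^sup>2)\<close>, which vanishes because
  \<open>G M + M G = 0\<close>. For completeness, \<open>ln (v\<^sup>* P v)\<close> is 2-Lipschitz along curves, so Cauchy sequences
  converge in \<open>Pos\<close>, and the zero set is closed there.
\<close>

section \<open>Calculus of smooth maps\<close>

text \<open>The atlas is maximal and \<open>chart_at\<close> may pick any of its charts, so nothing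
  can be computed in one convenient chart. Each chart is compared with the cone by maps
  \<open>Pc\<close> and \<open>crd\<close> that live on open sets of matrices, where ordinary
  derivatives exist; curves decide which of their values count. On the cone the Levi-Civita
  connection is flat differentiation minus the symmetrised product \<open>half_bracket\<close>, and
  for a linear function this correction is the whole Hessian. One global chart does matter:
  rescaling P to constant trace instead of determinant one makes the cone a convex open piece of a
  linear space and, as tr L = 0, the zero set a linear slice of it. This yields both the slice
  charts and the joining segments. That every P is some \<open>gram z\<close> is proved without
  square roots: the image of \<open>gram\<close> is open by the inverse function theorem, closed by
  compactness, and the convex cone is connected. Rank one survives the passage from L to M, and J is
  alternating, so a product of M with its own projection is a multiple of M. This is the source of
  the identity for the squares of tr (M X) and of G M + M G = 0.\<close>

definition Cinf :: "'a::euclidean_space set \<Rightarrow> ('a \<Rightarrow> 'b::euclidean_space) \<Rightarrow> bool" where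
  "Cinf V f \<longleftrightarrow> (\<forall>k. Ck_on k V f)"

lemma Ck_on_subset: "Ck_on k V f \<Longrightarrow> W \<subseteq> V \<Longrightarrow> Ck_on k W f"
  by (induction k arbitrary: f) (auto intro: continuous_on_subset)

lemma Ck_on_cong:
  assumes "open V" "\<And>x. x \<in> V \<Longrightarrow> f x = g x" "Ck_on k V f"
  shows "Ck_on k V g"
  using assms(2,3)
proof (induction k arbitrary: f g)
  case 0
  then show ?case by (auto cong: continuous_on_cong)
next
  case (Suc k)
  have d: "f differentiable (at x)" if "x \<in> V" for x using Suc.prems that by simp
  have "g differentiable (at x)" if "x \<in> V" for x
    by (rule differentiableI[OF has_derivative_transform_within_open[OF
          d[OF that, unfolded frechet_derivative_works] assms(1) that]]) (rule Suc.prems(1))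
  moreover have "frechet_derivative f (at x) = frechet_derivative g (at x)" if "x \<in> V" for x
    by (rule frechet_derivative_transform_within_open[OF d[OF that] assms(1) that Suc.prems(1)])
  then have "Ck_on k V (\<lambda>x. frechet_derivative g (at x) v)" for v
    using Suc.IH[of "\<lambda>x. frechet_derivative f (at x) v" "\<lambda>x. frechet_derivative g (at x) v"] Suc.prems(2) by simp
  ultimately show ?case by simp
qed

lemma Ck_on_SucI:
  assumes "open V" "\<And>x. x \<in> V \<Longrightarrow> (f has_derivative D x) (at x)" "\<And>v. Ck_on k V (\<lambda>x. D x v)"
  shows "Ck_on (Suc k) V f"
proof -
  have "Ck_on k V (\<lambda>x. frechet_derivative f (at x) v)" for v
    by (rule Ck_on_cong[OF assms(1) _ assms(3)[of v]]) (simp add: frechet_derivative_at[OF assms(2), symmetric])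
  then show ?thesis using differentiableI[OF assms(2)] by simp
qed

lemma Ck_on_SucD: "Ck_on (Suc k) V f \<Longrightarrow> Ck_on k V f"
proof (induction k arbitrary: f)
  case 0
  then show ?case by (simp add: continuous_on_eq_continuous_within continuous_at_imp_continuous_at_within differentiable_imp_continuous_within)
next
  case (Suc k)
  have "Ck_on k V (\<lambda>x. frechet_derivative f (at x) v)" for v
    by (rule Suc.IH) (use Suc.prems in simp)
  then show ?case using Suc.prems by simp
qed

lemma Ck_on_continuous: "Ck_on k V f \<Longrightarrow> continuous_on V f"
proof (induction k)
  case (Suc k)
  then show ?case using Ck_on_SucD by blast
qed simp

lemma Ck_on_has_derivative:
  "Ck_on (Suc k) V f \<Longrightarrow> x \<in> V \<Longrightarrow> (f has_derivative frechet_derivative f (at x)) (at x)"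
  by (simp add: frechet_derivative_works)

lemma Ck_on_local:
  assumes "\<And>x. x \<in> V \<Longrightarrow> \<exists>W. open W \<and> x \<in> W \<and> Ck_on k W f"
  shows "Ck_on k V f"
  using assms
proof (induction k arbitrary: f)
  case 0
  have "isCont f x" if "x \<in> V" for x using 0[OF that] continuous_on_eq_continuous_at by auto
  then show ?case by (simp add: continuous_at_imp_continuous_on)
next
  case (Suc k)
  have "Ck_on k V (\<lambda>x. frechet_derivative f (at x) v)" for v
  proof (rule Suc.IH)
    fix x assume "x \<in> V"
    then obtain W where "open W" "x \<in> W" "Ck_on (Suc k) W f" using Suc.prems by blast
    then show "\<exists>W. open W \<and> x \<in> W \<and> Ck_on k W (\<lambda>x. frechet_derivative f (at x) v)" by auto
  qed
  moreover have "f differentiable (at x)" if "x \<in> V" for x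
  proof -
    obtain W where "open W" "x \<in> W" "Ck_on (Suc k) W f" using Suc.prems \<open>x \<in> V\<close> by blast
    then show ?thesis by simp
  qed
  ultimately show ?case by simp
qed

lemma Ck_on_const: "Ck_on k V (\<lambda>x. c)"
  by (induction k arbitrary: c) auto

lemma Ck_on_linear:
  assumes "bounded_linear f" "open V" shows "Ck_on k V f"
proof (cases k)
  case 0
  then show ?thesis using assms by (simp add: linear_continuous_on)
next
  case (Suc m)
  show ?thesis unfolding Suc
    by (rule Ck_on_SucI[where D="\<lambda>x. f"]) (auto simp: assms bounded_linear_imp_has_derivative Ck_on_const)
qed

lemma Ck_on_add:
  assumes "open V" "Ck_on k V f" "Ck_on k V g" shows "Ck_on k V (\<lambda>x. f x + g x)"
  using assms(2,3)
proof (induction k arbitrary: f g)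
  case 0 then show ?case by (simp add: continuous_on_add)
next
  case (Suc k)
  show ?case
    by (rule Ck_on_SucI[OF assms(1), where D="\<lambda>x v. frechet_derivative f (at x) v + frechet_derivative g (at x) v"])
      (use Suc in \<open>auto intro!: has_derivative_add simp: frechet_derivative_works\<close>)
qed

lemma Ck_on_sum:
  assumes "open V" "\<And>i. i \<in> I \<Longrightarrow> Ck_on k V (f i)" shows "Ck_on k V (\<lambda>x. \<Sum>i\<in>I. f i x)"
  using assms(2) by (induction I rule: infinite_finite_induct) (auto simp: Ck_on_const intro!: Ck_on_add[OF assms(1)])

lemma Ck_on_bilinear:
  assumes "open V" "bounded_bilinear p" "Ck_on k V f" "Ck_on k V g"
  shows "Ck_on k V (\<lambda>x. p (f x) (g x))"
  using assms(3,4)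
proof (induction k arbitrary: f g)
  case 0 then show ?case by (simp add: bounded_bilinear.continuous_on[OF assms(2)])
next
  case (Suc k)
  have "Ck_on k V f" "Ck_on k V g" using Suc.prems Ck_on_SucD by blast+
  then show ?case
    by (intro Ck_on_SucI[OF assms(1), where D="\<lambda>x v. p (f x) (frechet_derivative g (at x) v) + p (frechet_derivative f (at x) v) (g x)"])
      (use Suc in \<open>auto intro!: bounded_bilinear.FDERIV[OF assms(2)] Ck_on_add[OF assms(1)] simp: frechet_derivative_works\<close>)
qed

text \<open>The chain rule applies the derivative of \<open>f\<close> in a direction that moves with
  \<open>x\<close>, whereas \<open>Ck_on\<close> only speaks of fixed directions. Expanding in
  \<open>Basis\<close> gives a sum of coordinates of the derivative of \<open>g\<close> times
  partial derivatives of \<open>f\<close> composed with \<open>g\<close>, to which the induction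
  hypothesis applies.\<close>

lemma Ck_on_compose:
  assumes "open V" "open W" "Ck_on k W f" "Ck_on k V g" "g ` V \<subseteq> W"
  shows "Ck_on k V (\<lambda>x. f (g x))"
  using assms(3,4)
proof (induction k arbitrary: f)
  case 0
  then show ?case using continuous_on_compose2[OF _ _ assms(5)] by simp
next
  case (Suc k)
  have fd: "(f has_derivative frechet_derivative f (at y)) (at y)" if "y \<in> W" for y
    using Suc.prems(1) that by (simp add: frechet_derivative_works)
  have gd: "(g has_derivative frechet_derivative g (at x)) (at x)" if "x \<in> V" for x
    using Suc.prems(2) that by (simp add: frechet_derivative_works)
  have lin: "frechet_derivative f (at y) v = (\<Sum>e\<in>Basis. (v \<bullet> e) *\<^sub>R frechet_derivative f (at y) e)" if "y \<in> W" for y v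
  proof -
    interpret linear "frechet_derivative f (at y)" using fd[OF that] has_derivative_linear by blast
    have "frechet_derivative f (at y) v = frechet_derivative f (at y) (\<Sum>e\<in>Basis. (v \<bullet> e) *\<^sub>R e)"
      by (simp add: euclidean_representation)
    also have "\<dots> = (\<Sum>e\<in>Basis. (v \<bullet> e) *\<^sub>R frechet_derivative f (at y) e)"
      by (simp add: sum scale)
    finally show ?thesis .
  qed
  show ?case
  proof (rule Ck_on_SucI[OF assms(1), where D="\<lambda>x v. \<Sum>e\<in>Basis. (frechet_derivative g (at x) v \<bullet> e) *\<^sub>R frechet_derivative f (at (g x)) e"])
    fix x assume x: "x \<in> V"
    then have gx: "g x \<in> W" using assms(5) by auto
    have "((\<lambda>x. f (g x)) has_derivative (\<lambda>v. frechet_derivative f (at (g x)) (frechet_derivative g (at x) v))) (at x)"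
      using diff_chain_at[OF gd[OF x] fd[OF gx]] by (simp add: o_def)
    then show "((\<lambda>x. f (g x)) has_derivative (\<lambda>v. \<Sum>e\<in>Basis. (frechet_derivative g (at x) v \<bullet> e) *\<^sub>R frechet_derivative f (at (g x)) e)) (at x)"
      by (simp only: lin[OF gx, symmetric])
  next
    fix v
    have "Ck_on k V (\<lambda>x. frechet_derivative g (at x) v \<bullet> e)" for e
      using Suc.prems(2) by (intro Ck_on_bilinear[OF assms(1) bounded_bilinear_inner] Ck_on_const) auto
    moreover have "Ck_on k V (\<lambda>x. frechet_derivative f (at (g x)) e)" for e
      by (rule Suc.IH) (use Suc.prems(1) Ck_on_SucD[OF Suc.prems(2)] in auto)
    ultimately show "Ck_on k V (\<lambda>x. \<Sum>e\<in>Basis. (frechet_derivative g (at x) v \<bullet> e) *\<^sub>R frechet_derivative f (at (g x)) e)"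
      by (intro Ck_on_sum Ck_on_bilinear[OF assms(1) bounded_bilinear_scaleR] assms(1))
  qed
qed

lemma Ck_on_powr: "Ck_on k {0<..} (\<lambda>t::real. t powr r)"
proof (induction k arbitrary: r)
  case 0
  then show ?case by (auto intro!: continuous_intros)
next
  case (Suc k)
  show ?case
  proof (rule Ck_on_SucI[where D="\<lambda>t h. (r * h) *\<^sub>R (t powr (r - 1))"])
    fix t :: real assume "t \<in> {0<..}"
    then have "((\<lambda>t. t powr r) has_real_derivative r * t powr (r - 1)) (at t)"
      by (intro has_real_derivative_powr) auto
    then show "((\<lambda>t. t powr r) has_derivative (\<lambda>h. (r * h) *\<^sub>R (t powr (r - 1)))) (at t)"
      unfolding has_field_derivative_def by (simp add: mult_ac mult_commute_abs)
  qed (simp, intro Ck_on_bilinear[OF _ bounded_bilinear_scaleR] Ck_on_const Suc.IH open_greaterThan)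
qed

lemma Cinf_subset: "Cinf V f \<Longrightarrow> W \<subseteq> V \<Longrightarrow> Cinf W f"
  unfolding Cinf_def using Ck_on_subset by blast

lemma Cinf_cong: "open V \<Longrightarrow> (\<And>x. x \<in> V \<Longrightarrow> f x = g x) \<Longrightarrow> Cinf V f \<Longrightarrow> Cinf V g"
  unfolding Cinf_def using Ck_on_cong by blast

lemma Cinf_continuous: "Cinf V f \<Longrightarrow> continuous_on V f"
  unfolding Cinf_def using Ck_on_continuous by blast

lemma Cinf_has_derivative:
  "Cinf V f \<Longrightarrow> x \<in> V \<Longrightarrow> (f has_derivative frechet_derivative f (at x)) (at x)"
  unfolding Cinf_def using Ck_on_has_derivative by blast

lemma Cinf_frechet: "Cinf V f \<Longrightarrow> Cinf V (\<lambda>x. frechet_derivative f (at x) v)"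
proof -
  assume "Cinf V f"
  then have "Ck_on (Suc k) V f" for k unfolding Cinf_def by blast
  then show ?thesis unfolding Cinf_def by simp
qed

lemma Cinf_local:
  "(\<And>x. x \<in> V \<Longrightarrow> \<exists>W. open W \<and> x \<in> W \<and> Cinf W f) \<Longrightarrow> Cinf V f"
  unfolding Cinf_def by (meson Ck_on_local)

lemma Cinf_const: "Cinf V (\<lambda>x. c)"
  unfolding Cinf_def using Ck_on_const by blast

lemma Cinf_linear: "linear f \<Longrightarrow> open V \<Longrightarrow> Cinf V f"
  unfolding Cinf_def using Ck_on_linear linear_conv_bounded_linear by blast

lemma Cinf_ident: "open V \<Longrightarrow> Cinf V (\<lambda>x. x)"
  by (rule Cinf_linear) (simp add: linear_iff)

lemma Cinf_add: "open V \<Longrightarrow> Cinf V f \<Longrightarrow> Cinf V g \<Longrightarrow> Cinf V (\<lambda>x. f x + g x)"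
  unfolding Cinf_def using Ck_on_add[of V _ f g] by blast

lemma Cinf_sum: "open V \<Longrightarrow> (\<And>i. i \<in> I \<Longrightarrow> Cinf V (f i)) \<Longrightarrow> Cinf V (\<lambda>x. \<Sum>i\<in>I. f i x)"
  unfolding Cinf_def using Ck_on_sum[of V I _ f] by blast

lemma Cinf_bilinear:
  "open V \<Longrightarrow> bounded_bilinear p \<Longrightarrow> Cinf V f \<Longrightarrow> Cinf V g \<Longrightarrow> Cinf V (\<lambda>x. p (f x) (g x))"
  unfolding Cinf_def using Ck_on_bilinear[of V p _ f g] by blast

lemma Cinf_compose:
  "open V \<Longrightarrow> open W \<Longrightarrow> Cinf W f \<Longrightarrow> Cinf V g \<Longrightarrow> g ` V \<subseteq> W \<Longrightarrow> Cinf V (\<lambda>x. f (g x))"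
  unfolding Cinf_def using Ck_on_compose[of V W _ f g] by blast

lemma Cinf_linear_compose:
  assumes "linear f" "open V" "Cinf V g" shows "Cinf V (\<lambda>x. f (g x))"
  by (rule Cinf_compose[OF assms(2) open_UNIV Cinf_linear[OF assms(1) open_UNIV] assms(3)]) simp

lemma Cinf_diff: "open V \<Longrightarrow> Cinf V f \<Longrightarrow> Cinf V g \<Longrightarrow> Cinf V (\<lambda>x. f x - g x)"
  using Cinf_add[of V f "\<lambda>x. - g x"] Cinf_linear_compose[of uminus V g] by (simp add: linear_uminus)

lemma Cinf_scaleR:
  "open V \<Longrightarrow> Cinf V f \<Longrightarrow> Cinf V g \<Longrightarrow> Cinf V (\<lambda>x. f x *\<^sub>R g x)"
  by (rule Cinf_bilinear[OF _ bounded_bilinear_scaleR])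

lemma Cinf_mult:
  fixes f g :: "'a::euclidean_space \<Rightarrow> complex"
  shows "open V \<Longrightarrow> Cinf V f \<Longrightarrow> Cinf V g \<Longrightarrow> Cinf V (\<lambda>x. f x * g x)"
  by (rule Cinf_bilinear[OF _ bounded_bilinear_mult])

lemma Cinf_prod:
  fixes f :: "'i \<Rightarrow> 'a::euclidean_space \<Rightarrow> complex"
  assumes "open V" "\<And>i. i \<in> I \<Longrightarrow> Cinf V (f i)" shows "Cinf V (\<lambda>x. \<Prod>i\<in>I. f i x)"
  using assms(2) by (induction I rule: infinite_finite_induct) (auto simp: Cinf_const intro!: Cinf_mult[OF assms(1)])

lemma Cinf_powr:
  assumes "open V" "Cinf V f" "\<And>x. x \<in> V \<Longrightarrow> (f x :: real) > 0"
  shows "Cinf V (\<lambda>x. f x powr r)"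
  by (rule Cinf_compose[OF assms(1) _ _ assms(2), of "{0<..}"])
    (use assms(3) in \<open>auto simp: Cinf_def Ck_on_powr\<close>)

section \<open>Derivatives in moving directions and smooth inverses\<close>

lemma frechet_derivative_sum_Basis:
  assumes "(f has_derivative D) (at x)"
  shows "D v = (\<Sum>e\<in>Basis. (v \<bullet> e) *\<^sub>R D e)"
proof -
  interpret linear D using assms has_derivative_linear by blast
  have "D v = D (\<Sum>e\<in>Basis. (v \<bullet> e) *\<^sub>R e)" by (simp add: euclidean_representation)
  then show ?thesis by (simp add: sum scale)
qed

text \<open>The direction itself varies, so it is expanded in \<open>Basis\<close> as in the chain
  rule. This carries vector fields on the cone into a chart through the derivative of
  \<open>crd\<close>.\<close>

lemma Cinf_frechet_apply:
  assumes "open V" "open W" "Cinf W f" "Cinf V g" "g ` V \<subseteq> W" "Cinf V h"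
  shows "Cinf V (\<lambda>x. frechet_derivative f (at (g x)) (h x))"
proof -
  have 1: "Cinf V (\<lambda>x. \<Sum>e\<in>Basis. (h x \<bullet> e) *\<^sub>R frechet_derivative f (at (g x)) e)"
    by (intro Cinf_sum Cinf_scaleR Cinf_bilinear[OF assms(1) bounded_bilinear_inner] Cinf_const
        Cinf_compose[OF assms(1,2) Cinf_frechet[OF assms(3)] assms(4,5)] assms)
  show ?thesis
    by (rule Cinf_cong[OF assms(1) _ 1])
      (use frechet_derivative_sum_Basis[OF Cinf_has_derivative[OF assms(3)]] assms(5) in auto)
qed

text \<open>Differentiability of the inverse family is read off from the inverse of the fibrewise
  linear map \<open>(y, w) \<mapsto> (y, A y w)\<close>.\<close>

lemma inverse_family_has_derivative:
  fixes A K :: "'a::euclidean_space \<Rightarrow> 'b::euclidean_space \<Rightarrow> 'b"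
  assumes V: "open V" and A: "\<And>w. Cinf V (\<lambda>y. A y w)" and lin: "\<And>y. y \<in> V \<Longrightarrow> linear (A y)"
    and KA: "\<And>y w. y \<in> V \<Longrightarrow> K y (A y w) = w" and y: "y \<in> V"
  shows "((\<lambda>y. K y w) has_derivative (\<lambda>h. - K y (frechet_derivative (\<lambda>y'. A y' (K y w)) (at y) h))) (at y)"
proof -
  \<comment> \<open>Finite dimension turns the left inverse into a two-sided one.\<close>
  have AK: "A y (K y w) = w" if "y \<in> V" for y w
  proof -
    have "inj (A y)" by (metis KA injI that)
    then have "surj (A y)" using linear_injective_imp_surjective[OF lin[OF that]] by blast
    then obtain w' where "w = A y w'" by blast
    then show ?thesis using KA[OF that] by simp
  qed
  have Klin: "linear (K y)" if "y \<in> V" for y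
  proof (rule linearI)
    interpret L: linear "A y" by (rule lin[OF that])
    show "K y (b1 + b2) = K y b1 + K y b2" for b1 b2
      by (metis AK KA L.add that)
    show "K y (r *\<^sub>R b) = r *\<^sub>R K y b" for r b
      by (metis AK KA L.scale that)
  qed
  define D where "D y h w = (\<Sum>e\<in>Basis. (w \<bullet> e) *\<^sub>R frechet_derivative (\<lambda>y. A y e) (at y) h)" for y h w
  have AB: "A y w = (\<Sum>e\<in>Basis. (w \<bullet> e) *\<^sub>R A y e)" if "y \<in> V" for y w
  proof -
    interpret L: linear "A y" by (rule lin[OF that])
    have "A y w = A y (\<Sum>e\<in>Basis. (w \<bullet> e) *\<^sub>R e)" by (simp add: euclidean_representation)
    then show ?thesis by (simp add: L.sum L.scale)
  qed
  let ?F = "\<lambda>(y, w). (y, A y w)" and ?G = "\<lambda>(y, w). (y, K y w)"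
  let ?F' = "\<lambda>(y, w) (h, k). (h, D y h w + A y k)"
  have Ad: "((\<lambda>y. A y e) has_derivative frechet_derivative (\<lambda>y. A y e) (at y)) (at y)" if "y \<in> V" for y e
    by (rule Cinf_has_derivative[OF A that])
  have "((\<lambda>q. A (fst q) (snd q)) has_derivative (\<lambda>p. D (fst z) (fst p) (snd z) + A (fst z) (snd p))) (at z)" if "fst z \<in> V" for z
  proof -
    have 1: "((\<lambda>q. A (fst q) e) has_derivative (\<lambda>p. frechet_derivative (\<lambda>y. A y e) (at (fst z)) (fst p))) (at z)" for e
      using diff_chain_at[OF has_derivative_fst[OF has_derivative_ident] Ad[OF that]] by (simp add: o_def)
    have "((\<lambda>q. \<Sum>e\<in>Basis. (snd q \<bullet> e) *\<^sub>R A (fst q) e) has_derivative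
      (\<lambda>p. \<Sum>e\<in>Basis. (snd z \<bullet> e) *\<^sub>R frechet_derivative (\<lambda>y. A y e) (at (fst z)) (fst p) + (snd p \<bullet> e) *\<^sub>R A (fst z) e)) (at z)"
      by (intro has_derivative_sum has_derivative_scaleR 1 has_derivative_inner_left has_derivative_snd has_derivative_ident)
    then have "((\<lambda>q. A (fst q) (snd q)) has_derivative
      (\<lambda>p. \<Sum>e\<in>Basis. (snd z \<bullet> e) *\<^sub>R frechet_derivative (\<lambda>y. A y e) (at (fst z)) (fst p) + (snd p \<bullet> e) *\<^sub>R A (fst z) e)) (at z)"
      by (rule has_derivative_transform_within_open[OF _ open_Times[OF V open_UNIV]])
        (use that in \<open>auto simp: mem_Times_iff AB[symmetric]\<close>)
    moreover have "(\<lambda>p. \<Sum>e\<in>Basis. (snd z \<bullet> e) *\<^sub>R frechet_derivative (\<lambda>y. A y e) (at (fst z)) (fst p) + (snd p \<bullet> e) *\<^sub>R A (fst z) e)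
        = (\<lambda>p. D (fst z) (fst p) (snd z) + A (fst z) (snd p))"
      by (simp add: D_def sum.distrib AB[OF that, symmetric])
    ultimately show ?thesis by simp
  qed
  then have Fd: "(?F has_derivative ?F' z) (at z)" if "z \<in> V \<times> UNIV" for z
    using that by (auto simp: case_prod_unfold intro!: has_derivative_Pair has_derivative_fst)
  let ?G' = "\<lambda>(h, k). (h, K y (k - D y h (K y w)))"
  have "(?G has_derivative ?G') (at (?F (y, K y w)))"
  proof (rule has_derivative_inverse_on[where S="V \<times> UNIV" and f="?F" and f'="?F'" and x="(y, K y w)" and g'="\<lambda>_. ?G'"])
    show "open (V \<times> (UNIV::'b set))" using V by (simp add: open_Times)
    show "(?F has_derivative ?F' z) (at z)" if "z \<in> V \<times> UNIV" for z by (rule Fd[OF that])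
  qed (use y KA AK in \<open>auto simp: fun_eq_iff\<close>)
  then have 2: "(?G has_derivative ?G') (at (y, w))" using AK y by simp
  have 3: "((\<lambda>y. (y, w)) has_derivative (\<lambda>h. (h, 0))) (at y)"
    by (auto intro!: derivative_eq_intros)
  have "((\<lambda>y. snd (?G (y, w))) has_derivative (\<lambda>h. snd (?G' (h, 0)))) (at y)"
    using has_derivative_snd[OF diff_chain_at[OF 3 2]] by (simp add: o_def)
  moreover have "D y h u = frechet_derivative (\<lambda>y. A y u) (at y) h" for h u
  proof -
    have "((\<lambda>y. \<Sum>e\<in>Basis. (u \<bullet> e) *\<^sub>R A y e) has_derivative (\<lambda>h. D y h u)) (at y)"
      unfolding D_def by (intro has_derivative_sum has_derivative_scaleR_right Ad y)
    then have "((\<lambda>y. A y u) has_derivative (\<lambda>h. D y h u)) (at y)"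
      by (rule has_derivative_transform_within_open[OF _ V y]) (simp add: AB[symmetric])
    then show ?thesis by (simp add: frechet_derivative_at[symmetric])
  qed
  then have "snd (?G' (h, 0)) = - K y (frechet_derivative (\<lambda>y'. A y' (K y w)) (at y) h)" for h
    by (simp add: linear_neg[OF Klin[OF y]])
  ultimately show ?thesis by simp
qed

text \<open>The formula \<open>d\<close> expresses the derivative of K through K itself and the
  derivative of A, so each degree of smoothness of K yields the next. The double sum over
  \<open>Basis\<close> involves K only through the functions sending \<open>y\<close> to
  \<open>K y w\<close> or \<open>K y e\<close> with a fixed second argument, for which the induction
  hypothesis is available.\<close>

lemma Cinf_inverse_family:
  fixes A K :: "'a::euclidean_space \<Rightarrow> 'b::euclidean_space \<Rightarrow> 'b"
  assumes V: "open V" and A: "\<And>w. Cinf V (\<lambda>y. A y w)" and lin: "\<And>y. y \<in> V \<Longrightarrow> linear (A y)"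
    and KA: "\<And>y w. y \<in> V \<Longrightarrow> K y (A y w) = w"
  shows "Cinf V (\<lambda>y. K y w)"
proof -
  have d: "((\<lambda>y. K y w) has_derivative (\<lambda>h. - K y (frechet_derivative (\<lambda>y'. A y' (K y w)) (at y) h))) (at y)"
    if "y \<in> V" for y w
    by (rule inverse_family_has_derivative[OF V A lin KA that])
  have AK: "A y (K y w) = w" if "y \<in> V" for y w
  proof -
    have "inj (A y)" by (metis KA injI that)
    then have "surj (A y)" using linear_injective_imp_surjective[OF lin[OF that]] by blast
    then obtain w' where "w = A y w'" by blast
    then show ?thesis using KA[OF that] by simp
  qed
  have Ksum: "K y w = (\<Sum>e\<in>Basis. (w \<bullet> e) *\<^sub>R K y e)" if "y \<in> V" for y w
  proof -
    interpret L: linear "A y" by (rule lin[OF that])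
    have "A y (\<Sum>e\<in>Basis. (w \<bullet> e) *\<^sub>R K y e) = w"
      by (simp add: L.sum L.scale AK that euclidean_representation)
    then show ?thesis using KA[OF that] by metis
  qed
  have Asum: "frechet_derivative (\<lambda>y. A y u) (at y) h = (\<Sum>e\<in>Basis. (u \<bullet> e) *\<^sub>R frechet_derivative (\<lambda>y. A y e) (at y) h)" if y: "y \<in> V" for y u h
  proof -
    have AB: "A y w = (\<Sum>e\<in>Basis. (w \<bullet> e) *\<^sub>R A y e)" if "y \<in> V" for y w
    proof -
      interpret L: linear "A y" by (rule lin[OF that])
      have "A y w = A y (\<Sum>e\<in>Basis. (w \<bullet> e) *\<^sub>R e)" by (simp add: euclidean_representation)
      then show ?thesis by (simp add: L.sum L.scale)
    qed
    have "((\<lambda>y. \<Sum>e\<in>Basis. (u \<bullet> e) *\<^sub>R A y e) has_derivative (\<lambda>h. \<Sum>e\<in>Basis. (u \<bullet> e) *\<^sub>R frechet_derivative (\<lambda>y. A y e) (at y) h)) (at y)"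
      by (intro has_derivative_sum has_derivative_scaleR_right Cinf_has_derivative[OF A] y)
    then have "((\<lambda>y. A y u) has_derivative (\<lambda>h. \<Sum>e\<in>Basis. (u \<bullet> e) *\<^sub>R frechet_derivative (\<lambda>y. A y e) (at y) h)) (at y)"
      by (rule has_derivative_transform_within_open[OF _ V y]) (simp add: AB[symmetric])
    then show ?thesis by (simp add: frechet_derivative_at[symmetric])
  qed
  have "Ck_on k V (\<lambda>y. K y w)" for k
  proof (induction k arbitrary: w)
    case 0
    have "isCont (\<lambda>y. K y w) y" if "y \<in> V" for y using d[OF that] has_derivative_continuous by blast
    then show ?case by (simp add: continuous_at_imp_continuous_on)
  next
    case (Suc k)
    let ?B = "\<lambda>y e h. frechet_derivative (\<lambda>y. A y e) (at y) h"
    have eq: "- K y (?B y (K y w) h) = - (\<Sum>e\<in>Basis. \<Sum>e'\<in>Basis. ((K y w \<bullet> e') * (?B y e' h \<bullet> e)) *\<^sub>R K y e)" if "y \<in> V" for y h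
      by (subst Ksum[OF that], subst Asum[OF that]) (simp add: inner_sum_left scaleR_sum_left)
    have "Ck_on k V (\<lambda>y. - (\<Sum>e\<in>Basis. \<Sum>e'\<in>Basis. ((K y w \<bullet> e') * (?B y e' h \<bullet> e)) *\<^sub>R K y e))" for h
    proof -
      have "Ck_on k V (\<lambda>y. (-1::real) *\<^sub>R (\<Sum>e\<in>Basis. \<Sum>e'\<in>Basis. ((K y w \<bullet> e') * (?B y e' h \<bullet> e)) *\<^sub>R K y e))"
        using A[THEN Cinf_frechet]
        by (intro Ck_on_sum Ck_on_bilinear[OF V bounded_bilinear_scaleR] Ck_on_const
          Ck_on_bilinear[OF V bounded_bilinear_mult] Ck_on_bilinear[OF V bounded_bilinear_inner] Suc.IH V)
          (auto simp: Cinf_def)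
      then show ?thesis by simp
    qed
    then have "Ck_on k V (\<lambda>y. - K y (?B y (K y w) h))" for h
      by (rule Ck_on_cong[OF V, rotated]) (simp add: eq)
    then show ?case by (intro Ck_on_SucI[OF V d])
  qed
  then show ?thesis by (simp add: Cinf_def)
qed

text \<open>The image is open by invariance of domain. The derivative of \<open>g\<close> at
  \<open>y\<close> is \<open>K (g y)\<close>, where \<open>K\<close> inverts the derivative of
  \<open>f\<close> and is smooth as an inverse family, so the smoothness of \<open>g\<close>
  bootstraps itself.\<close>

lemma Cinf_inverse:
  fixes f g :: "'a::euclidean_space \<Rightarrow> 'a"
  assumes V: "open V" and f: "Cinf V f"
    and inj: "\<And>x h. x \<in> V \<Longrightarrow> frechet_derivative f (at x) h = 0 \<Longrightarrow> h = 0"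
    and gf: "\<And>x. x \<in> V \<Longrightarrow> g (f x) = x"
  shows "open (f ` V)" and "Cinf (f ` V) g"
proof -
  show o: "open (f ` V)"
    by (rule invariance_of_domain[OF Cinf_continuous[OF f] V]) (metis gf inj_on_inverseI)
  let ?D = "\<lambda>x. frechet_derivative f (at x)"
  define K where "K x = inv (?D x)" for x
  have lin: "linear (?D x)" if "x \<in> V" for x using Cinf_has_derivative[OF f that] has_derivative_linear by blast
  have injD: "inj (?D x)" if "x \<in> V" for x
    using linear_injective_0[OF lin[OF that]] inj[OF that] by blast
  have KD: "K x (?D x w) = w" if "x \<in> V" for x w
    unfolding K_def using injD[OF that] by simp
  have K: "Cinf V (\<lambda>x. K x w)" for w
    by (rule Cinf_inverse_family[OF V _ lin KD]) (auto intro: Cinf_frechet[OF f])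
  have DK: "?D x (K x w) = w" if "x \<in> V" for x w
    using linear_injective_imp_surjective[OF lin[OF that] injD[OF that]] unfolding K_def by (simp add: surj_f_inv_f)
  have d: "(g has_derivative K (g y)) (at y)" if y: "y \<in> f ` V" for y
  proof -
    obtain x where x: "x \<in> V" "y = f x" using y by blast
    have "(g has_derivative K x) (at (f x))"
      by (rule has_derivative_inverse_on[OF V Cinf_has_derivative[OF f] gf _ x(1)]) (auto simp: DK x(1))
    then show ?thesis using x gf by simp
  qed
  have "Ck_on k (f ` V) g" for k
  proof (induction k)
    case 0
    have "isCont g y" if "y \<in> f ` V" for y using d[OF that] has_derivative_continuous by blast
    then show ?case by (simp add: continuous_at_imp_continuous_on)
  next
    case (Suc k)
    have "Ck_on k (f ` V) (\<lambda>y. K (g y) v)" for v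
      by (rule Ck_on_compose[OF o V _ Suc]) (use K gf in \<open>auto simp: Cinf_def\<close>)
    then show ?case by (intro Ck_on_SucI[OF o d])
  qed
  then show "Cinf (f ` V) g" by (simp add: Cinf_def)
qed

text \<open>The inverse function theorem provides a neighbourhood on which \<open>f\<close> is a
  homeomorphism with bijective derivatives; smoothness of the local inverse is then
  \<open>Cinf_inverse\<close>.\<close>

lemma Cinf_local_inverse:
  fixes f :: "'a::euclidean_space \<Rightarrow> 'a"
  assumes V: "open V" and f: "Cinf V f" and x0: "x0 \<in> V"
    and inj: "\<And>h. frechet_derivative f (at x0) h = 0 \<Longrightarrow> h = 0"
  obtains U g where "open U" "x0 \<in> U" "U \<subseteq> V" "open (f ` U)" "Cinf (f ` U) g" "\<And>x. x \<in> U \<Longrightarrow> g (f x) = x"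
proof -
  let ?D = "\<lambda>x. frechet_derivative f (at x)"
  have bl: "bounded_linear (?D x)" if "x \<in> V" for x using Cinf_has_derivative[OF f that] has_derivative_bounded_linear by blast
  have ap: "blinfun_apply (Blinfun (?D x)) = ?D x" if "x \<in> V" for x
    using bl[OF that] bounded_linear_Blinfun_apply by blast
  have lin: "linear (?D x0)" using bl[OF x0] bounded_linear.linear by blast
  have i: "inj (?D x0)" using linear_injective_0[OF lin] inj by blast
  obtain K where K: "linear K" "K \<circ> ?D x0 = id" using linear_injective_left_inverse[OF lin i] by blast
  have c: "continuous_on V (\<lambda>x. Blinfun (?D x))"
  proof (rule continuous_on_blinfun_componentwise)
    fix e :: 'a
    show "continuous_on V (\<lambda>x. blinfun_apply (Blinfun (?D x)) e)"
      using Cinf_continuous[OF Cinf_frechet[OF f, of e]] by (rule continuous_on_eq) (simp add: ap)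
  qed
  have inv: "Blinfun K o\<^sub>L Blinfun (?D x0) = id_blinfun"
    using K x0 by (intro blinfun_eqI) (auto simp: ap bounded_linear_Blinfun_apply linear_conv_bounded_linear fun_eq_iff)
  obtain U W g g' where *: "open U" "U \<subseteq> V" "x0 \<in> U" "homeomorphism U W f g"
    "\<And>y. y \<in> W \<Longrightarrow> bij (blinfun_apply (Blinfun (?D (g y))))"
    by (rule inverse_function_theorem[OF V _ c x0 inv]) (use Cinf_has_derivative[OF f] ap in \<open>auto\<close>)
  have gf: "g (f x) = x" if "x \<in> U" for x using *(4) that homeomorphism_apply1 by blast
  have W: "f x \<in> W" if "x \<in> U" for x using *(4) that homeomorphism_image1 by blast
  have "h = 0" if "x \<in> U" "?D x h = 0" for x h
  proof -
    have xV: "x \<in> V" using that *(2) by blast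
    have "inj (?D x)" using *(5)[OF W[OF that(1)]] gf[OF that(1)] ap[OF xV] bij_is_inj by metis
    then show ?thesis using linear_injective_0 bl[OF xV] bounded_linear.linear that(2) by blast
  qed
  then have "open (f ` U)" "Cinf (f ` U) g"
    using Cinf_inverse[OF *(1) Cinf_subset[OF f *(2)]] gf by blast+
  then show ?thesis using that *(1-3) gf by blast
qed

text \<open>The mean value theorem is applied twice to the second difference over a parallelogram:
  along \<open>v\<close> to the difference of two parallel sides, then along \<open>w\<close>. The
  difference is symmetric in \<open>v\<close> and \<open>w\<close>, and the mixed derivative
  inherits this in the limit.\<close>

lemma second_derivative_mvt:
  fixes f :: "'a::euclidean_space \<Rightarrow> real"
  assumes f: "Cinf V f" and ball: "ball x r \<subseteq> V" and t: "t > 0" "t * (norm v + norm w) < r"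
  shows "\<exists>y\<in>ball x r. f (x + t *\<^sub>R v + t *\<^sub>R w) - f (x + t *\<^sub>R v) - f (x + t *\<^sub>R w) + f x
    = t * t * frechet_derivative (\<lambda>y. frechet_derivative f (at y) v) (at y) w"
proof -
  have line: "((\<lambda>s. F (c + s *\<^sub>R u)) has_real_derivative frechet_derivative F (at (c + s *\<^sub>R u)) u) (at s)"
    if "Cinf V F" "c + s *\<^sub>R u \<in> V" for F :: "'a \<Rightarrow> real" and c s u
  proof -
    have d: "(F has_derivative frechet_derivative F (at (c + s *\<^sub>R u))) (at (c + s *\<^sub>R u))"
      by (rule Cinf_has_derivative[OF that])
    have "((\<lambda>s. c + s *\<^sub>R u) has_derivative (\<lambda>h. h *\<^sub>R u)) (at s)"
      by (auto intro!: derivative_eq_intros)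
    from diff_chain_at[OF this d]
    have "((\<lambda>s. F (c + s *\<^sub>R u)) has_derivative (\<lambda>h. frechet_derivative F (at (c + s *\<^sub>R u)) (h *\<^sub>R u))) (at s)"
      by (simp add: o_def)
    then show ?thesis
      unfolding has_field_derivative_def using linear_scale[OF has_derivative_linear[OF d]]
      by (simp add: mult_commute_abs)
  qed
  have inb: "x + s *\<^sub>R v + q *\<^sub>R w \<in> ball x r" if "0 \<le> s" "s \<le> t" "0 \<le> q" "q \<le> t" for s q
  proof -
    have "norm (s *\<^sub>R v + q *\<^sub>R w) \<le> s * norm v + q * norm w"
      using norm_triangle_ineq[of "s *\<^sub>R v" "q *\<^sub>R w"] that by simp
    also have "\<dots> \<le> t * (norm v + norm w)" using that by (simp add: distrib_left add_mono mult_right_mono)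
    finally have "norm (q *\<^sub>R w + s *\<^sub>R v) < r" using t by (simp add: add.commute)
    then show ?thesis by (simp add: dist_norm norm_minus_commute add.assoc)
  qed
  have inV: "x + s *\<^sub>R v + q *\<^sub>R w \<in> V" if "0 \<le> s" "s \<le> t" "0 \<le> q" "q \<le> t" for s q
    using inb[OF that] ball by blast
  let ?g = "\<lambda>s. f (x + t *\<^sub>R w + s *\<^sub>R v) - f (x + s *\<^sub>R v)"
  let ?g' = "\<lambda>s. frechet_derivative f (at (x + t *\<^sub>R w + s *\<^sub>R v)) v - frechet_derivative f (at (x + s *\<^sub>R v)) v"
  have "DERIV ?g s :> ?g' s" if "0 \<le> s" "s \<le> t" for s
    using inV[of s t] inV[of s 0] that t by (intro DERIV_diff line f) (auto simp: add_ac)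
  then obtain s where s: "0 < s" "s < t" "?g t - ?g 0 = (t - 0) * ?g' s"
    using MVT2[of 0 t ?g ?g'] t by blast
  let ?h = "\<lambda>q. frechet_derivative f (at (x + s *\<^sub>R v + q *\<^sub>R w)) v"
  let ?h' = "\<lambda>q. frechet_derivative (\<lambda>y. frechet_derivative f (at y) v) (at (x + s *\<^sub>R v + q *\<^sub>R w)) w"
  have "DERIV ?h q :> ?h' q" if "0 \<le> q" "q \<le> t" for q
    using inV[of s q] that s by (intro line Cinf_frechet[OF f]) auto
  then obtain q where q: "0 < q" "q < t" "?h t - ?h 0 = (t - 0) * ?h' q"
    using MVT2[of 0 t ?h ?h'] t by blast
  have "?g' s = ?h t - ?h 0" by (simp add: add_ac)
  then have "?g t - ?g 0 = t * t * ?h' q" using s q by simp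
  then show ?thesis using inb[of s q] s q
    by (intro bexI[of _ "x + s *\<^sub>R v + q *\<^sub>R w"]) (auto simp: algebra_simps)
qed

lemma second_derivative_symmetric_real:
  fixes f :: "'a::euclidean_space \<Rightarrow> real"
  assumes V: "open V" and f: "Cinf V f" and x: "x \<in> V"
  shows "frechet_derivative (\<lambda>y. frechet_derivative f (at y) v) (at x) w
    = frechet_derivative (\<lambda>y. frechet_derivative f (at y) w) (at x) v"
proof (rule ccontr)
  define H where "H v w y = frechet_derivative (\<lambda>y. frechet_derivative f (at y) v) (at y) w" for v w y
  assume "\<not> ?thesis"
  then have ne: "H v w x \<noteq> H w v x" by (simp add: H_def)
  \<comment> \<open>Half the gap: two numbers closer than \<open>e\<close> to the two mixed
    derivatives cannot coincide.\<close>
  define e where "e = \<bar>H v w x - H w v x\<bar> / 2"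
  have e: "e > 0" using ne by (simp add: e_def)
  have cont: "isCont (H v w) x" for v w
    using Cinf_continuous[OF Cinf_frechet[OF Cinf_frechet[OF f]]] V x
    unfolding H_def by (simp add: continuous_on_eq_continuous_at)
  obtain d1 where d1: "d1 > 0" "\<And>y. dist y x < d1 \<Longrightarrow> dist (H v w y) (H v w x) < e"
    using cont[of v w] e unfolding continuous_at_eps_delta by blast
  obtain d2 where d2: "d2 > 0" "\<And>y. dist y x < d2 \<Longrightarrow> dist (H w v y) (H w v x) < e"
    using cont[of w v] e unfolding continuous_at_eps_delta by blast
  obtain d3 where d3: "d3 > 0" "ball x d3 \<subseteq> V" using V x open_contains_ball by blast
  define r where "r = min d1 (min d2 d3)"
  have r: "r > 0" "ball x r \<subseteq> V" using d1 d2 d3 by (auto simp: r_def)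
  \<comment> \<open>The added 1 keeps \<open>N\<close> positive even if both vectors vanish, and the
    factor 2 in \<open>t\<close> leaves the parallelogram strictly inside the ball.\<close>
  define N where "N = norm v + norm w + 1"
  define t where "t = r / (2 * N)"
  have pos: "N > 0" by (simp add: N_def add_nonneg_pos)
  have t0: "t > 0" using r pos by (simp add: t_def)
  have "t * (norm v + norm w) \<le> t * N" using t0 by (simp add: N_def)
  also have "\<dots> = r / 2" using pos by (simp add: t_def)
  also have "\<dots> < r" using r by simp
  finally have t1: "t * (norm v + norm w) < r" .
  obtain y1 where y1: "y1 \<in> ball x r" "f (x + t *\<^sub>R v + t *\<^sub>R w) - f (x + t *\<^sub>R v) - f (x + t *\<^sub>R w) + f x = t * t * H v w y1"
    using second_derivative_mvt[OF f r(2) t0 t1] unfolding H_def by blast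
  obtain y2 where y2: "y2 \<in> ball x r" "f (x + t *\<^sub>R w + t *\<^sub>R v) - f (x + t *\<^sub>R w) - f (x + t *\<^sub>R v) + f x = t * t * H w v y2"
    using second_derivative_mvt[OF f r(2) t0, of w v] t1 unfolding H_def by (auto simp: add.commute)
  have "x + t *\<^sub>R w + t *\<^sub>R v = x + t *\<^sub>R v + t *\<^sub>R w" by simp
  then have "t * t * H v w y1 = t * t * H w v y2" using y1 y2 by (simp only:)
  then have "H v w y1 = H w v y2" using t0 by simp
  moreover have "\<bar>H v w y1 - H v w x\<bar> < e" "\<bar>H w v y2 - H w v x\<bar> < e"
    using d1(2)[of y1] d2(2)[of y2] y1(1) y2(1) by (auto simp: r_def dist_real_def dist_commute)
  ultimately show False unfolding e_def by argo
qed

lemma second_derivative_symmetric: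
  fixes f :: "'a::euclidean_space \<Rightarrow> 'b::euclidean_space"
  assumes V: "open V" and f: "Cinf V f" and x: "x \<in> V"
  shows "frechet_derivative (\<lambda>y. frechet_derivative f (at y) v) (at x) w
    = frechet_derivative (\<lambda>y. frechet_derivative f (at y) w) (at x) v"
proof (rule euclidean_eqI)
  fix e :: 'b
  have c: "Cinf V (\<lambda>y. f y \<bullet> e)" by (intro Cinf_bilinear[OF V bounded_bilinear_inner] f Cinf_const)
  have 1: "frechet_derivative (\<lambda>y. g y \<bullet> e) (at y) v = frechet_derivative g (at y) v \<bullet> e"
    if "Cinf V g" "y \<in> V" for g y v
  proof -
    have "((\<lambda>y. g y \<bullet> e) has_derivative (\<lambda>v. frechet_derivative g (at y) v \<bullet> e)) (at y)"
      by (rule has_derivative_inner_left[OF Cinf_has_derivative[OF that]])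
    then show ?thesis by (simp add: frechet_derivative_at[symmetric])
  qed
  have 2: "frechet_derivative (\<lambda>y. frechet_derivative (\<lambda>y. f y \<bullet> e) (at y) v) (at x) w
    = frechet_derivative (\<lambda>y. frechet_derivative f (at y) v) (at x) w \<bullet> e" for v w
  proof -
    have "frechet_derivative (\<lambda>y. frechet_derivative (\<lambda>y. f y \<bullet> e) (at y) v) (at x)
      = frechet_derivative (\<lambda>y. frechet_derivative f (at y) v \<bullet> e) (at x)"
      by (rule frechet_derivative_transform_within_open[OF _ V x])
        (use 1[OF f] Cinf_has_derivative[OF Cinf_frechet[OF c] x] in \<open>auto simp: differentiable_def\<close>)
    then show ?thesis using 1[OF Cinf_frechet[OF f] x] by simp
  qed
  show "frechet_derivative (\<lambda>y. frechet_derivative f (at y) v) (at x) w \<bullet> e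
    = frechet_derivative (\<lambda>y. frechet_derivative f (at y) w) (at x) v \<bullet> e"
    unfolding 2[symmetric] by (rule second_derivative_symmetric_real[OF V c x])
qed

section \<open>Maps on subsets and tangent vectors as velocities of curves\<close>

lemma smooth_onI:
  assumes "open V" "A \<subseteq> V" "Cinf V F" "\<And>y. y \<in> A \<Longrightarrow> F y = f y" shows "smooth_on A f"
  unfolding smooth_on_def using assms unfolding Cinf_def by blast

lemma smooth_onD:
  assumes "smooth_on A f" "x \<in> A"
  obtains V F where "open V" "x \<in> V" "Cinf V F" "\<And>y. y \<in> V \<Longrightarrow> y \<in> A \<Longrightarrow> F y = f y"
  using assms unfolding smooth_on_def Cinf_def by (metis IntI)

lemma has_derivative_agree:
  assumes "(F has_derivative D) (at x)" "open V" "x \<in> V" "x \<in> A" "\<And>y. y \<in> V \<Longrightarrow> y \<in> A \<Longrightarrow> F y = f y"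
  shows "(f has_derivative D) (at x within A)"
proof -
  have "(F has_derivative D) (at x within V \<inter> A)" using assms(1) has_derivative_at_withinI by blast
  then have "(f has_derivative D) (at x within V \<inter> A)"
    by (rule has_derivative_transform[rotated 2]) (use assms in auto)
  moreover have "at x within V \<inter> A = at x within A"
    using at_within_nhd[OF assms(3,2), of "V \<inter> A" A] by auto
  ultimately show ?thesis by simp
qed

lemma smooth_on_has_derivative:
  assumes "smooth_on A f" "x \<in> A" shows "(f has_derivative deriv_on A f x) (at x within A)"
proof -
  obtain V F where "open V" "x \<in> V" "Cinf V F" "\<And>y. y \<in> V \<Longrightarrow> y \<in> A \<Longrightarrow> F y = f y"
    using smooth_onD[OF assms] by metis
  then have "(f has_derivative frechet_derivative F (at x)) (at x within A)"
    using has_derivative_agree[OF Cinf_has_derivative] assms(2) by metis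
  then show ?thesis using differentiableI frechet_derivative_works by metis
qed

text \<open>The curve runs inside A, where alone \<open>f\<close> is known. As tangent vectors are
  velocities, derivatives on subsets are evaluated below by this chain rule.\<close>

lemma has_derivative_curve:
  assumes f: "(f has_derivative D) (at x within A)" and \<gamma>: "\<And>t::real. \<gamma> t \<in> A" "\<gamma> 0 = x"
    "(\<gamma> has_vector_derivative v) (at 0)"
  shows "((\<lambda>t. f (\<gamma> t)) has_vector_derivative D v) (at 0)"
proof -
  have "(f has_derivative D) (at (\<gamma> 0) within \<gamma> ` UNIV)"
    using has_derivative_subset[OF f, of "\<gamma> ` UNIV"] \<gamma> by (simp add: image_subset_iff)
  moreover have "(\<gamma> has_derivative (\<lambda>h. h *\<^sub>R v)) (at 0)" using \<gamma>(3) has_vector_derivative_def by blast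
  ultimately have "(f \<circ> \<gamma> has_derivative D \<circ> (\<lambda>h. h *\<^sub>R v)) (at 0)"
    by (metis diff_chain_within)
  then show ?thesis
    unfolding has_vector_derivative_def using linear_scale[OF has_derivative_linear[OF f]] by (simp add: o_def)
qed

text \<open>A derivative within A need not be unique as a linear map, but along a curve in A all
  candidates produce the same velocity. Hence the one selected by \<open>frechet_derivative\<close>
  may be replaced on tangent vectors by any computed one.\<close>

lemma deriv_on_tangent:
  assumes f: "(f has_derivative D) (at x within A)" and v: "v \<in> tangent_space A x"
  shows "deriv_on A f x v = D v"
proof -
  obtain \<gamma> where \<gamma>: "\<And>t::real. \<gamma> t \<in> A" "\<gamma> 0 = x" "(\<gamma> has_vector_derivative v) (at 0)"
    using v unfolding tangent_space_def by blast
  have "(f has_derivative deriv_on A f x) (at x within A)"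
    using f differentiableI frechet_derivative_works by metis
  then show ?thesis
    using has_derivative_curve[OF _ \<gamma>] f vector_derivative_unique_at by metis
qed

text \<open>\<open>tangent_space\<close> wants a curve for all times but asks for regularity at 0
  only, so a local curve may be frozen at \<open>x\<close> outside its interval.\<close>

lemma tangent_spaceI:
  assumes e: "e > 0" and \<gamma>: "\<And>t::real. \<bar>t\<bar> < e \<Longrightarrow> \<gamma> t \<in> A" "\<gamma> 0 = x" "(\<gamma> has_vector_derivative v) (at 0)"
  shows "v \<in> tangent_space A x"
proof -
  let ?\<gamma> = "\<lambda>t. if \<bar>t\<bar> < e then \<gamma> t else x"
  have "x \<in> A" using \<gamma>(1)[of 0] \<gamma>(2) e by simp
  moreover have "(?\<gamma> has_vector_derivative v) (at 0)"
    by (rule has_vector_derivative_transform_within_open[OF \<gamma>(3), of "ball 0 e"]) (use e in auto)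
  ultimately show ?thesis unfolding tangent_space_def using \<gamma> e by (intro CollectI exI[of _ ?\<gamma>]) auto
qed

lemma orthogonal_projection:
  fixes S :: "'a::euclidean_space set"
  assumes S: "subspace S"
  obtains \<pi> where "linear \<pi>" "\<And>y. \<pi> y \<in> S" "\<And>y. y \<in> S \<Longrightarrow> \<pi> y = y"
    "\<And>y s. s \<in> S \<Longrightarrow> (y - \<pi> y) \<bullet> s = 0"
proof -
  obtain B where B: "B \<subseteq> S" "pairwise orthogonal B" "\<And>x. x \<in> B \<Longrightarrow> norm x = 1"
     "independent B" "card B = dim S" "span B = S"
    using orthonormal_basis_subspace[OF S] by metis
  have fin: "finite B" using B(4) independent_imp_finite by blast
  define \<pi> where "\<pi> y = (\<Sum>b\<in>B. (y \<bullet> b) *\<^sub>R b)" for y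
  have orth: "b \<bullet> b' = (if b = b' then 1 else 0)" if "b \<in> B" "b' \<in> B" for b b'
    using B(2,3) that by (auto simp: pairwise_def orthogonal_def dot_square_norm)
  have lin: "linear \<pi>" unfolding \<pi>_def
    by (auto simp: linear_iff inner_add_left scaleR_add_left sum.distrib scaleR_sum_right)
  have S': "\<pi> y \<in> S" for y unfolding \<pi>_def
    using B(1) by (auto intro!: subspace_sum[OF S] subspace_scale[OF S])
  have orthB: "(y - \<pi> y) \<bullet> b = 0" if "b \<in> B" for y b
  proof -
    have "\<pi> y \<bullet> b = (\<Sum>b'\<in>B. if b' = b then y \<bullet> b else 0)"
      unfolding \<pi>_def inner_sum_left using orth[OF _ that] by (intro sum.cong) auto
    then show ?thesis using fin that by (simp add: inner_diff_left)
  qed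
  have o: "(y - \<pi> y) \<bullet> s = 0" if "s \<in> S" for y s
  proof -
    have "s \<in> span B" using that B by simp
    then show ?thesis
      by (induction rule: span_induct_alt) (auto simp: inner_add_right orthB)
  qed
  have "\<pi> y = y" if "y \<in> S" for y
    using o[of "y - \<pi> y" y] subspace_diff[OF S that S'[of y]] by simp
  then show ?thesis using that lin S' o by blast
qed

text \<open>Orthogonal projection onto S is linear and fixes the curve, hence it fixes the
  velocity.\<close>

lemma vector_derivative_in_subspace:
  fixes S :: "'a::euclidean_space set"
  assumes S: "subspace S" and \<gamma>: "\<And>t::real. \<gamma> t \<in> S" "(\<gamma> has_vector_derivative v) (at 0)"
  shows "v \<in> S"
proof -
  obtain \<pi> where \<pi>: "linear \<pi>" "\<And>y. \<pi> y \<in> S" "\<And>y. y \<in> S \<Longrightarrow> \<pi> y = y"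
    using orthogonal_projection[OF S] by metis
  have "((\<lambda>t. \<pi> (\<gamma> t)) has_vector_derivative \<pi> v) (at 0)"
    using \<pi>(1) \<gamma>(2) by (simp add: linear_conv_bounded_linear bounded_linear.has_vector_derivative)
  then have "v = \<pi> v" using \<gamma> \<pi>(3) vector_derivative_unique_at by fastforce
  then show ?thesis using \<pi>(2) by metis
qed

lemma tangent_space_subset: "subspace S \<Longrightarrow> A \<subseteq> S \<Longrightarrow> tangent_space A x \<subseteq> S"
  unfolding tangent_space_def using vector_derivative_in_subspace by blast

lemma has_vector_derivative_line: "((\<lambda>t. x + t *\<^sub>R v) has_vector_derivative v) (at s)"
  by (auto intro!: derivative_eq_intros simp: has_vector_derivative_def)

lemma tangent_space_openin_subspace:
  fixes S :: "'a::euclidean_space set"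
  assumes S: "subspace S" and U: "openin (top_of_set S) U" "u \<in> U"
  shows "tangent_space U u = S"
proof
  show "tangent_space U u \<subseteq> S" by (rule tangent_space_subset[OF S]) (use U openin_subset in fastforce)
  obtain T where T: "open T" "U = S \<inter> T" using U(1) openin_open by blast
  show "S \<subseteq> tangent_space U u"
  proof
    fix v assume v: "v \<in> S"
    have "open ((\<lambda>t::real. u + t *\<^sub>R v) -` T)" by (intro open_vimage T continuous_intros)
    moreover have "0 \<in> (\<lambda>t::real. u + t *\<^sub>R v) -` T" using T U by simp
    ultimately obtain e where "e > 0" "ball 0 e \<subseteq> (\<lambda>t::real. u + t *\<^sub>R v) -` T"
      using open_contains_ball by blast
    then have "e > 0" "\<And>t. \<bar>t\<bar> < e \<Longrightarrow> u + t *\<^sub>R v \<in> T" by (auto simp: subset_iff)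
    moreover have "u \<in> S" using T U by simp
    ultimately show "v \<in> tangent_space U u"
      using T v S by (intro tangent_spaceI[of e "\<lambda>t. u + t *\<^sub>R v"] has_vector_derivative_line)
        (auto intro: subspace_add subspace_scale)
  qed
qed

lemma tangent_space_subspace: "subspace S \<Longrightarrow> u \<in> S \<Longrightarrow> tangent_space S u = (S :: 'a::euclidean_space set)"
  by (rule tangent_space_openin_subspace) auto

lemma at_within_openin:
  assumes "openin (top_of_set S) U" "u \<in> U" shows "at u within U = at u within S"
proof -
  obtain T where "open T" "U = S \<inter> T" using assms(1) openin_open by blast
  then show ?thesis using at_within_nhd[of u T U S] assms(2) by auto
qed

section \<open>Complex matrices\<close>

lemma bounded_bilinear_matrix_mult: "bounded_bilinear ((**) :: complex^'m^'m \<Rightarrow> complex^'m^'m \<Rightarrow> complex^'m^'m)"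
proof -
  have "bilinear ((**) :: complex^'m^'m \<Rightarrow> complex^'m^'m \<Rightarrow> complex^'m^'m)"
    unfolding bilinear_def linear_iff
    by (auto simp: matrix_add_ldistrib matrix_scalar_ac scalar_matrix_assoc
        vec_eq_iff matrix_matrix_mult_def algebra_simps sum.distrib scaleR_sum_right)
  then show ?thesis using bilinear_conv_bounded_bilinear by blast
qed

interpretation mm: bounded_bilinear "(**) :: complex^'m^'m \<Rightarrow> complex^'m^'m \<Rightarrow> complex^'m^'m"
  by (rule bounded_bilinear_matrix_mult)

lemma linear_trace: "linear (trace :: complex^'m^'m \<Rightarrow> complex)"
  by (auto simp: linear_iff trace_def sum.distrib scaleR_sum_right)

lemmas tr_add = linear_add[OF linear_trace] and
  tr_scale = linear_scale[OF linear_trace] and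
  tr_neg = linear_neg[OF linear_trace] and
  tr_diff = linear_diff[OF linear_trace] and
  tr_sum = linear_sum[OF linear_trace] and
  tr_0 = linear_0[OF linear_trace]

lemma bounded_linear_trace_mult: "bounded_linear (\<lambda>A. trace (A ** (L :: complex^'m^'m)))"
  using bounded_linear_compose[OF _ mm.bounded_linear_left[of L], of trace] linear_trace linear_conv_bounded_linear by (auto simp: o_def)

lemma ctranspose_nth: "ctranspose A $ i $ j = cnj (A $ j $ i)"
  by (simp add: ctranspose_def transpose_def)

lemma linear_ctranspose: "linear (ctranspose :: complex^'m^'m \<Rightarrow> complex^'m^'m)"
  by (auto simp: linear_iff vec_eq_iff ctranspose_nth)

lemmas ct_add = linear_add[OF linear_ctranspose] and
  ct_scale = linear_scale[OF linear_ctranspose] and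
  ct_neg = linear_neg[OF linear_ctranspose] and
  ct_diff = linear_diff[OF linear_ctranspose] and
  ct_0 = linear_0[OF linear_ctranspose]

lemma linear_map_cnj: "linear (map_matrix cnj :: complex^'m^'m \<Rightarrow> complex^'m^'m)"
  by (auto simp: linear_iff vec_eq_iff)

lemmas mc_0 = linear_0[OF linear_map_cnj] and
  mc_add = linear_add[OF linear_map_cnj] and
  mc_scale = linear_scale[OF linear_map_cnj] and
  mc_diff = linear_diff[OF linear_map_cnj]

lemma linear_transpose_complex: "linear (transpose :: complex^'m^'m \<Rightarrow> complex^'m^'m)"
  by (auto simp: linear_iff vec_eq_iff transpose_def)

lemmas tp_diff = linear_diff[OF linear_transpose_complex] and
  tp_scale = linear_scale[OF linear_transpose_complex]

lemma ctranspose_mult: "ctranspose (A ** B) = ctranspose B ** ctranspose A"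
  by (simp add: ctranspose_def map_matrix_cnj_mult matrix_transpose_mul)

lemma ctranspose_ctranspose [simp]: "ctranspose (ctranspose A) = A"
  by (simp add: vec_eq_iff ctranspose_nth)

lemma ctranspose_mat_1 [simp]: "ctranspose (mat 1) = mat 1"
  by (simp add: vec_eq_iff ctranspose_nth mat_def)

lemma map_cnj_mat_1 [simp]: "map_matrix cnj (mat 1) = mat 1"
  by (simp add: vec_eq_iff mat_def)

lemma trace_ctranspose: "trace (ctranspose A) = cnj (trace A)"
  by (simp add: trace_def ctranspose_nth)

lemma trace_map_cnj: "trace (map_matrix cnj A) = cnj (trace A)"
  by (simp add: trace_def)

lemma trace_transpose: "trace (transpose A) = trace A"
  by (simp add: trace_def transpose_def)

lemma det_map_cnj: "det (map_matrix cnj A) = cnj (det A)"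
  by (simp add: det_def)

lemma ctranspose_conv: "ctranspose A = map_matrix cnj (transpose A)"
  by (simp add: vec_eq_iff ctranspose_nth transpose_def)

lemma det_ctranspose: "det (ctranspose A) = cnj (det A)"
  by (simp add: ctranspose_conv det_map_cnj)

lemma inner_matrix: "(A::complex^'m^'m) \<bullet> B = Re (trace (A ** ctranspose B))"
  by (simp add: inner_vec_def trace_def matrix_matrix_mult_def ctranspose_nth inner_complex_def)

lemma matrix_inv_right: "det A \<noteq> 0 \<Longrightarrow> A ** matrix_inv A = mat 1"
  and matrix_inv_left: "det A \<noteq> 0 \<Longrightarrow> matrix_inv A ** A = mat 1" for A :: "'a::field^'m^'m"
proof -
  assume "det A \<noteq> 0"
  then have "\<exists>A'. A ** A' = mat 1 \<and> A' ** A = mat 1" using invertible_det_nz[of A] invertible_def by blast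
  from someI_ex[OF this] show "A ** matrix_inv A = mat 1" "matrix_inv A ** A = mat 1"
    unfolding matrix_inv_def by auto
qed

lemma matrix_inv_right': "det A \<noteq> 0 \<Longrightarrow> X ** A ** matrix_inv A = X"
  and matrix_inv_left': "det A \<noteq> 0 \<Longrightarrow> X ** matrix_inv A ** A = X" for A :: "'a::field^'m^'m"
  by (simp_all add: matrix_mul_assoc[symmetric] matrix_inv_right matrix_inv_left)

lemma matrix_inv_unique: "A ** B = mat 1 \<Longrightarrow> B = matrix_inv A" for A :: "'a::field^'m^'m"
  by (metis det_I det_mul matrix_inv_left matrix_mul_assoc matrix_mul_lid matrix_mul_rid mult_zero_left zero_neq_one)

lemma det_matrix_inv: "det A \<noteq> 0 \<Longrightarrow> det (matrix_inv A) = inverse (det A)" for A :: "'a::field^'m^'m"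
  by (metis det_I det_mul inverse_unique matrix_inv_right)

lemma det_scaleR: "det (c *\<^sub>R A) = of_real c ^ CARD('m) * det A" for A :: "complex^'m^'m"
proof -
  have "c *\<^sub>R A = mat (of_real c) ** A"
    by (simp add: vec_eq_iff matrix_matrix_mult_def mat_def if_distrib if_distribR sum.delta' cong: if_cong) (simp add: scaleR_conv_of_real)
  moreover have "det (mat (of_real c) :: complex^'m^'m) = of_real c ^ CARD('m)"
    by (subst det_diagonal) (auto simp: mat_def)
  ultimately show ?thesis by (simp add: det_mul)
qed

text \<open>In the Leibniz formula only the identity permutation contributes to first order: any
  other permutation moves at least two indices, so after one factor is differentiated another
  off-diagonal factor remains, and it vanishes at the identity matrix.\<close>

lemma det_has_derivative_mat_1: "((det :: complex^'m^'m \<Rightarrow> complex) has_derivative trace) (at (mat 1))"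
proof -
  let ?I = "mat 1 :: complex^'m^'m"
  let ?D = "\<lambda>H::complex^'m^'m. \<Sum>p | p permutes (UNIV::'m set). of_int (sign p) * (\<Sum>i\<in>UNIV. H$i$p i * (\<Prod>j\<in>UNIV-{i}. ?I$j$p j))"
  have 1: "((\<lambda>A::complex^'m^'m. A$i$j) has_derivative (\<lambda>H. H$i$j)) (at ?I)" for i j
    by (auto intro!: bounded_linear_imp_has_derivative bounded_linear_compose[OF bounded_linear_vec_nth bounded_linear_vec_nth, simplified])
  have "((\<lambda>A::complex^'m^'m. det A) has_derivative ?D) (at ?I)"
    unfolding det_def by (intro has_derivative_sum has_derivative_mult_right has_derivative_prod 1)
  moreover have "?D H = trace H" for H
  proof -
    have "(\<Sum>i\<in>UNIV. H$i$p i * (\<Prod>j\<in>UNIV-{i}. ?I$j$p j)) = (if p = id then trace H else 0)"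
      if p: "p permutes (UNIV::'m set)" for p
    proof (cases "p = id")
      case True
      then show ?thesis by (simp add: trace_def mat_def)
    next
      case False
      have z: "(\<Prod>j\<in>UNIV-{i}. ?I$j$p j) = 0" for i
      proof -
        obtain k where k: "p k \<noteq> k" using False by (auto simp: fun_eq_iff)
        have "p (p k) \<noteq> p k" using k permutes_inj[OF p] by (auto dest: injD)
        then obtain j where "j \<noteq> i" "p j \<noteq> j" using k by metis
        then show ?thesis by (intro prod_zero) (auto simp: mat_def intro!: bexI[of _ j])
      qed
      show ?thesis unfolding z using False by simp
    qed
    then have "?D H = (\<Sum>p | p permutes (UNIV::'m set). of_int (sign p) * (if p = id then trace H else 0))"
      by (intro sum.cong) auto
    also have "\<dots> = (\<Sum>p | p permutes (UNIV::'m set). if p = id then trace H else 0)"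
      by (intro sum.cong) (auto simp: sign_id)
    also have "\<dots> = trace H" using permutes_id[of "UNIV::'m set"] by (simp add: finite_permutations)
    finally show ?thesis .
  qed
  ultimately show ?thesis by (metis (no_types, lifting) ext)
qed

text \<open>Jacobi's formula, transported from the identity by writing \<open>A\<close> as
  \<open>P\<close> times \<open>matrix_inv P ** A\<close>.\<close>

lemma det_has_derivative:
  fixes P :: "complex^'m^'m"
  assumes "det P \<noteq> 0"
  shows "(det has_derivative (\<lambda>H. det P * trace (matrix_inv P ** H))) (at P)"
proof -
  have "((\<lambda>A. matrix_inv P ** A) has_derivative (\<lambda>H. matrix_inv P ** H)) (at P)"
    by (rule bounded_linear_imp_has_derivative[OF mm.bounded_linear_right])
  moreover have "(det has_derivative trace) (at (matrix_inv P ** P))"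
    using det_has_derivative_mat_1 matrix_inv_left[OF assms] by simp
  ultimately have "((\<lambda>A. det (matrix_inv P ** A)) has_derivative (\<lambda>H. trace (matrix_inv P ** H))) (at P)"
    using diff_chain_at[of "\<lambda>A. matrix_inv P ** A"] by (force simp: o_def)
  from has_derivative_mult_right[OF this, of "det P"]
  show ?thesis using assms by (simp add: det_mul det_matrix_inv mult.assoc[symmetric])
qed

lemma Cinf_vec_nth: "Cinf V f \<Longrightarrow> open V \<Longrightarrow> Cinf V (\<lambda>x. (f x :: complex^'m^'m) $ i $ j)"
  by (rule Cinf_linear_compose) (auto simp: linear_iff)

lemma Cinf_det: "open V \<Longrightarrow> Cinf V f \<Longrightarrow> Cinf V (\<lambda>x. det (f x :: complex^'m^'m))"
  unfolding det_def by (intro Cinf_sum Cinf_mult Cinf_prod Cinf_const Cinf_vec_nth)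

lemma Cinf_trace: "open V \<Longrightarrow> Cinf V f \<Longrightarrow> Cinf V (\<lambda>x. trace (f x :: complex^'m^'m))"
  by (rule Cinf_linear_compose[OF linear_trace])

lemma linear_Re: "linear Re" by (auto simp: linear_iff)

lemma Cinf_Re: "open V \<Longrightarrow> Cinf V f \<Longrightarrow> Cinf V (\<lambda>x. Re (f x))"
  by (rule Cinf_linear_compose[OF linear_Re])

lemma Cinf_matrix_mult: "open V \<Longrightarrow> Cinf V f \<Longrightarrow> Cinf V g \<Longrightarrow> Cinf V (\<lambda>x. (f x :: complex^'m^'m) ** (g x :: complex^'m^'m))"
  by (rule Cinf_bilinear[OF _ bounded_bilinear_matrix_mult])

lemma Cinf_ctranspose: "open V \<Longrightarrow> Cinf V f \<Longrightarrow> Cinf V (\<lambda>x. ctranspose (f x :: complex^'m^'m))"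
  by (rule Cinf_linear_compose[OF linear_ctranspose])

lemma open_det_nonzero: "open {A :: complex^'m^'m. det A \<noteq> 0}"
  by (rule open_Collect_neq[OF Cinf_continuous[OF Cinf_det[OF open_UNIV Cinf_ident[OF open_UNIV]]] continuous_on_const])

text \<open>Left multiplication by \<open>y\<close> is a smooth family of invertible linear maps,
  and its inverse family evaluated at \<open>mat 1\<close> is \<open>matrix_inv\<close>. Both claims
  are instances of the results on inverse families.\<close>

lemma
  shows Cinf_matrix_inv': "Cinf {A :: complex^'m^'m. det A \<noteq> 0} matrix_inv"
    and matrix_inv_has_derivative: "det A \<noteq> 0 \<Longrightarrow>
      (matrix_inv has_derivative (\<lambda>H. - (matrix_inv A ** H ** matrix_inv A))) (at (A :: complex^'m^'m))"
proof -
  let ?V = "{A :: complex^'m^'m. det A \<noteq> 0}"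
  have A: "Cinf ?V (\<lambda>y. y ** w)" for w :: "complex^'m^'m"
    by (intro Cinf_matrix_mult Cinf_ident Cinf_const open_det_nonzero)
  have lin: "linear ((**) y :: complex^'m^'m \<Rightarrow> complex^'m^'m)" for y :: "complex^'m^'m" by (rule bounded_linear.linear[OF mm.bounded_linear_right])
  have KA: "matrix_inv y ** (y ** w) = w" if "y \<in> ?V" for y w
    using that by (simp add: matrix_mul_assoc matrix_inv_left)
  show "Cinf ?V matrix_inv"
    using Cinf_inverse_family[OF open_det_nonzero A lin KA, of "mat 1"] by simp
  assume "det A \<noteq> 0"
  then have "((\<lambda>y. matrix_inv y ** mat 1) has_derivative
     (\<lambda>h. - (matrix_inv A ** frechet_derivative (\<lambda>y. y ** (matrix_inv A ** mat 1)) (at A) h))) (at A)"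
    using inverse_family_has_derivative[OF open_det_nonzero A lin KA, of A "mat 1"] by simp
  moreover have "frechet_derivative (\<lambda>y. y ** (matrix_inv A ** mat 1)) (at A) = (\<lambda>h. h ** matrix_inv A)"
    using frechet_derivative_at[OF bounded_linear_imp_has_derivative[OF mm.bounded_linear_left[of "matrix_inv A"]], of A] by simp
  ultimately show "(matrix_inv has_derivative (\<lambda>H. - (matrix_inv A ** H ** matrix_inv A))) (at A)"
    by (simp add: matrix_mul_assoc)
qed

lemma Cinf_matrix_inv:
  "open V \<Longrightarrow> Cinf V f \<Longrightarrow> (\<And>x. x \<in> V \<Longrightarrow> det (f x) \<noteq> 0) \<Longrightarrow> Cinf V (\<lambda>x. matrix_inv (f x :: complex^'m^'m))"
  by (rule Cinf_compose[OF _ open_det_nonzero Cinf_matrix_inv']) auto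

section \<open>Quaternionic matrices\<close>

lemma J_nth [simp]:
  "J $ Inl k $ Inl l = 0" "J $ Inr k $ Inr l = 0"
  "J $ Inl k $ Inr l = (if k = l then 1 else 0)" "J $ Inr k $ Inl l = (if k = l then - 1 else 0)"
  by (simp_all add: J_def)

lemma UNIV_sum_split: "(\<Sum>i\<in>(UNIV :: ('n::finite + 'n) set). f i) = (\<Sum>i\<in>UNIV. f (Inl i)) + (\<Sum>i\<in>UNIV. f (Inr i))"
  by (subst UNIV_Plus_UNIV[symmetric], subst sum.Plus) (simp_all add: o_def)

lemma J_J: "J ** J = - mat 1"
proof -
  have "(J ** J) $ i $ j = (- mat 1) $ i $ j" for i j :: "'a::finite + 'a"
    by (cases i; cases j) (simp_all add: matrix_matrix_mult_def UNIV_sum_split mat_def if_distrib if_distribR cong: if_cong)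
  then show ?thesis by (simp add: vec_eq_iff)
qed

lemma map_cnj_J [simp]: "map_matrix cnj J = J"
proof -
  have "map_matrix cnj J $ i $ j = J $ i $ j" for i j :: "'a::finite + 'a"
    by (cases i; cases j) simp_all
  then show ?thesis by (simp add: vec_eq_iff)
qed

lemma transpose_J: "transpose J = - J"
proof -
  have "transpose J $ i $ j = (- J) $ i $ j" for i j :: "'a::finite + 'a"
    by (cases i; cases j) (simp_all add: transpose_def)
  then show ?thesis by (simp add: vec_eq_iff)
qed

lemma J_J': "X ** J ** J = - X" for X :: "'n::finite cmat"
  by (simp add: matrix_mul_assoc[symmetric] J_J mm.minus_right)

text \<open>The matrices that commute with the antilinear map sending v to J times the conjugate of
  v, whose square is -1: these are the quaternionic n by n matrices, a real algebra.\<close>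

definition quat :: "'n::finite cmat set" where
  "quat = {A. A ** J = J ** map_matrix cnj A}"

definition qherm :: "'n::finite cmat set" where
  "qherm = {A \<in> quat. ctranspose A = A}"

text \<open>The Lie algebra of Sp(n).\<close>

definition qskew :: "'n::finite cmat set" where
  "qskew = {A \<in> quat. ctranspose A = - A}"

text \<open>The noncompact part of the Cartan decomposition, complementary to the Lie algebra of
  Sp(n). It is the model space of the quotient.\<close>

definition pspace :: "'n::finite cmat set" where
  "pspace = {A \<in> qherm. trace A = 0}"

lemma quat_cnj: "A \<in> quat \<Longrightarrow> map_matrix cnj A = - (J ** A ** J)"
proof -
  assume "A \<in> quat"
  then have "J ** (A ** J) = J ** (J ** map_matrix cnj A)" by (simp add: quat_def)
  then show ?thesis by (simp add: matrix_mul_assoc J_J mm.minus_left)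
qed

lemma subspace_quat: "subspace quat"
  by (auto simp: subspace_def quat_def mm.add_left mm.add_right mc_add mm.scaleR_left mm.scaleR_right mc_scale mc_0
      simp del: nth_map_matrix)

lemma subspace_qherm: "subspace qherm"
  using subspace_quat unfolding subspace_def qherm_def by (auto simp: ct_add ct_scale ct_0)

lemma subspace_pspace: "subspace pspace"
  using subspace_qherm unfolding subspace_def pspace_def by (auto simp: tr_add tr_scale tr_0)

lemma quat_mult: "A \<in> quat \<Longrightarrow> B \<in> quat \<Longrightarrow> A ** B \<in> quat"
  by (simp add: quat_def map_matrix_cnj_mult) (metis matrix_mul_assoc)

lemma quat_mat_1: "mat 1 \<in> quat" by (simp add: quat_def)

lemma quat_ctranspose: "A \<in> quat \<Longrightarrow> ctranspose A \<in> quat"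
proof -
  assume "A \<in> quat"
  then have "ctranspose (map_matrix cnj A) = ctranspose (- (J ** A ** J))" by (simp add: quat_cnj)
  moreover have "ctranspose J = - (J :: 'a cmat)" by (simp add: ctranspose_def transpose_J)
  ultimately have 1: "transpose A = - (J ** ctranspose A ** J)"
    by (simp add: ct_neg ctranspose_mult mm.minus_left mm.minus_right matrix_mul_assoc) (simp add: ctranspose_def)
  have "map_matrix cnj (ctranspose A) = transpose A" by (simp add: vec_eq_iff ctranspose_nth transpose_def)
  then have "J ** map_matrix cnj (ctranspose A) = - (J ** J ** ctranspose A ** J)"
    by (simp add: 1 mm.minus_right matrix_mul_assoc)
  then show ?thesis by (simp add: quat_def J_J mm.minus_left)
qed

lemma quat_matrix_inv:
  assumes A: "A \<in> quat" and d: "det A \<noteq> 0" shows "matrix_inv A \<in> quat"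
proof -
  have "map_matrix cnj A ** map_matrix cnj (matrix_inv A) = mat 1"
    by (simp add: map_matrix_cnj_mult[symmetric] matrix_inv_right[OF d])
  then have "J ** map_matrix cnj (matrix_inv A) = matrix_inv A ** (A ** J) ** map_matrix cnj (matrix_inv A)"
    by (simp add: matrix_mul_assoc matrix_inv_left[OF d])
  also have "\<dots> = matrix_inv A ** J ** (map_matrix cnj A ** map_matrix cnj (matrix_inv A))"
    using A by (simp add: quat_def matrix_mul_assoc)
  also have "\<dots> = matrix_inv A ** J"
    by (simp add: map_matrix_cnj_mult[symmetric] matrix_inv_right[OF d])
  finally show ?thesis by (simp add: quat_def)
qed

text \<open>Conjugation by \<open>J\<close> carries a quaternionic matrix to its complex conjugate,
  so both have the same trace.\<close>

lemma quat_trace_real: "A \<in> quat \<Longrightarrow> Im (trace A) = 0"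
proof -
  assume A: "A \<in> quat"
  have "cnj (trace A) = - trace (J ** A ** J)"
    using quat_cnj[OF A] trace_map_cnj[of A] by (simp add: tr_neg)
  also have "\<dots> = - trace (A ** (J ** J))" using trace_mul_sym[of J "A ** J"] by (simp add: matrix_mul_assoc)
  also have "\<dots> = trace A" by (simp add: J_J mm.minus_right tr_neg)
  finally show ?thesis by (simp add: complex_eq_iff)
qed

lemma det_J_J: "det (J :: 'n::finite cmat) * det (J :: 'n cmat) = 1"
proof -
  have "det (J :: 'n cmat) * det (J :: 'n cmat) = det (- (mat 1 :: 'n cmat))" by (simp add: det_mul[symmetric] J_J)
  also have "- (mat 1 :: 'n cmat) = (-1) *\<^sub>R mat 1" by simp
  also have "det \<dots> = 1" unfolding det_scaleR by (simp add: mult_2[symmetric] power_mult)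
  finally show ?thesis .
qed

lemma quat_det_real: "A \<in> quat \<Longrightarrow> Im (det A) = 0"
proof -
  assume A: "A \<in> quat"
  then have "det (A ** J) = det (J ** map_matrix cnj A)" by (simp add: quat_def)
  then have "det A * det (J :: 'a cmat) = det (J :: 'a cmat) * cnj (det A)" by (simp only: det_mul det_map_cnj)
  moreover have "det (J :: 'a cmat) \<noteq> 0" using det_J_J by (metis mult_zero_left zero_neq_one)
  ultimately have "cnj (det A) = det A" by (simp add: mult.commute)
  then show ?thesis by (simp add: complex_eq_iff)
qed

lemma quat_ctranspose_J: "A \<in> quat \<Longrightarrow> ctranspose A ** J = J ** transpose A"
proof -
  assume "A \<in> quat"
  moreover have "map_matrix cnj (ctranspose A) = transpose A" by (simp add: vec_eq_iff ctranspose_nth transpose_def)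
  ultimately show ?thesis using quat_ctranspose[of A] by (simp add: quat_def)
qed

lemma qskew_trace: "A \<in> qskew \<Longrightarrow> trace A = 0"
proof -
  assume A: "A \<in> qskew"
  then have "cnj (trace A) = - trace A" using trace_ctranspose[of A] by (simp add: qskew_def tr_neg)
  then show ?thesis using quat_trace_real[of A] A by (auto simp: qskew_def complex_eq_iff)
qed

lemma SUstar_quat: "SUstar = {z \<in> quat. det z = 1}"
  by (auto simp: SUstar_def quat_def)

lemma qherm_sandwich: "z \<in> quat \<Longrightarrow> X \<in> qherm \<Longrightarrow> z ** X ** ctranspose z \<in> qherm"
  by (auto simp: qherm_def ctranspose_mult matrix_mul_assoc intro!: quat_mult quat_ctranspose)

lemma qherm_quat: "A \<in> qherm \<Longrightarrow> A \<in> quat" by (simp add: qherm_def)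

lemma pspace_qherm: "A \<in> pspace \<Longrightarrow> A \<in> qherm" by (simp add: pspace_def)

lemma qherm_mat_1: "mat 1 \<in> qherm" by (simp add: qherm_def quat_mat_1)

lemma ctranspose_matrix_inv: "det A \<noteq> 0 \<Longrightarrow> ctranspose (matrix_inv A) = matrix_inv (ctranspose A)"
  by (rule matrix_inv_unique) (simp add: ctranspose_mult[symmetric] matrix_inv_left)

lemma qherm_matrix_inv: "A \<in> qherm \<Longrightarrow> det A \<noteq> 0 \<Longrightarrow> matrix_inv A \<in> qherm"
  by (auto simp: qherm_def quat_matrix_inv ctranspose_matrix_inv)

lemma qherm_trace_mult: "A \<in> qherm \<Longrightarrow> B \<in> qherm \<Longrightarrow> trace (A ** B) = of_real (A \<bullet> B)"
  using quat_trace_real[OF quat_mult[of A B]] by (auto simp: inner_matrix complex_eq_iff qherm_def)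

section \<open>Quadratic forms and positive definite matrices\<close>

definition qform :: "complex^'m^'m \<Rightarrow> complex^'m \<Rightarrow> real" where
  "qform P v = Re (hermitian_inner (P *v v) v)"

definition posdef :: "complex^'m^'m \<Rightarrow> bool" where
  "posdef P \<longleftrightarrow> (\<forall>v. v \<noteq> 0 \<longrightarrow> qform P v > 0)"

lemma qform_inner: "qform P v = (P *v v) \<bullet> v"
  by (simp add: qform_def hermitian_inner_def inner_vec_def inner_complex_def)

lemma linear_qform: "linear (\<lambda>P :: complex^'m^'m. qform P v)"
proof -
  have "(c *\<^sub>R P) *v v = c *\<^sub>R (P *v v)" for c and P :: "complex^'m^'m"
    by (simp add: vec_eq_iff matrix_vector_mult_def scaleR_sum_right)
  then show ?thesis
    by (simp add: linear_iff qform_inner matrix_vector_mult_add_rdistrib inner_add_left)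
qed

lemma hermitian_inner_adjoint: "hermitian_inner (A *v v) w = hermitian_inner v (ctranspose A *v w)"
  by (simp add: hermitian_inner_def matrix_vector_mult_def ctranspose_nth sum_distrib_left sum_distrib_right)
    (subst sum.swap, simp add: mult_ac)

lemma qform_gram: "qform (z ** ctranspose z) v = norm (ctranspose z *v v) ^ 2"
proof -
  have "hermitian_inner w w = of_real (norm w ^ 2)" for w :: "complex^'a"
    by (simp add: hermitian_inner_def power2_norm_eq_inner inner_vec_def complex_eq_iff inner_complex_def)
  then show ?thesis unfolding qform_def by (simp add: hermitian_inner_adjoint flip: matrix_vector_mul_assoc)
qed

lemma posdef_det: "posdef P \<Longrightarrow> det P \<noteq> 0"
proof
  assume P: "posdef P" "det P = 0"
  then have "\<not> invertible P" by (simp add: invertible_det_nz)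
  then obtain v where "v \<noteq> 0" "P *v v = 0"
    using matrix_left_invertible_ker[of P] invertible_left_inverse by blast
  then show False using P(1) unfolding posdef_def qform_def by (auto simp: hermitian_inner_def)
qed

lemma posdef_mat_1: "posdef (mat 1 :: complex^'m^'m)"
  unfolding posdef_def using qform_gram[of "mat 1 :: complex^'m^'m"] by simp

lemma posdef_convex: "convex {P. posdef P}"
proof (rule convexI)
  fix A B :: "complex^'a^'a" and u v :: real
  assume *: "A \<in> {P. posdef P}" "B \<in> {P. posdef P}" "0 \<le> u" "0 \<le> v" "u + v = 1"
  have "qform (u *\<^sub>R A + v *\<^sub>R B) w > 0" if "w \<noteq> 0" for w
  proof -
    interpret linear "\<lambda>P. qform P w" by (rule linear_qform)
    have "qform A w > 0" "qform B w > 0" using * that by (auto simp: posdef_def)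
    then have "u * qform A w + v * qform B w > 0"
      using * by (cases "u = 0") (auto intro!: add_pos_nonneg mult_pos_pos mult_nonneg_nonneg)
    then show ?thesis by (simp add: add scale)
  qed
  then show "u *\<^sub>R A + v *\<^sub>R B \<in> {P. posdef P}" by (simp add: posdef_def)
qed

text \<open>Along the segment from the identity to P all matrices are positive definite, hence
  invertible, and quaternionic, hence of real determinant. The determinant starts at 1 and cannot
  cross zero.\<close>

lemma posdef_det_pos:
  assumes P: "P \<in> qherm" "posdef P" shows "Re (det P) > 0"
proof (rule ccontr)
  assume neg: "\<not> Re (det P) > 0"
  let ?\<gamma> = "\<lambda>t::real. (1 - t) *\<^sub>R mat 1 + t *\<^sub>R P"
  have "continuous_on {0..1} ?\<gamma>" by (intro continuous_intros)
  then have "continuous_on {0..1} (\<lambda>t. det (?\<gamma> t))"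
    by (rule continuous_on_compose2[OF Cinf_continuous[OF Cinf_det[OF open_UNIV Cinf_ident[OF open_UNIV]]]]) simp
  then have "continuous_on {0..1} (\<lambda>t. Re (det (?\<gamma> t)))" by (rule continuous_on_Re)
  then obtain t where t: "0 \<le> t" "t \<le> 1" "Re (det (?\<gamma> t)) = 0"
    using IVT2'[of "\<lambda>t. Re (det (?\<gamma> t))" 1 0 0] neg by auto
  have "?\<gamma> t \<in> quat" using P(1) quat_mat_1 subspace_quat by (auto simp: qherm_def intro!: subspace_add subspace_scale)
  then have "det (?\<gamma> t) = 0" using quat_det_real t(3) by (auto simp: complex_eq_iff)
  moreover have "posdef (?\<gamma> t)"
    using convexD[OF posdef_convex, of "mat 1" P "1 - t" t] P(2) posdef_mat_1 t by auto
  ultimately show False using posdef_det by blast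
qed

text \<open>The complex linear projection onto the complexification of \<open>pspace\<close>: the
  involution sending M to \<open>- (J ** transpose M ** J)\<close> fixes \<open>qherm\<close>,
  averaging M with its image symmetrises it, and the last term removes the trace.\<close>

definition pproj :: "'n::finite cmat \<Rightarrow> 'n cmat" where
  "pproj M = (1/2) *\<^sub>R (M - J ** transpose M ** J) - mat (trace M / of_nat CARD('n + 'n))"

lemma mat_mult_nth [simp]: "(mat c ** A) $ i $ j = c * (A :: complex^'m^'m) $ i $ j"
  by (simp add: matrix_matrix_mult_def mat_def if_distrib if_distribR sum.delta' cong: if_cong)

lemma mult_mat_nth [simp]: "(A ** mat c) $ i $ j = c * (A :: complex^'m^'m) $ i $ j"
  by (simp add: matrix_matrix_mult_def mat_def if_distrib if_distribR sum.delta' mult.commute cong: if_cong)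

lemma mat_commute: "A ** mat c = mat c ** (A :: complex^'m^'m)"
  by (simp add: vec_eq_iff)

lemma trace_mat_mult: "trace (mat c ** A) = c * trace (A :: complex^'m^'m)"
  by (simp add: trace_def sum_distrib_left)

lemma trace_mat: "trace (mat c :: complex^'m^'m) = of_nat CARD('m) * c"
  by (simp add: trace_def mat_def)

lemma mat_of_real_mult: "mat (of_real c) ** A = c *\<^sub>R (A :: complex^'m^'m)"
  by (simp add: vec_eq_iff) (simp add: scaleR_conv_of_real)

lemma mat_add: "mat (c + d) = mat c + (mat d :: complex^'m^'m)"
  by (simp add: vec_eq_iff mat_def)

lemma mat_mat_mult: "mat c ** mat d = (mat (c * d) :: complex^'m^'m)"
  by (simp add: vec_eq_iff) (simp add: mat_def)

lemma qherm_J: "X \<in> qherm \<Longrightarrow> X ** J = J ** transpose X"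
  using quat_ctranspose_J[of X] by (simp add: qherm_def)

lemma J_transpose_J: "X \<in> qherm \<Longrightarrow> J ** transpose X ** J = - X"
  by (simp add: qherm_J[symmetric] J_J')

lemma trace_mult_J_transpose: "X \<in> qherm \<Longrightarrow> trace (X ** (J ** transpose M ** J)) = - trace (X ** M)"
proof -
  assume X: "X \<in> qherm"
  have "trace (X ** (J ** transpose M ** J)) = trace (transpose (X ** (J ** transpose M ** J)))"
    by (simp add: trace_transpose)
  also have "\<dots> = trace (J ** (M ** J ** transpose X))"
    by (simp add: matrix_transpose_mul transpose_J mm.minus_left mm.minus_right matrix_mul_assoc)
  also have "\<dots> = trace (M ** J ** transpose X ** J)" by (simp add: trace_mul_sym[of J])
  also have "\<dots> = trace (M ** (J ** transpose X ** J))" by (simp add: matrix_mul_assoc)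
  also have "\<dots> = - trace (X ** M)"
    by (simp add: J_transpose_J[OF X] mm.minus_right tr_neg trace_mul_sym[of M])
  finally show ?thesis .
qed

text \<open>Both parts that the projection discards, the antisymmetric one under the involution and
  the scalar one, pair to zero with \<open>pspace\<close> under the trace form.\<close>

lemma trace_mult_pproj: "X \<in> pspace \<Longrightarrow> trace (X ** pproj M) = trace (X ** M)"
  unfolding pproj_def
  by (simp add: mm.diff_right mm.scaleR_right tr_diff tr_scale trace_mult_J_transpose[OF pspace_qherm]
      mat_commute trace_mat_mult) (simp add: pspace_def)

lemma trace_pproj_mult: "X \<in> pspace \<Longrightarrow> trace (pproj M ** X) = trace (M ** X)"
  using trace_mult_pproj[of X M] trace_mul_sym[of X M] trace_mul_sym[of X "pproj M"] by simp

text \<open>H is the Hermitian part of P, and K is the skew part divided by the imaginary unit.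
  Moving J past P or past its adjoint yields the conjugate of the other one (\<open>PJ\<close> and
  \<open>PJ'\<close>), which makes the two combinations quaternionic.\<close>

lemma pproj_decomp:
  obtains H K :: "'n::finite cmat" where "H \<in> pspace" "K \<in> pspace" "pproj M = H + mat \<i> ** K"
proof -
  define P where "P = pproj M"
  have PJ: "P ** J = J ** transpose P"
  proof -
    have "transpose P = (1/2) *\<^sub>R (transpose M - J ** M ** J) - mat (trace M / of_nat CARD('n + 'n))"
      unfolding P_def pproj_def
      by (simp add: tp_diff tp_scale matrix_transpose_mul transpose_J mm.minus_left mm.minus_right matrix_mul_assoc transpose_mat)
    then show ?thesis unfolding P_def pproj_def
      by (simp add: mm.diff_left mm.diff_right mm.scaleR_left mm.scaleR_right matrix_mul_assoc J_J J_J' mm.minus_left mat_commute)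
  qed
  have trP: "trace P = 0"
  proof -
    have "trace (J ** transpose M ** J) = trace (J ** J ** transpose M)"
      using trace_mul_sym[of "J ** transpose M" J] by (simp add: matrix_mul_assoc)
    then have "trace (J ** transpose M ** J) = - trace M" by (simp add: J_J mm.minus_left tr_neg trace_transpose)
    then show ?thesis unfolding P_def pproj_def by (simp add: tr_diff tr_scale trace_mat)
  qed
  have PJ': "ctranspose P ** J = J ** map_matrix cnj P"
  proof -
    have "map_matrix cnj P ** J = J ** ctranspose P"
      using arg_cong[OF PJ, of "map_matrix cnj"] by (simp add: map_matrix_cnj_mult ctranspose_conv)
    then have "J ** (map_matrix cnj P ** J) ** J = J ** (J ** ctranspose P) ** J" by simp
    then show ?thesis by (simp add: matrix_mul_assoc J_J J_J' mm.minus_left)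
  qed
  define H where "H = (1/2) *\<^sub>R (P + ctranspose P)"
  define K where "K = (1/2) *\<^sub>R (mat (-\<i>) ** (P - ctranspose P))"
  have cc: "map_matrix cnj (ctranspose P) = transpose P" by (simp add: vec_eq_iff ctranspose_nth transpose_def)
  have ctm: "ctranspose (mat c ** A) = mat (cnj c) ** ctranspose A" for c and A :: "'n cmat"
    by (simp add: vec_eq_iff ctranspose_nth)
  have mcm: "map_matrix cnj (mat c ** A) = mat (cnj c) ** map_matrix cnj A" for c and A :: "'n cmat"
    by (simp add: vec_eq_iff)
  have Jm: "J ** (mat c ** A) = mat c ** (J ** A)" for c and A :: "'n cmat"
    by (simp only: matrix_mul_assoc mat_commute)
  have neg: "mat (- c) ** A = - (mat c ** A)" for c and A :: "'n cmat" by (simp add: vec_eq_iff)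
  have "H ** J = J ** map_matrix cnj H"
    unfolding H_def mc_scale mc_add cc
    by (simp only: mm.scaleR_left mm.add_left mm.scaleR_right mm.add_right PJ PJ' add.commute)
  moreover have "K ** J = J ** map_matrix cnj K"
    unfolding K_def mc_scale mcm mc_diff cc mm.scaleR_left mm.scaleR_right Jm matrix_mul_assoc[symmetric] mm.diff_left mm.diff_right PJ PJ'
    by (simp add: neg mm.diff_right)
  moreover have "ctranspose H = H" unfolding H_def by (simp add: ct_scale ct_add add.commute)
  moreover have "ctranspose K = K" unfolding K_def by (simp add: ct_scale ctm ct_diff neg mm.diff_right)
  moreover have "trace H = 0" unfolding H_def by (simp add: tr_scale tr_add trace_ctranspose trP)
  moreover have "trace K = 0" unfolding K_def by (simp add: tr_scale trace_mat_mult tr_diff trace_ctranspose trP)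
  moreover have "P = H + mat \<i> ** K"
    unfolding H_def K_def by (simp add: vec_eq_iff field_simps)
  ultimately show ?thesis using that[of H K] unfolding P_def pspace_def qherm_def quat_def by blast
qed

section \<open>Sums over orthonormal bases of the model space\<close>

lemma orthonormal_basis_expansion:
  assumes B: "orthonormal_basis inner F B" and x: "x \<in> F"
  shows "(\<Sum>b\<in>B. (x \<bullet> b) *\<^sub>R b) = x"
proof -
  have fin: "finite B" and orth: "\<And>b b'. b \<in> B \<Longrightarrow> b' \<in> B \<Longrightarrow> b \<bullet> b' = (if b = b' then 1 else 0)"
    using B by (auto simp: orthonormal_basis_def)
  have "x \<in> span B" using B x by (auto simp: orthonormal_basis_def)
  then show ?thesis
  proof (induction rule: span_induct_alt)
    case base
    then show ?case by simp
  next
    case (step c y z)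
    have "(\<Sum>b\<in>B. (y \<bullet> b) *\<^sub>R b) = (\<Sum>b\<in>B. if b = y then y else 0)"
      using orth[OF step(1)] by (intro sum.cong) auto
    then have "(\<Sum>b\<in>B. (y \<bullet> b) *\<^sub>R b) = y" using fin step(1) by simp
    then have "(\<Sum>b\<in>B. (c * (y \<bullet> b)) *\<^sub>R b) = c *\<^sub>R y"
      by (simp add: scaleR_sum_right[symmetric] flip: scaleR_scaleR)
    then show ?case using step by (simp add: inner_add_left scaleR_add_left sum.distrib)
  qed
qed

text \<open>The completeness relation of an orthonormal basis, extended to complex coefficients:
  both components of the projection are expanded in the same real basis, and
  \<open>trace (M ** b)\<close> collects the two coefficients.\<close>

lemma sum_pproj:
  assumes B: "orthonormal_basis inner pspace B"
  shows "(\<Sum>b\<in>B. mat (trace (M ** b)) ** b) = pproj (M :: 'n::finite cmat)"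
proof -
  obtain H K where HK: "H \<in> pspace" "K \<in> pspace" "pproj M = H + mat \<i> ** K" by (rule pproj_decomp)
  have Bp: "b \<in> pspace" if "b \<in> B" for b using B that by (auto simp: orthonormal_basis_def)
  have "mat (trace (M ** b)) ** b = (H \<bullet> b) *\<^sub>R b + mat \<i> ** ((K \<bullet> b) *\<^sub>R b)" if "b \<in> B" for b
  proof -
    have "trace (M ** b) = trace (H ** b) + \<i> * trace (K ** b)"
      using trace_pproj_mult[OF Bp[OF that], of M] HK(3)
      by (simp add: mm.add_left tr_add matrix_mul_assoc[symmetric] trace_mat_mult)
    also have "\<dots> = of_real (H \<bullet> b) + \<i> * of_real (K \<bullet> b)"
      using HK Bp[OF that] by (simp add: qherm_trace_mult pspace_qherm)
    finally show ?thesis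
      by (simp add: mat_add mm.add_left mat_of_real_mult flip: mat_mat_mult matrix_mul_assoc)
  qed
  then have "(\<Sum>b\<in>B. mat (trace (M ** b)) ** b) = (\<Sum>b\<in>B. (H \<bullet> b) *\<^sub>R b) + mat \<i> ** (\<Sum>b\<in>B. (K \<bullet> b) *\<^sub>R b)"
    by (simp add: sum.distrib mm.sum_right)
  then show ?thesis using orthonormal_basis_expansion[OF B] HK by simp
qed

section \<open>Rank-one matrices\<close>

definition dot :: "complex^'m \<Rightarrow> complex^'m \<Rightarrow> complex" where
  "dot x y = (\<Sum>i\<in>UNIV. x $ i * y $ i)"

lemma trace_outer: "trace (outer c e) = dot c e"
  by (simp add: trace_def outer_def dot_def)

lemma outer_mult_outer: "outer c e ** outer c' e' = mat (dot e c') ** outer c e'"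
  by (simp add: vec_eq_iff) (simp add: outer_def matrix_matrix_mult_def dot_def sum_distrib_right sum_distrib_left mult_ac)

lemma mult_outer: "A ** outer c e = outer (A *v c) (e :: complex^'m)"
  by (simp add: vec_eq_iff outer_def matrix_matrix_mult_def matrix_vector_mult_def sum_distrib_left mult_ac)

lemma outer_mult: "outer c e ** A = outer c (transpose A *v (e :: complex^'m))"
  by (simp add: vec_eq_iff outer_def matrix_matrix_mult_def matrix_vector_mult_def transpose_def sum_distrib_left mult_ac)

lemma transpose_outer: "transpose (outer c e) = outer e c"
  by (simp add: vec_eq_iff outer_def transpose_def mult.commute)

lemma neg_mult_vec: "(- A) *v x = - (A *v (x :: complex^'m))"
  by (simp add: vec_eq_iff matrix_vector_mult_def sum_negf)

text \<open>\<open>J\<close> is antisymmetric, and the pairing involves no conjugation.\<close>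

lemma dot_J: "dot x (J *v x) = 0" and dot_J': "dot (J *v x) x = 0"
proof -
  have "dot x (J *v x) = (\<Sum>i\<in>UNIV. \<Sum>j\<in>UNIV. x $ i * (J $ i $ j * x $ j))"
    by (simp add: dot_def matrix_vector_mult_def sum_distrib_left)
  also have "\<dots> = (\<Sum>j\<in>UNIV. \<Sum>i\<in>UNIV. x $ i * (J $ i $ j * x $ j))" by (rule sum.swap)
  also have "\<dots> = (\<Sum>j\<in>UNIV. \<Sum>i\<in>UNIV. x $ j * ((transpose J) $ j $ i * x $ i))" by (simp add: transpose_def mult_ac)
  also have "\<dots> = - dot x (J *v x)"
    by (simp add: transpose_J dot_def matrix_vector_mult_def sum_distrib_left sum_negf)
  finally show *: "dot x (J *v x) = 0" by simp
  then show "dot (J *v x) x = 0" by (simp add: dot_def mult.commute)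
qed

lemma dot_axis: "dot (axis k 1) y = y $ k"
proof -
  have "dot (axis k 1) y = (\<Sum>i\<in>UNIV. if i = k then y $ i else 0)"
    unfolding dot_def by (intro sum.cong) (auto simp: axis_def)
  then show ?thesis by simp
qed

lemma mult_axis_nth: "(A *v axis k 1) $ i = (A :: complex^'m^'m) $ i $ k"
proof -
  have "(A *v axis k 1) $ i = (\<Sum>j\<in>UNIV. A $ i $ j * (if j = k then 1 else 0))"
    by (simp add: matrix_vector_mult_def axis_def)
  also have "\<dots> = (\<Sum>j\<in>UNIV. if j = k then A $ i $ j else 0)"
    by (intro sum.cong) auto
  finally have "(A *v axis k 1) $ i = (\<Sum>j\<in>UNIV. if j = k then A $ i $ j else 0)" .
  then show ?thesis by simp
qed

lemma half_scaleR: "(1/2) *\<^sub>R x = x / (2::complex)"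
  by (simp add: scaleR_conv_of_real)

text \<open>An entry of the sum is a sum over k of products of two entries, and for each k this is
  an entry of the completeness relation for the matrix unit \<open>E k r\<close>. Summed over k, the
  unit contributes N/2, its reflection through J contributes -1/2, and the trace correction
  -1/N.\<close>

lemma sum_squares_pspace:
  assumes B: "orthonormal_basis inner (pspace :: 'n::finite cmat set) B"
  shows "(\<Sum>b\<in>B. b ** b) = ((real CARD('n + 'n) - 1) / 2 - 1 / real CARD('n + 'n)) *\<^sub>R mat 1"
proof -
  define N where "N = CARD('n + 'n)"
  have N: "N > 0" unfolding N_def by (rule zero_less_card_finite)
  define E :: "'n + 'n \<Rightarrow> 'n + 'n \<Rightarrow> 'n cmat" where "E k r = outer (axis k 1) (axis r 1)" for k r
  have Eb: "trace (E k r ** b) = b $ r $ k" for k r b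
    unfolding E_def outer_mult trace_outer dot_axis mult_axis_nth by (simp add: transpose_def)
  have JEJ: "(J ** transpose (E k r) ** J) $ k $ s = J $ k $ r * J $ k $ s" for k r s
    unfolding E_def transpose_outer mult_outer outer_mult by (simp add: outer_def mult_axis_nth del: transpose_matrix_vector) (simp add: transpose_def)
  have JJ: "(\<Sum>k\<in>UNIV. J $ k $ r * J $ k $ s) = (mat 1 :: 'n cmat) $ r $ s" for r s
  proof -
    have "(\<Sum>k\<in>UNIV. J $ k $ r * J $ k $ s) = (transpose J ** J) $ r $ s"
      by (simp add: matrix_matrix_mult_def transpose_def)
    then show ?thesis by (simp add: transpose_J mm.minus_left J_J)
  qed
  have trE: "trace (E k r) = (if k = r then 1 else 0)" for k r
    unfolding E_def trace_outer dot_axis by (simp add: axis_def)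
  have Ek: "E k r $ k $ s = mat 1 $ r $ s" for k r s
    by (simp add: E_def outer_def axis_def mat_def)
  have key: "(\<Sum>b\<in>B. b $ r $ k * b $ k $ s) = (E k r $ k $ s - J $ k $ r * J $ k $ s) / 2 - (if k = s then (if k = r then 1 / of_nat N else 0) else 0)" for r k s
  proof -
    have "(\<Sum>b\<in>B. b $ r $ k * b $ k $ s) = (\<Sum>b\<in>B. mat (trace (E k r ** b)) ** b) $ k $ s"
      by (simp add: Eb)
    also have "\<dots> = pproj (E k r) $ k $ s" by (simp only: sum_pproj[OF B])
    also have "\<dots> = (E k r $ k $ s - J $ k $ r * J $ k $ s) / 2 - (if k = s then (if k = r then 1 / of_nat N else 0) else 0)"
      by (simp add: pproj_def JEJ trE N_def mat_def half_scaleR)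
    finally show ?thesis .
  qed
  have "(\<Sum>b\<in>B. b ** b) $ r $ s = ((((real N - 1) / 2 - 1 / real N) *\<^sub>R mat 1) :: 'n cmat) $ r $ s" for r s
  proof -
    have "(\<Sum>b\<in>B. b ** b) $ r $ s = (\<Sum>k\<in>UNIV. \<Sum>b\<in>B. b $ r $ k * b $ k $ s)"
      by (subst sum.swap) (simp add: matrix_matrix_mult_def)
    also have "\<dots> = ((\<Sum>k\<in>UNIV. E k r $ k $ s) - (\<Sum>k\<in>UNIV. J $ k $ r * J $ k $ s)) / 2 - (\<Sum>k\<in>UNIV. if k = s then (if k = r then 1 / of_nat N else 0) else 0)"
      unfolding key by (simp add: sum_subtractf sum_divide_distrib[symmetric] del: sum.delta sum.delta')
    also have "(\<Sum>k\<in>UNIV. E k r $ k $ s) = of_nat N * mat 1 $ r $ s"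
      by (simp add: Ek N_def)
    also have "(\<Sum>k\<in>UNIV. if k = s then (if k = r then 1 / complex_of_nat N else 0) else 0) = mat 1 $ r $ s / of_nat N"
      by (simp add: mat_def)
    finally show ?thesis unfolding JJ by (simp add: mat_def) (simp add: scaleR_conv_of_real field_simps)
  qed
  then show ?thesis unfolding vec_eq_iff N_def by blast
qed

lemma pproj_outer:
  "pproj (outer c e :: 'n::finite cmat) = (1/2) *\<^sub>R (outer c e + outer (J *v e) (J *v c)) - mat (dot c e / of_nat CARD('n + 'n))"
proof -
  have "outer x (- y) = - outer x y" for x y :: "'n cvec" by (simp add: vec_eq_iff outer_def)
  then show ?thesis
    by (simp add: pproj_def trace_outer transpose_outer mult_outer outer_mult transpose_J neg_mult_vec)
qed

lemma mat_0_mult: "mat 0 ** A = (0 :: complex^'m^'m)" by simp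

text \<open>Of the three terms in \<open>pproj_outer\<close> the reflected one is annihilated
  because J is alternating, while the others reproduce \<open>outer c e\<close>: 1/2 comes from the
  matrix itself and -1/N from its trace.\<close>

lemma pproj_outer_mult:
  "pproj (outer c e :: 'n::finite cmat) ** outer c e = mat ((1/2 - 1 / of_nat CARD('n + 'n)) * dot c e) ** outer c e"
  "outer c e ** pproj (outer c e :: 'n::finite cmat) = mat ((1/2 - 1 / of_nat CARD('n + 'n)) * dot c e) ** outer c e"
proof -
  have d: "dot e c = dot c e" by (simp add: dot_def mult.commute)
  show "pproj (outer c e :: 'n::finite cmat) ** outer c e = mat ((1/2 - 1 / of_nat CARD('n + 'n)) * dot c e) ** outer c e"
    unfolding pproj_outer mm.diff_left mm.scaleR_left mm.add_left outer_mult_outer d dot_J' mat_0_mult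
    by (simp add: vec_eq_iff algebra_simps half_scaleR)
  show "outer c e ** pproj (outer c e :: 'n::finite cmat) = mat ((1/2 - 1 / of_nat CARD('n + 'n)) * dot c e) ** outer c e"
    unfolding pproj_outer mm.diff_right mm.scaleR_right mm.add_right outer_mult_outer d dot_J mat_0_mult mat_commute
    by (simp add: vec_eq_iff algebra_simps half_scaleR)
qed

text \<open>One of the two trace factors is absorbed by the completeness relation, which leaves
  \<open>trace (M ** pproj M)\<close>; for rank one this product is a multiple of M.\<close>

lemma sum_trace_squared:
  assumes B: "orthonormal_basis inner pspace B" and M: "M = (outer c e :: 'n::finite cmat)"
  shows "(\<Sum>b\<in>B. (trace (M ** b))\<^sup>2) = (1/2 - 1 / of_nat CARD('n + 'n)) * (trace M)\<^sup>2"
proof -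
  have "(\<Sum>b\<in>B. (trace (M ** b))\<^sup>2) = trace (M ** (\<Sum>b\<in>B. mat (trace (M ** b)) ** b))"
    by (simp add: mm.sum_right tr_sum matrix_mul_assoc mat_commute power2_eq_square)
      (simp add: matrix_mul_assoc[symmetric] trace_mat_mult)
  also have "\<dots> = trace (M ** pproj M)" by (simp only: sum_pproj[OF B])
  also have "\<dots> = (1/2 - 1 / of_nat CARD('n + 'n)) * (trace M)\<^sup>2"
    unfolding M pproj_outer_mult trace_mat_mult trace_outer by (simp add: power2_eq_square)
  finally show ?thesis .
qed

text \<open>The two normal directions \<open>g1\<close>, \<open>g2\<close> are the real and imaginary part of \<open>G = pproj M\<close>, and
  \<open>2 (g1\<^sup>2 + g2\<^sup>2) = G G' + G' G\<close> with \<open>G' = g1 - i g2\<close>. As \<open>G M + M G = 0\<close>, they do not contribute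
  to the trace.\<close>

lemma
  assumes M: "M = (outer c e :: 'n::finite cmat)" "trace M = 0" "pproj M \<noteq> 0"
  shows sum_squares_kernel: "orthonormal_basis inner {X \<in> pspace. trace (M ** X) = 0} B \<Longrightarrow> (\<Sum>b\<in>B. trace (M ** (b ** b))) = 0"
    and dim_kernel: "dim {X \<in> pspace. trace (M ** X) = 0} + 2 = dim (pspace :: 'n cmat set)"
proof -
  obtain g1 g2 where g: "g1 \<in> pspace" "g2 \<in> pspace" "pproj M = g1 + mat \<i> ** g2" by (rule pproj_decomp)
  define G where "G = pproj M"
  have t: "trace (M ** X) = of_real (X \<bullet> g1) + \<i> * of_real (X \<bullet> g2)" if "X \<in> pspace" for X
    using trace_pproj_mult[OF that, of M] that g
    by (simp add: mm.add_left tr_add matrix_mul_assoc[symmetric] trace_mat_mult qherm_trace_mult pspace_qherm inner_commute)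
  have ker: "{X \<in> pspace. trace (M ** X) = 0} = {X \<in> pspace. X \<bullet> g1 = 0 \<and> X \<bullet> g2 = 0}"
    using t by (auto simp: complex_eq_iff)
  have d: "dot c e = 0" using M by (simp add: trace_outer)
  have GM: "G ** M = 0" "M ** G = 0"
    unfolding G_def M(1) by (simp_all only: pproj_outer_mult d mult_zero_right mat_0_mult)
  \<comment> \<open>Comparing real and imaginary parts in \<open>trace (M ** G) = 0\<close> shows
    that \<open>g1\<close> and \<open>g2\<close> are orthogonal and of equal length.\<close>
  have "trace (M ** g1) + \<i> * trace (M ** g2) = trace (M ** G)"
    unfolding G_def g by (simp add: mm.add_right tr_add matrix_mul_assoc mat_commute) (simp add: matrix_mul_assoc[symmetric] trace_mat_mult)
  then have "of_real (g1 \<bullet> g1) + \<i> * of_real (g1 \<bullet> g2) + \<i> * (of_real (g2 \<bullet> g1) + \<i> * of_real (g2 \<bullet> g2)) = (0::complex)"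
    using t g GM by (simp add: tr_0)
  then have n: "g1 \<bullet> g1 = g2 \<bullet> g2" "g1 \<bullet> g2 = 0"
    by (auto simp: complex_eq_iff inner_commute algebra_simps)
  have nz: "g1 \<noteq> 0" "g2 \<noteq> 0" using n g M(3) by (auto simp: mm.zero_right)
  define r where "r = norm g1"
  have r: "r > 0" "g1 \<bullet> g1 = r^2" "g2 \<bullet> g2 = r^2"
    using nz n by (auto simp: r_def dot_square_norm)
  show "dim {X \<in> pspace. trace (M ** X) = 0} + 2 = dim (pspace :: 'n cmat set)"
  proof -
    have "dim {y \<in> pspace. \<forall>x\<in>span {g1, g2}. orthogonal x y} + dim (span {g1, g2}) = dim (pspace :: 'n cmat set)"
      by (rule dim_subspace_orthogonal_to_vectors) (simp_all add: subspace_pspace span_minimal g)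
    moreover have "independent {g1, g2}"
      using n nz by (intro pairwise_orthogonal_independent) (auto simp: pairwise_def orthogonal_def inner_commute)
    moreover have "g1 \<noteq> g2" using n nz by auto
    moreover have "{y \<in> pspace. \<forall>x\<in>span {g1, g2}. orthogonal x y} = {X \<in> pspace. X \<bullet> g1 = 0 \<and> X \<bullet> g2 = 0}"
    proof -
      have "orthogonal x y" if "y \<bullet> g1 = 0" "y \<bullet> g2 = 0" "x \<in> span {g1, g2}" for x y
        using that(3) by (induction rule: span_induct_alt)
          (use that in \<open>auto simp: orthogonal_def inner_add_left inner_add_right inner_commute\<close>)
      moreover have "y \<bullet> g1 = 0 \<and> y \<bullet> g2 = 0" if "\<forall>x\<in>span {g1, g2}. orthogonal x y" for y
        using that[rule_format, of g1] that[rule_format, of g2] by (simp add: span_base orthogonal_def inner_commute)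
      ultimately show ?thesis by blast
    qed
    ultimately show ?thesis unfolding ker by (simp add: dim_eq_card_independent)
  qed
  assume B: "orthonormal_basis inner {X \<in> pspace. trace (M ** X) = 0} B"
  then have B': "finite B" "B \<subseteq> {X \<in> pspace. X \<bullet> g1 = 0 \<and> X \<bullet> g2 = 0}" "{X \<in> pspace. X \<bullet> g1 = 0 \<and> X \<bullet> g2 = 0} \<subseteq> span B"
    "\<And>b b'. b \<in> B \<Longrightarrow> b' \<in> B \<Longrightarrow> b \<bullet> b' = (if b = b' then 1 else 0)"
    unfolding ker by (auto simp: orthonormal_basis_def)
  define h1 h2 where "h1 = g1 /\<^sub>R r" and "h2 = g2 /\<^sub>R r"
  have h: "h1 \<bullet> h1 = 1" "h2 \<bullet> h2 = 1" "h1 \<bullet> h2 = 0" "h1 \<in> pspace" "h2 \<in> pspace"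
    using r n g by (auto simp: h1_def h2_def power2_eq_square field_simps intro!: subspace_scale[OF subspace_pspace])
  have Bh: "b \<bullet> h1 = 0" "b \<bullet> h2 = 0" if "b \<in> B" for b using B'(2) that by (auto simp: h1_def h2_def)
  have notin: "h1 \<notin> insert h2 B" "h2 \<notin> B" using Bh h by auto
  \<comment> \<open>With the two unit normals adjoined, B becomes an orthonormal basis of
    \<open>pspace\<close>. There the sum of squares is scalar and is killed by the vanishing trace
    of M, so only the contribution of the normals has to be examined.\<close>
  have "orthonormal_basis inner pspace (insert h1 (insert h2 B))"
    unfolding orthonormal_basis_def
  proof (intro conjI ballI subsetI)
    show "finite (insert h1 (insert h2 B))" using B' by simp
    show "x \<in> pspace" if "x \<in> insert h1 (insert h2 B)" for x using that h B' by auto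
    show "b \<bullet> b' = (if b = b' then 1 else 0)" if "b \<in> insert h1 (insert h2 B)" "b' \<in> insert h1 (insert h2 B)" for b b'
      using that h Bh B'(4) notin by (auto simp: inner_commute)
    fix X :: "'n cmat" assume X: "X \<in> pspace"
    let ?Y = "X - (X \<bullet> h1) *\<^sub>R h1 - (X \<bullet> h2) *\<^sub>R h2"
    have "?Y \<in> pspace" using X h by (auto intro!: subspace_diff[OF subspace_pspace] subspace_scale[OF subspace_pspace])
    moreover have "?Y \<bullet> h1 = 0" "?Y \<bullet> h2 = 0" using h inner_commute[of h1 h2] by (auto simp: inner_diff_left)
    then have "?Y \<bullet> g1 = 0" "?Y \<bullet> g2 = 0" using r by (auto simp: h1_def h2_def)
    ultimately have "?Y \<in> span B" using B'(3) by blast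
    then have "?Y \<in> span (insert h1 (insert h2 B))" using span_mono[of B "insert h1 (insert h2 B)"] by blast
    then have "?Y + (X \<bullet> h1) *\<^sub>R h1 + (X \<bullet> h2) *\<^sub>R h2 \<in> span (insert h1 (insert h2 B))"
      by (intro span_add) (auto intro: span_scale span_base)
    then show "X \<in> span (insert h1 (insert h2 B))" by simp
  qed
  from sum_squares_pspace[OF this]
  obtain k where k: "(\<Sum>b\<in>insert h1 (insert h2 B). b ** b) = k *\<^sub>R mat 1" by blast
  have "(\<Sum>b\<in>B. trace (M ** (b ** b))) + trace (M ** (h1 ** h1 + h2 ** h2)) = trace (M ** (\<Sum>b\<in>insert h1 (insert h2 B). b ** b))"
    using B'(1) notin by (simp add: mm.add_right tr_add mm.sum_right tr_sum)
  also have "\<dots> = 0" unfolding k by (simp add: mm.scaleR_right tr_scale M(2))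
  finally have s: "(\<Sum>b\<in>B. trace (M ** (b ** b))) + trace (M ** (h1 ** h1 + h2 ** h2)) = 0" .
  define G' where "G' = g1 - mat \<i> ** g2"
  have "G ** G' + G' ** G = 2 *\<^sub>R (g1 ** g1 + g2 ** g2)"
  proof -
    have i: "mat \<i> ** g2 ** (mat \<i> ** g2) = - (g2 ** g2)"
    proof -
      have "mat \<i> ** g2 ** (mat \<i> ** g2) = mat \<i> ** mat \<i> ** (g2 ** g2)"
        by (metis mat_commute matrix_mul_assoc)
      then show ?thesis by (simp add: mat_mat_mult vec_eq_iff)
    qed
    show ?thesis unfolding G_def g G'_def
      by (simp add: mm.add_left mm.add_right mm.diff_left mm.diff_right i scaleR_2)
  qed
  moreover have "trace (M ** (G ** G' + G' ** G)) = 0"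
  proof -
    have "trace (M ** (G' ** G)) = trace (G ** M ** G')" using trace_mul_sym[of "M ** G'" G] by (simp add: matrix_mul_assoc)
    then show ?thesis by (simp add: mm.add_right tr_add matrix_mul_assoc GM tr_0)
  qed
  ultimately have "trace (M ** (g1 ** g1 + g2 ** g2)) = 0"
    by (simp add: mm.scaleR_right tr_scale)
  then have "trace (M ** (h1 ** h1 + h2 ** h2)) = 0"
    unfolding h1_def h2_def by (simp add: mm.scaleR_left mm.scaleR_right flip: scaleR_add_right) (simp add: tr_scale)
  then show "(\<Sum>b\<in>B. trace (M ** (b ** b))) = 0" using s by simp
qed

text \<open>A vanishing projection makes \<open>outer c e\<close> equal to minus its reflection, so
  c is a multiple of \<open>J *v e\<close>. Cancelling J and the invertible
  \<open>transpose z\<close> makes a a multiple of b.\<close>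

lemma pproj_outer_nonzero:
  fixes a b :: "'n::finite cvec"
  assumes ab: "a \<noteq> b" "vec.independent {a, b}" and z: "det z \<noteq> 0"
    and c: "c = J *v (transpose z *v a)" and e: "e = transpose z *v b" and d: "dot c e = 0"
  shows "pproj (outer c e) \<noteq> 0"
proof
  assume "pproj (outer c e) = 0"
  then have eq: "outer c e + outer (J *v e) (J *v c) = 0" using d by (simp add: pproj_outer)
  have b0: "b \<noteq> 0" using ab(2) vec.dependent_zero[of "{a, b}"] by auto
  define T where "T = transpose z"
  have dt: "det T \<noteq> 0" using z by (simp add: T_def)
  have injz: "x = y" if "T *v x = T *v y" for x y
    using arg_cong[OF that, of "(*v) (matrix_inv T)"]
    by (simp add: matrix_vector_mul_assoc matrix_inv_left[OF dt])
  note c = c[folded T_def] and e = e[folded T_def]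
  have injJ: "x = y" if "J *v x = J *v y" for x y :: "'n cvec"
    using arg_cong[OF that, of "(*v) J"] by (simp add: matrix_vector_mul_assoc J_J neg_mult_vec)
  have "e \<noteq> 0" using injz[of b 0] b0 e by (auto simp: matrix_vector_mult_0_right)
  then obtain j where j: "e $ j \<noteq> 0" by (auto simp: vec_eq_iff)
  \<comment> \<open>The factor is read off in a column j in which e does not vanish.\<close>
  define l where "l = - ((J *v c) $ j / e $ j)"
  have "c $ i = l * (J *v e) $ i" for i
  proof -
    have "c $ i * e $ j + (J *v e) $ i * (J *v c) $ j = 0"
      using eq by (simp add: vec_eq_iff outer_def)
    then have "c $ i * e $ j = - ((J *v e) $ i * (J *v c) $ j)" by (simp add: eq_neg_iff_add_eq_0)
    then show ?thesis using j by (simp add: l_def field_simps)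
  qed
  then have "c = l *s (J *v e)" by (simp add: vec_eq_iff)
  then have "J *v (T *v a) = J *v (T *v (l *s b))"
    unfolding c e by (simp add: matrix_vector_mult_def vec_eq_iff sum_distrib_left mult_ac)
  then have "a = l *s b" using injz injJ by blast
  then have "a \<in> vec.span {b}" using vec.span_scale vec.span_base by blast
  moreover have "{a, b} - {a} = {b}" using ab(1) by auto
  ultimately show False using ab(2) unfolding vec.dependent_def by (metis insertI1)
qed

section \<open>Tangent and horizontal spaces of the group\<close>

text \<open>Radial rescaling to determinant one: the determinant is homogeneous of degree
  \<open>CARD('m)\<close>, which dictates the exponent. On quaternionic matrices the real part is
  the determinant itself.\<close>

definition unimod :: "complex^'m^'m \<Rightarrow> complex^'m^'m" where
  "unimod Y = (Re (det Y) powr (- 1 / real CARD('m))) *\<^sub>R Y"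

lemma quat_det: "A \<in> quat \<Longrightarrow> det A = of_real (Re (det A))"
  using quat_det_real[of A] by (simp add: complex_eq_iff)

lemma det_unimod:
  assumes "Y \<in> quat" "Re (det Y) > 0" shows "det (unimod Y :: 'n::finite cmat) = 1"
proof -
  let ?N = "CARD('n + 'n)" and ?d = "Re (det Y)"
  have "(?d powr (- 1 / real ?N)) ^ ?N = ?d powr - 1"
    using assms(2) by (simp add: powr_powr flip: powr_realpow)
  then have "(?d powr (- 1 / real ?N)) ^ ?N * ?d = 1" using assms(2) by (simp add: powr_minus)
  moreover have "det (unimod Y) = of_real ((?d powr (- 1 / real ?N)) ^ ?N * ?d)"
    by (simp only: unimod_def det_scaleR of_real_power of_real_mult quat_det[OF assms(1), symmetric])
  ultimately show ?thesis by simp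
qed

lemma unimod_quat: "Y \<in> quat \<Longrightarrow> unimod Y \<in> quat"
  unfolding unimod_def by (intro subspace_scale[OF subspace_quat])

lemma unimod_eq: "det Y = 1 \<Longrightarrow> unimod Y = Y" by (simp add: unimod_def)

lemma unimod_scaleR:
  assumes "c > 0" "det P = 1" shows "unimod (c *\<^sub>R P) = P"
  using assms by (simp add: unimod_def det_scaleR powr_powr flip: powr_realpow of_real_power)

lemma Cinf_unimod:
  assumes "open V" "Cinf V f" "\<And>x. x \<in> V \<Longrightarrow> Re (det (f x)) > 0" shows "Cinf V (\<lambda>x. unimod (f x))"
  unfolding unimod_def by (intro Cinf_scaleR Cinf_powr Cinf_Re Cinf_det assms)

lemma open_det_pos: "open {A :: complex^'m^'m. Re (det A) > 0}"
  using Cinf_continuous[OF Cinf_Re[OF open_UNIV Cinf_det[OF open_UNIV Cinf_ident[OF open_UNIV]]]]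
  by (intro open_Collect_less) auto

lemma unimod_has_derivative:
  fixes Y :: "complex^'m^'m"
  assumes "det Y = 1"
  shows "(unimod has_derivative (\<lambda>H. H - (Re (trace (matrix_inv Y ** H)) / real CARD('m)) *\<^sub>R Y)) (at Y)"
proof -
  let ?r = "- 1 / real CARD('m)"
  have 1: "((\<lambda>A. Re (det A)) has_derivative (\<lambda>H. Re (trace (matrix_inv Y ** H)))) (at Y)"
    using has_derivative_Re[OF det_has_derivative[of Y]] assms by simp
  have "((\<lambda>t::real. t powr ?r) has_real_derivative ?r * 1 powr (?r - 1)) (at 1)"
    by (intro has_real_derivative_powr) auto
  then have 2: "((\<lambda>t::real. t powr ?r) has_derivative (*) ?r) (at (Re (det Y)))"
    using assms by (simp add: has_field_derivative_def)
  have "((\<lambda>A. Re (det A) powr ?r) has_derivative (\<lambda>H. ?r * Re (trace (matrix_inv Y ** H)))) (at Y)"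
    using diff_chain_at[OF 1 2] by (simp add: o_def)
  from has_derivative_scaleR[OF this has_derivative_ident]
  show ?thesis using assms unfolding unimod_def by (simp add: algebra_simps)
qed

text \<open>A substitute for the exponential map: at a point of determinant one, rescaling changes a
  velocity only by a multiple of Y, and this multiple vanishes for directions tangent to the level
  set of the determinant.\<close>

lemma unimod_curve:
  fixes Y H :: "complex^'m^'m"
  assumes "det Y = 1" "Re (trace (matrix_inv Y ** H)) = 0"
  shows "((\<lambda>t. unimod (Y + t *\<^sub>R H)) has_vector_derivative H) (at 0)"
    and "\<exists>e>0. \<forall>t. \<bar>t\<bar> < e \<longrightarrow> Re (det (Y + t *\<^sub>R H)) > 0"
proof -
  have "((\<lambda>t. Y + t *\<^sub>R H) has_derivative (\<lambda>h. h *\<^sub>R H)) (at 0)"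
    by (auto intro!: derivative_eq_intros)
  from diff_chain_at[OF this, of unimod] unimod_has_derivative[OF assms(1)]
  have "((\<lambda>t. unimod (Y + t *\<^sub>R H)) has_derivative
     (\<lambda>h. h *\<^sub>R H - (Re (trace (matrix_inv Y ** (h *\<^sub>R H))) / real CARD('m)) *\<^sub>R Y)) (at 0)"
    by (simp add: o_def)
  then show "((\<lambda>t. unimod (Y + t *\<^sub>R H)) has_vector_derivative H) (at 0)"
    unfolding has_vector_derivative_def using assms(2) by (simp add: mm.scaleR_right tr_scale)
  have "open ((\<lambda>t. Y + t *\<^sub>R H) -` {A. Re (det A) > 0})"
    by (intro open_vimage open_det_pos continuous_intros)
  moreover have "0 \<in> (\<lambda>t. Y + t *\<^sub>R H) -` {A. Re (det A) > 0}" using assms by simp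
  ultimately obtain e where "e > 0" "ball 0 e \<subseteq> (\<lambda>t. Y + t *\<^sub>R H) -` {A. Re (det A) > 0}"
    using open_contains_ball by blast
  then show "\<exists>e>0. \<forall>t. \<bar>t\<bar> < e \<longrightarrow> Re (det (Y + t *\<^sub>R H)) > 0"
    by (intro exI[of _ e]) (auto simp: subset_iff)
qed

lemma SUstar_det: "z \<in> SUstar \<Longrightarrow> det z = 1" "z \<in> SUstar \<Longrightarrow> det z \<noteq> 0"
  by (auto simp: SUstar_quat)

lemma SUstar_in_quat: "z \<in> SUstar \<Longrightarrow> z \<in> quat" by (simp add: SUstar_quat)

lemma SUstar_mult: "z \<in> SUstar \<Longrightarrow> w \<in> SUstar \<Longrightarrow> z ** w \<in> SUstar"
  by (simp add: SUstar_quat quat_mult det_mul)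

lemma SUstar_matrix_inv: "z \<in> SUstar \<Longrightarrow> matrix_inv z \<in> SUstar"
  by (simp add: SUstar_quat quat_matrix_inv det_matrix_inv)

lemma SUstar_mat_1: "mat 1 \<in> SUstar" by (simp add: SUstar_quat quat_mat_1)

lemma matrix_inv_mat_1 [simp]: "matrix_inv (mat 1) = (mat 1 :: 'a::field^'m^'m)"
  by (rule matrix_inv_unique[symmetric]) simp

text \<open>One inclusion differentiates the constant determinant; the other uses the line
  \<open>mat 1 + t *\<^sub>R X\<close>, rescaled to determinant one and translated by z.\<close>

lemma tangent_SUstar:
  assumes z: "z \<in> SUstar"
  shows "tangent_space SUstar z = (\<lambda>X. z ** X) ` {X \<in> quat. trace X = 0}"
proof (intro equalityI subsetI)
  fix V assume V: "V \<in> tangent_space SUstar z"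
  then obtain \<gamma> where \<gamma>: "\<And>t::real. \<gamma> t \<in> SUstar" "\<gamma> 0 = z" "(\<gamma> has_vector_derivative V) (at 0)"
    unfolding tangent_space_def by blast
  have "V \<in> quat" using V tangent_space_subset[OF subspace_quat, of SUstar z] by (auto simp: SUstar_quat)
  then have X: "matrix_inv z ** V \<in> quat"
    using z SUstar_in_quat SUstar_matrix_inv by (intro quat_mult) auto
  have "((\<lambda>t. det (\<gamma> t)) has_vector_derivative det z * trace (matrix_inv z ** V)) (at 0)"
    by (rule has_derivative_curve[OF det_has_derivative[OF SUstar_det(2)[OF z]] _ \<gamma>(2,3)]) simp
  moreover have "((\<lambda>t. det (\<gamma> t)) has_vector_derivative 0) (at 0)"
    using SUstar_det(1)[OF \<gamma>(1)] by simp
  ultimately have "trace (matrix_inv z ** V) = 0"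
    using vector_derivative_unique_at SUstar_det(1)[OF z] by fastforce
  moreover have "V = z ** (matrix_inv z ** V)"
    using z by (simp add: matrix_mul_assoc matrix_inv_right SUstar_det)
  ultimately show "V \<in> (\<lambda>X. z ** X) ` {X \<in> quat. trace X = 0}" using X by blast
next
  fix V assume "V \<in> (\<lambda>X. z ** X) ` {X \<in> quat. trace X = 0}"
  then obtain X where X: "X \<in> quat" "trace X = 0" "V = z ** X" by blast
  obtain e where e: "e > 0" "\<And>t. \<bar>t\<bar> < e \<Longrightarrow> Re (det (mat 1 + t *\<^sub>R X)) > 0"
    using unimod_curve(2)[of "mat 1" X] X(2) by auto
  show "V \<in> tangent_space SUstar z"
  proof (rule tangent_spaceI[OF e(1), of "\<lambda>t. z ** unimod (mat 1 + t *\<^sub>R X)"])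
    fix t :: real assume "\<bar>t\<bar> < e"
    moreover have "mat 1 + t *\<^sub>R X \<in> quat"
      by (intro subspace_add[OF subspace_quat] subspace_scale[OF subspace_quat] quat_mat_1 X)
    ultimately show "z ** unimod (mat 1 + t *\<^sub>R X) \<in> SUstar"
      using e(2) by (intro SUstar_mult z) (simp add: SUstar_quat unimod_quat det_unimod)
  next
    show "((\<lambda>t. z ** unimod (mat 1 + t *\<^sub>R X)) has_vector_derivative V) (at 0)"
      unfolding X(3) using X(2) by (intro bounded_linear.has_vector_derivative[OF mm.bounded_linear_right] unimod_curve(1)) auto
  qed (simp add: unimod_eq)
qed

section \<open>The group Sp(n), its cosets and their tangent spaces\<close>

lemma Sp_iff: "k \<in> Sp \<longleftrightarrow> k \<in> SUstar \<and> k ** ctranspose k = mat 1"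
  unfolding Sp_def unitary_group_def using matrix_left_right_inverse by blast

lemma Sp_mult: "k \<in> Sp \<Longrightarrow> l \<in> Sp \<Longrightarrow> k ** l \<in> Sp"
  unfolding Sp_iff by (auto simp: SUstar_mult ctranspose_mult) (metis matrix_mul_assoc matrix_mul_rid)

lemma coset_subset: "z \<in> SUstar \<Longrightarrow> coset z \<subseteq> SUstar"
  by (auto simp: coset_def Sp_iff SUstar_mult)

lemma coset_self: "z \<in> coset z"
  unfolding coset_def using mat_1_in_Sp by (metis image_eqI matrix_mul_rid)

definition gram :: "complex^'m^'m \<Rightarrow> complex^'m^'m" where
  "gram z = z ** ctranspose z"

lemma gram_mult: "gram (z ** k) = z ** gram k ** ctranspose z"
  by (simp add: gram_def ctranspose_mult matrix_mul_assoc)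

lemma gram_coset: "w \<in> coset z \<Longrightarrow> gram w = gram z"
  by (auto simp: coset_def gram_mult) (simp add: gram_def Sp_iff)

text \<open>Equal Gram matrices mean that \<open>matrix_inv w ** z\<close> is unitary. Thus
  \<open>gram\<close> identifies the quotient with its image.\<close>

lemma coset_eq_iff:
  assumes "z \<in> SUstar" "w \<in> SUstar" shows "coset z = coset w \<longleftrightarrow> gram z = gram w"
proof
  assume "coset z = coset w"
  then show "gram z = gram w" using coset_self gram_coset by metis
next
  have sub: "coset z \<subseteq> coset w" if "gram z = gram w" "z \<in> SUstar" "w \<in> SUstar" for z w :: "'a cmat"
  proof -
    define k where "k = matrix_inv w ** z"
    have z: "z = w ** k" unfolding k_def using that by (simp add: matrix_mul_assoc matrix_inv_right SUstar_det)
    have "gram k = matrix_inv w ** gram w ** ctranspose (matrix_inv w)"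
      unfolding k_def gram_mult that(1) ..
    also have "\<dots> = (matrix_inv w ** w) ** ctranspose (matrix_inv w ** w)"
      by (simp add: gram_def ctranspose_mult matrix_mul_assoc)
    also have "\<dots> = mat 1" using that by (simp add: matrix_inv_left SUstar_det)
    finally have "k \<in> Sp" using that unfolding Sp_iff by (simp add: gram_def k_def SUstar_mult SUstar_matrix_inv)
    then show ?thesis unfolding z coset_def using Sp_mult by (auto simp: matrix_mul_assoc[symmetric])
  qed
  assume "gram z = gram w"
  then show "coset z = coset w" using sub assms by (metis subset_antisym)
qed

lemma coset_cong: "z \<in> SUstar \<Longrightarrow> w \<in> coset z \<Longrightarrow> coset w = coset z"
  using coset_eq_iff gram_coset coset_subset by blast

lemma tangent_coset:
  assumes z: "z \<in> SUstar"
  shows "tangent_space (coset z) z = (\<lambda>X. z ** X) ` qskew"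
proof (intro equalityI subsetI)
  fix V assume V: "V \<in> tangent_space (coset z) z"
  then obtain \<gamma> where \<gamma>: "\<And>t::real. \<gamma> t \<in> coset z" "\<gamma> 0 = z" "(\<gamma> has_vector_derivative V) (at 0)"
    unfolding tangent_space_def by blast
  let ?k = "\<lambda>t. matrix_inv z ** \<gamma> t"
  have k: "?k t \<in> Sp" for t
    using \<gamma>(1)[of t] z by (auto simp: coset_def matrix_mul_assoc matrix_inv_left SUstar_det)
  have dk: "(?k has_vector_derivative matrix_inv z ** V) (at 0)"
    by (intro bounded_linear.has_vector_derivative[OF mm.bounded_linear_right] \<gamma>)
  have q: "matrix_inv z ** V \<in> quat"
    by (rule vector_derivative_in_subspace[OF subspace_quat _ dk]) (use k in \<open>auto simp: Sp_iff SUstar_quat\<close>)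
  have dct: "((\<lambda>t. ctranspose (?k t)) has_vector_derivative ctranspose (matrix_inv z ** V)) (at 0)"
    by (rule bounded_linear.has_vector_derivative[OF _ dk]) (use linear_ctranspose linear_conv_bounded_linear in blast)
  have "?k 0 = mat 1" using \<gamma>(2) z by (simp add: matrix_inv_left SUstar_det)
  then have "((\<lambda>t. ?k t ** ctranspose (?k t)) has_vector_derivative (matrix_inv z ** V) + ctranspose (matrix_inv z ** V)) (at 0)"
    using mm.has_vector_derivative[OF dk dct] by (simp add: add.commute)
  moreover have "((\<lambda>t. ?k t ** ctranspose (?k t)) has_vector_derivative 0) (at 0)"
    using k unfolding Sp_iff by simp
  ultimately have "(matrix_inv z ** V) + ctranspose (matrix_inv z ** V) = 0"
    using vector_derivative_unique_at by blast
  then have "matrix_inv z ** V \<in> qskew" using q by (simp add: qskew_def eq_neg_iff_add_eq_0 add.commute)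
  moreover have "V = z ** (matrix_inv z ** V)"
    using z by (simp add: matrix_mul_assoc matrix_inv_right SUstar_det)
  ultimately show "V \<in> (\<lambda>X. z ** X) ` qskew" by blast
next
  fix V assume "V \<in> (\<lambda>X. z ** X) ` qskew"
  then obtain Y where Y: "Y \<in> qskew" "V = z ** Y" by blast
  \<comment> \<open>The Cayley transform of \<open>t *\<^sub>R Y\<close> gives a curve in Sp(n) with
    velocity Y: its factors A and B commute, are adjoint to each other, and have the same real
    determinant.\<close>
  define A where "A t = mat 1 - t *\<^sub>R ((1/2) *\<^sub>R Y)" for t :: real
  define B where "B t = mat 1 + t *\<^sub>R ((1/2) *\<^sub>R Y)" for t :: real
  have "open ((\<lambda>t. A t) -` {A. det A \<noteq> 0})" unfolding A_def
    by (intro open_vimage open_det_nonzero continuous_intros)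
  moreover have "0 \<in> (\<lambda>t. A t) -` {A. det A \<noteq> 0}" by (simp add: A_def)
  ultimately obtain e where "e > 0" "ball 0 e \<subseteq> (\<lambda>t. A t) -` {A. det A \<noteq> 0}"
    using open_contains_ball by blast
  then have e: "e > 0" "\<And>t. \<bar>t\<bar> < e \<Longrightarrow> det (A t) \<noteq> 0" by (auto simp: subset_iff)
  have Yq: "Y \<in> quat" using Y by (simp add: qskew_def)
  have "(mat 1 - K) ** (mat 1 + K) = (mat 1 + K) ** (mat 1 - K)" for K :: "'a cmat"
    by (simp add: mm.add_left mm.add_right mm.diff_left mm.diff_right)
  then have AB: "A t ** B t = B t ** A t" for t unfolding A_def B_def by blast
  have cA: "ctranspose (A t) = B t" for t
    using Y by (simp add: A_def B_def ct_diff ct_scale qskew_def)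
  have Aq: "A t \<in> quat" "B t \<in> quat" for t unfolding A_def B_def
    by (auto intro!: subspace_add[OF subspace_quat] subspace_diff[OF subspace_quat] subspace_scale[OF subspace_quat] quat_mat_1 Yq)
  have dB: "det (B t) = det (A t)" for t
    using det_ctranspose[of "A t"] quat_det_real[OF Aq(1)] unfolding cA by (simp add: complex_eq_iff)
  let ?K = "\<lambda>t. matrix_inv (A t) ** B t"
  have K: "?K t \<in> Sp" if "\<bar>t\<bar> < e" for t
  proof -
    have dA: "det (A t) \<noteq> 0" by (rule e(2)[OF that])
    have "?K t ** ctranspose (?K t) = matrix_inv (A t) ** (B t ** A t) ** matrix_inv (B t)"
      using dA cA[of t] by (simp add: ctranspose_mult ctranspose_matrix_inv matrix_mul_assoc)
        (metis ctranspose_ctranspose)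
    also have "\<dots> = mat 1" unfolding AB[symmetric] using dA dB[of t]
      by (simp add: matrix_mul_assoc matrix_inv_left matrix_inv_right)
    finally show ?thesis unfolding Sp_iff SUstar_quat
      using Aq dA dB[of t] by (simp add: quat_mult quat_matrix_inv det_mul det_matrix_inv)
  qed
  have dAt: "(A has_vector_derivative - ((1/2) *\<^sub>R Y)) (at 0)" "(B has_vector_derivative (1/2) *\<^sub>R Y) (at 0)"
    unfolding A_def B_def has_vector_derivative_def by (auto intro!: derivative_eq_intros)
  have A0: "A 0 = mat 1" "B 0 = mat 1" by (auto simp: A_def B_def)
  have "((\<lambda>t. matrix_inv (A t)) has_vector_derivative (1/2) *\<^sub>R Y) (at 0)"
    using has_derivative_curve[OF matrix_inv_has_derivative[of "mat 1"] _ A0(1) dAt(1)] by simp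
  from mm.has_vector_derivative[OF this dAt(2)]
  have "(?K has_vector_derivative Y) (at 0)" using A0 by (simp flip: scaleR_add_left)
  then have d: "((\<lambda>t. z ** ?K t) has_vector_derivative V) (at 0)"
    unfolding Y(2) by (intro bounded_linear.has_vector_derivative[OF mm.bounded_linear_right])
  show "V \<in> tangent_space (coset z) z"
    by (rule tangent_spaceI[OF e(1) _ _ d]) (use K A0 in \<open>auto simp: coset_def\<close>)
qed

lemma gl_metric_mult: "z \<in> SUstar \<Longrightarrow> gl_metric z (z ** X) (z ** Y) = X \<bullet> Y"
  by (simp add: gl_metric_def matrix_mul_assoc matrix_inv_left SUstar_det inner_matrix)

lemma qherm_qskew_orthogonal: "X \<in> qherm \<Longrightarrow> Y \<in> qskew \<Longrightarrow> X \<bullet> Y = 0"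
proof -
  assume X: "X \<in> qherm" "Y \<in> qskew"
  have "X \<bullet> Y = - Re (trace (X ** Y))" using X by (simp add: inner_matrix qskew_def mm.minus_right tr_neg)
  moreover have "Y \<bullet> X = Re (trace (Y ** X))" using X by (simp add: inner_matrix qherm_def)
  ultimately show ?thesis using trace_mul_sym[of X Y] by (simp add: inner_commute)
qed

text \<open>After left translation a tangent vector splits into a Hermitian and a skew part. The
  skew part is itself vertical, so testing against it forces it to vanish.\<close>

lemma horizontal_eq:
  assumes z: "z \<in> SUstar"
  shows "horizontal z = (\<lambda>X. z ** X) ` pspace"
proof (intro equalityI subsetI)
  fix V assume V: "V \<in> horizontal z"
  then obtain X where X: "X \<in> quat" "trace X = 0" "V = z ** X"
    unfolding horizontal_def tangent_SUstar[OF z] by blast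
  define S K where "S = (1/2) *\<^sub>R (X + ctranspose X)" and "K = (1/2) *\<^sub>R (X - ctranspose X)"
  have SK: "S \<in> qherm" "K \<in> qskew"
    using X(1) unfolding S_def K_def qherm_def qskew_def
    by (auto simp: ct_add ct_diff ct_scale add.commute intro!: subspace_add[OF subspace_quat] subspace_diff[OF subspace_quat] subspace_scale[OF subspace_quat] quat_ctranspose)
      (simp flip: scaleR_minus_right)
  have XSK: "X = S + K" unfolding S_def K_def by (simp add: vec_eq_iff complex_eq_iff field_simps)
  have "gl_metric z V (z ** K) = 0" using V SK unfolding horizontal_def tangent_coset[OF z] by blast
  then have "X \<bullet> K = 0" unfolding X(3) gl_metric_mult[OF z] .
  then have "K \<bullet> K = 0" using XSK qherm_qskew_orthogonal[OF SK] by (simp add: inner_add_left)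
  then have "X = S" using XSK by simp
  then show "V \<in> (\<lambda>X. z ** X) ` pspace" using X SK by (auto simp: pspace_def)
next
  fix V assume "V \<in> (\<lambda>X. z ** X) ` pspace"
  then obtain X where X: "X \<in> pspace" "V = z ** X" by blast
  then show "V \<in> horizontal z"
    unfolding horizontal_def tangent_SUstar[OF z] tangent_coset[OF z]
    by (auto simp: gl_metric_mult[OF z] pspace_def qherm_quat intro: qherm_qskew_orthogonal)
qed

lemma horizontal_mat_1: "horizontal (mat 1) = pspace"
  using horizontal_eq[OF SUstar_mat_1] by simp

section \<open>The cone model of the quotient\<close>

definition Pos :: "'n::finite cmat set" where
  "Pos = {P \<in> qherm. posdef P \<and> det P = 1}"

text \<open>The ray of P is represented by its member of trace \<open>CARD('m)\<close> instead of
  determinant one, and the identity is shifted to the origin. As the trace is linear, the image of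
  the cone is convex and lies in a linear space, and a linear function that vanishes at the identity
  keeps a linear zero set.\<close>

definition xi :: "complex^'m^'m \<Rightarrow> complex^'m^'m" where
  "xi P = (real CARD('m) / Re (trace P)) *\<^sub>R P - mat 1"

definition cone_domain :: "'n::finite cmat set" where
  "cone_domain = {X \<in> pspace. posdef (mat 1 + X)}"

lemma qform_scaleR: "qform (c *\<^sub>R P) v = c * qform P v"
  using linear_scale[OF linear_qform] by simp

lemma posdef_scaleR: "c > 0 \<Longrightarrow> posdef P \<Longrightarrow> posdef (c *\<^sub>R P)"
  by (simp add: posdef_def qform_scaleR)

lemma posdef_trace: "posdef P \<Longrightarrow> Re (trace P) > 0" for P :: "complex^'m^'m"
proof -
  assume P: "posdef P"
  have "qform P v = (P *v v) \<bullet> v" for v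
    by (simp add: qform_def hermitian_inner_def inner_vec_def inner_complex_def)
  then have "qform P (axis i 1) = Re (P $ i $ i)" for i
    by (simp add: inner_axis mult_axis_nth inner_complex_def)
  moreover have "axis i (1::complex) \<noteq> 0" for i :: 'm by simp
  ultimately have "Re (P $ i $ i) > 0" for i using P unfolding posdef_def by metis
  then show ?thesis by (simp add: trace_def sum_pos)
qed

lemma PosD: "P \<in> Pos \<Longrightarrow> P \<in> qherm" "P \<in> Pos \<Longrightarrow> posdef P" "P \<in> Pos \<Longrightarrow> det P = 1" "P \<in> Pos \<Longrightarrow> det P \<noteq> 0"
  "P \<in> Pos \<Longrightarrow> Re (trace P) > 0"
  by (auto simp: Pos_def posdef_trace)

lemma gram_qherm: "z \<in> quat \<Longrightarrow> gram z \<in> qherm"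
  using qherm_sandwich[OF _ qherm_mat_1] by (simp add: gram_def)

lemma gram_posdef: "det z \<noteq> 0 \<Longrightarrow> posdef (gram z)"
  unfolding posdef_def gram_def qform_gram
proof (intro allI impI)
  fix v :: "complex^'a" assume z: "det z \<noteq> 0" "v \<noteq> 0"
  then have "det (ctranspose z) \<noteq> 0" by (simp add: det_ctranspose)
  then have "ctranspose z *v v \<noteq> 0"
    using z(2) matrix_left_invertible_ker[of "ctranspose z"] matrix_inv_left by blast
  then show "0 < (norm (ctranspose z *v v))\<^sup>2" by simp
qed

lemma gram_Pos: "z \<in> SUstar \<Longrightarrow> gram z \<in> Pos"
  by (simp add: Pos_def gram_qherm gram_posdef SUstar_in_quat SUstar_det)
    (simp add: gram_def det_mul det_ctranspose SUstar_det)

lemma trace_gram: "Re (trace (gram z)) = norm z ^ 2"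
  by (simp add: gram_def power2_norm_eq_inner inner_matrix)

lemma xi_scaleR: "c > 0 \<Longrightarrow> xi (c *\<^sub>R P) = xi P"
  by (simp add: xi_def tr_scale)

lemma mat_1_add_xi: "mat 1 + xi P = (real CARD('m) / Re (trace P)) *\<^sub>R P" for P :: "complex^'m^'m"
  by (simp add: xi_def)

lemma CARD_pos: "real CARD('m::finite) > 0" by simp

lemma qherm_trace: "P \<in> qherm \<Longrightarrow> trace P = of_real (Re (trace P))"
  using quat_trace_real[OF qherm_quat] by (simp add: complex_eq_iff)

lemma xi_pspace:
  assumes "P \<in> qherm" "Re (trace P) > 0" shows "xi P \<in> pspace"
proof -
  have "xi P \<in> qherm" unfolding xi_def
    by (intro subspace_diff[OF subspace_qherm] subspace_scale[OF subspace_qherm] qherm_mat_1 assms)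
  moreover have "trace (xi P) = 0"
  proof -
    define r where "r = Re (trace P)"
    have "trace P = of_real r" "r > 0" using qherm_trace[OF assms(1)] assms(2) by (auto simp: r_def)
    then show ?thesis by (simp add: xi_def tr_diff tr_scale trace_mat) (simp add: scaleR_conv_of_real)
  qed
  ultimately show ?thesis by (simp add: pspace_def)
qed

lemma xi_cone: "P \<in> Pos \<Longrightarrow> xi P \<in> cone_domain"
  unfolding cone_domain_def using PosD[of P]
  by (auto simp: xi_pspace mat_1_add_xi intro!: posdef_scaleR divide_pos_pos)

lemma unimod_xi: "P \<in> Pos \<Longrightarrow> unimod (mat 1 + xi P) = P"
  unfolding mat_1_add_xi using PosD[of P] by (intro unimod_scaleR divide_pos_pos) auto

lemma xi_inj: "P \<in> Pos \<Longrightarrow> Q \<in> Pos \<Longrightarrow> xi P = xi Q \<Longrightarrow> P = Q"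
  using unimod_xi by metis

lemma mat_1_add_qherm: "X \<in> pspace \<Longrightarrow> mat 1 + X \<in> qherm"
  by (intro subspace_add[OF subspace_qherm] qherm_mat_1 pspace_qherm)

lemma cone_unimod:
  assumes X: "X \<in> (cone_domain :: 'n::finite cmat set)"
  shows "unimod (mat 1 + X) \<in> Pos" "xi (unimod (mat 1 + X)) = X"
proof -
  have X': "X \<in> pspace" "posdef (mat 1 + X)" using X by (auto simp: cone_domain_def)
  have q: "mat 1 + X \<in> qherm" by (intro subspace_add[OF subspace_qherm] qherm_mat_1 pspace_qherm X')
  have d: "Re (det (mat 1 + X)) > 0" by (rule posdef_det_pos[OF q X'(2)])
  define c where "c = Re (det (mat 1 + X)) powr (- 1 / real CARD('n + 'n))"
  have c: "c > 0" using d by (simp add: c_def)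
  have u: "unimod (mat 1 + X) = c *\<^sub>R (mat 1 + X)" by (simp add: unimod_def c_def)
  show "unimod (mat 1 + X) \<in> Pos"
    unfolding Pos_def using det_unimod[OF qherm_quat[OF q] d] posdef_scaleR[OF c X'(2)] subspace_scale[OF subspace_qherm q, of c]
    by (simp add: u)
  have "trace (mat 1 + X) = of_nat CARD('n + 'n)" using X'(1) by (simp add: tr_add trace_mat pspace_def)
  then have "xi (mat 1 + X) = X" using CARD_pos[where 'm="'n + 'n"] by (simp add: xi_def)
  then show "xi (unimod (mat 1 + X)) = X" unfolding u by (simp add: xi_scaleR[OF c])
qed

lemma cone_convex: "convex cone_domain"
proof (rule convexI)
  fix A B :: "'a cmat" and u v :: real
  assume *: "A \<in> cone_domain" "B \<in> cone_domain" "0 \<le> u" "0 \<le> v" "u + v = 1"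
  have "mat 1 + (u *\<^sub>R A + v *\<^sub>R B) = (u + v) *\<^sub>R mat 1 + (u *\<^sub>R A + v *\<^sub>R B)" using * by simp
  also have "\<dots> = u *\<^sub>R (mat 1 + A) + v *\<^sub>R (mat 1 + B)" by (simp add: scaleR_add_left scaleR_add_right)
  finally have "posdef (mat 1 + (u *\<^sub>R A + v *\<^sub>R B))"
    using convexD[OF posdef_convex, of "mat 1 + A" "mat 1 + B" u v] * by (simp add: cone_domain_def)
  then show "u *\<^sub>R A + v *\<^sub>R B \<in> cone_domain"
    using * by (auto simp: cone_domain_def intro!: subspace_add[OF subspace_pspace] subspace_scale[OF subspace_pspace])
qed

lemma Cinf_xi:
  assumes V: "open V" and f: "Cinf V f" and p: "\<And>x. x \<in> V \<Longrightarrow> Re (trace (f x :: complex^'m^'m)) > 0"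
  shows "Cinf V (\<lambda>x. xi (f x))"
proof -
  have "Cinf V (\<lambda>x. (real CARD('m) *\<^sub>R Re (trace (f x)) powr - 1) *\<^sub>R f x - mat 1)"
    by (intro Cinf_diff Cinf_scaleR[OF V] Cinf_powr Cinf_Re Cinf_trace Cinf_const V f p)
  then show ?thesis
    by (rule Cinf_cong[OF V, rotated]) (use p in \<open>simp add: xi_def powr_minus divide_inverse less_imp_le\<close>)
qed

lemma Cinf_gram: "open V \<Longrightarrow> Cinf V f \<Longrightarrow> Cinf V (\<lambda>x. gram (f x))"
  unfolding gram_def by (intro Cinf_matrix_mult Cinf_ctranspose)

lemma open_trace_pos: "open {A :: complex^'m^'m. Re (trace A) > 0}"
  using Cinf_continuous[OF Cinf_Re[OF open_UNIV Cinf_trace[OF open_UNIV Cinf_ident[OF open_UNIV]]]]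
  by (intro open_Collect_less) auto

text \<open>Recovers the Gram matrix from its normalised form even for w = 0, so that the identity
  can be differentiated along a whole curve.\<close>

lemma gram_xi: "gram w = (Re (trace (gram w)) / real CARD('m)) *\<^sub>R (xi (gram w) + mat 1)" for w :: "complex^'m^'m"
proof (cases "w = 0")
  case True
  then show ?thesis by (simp add: gram_def tr_0)
next
  case False
  then show ?thesis by (simp add: xi_def trace_gram)
qed

lemma gram_scaleR: "gram (c *\<^sub>R w) = (c * c) *\<^sub>R gram w"
  by (simp add: gram_def ct_scale mm.scaleR_left mm.scaleR_right)

text \<open>Near \<open>z0\<close> every point of the cone is the image of \<open>z0 (1 + X)\<close>, up to a scalar factor, for some
  \<open>X\<close> in the tangent space of the quotient; this is where the inverse function theorem enters.\<close>

lemma local_section: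
  assumes z0: "z0 \<in> (SUstar :: 'n::finite cmat set)"
  obtains W s where "open W" "xi (gram z0) \<in> W" "Cinf W s" "s (xi (gram z0)) = z0"
    "\<And>X. X \<in> W \<Longrightarrow> X \<in> pspace \<Longrightarrow> s X \<in> SUstar \<and> xi (gram (s X)) = X"
proof -
  obtain \<pi> :: "'n cmat \<Rightarrow> 'n cmat" where \<pi>: "linear \<pi>" "\<And>y. \<pi> y \<in> pspace" "\<And>y. y \<in> pspace \<Longrightarrow> \<pi> y = y"
    "\<And>y s. s \<in> pspace \<Longrightarrow> (y - \<pi> y) \<bullet> s = 0"
    using orthogonal_projection[OF subspace_pspace] by metis
  have orth: "y = \<pi> y" if "y - \<pi> y \<in> pspace" for y using \<pi>(4)[OF that, of y] by simp
  define f where "f y = z0 ** (mat 1 + \<pi> y)" for y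
  define \<Psi> where "\<Psi> y = xi (gram (f y))" for y
  \<comment> \<open>\<open>\<Psi>\<close> sees only the component of \<open>y\<close> in
    \<open>pspace\<close>. Adding the normal component makes the derivative an invertible
    endomorphism of the whole matrix space, as the inverse function theorem requires.\<close>
  define \<Phi> where "\<Phi> y = \<Psi> y + (y - \<pi> y)" for y
  have C\<pi>: "Cinf V \<pi>" if "open V" for V by (rule Cinf_linear[OF \<pi>(1) that])
  have Cf: "Cinf V f" if "open V" for V
    unfolding f_def by (intro Cinf_matrix_mult Cinf_add Cinf_const C\<pi> that)
  have C1: "Cinf V (\<lambda>y. mat 1 + \<pi> y)" if "open V" for V by (intro Cinf_add Cinf_const C\<pi> that)
  define V where "V = (\<lambda>y. gram (f y)) -` {A. Re (trace A) > 0} \<inter> (\<lambda>y. mat 1 + \<pi> y) -` {A. Re (det A) > 0}"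
  have V: "open V" unfolding V_def
    using Cinf_continuous[OF Cinf_gram[OF open_UNIV Cf[OF open_UNIV]]] Cinf_continuous[OF C1[OF open_UNIV]]
    by (intro open_Int open_vimage open_trace_pos open_det_pos) auto
  have C\<Psi>: "Cinf V \<Psi>" unfolding \<Psi>_def by (intro Cinf_xi Cinf_gram Cf V) (auto simp: V_def)
  have C\<Phi>: "Cinf V \<Phi>" unfolding \<Phi>_def by (intro Cinf_add Cinf_diff C\<Psi> C\<pi> Cinf_ident V)
  have \<pi>0: "\<pi> 0 = 0" using \<pi>(1) linear_0 by blast
  have z0V: "0 \<in> V" using z0 gram_Pos[OF z0] by (simp add: V_def \<pi>0 f_def PosD)
  have q1: "mat 1 + \<pi> y \<in> quat" for y
    by (intro subspace_add[OF subspace_quat] quat_mat_1 qherm_quat pspace_qherm \<pi>)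
  have \<Psi>p: "\<Psi> y \<in> pspace" if "y \<in> V" for y
    unfolding \<Psi>_def using that
    by (intro xi_pspace gram_qherm) (simp_all add: V_def f_def quat_mult[OF SUstar_in_quat[OF z0] q1])
  have inj: "h = 0" if D: "frechet_derivative \<Phi> (at 0) h = 0" for h
  proof -
    let ?D = "frechet_derivative \<Psi> (at 0)"
    have d1: "(\<Psi> has_derivative ?D) (at 0)" by (rule Cinf_has_derivative[OF C\<Psi> z0V])
    have "((\<lambda>y. \<pi> (\<Psi> y)) has_derivative (\<lambda>h. \<pi> (?D h))) (at 0)"
      using \<pi>(1) d1 by (simp add: linear_conv_bounded_linear bounded_linear.has_derivative)
    then have "(\<Psi> has_derivative (\<lambda>h. \<pi> (?D h))) (at 0)"
      by (rule has_derivative_transform_within_open[OF _ V z0V]) (simp add: \<pi>(3) \<Psi>p)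
    then have Dp: "?D h \<in> pspace" using has_derivative_unique[OF d1] \<pi>(2) by metis
    have "(\<pi> has_derivative \<pi>) (at 0)"
      using \<pi>(1) by (simp add: linear_conv_bounded_linear bounded_linear_imp_has_derivative)
    then have "(\<Phi> has_derivative (\<lambda>h. ?D h + (h - \<pi> h))) (at 0)"
      unfolding \<Phi>_def by (intro has_derivative_add has_derivative_diff d1 has_derivative_ident)
    then have "frechet_derivative \<Phi> (at 0) = (\<lambda>h. ?D h + (h - \<pi> h))"
      by (rule frechet_derivative_at[symmetric])
    then have e: "?D h + (h - \<pi> h) = 0" using D by simp
    then have "h - \<pi> h = - ?D h" by (simp add: eq_neg_iff_add_eq_0 add.commute)
    then have h: "h = \<pi> h" using orth subspace_neg[OF subspace_pspace Dp] by metis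
    then have Dh: "?D h = 0" using e by simp
    have hp: "h \<in> pspace" using h \<pi>(2) by metis
    have line: "((\<lambda>t. t *\<^sub>R h) has_vector_derivative h) (at 0)"
      by (auto intro!: derivative_eq_intros simp: has_vector_derivative_def)
    have d\<Psi>: "((\<lambda>t. \<Psi> (t *\<^sub>R h)) has_vector_derivative 0) (at 0)"
      using has_derivative_curve[of \<Psi> ?D 0 UNIV "\<lambda>t. t *\<^sub>R h" h] d1 line Dh by simp
    have "((\<lambda>t. f (t *\<^sub>R h)) has_vector_derivative z0 ** h) (at 0)"
      unfolding f_def using has_vector_derivative_line[of "mat 1" h 0] hp
      by (intro bounded_linear.has_vector_derivative[OF mm.bounded_linear_right])
        (simp add: \<pi>(3) subspace_scale[OF subspace_pspace])
    note df = this
    have dct: "((\<lambda>t. ctranspose (f (t *\<^sub>R h))) has_vector_derivative ctranspose (z0 ** h)) (at 0)"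
      by (rule bounded_linear.has_vector_derivative[OF _ df]) (use linear_ctranspose linear_conv_bounded_linear in blast)
    \<comment> \<open>If \<open>\<Psi>\<close> has velocity zero, the Gram matrix can only move
      along its own ray, so its velocity A is a multiple of \<open>gram z0\<close>. Stripping off
      \<open>z0\<close> on both sides leaves h as a multiple of the identity, and its trace is
      zero.\<close>
    define A where "A = 2 *\<^sub>R (z0 ** h ** ctranspose z0)"
    have f0: "f 0 = z0" by (simp add: f_def \<pi>0)
    have "ctranspose h = h" using hp by (simp add: pspace_def qherm_def)
    then have dP: "((\<lambda>t. gram (f (t *\<^sub>R h))) has_vector_derivative A) (at 0)"
      using mm.has_vector_derivative[OF df dct] f0 by (simp add: gram_def ctranspose_mult matrix_mul_assoc A_def scaleR_2)
    let ?\<tau> = "\<lambda>t. Re (trace (gram (f (t *\<^sub>R h)))) / real CARD('n + 'n)"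
    have "linear (\<lambda>A :: 'n cmat. Re (trace A) / real CARD('n + 'n))"
      by (auto simp: linear_iff tr_add tr_scale add_divide_distrib)
    then have d\<tau>: "(?\<tau> has_vector_derivative Re (trace A) / real CARD('n + 'n)) (at 0)"
      using bounded_linear.has_vector_derivative[OF _ dP] linear_conv_bounded_linear by blast
    have d2: "((\<lambda>t. ?\<tau> t *\<^sub>R (\<Psi> (t *\<^sub>R h) + mat 1)) has_vector_derivative
      ?\<tau> 0 *\<^sub>R (0 + 0) + (Re (trace A) / real CARD('n + 'n)) *\<^sub>R (\<Psi> (0 *\<^sub>R h) + mat 1)) (at 0)"
      by (intro has_vector_derivative_scaleR has_vector_derivative_add d\<Psi> has_vector_derivative_const)
        (use d\<tau> in \<open>simp add: has_real_derivative_iff_has_vector_derivative\<close>)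
    have eq: "(\<lambda>t. ?\<tau> t *\<^sub>R (\<Psi> (t *\<^sub>R h) + mat 1)) = (\<lambda>t. gram (f (t *\<^sub>R h)))"
      unfolding \<Psi>_def by (rule ext) (rule gram_xi[symmetric])
    have "A = (Re (trace A) / real CARD('n + 'n)) *\<^sub>R (\<Psi> 0 + mat 1)"
      using vector_derivative_unique_at[OF dP d2[unfolded eq]] by simp
    also have "\<Psi> 0 + mat 1 = (real CARD('n + 'n) / Re (trace (gram z0))) *\<^sub>R gram z0"
      using mat_1_add_xi[of "gram z0"] by (simp add: \<Psi>_def f0 add.commute)
    finally obtain c where "A = c *\<^sub>R gram z0" by simp
    then have "matrix_inv z0 ** A ** matrix_inv (ctranspose z0) = matrix_inv z0 ** (c *\<^sub>R gram z0) ** matrix_inv (ctranspose z0)"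
      by simp
    moreover have "det (ctranspose z0) \<noteq> 0" using z0 by (simp add: det_ctranspose SUstar_det)
    ultimately have hc: "2 *\<^sub>R h = c *\<^sub>R mat 1"
      using z0 unfolding A_def gram_def
      by (simp add: mm.scaleR_left mm.scaleR_right matrix_mul_assoc matrix_inv_left matrix_inv_right matrix_inv_right' SUstar_det)
    have "2 *\<^sub>R trace h = c *\<^sub>R trace (mat 1 :: 'n cmat)" unfolding tr_scale[symmetric] hc ..
    then have "c = 0" using hp by (simp add: pspace_def trace_mat)
    then show "h = 0" using hc by simp
  qed
  obtain U g where U: "open U" "0 \<in> U" "U \<subseteq> V" "open (\<Phi> ` U)" "Cinf (\<Phi> ` U) g" "\<And>x. x \<in> U \<Longrightarrow> g (\<Phi> x) = x"
    using Cinf_local_inverse[OF V C\<Phi> z0V inj] by metis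
  define s where "s X = z0 ** unimod (mat 1 + \<pi> (g X))" for X
  have \<Phi>0: "\<Phi> 0 = xi (gram z0)" by (simp add: \<Phi>_def \<Psi>_def f_def \<pi>0)
  show ?thesis
  proof (rule that[of "\<Phi> ` U" s])
    show "open (\<Phi> ` U)" by (rule U)
    show "xi (gram z0) \<in> \<Phi> ` U" using \<Phi>0 U(2) by (metis imageI)
    have "Re (det (mat 1 + \<pi> (g X))) > 0" if "X \<in> \<Phi> ` U" for X
      using that U(3,6) by (auto simp: V_def)
    then show "Cinf (\<Phi> ` U) s"
      unfolding s_def by (intro Cinf_matrix_mult Cinf_const Cinf_unimod Cinf_add Cinf_linear_compose[OF \<pi>(1)] U)
    show "s (xi (gram z0)) = z0" unfolding s_def \<Phi>0[symmetric] U(6)[OF U(2)] by (simp add: \<pi>0 unimod_eq)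
    fix X assume X: "X \<in> \<Phi> ` U" "X \<in> pspace"
    then obtain y where y: "y \<in> U" "X = \<Phi> y" by blast
    then have yV: "y \<in> V" using U by blast
    have "y - \<pi> y = X - \<Psi> y" unfolding y \<Phi>_def by simp
    then have "y - \<pi> y \<in> pspace" using subspace_diff[OF subspace_pspace X(2) \<Psi>p[OF yV]] by simp
    then have "y = \<pi> y" by (rule orth)
    then have X\<Psi>: "X = \<Psi> y" unfolding y(2) \<Phi>_def by simp
    have gX: "g X = y" using U(6)[OF y(1)] y(2) by simp
    have dp: "Re (det (mat 1 + \<pi> y)) > 0" using yV by (simp add: V_def)
    define c where "c = Re (det (mat 1 + \<pi> y)) powr (- 1 / real CARD('n + 'n))"
    have c: "c > 0" using dp by (simp add: c_def)
    have "s X = c *\<^sub>R f y" unfolding s_def gX unimod_def f_def c_def by (simp add: mm.scaleR_right)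
    then have "xi (gram (s X)) = X" using c by (simp add: gram_scaleR xi_scaleR X\<Psi> \<Psi>_def)
    moreover have "s X \<in> SUstar" unfolding s_def gX
      by (intro SUstar_mult z0) (simp add: SUstar_quat unimod_quat q1 det_unimod[OF q1 dp])
    ultimately show "s X \<in> SUstar \<and> xi (gram (s X)) = X" by blast
  qed
qed

section \<open>Every point of the cone is a Gram matrix\<close>

lemma closed_quat: "closed quat" by (rule closed_subspace[OF subspace_quat])

lemma closed_SUstar: "closed (SUstar :: 'n::finite cmat set)"
proof -
  have "closed {z :: 'n cmat. det z = 1}"
    using Cinf_continuous[OF Cinf_det[OF open_UNIV Cinf_ident[OF open_UNIV]]] by (intro closed_Collect_eq) auto
  then have "closed (quat \<inter> {z :: 'n cmat. det z = 1})" by (rule closed_Int[OF closed_quat])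
  moreover have "SUstar = quat \<inter> {z :: 'n cmat. det z = 1}" by (auto simp: SUstar_quat)
  ultimately show ?thesis by simp
qed

lemma continuous_gram: "continuous_on A gram"
  using Cinf_continuous[OF Cinf_gram[OF open_UNIV Cinf_ident[OF open_UNIV]]] continuous_on_subset by blast

text \<open>The image is open by \<open>local_section\<close> and closed in the cone, which is
  convex and hence connected. For closedness, \<open>trace_gram\<close> bounds the representatives
  of a convergent sequence of Gram matrices, and a limit of a subsequence lies in the closed
  group.\<close>

lemma xi_gram_image: "(\<lambda>z. xi (gram z)) ` SUstar = (cone_domain :: 'n::finite cmat set)"
  and openin_cone: "openin (top_of_set pspace) (cone_domain :: 'n::finite cmat set)"
proof -
  let ?I = "(\<lambda>z. xi (gram z)) ` (SUstar :: 'n cmat set)"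
  have sub: "?I \<subseteq> cone_domain" using xi_cone gram_Pos by blast
  have ex: "\<exists>W. open W \<and> X \<in> W \<and> W \<inter> pspace \<subseteq> ?I" if X: "X \<in> ?I" for X
  proof -
    obtain z where z: "z \<in> SUstar" "X = xi (gram z)" using X by blast
    obtain W s where "open W" "xi (gram z) \<in> W" "\<And>X. X \<in> W \<Longrightarrow> X \<in> pspace \<Longrightarrow> s X \<in> SUstar \<and> xi (gram (s X)) = X"
      using local_section[OF z(1)] by metis
    then show ?thesis using z(2) by (intro exI[of _ W]) (auto simp: image_iff, metis)
  qed
  have op: "openin (top_of_set S) ?I" if "?I \<subseteq> S" "S \<subseteq> pspace" for S
    unfolding openin_subopen[of _ ?I]
  proof
    fix X assume X: "X \<in> ?I"
    then obtain W where "open W" "X \<in> W" "W \<inter> pspace \<subseteq> ?I" using ex by blast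
    then show "\<exists>T. openin (top_of_set S) T \<and> X \<in> T \<and> T \<subseteq> ?I"
      using that X by (intro exI[of _ "S \<inter> W"]) (auto simp: openin_open_Int)
  qed
  have cl: "X \<in> ?I" if X: "X \<in> cone_domain" "X \<in> closure ?I" for X
  proof -
    obtain Y where Y: "\<And>n. Y n \<in> ?I" "Y \<longlonglongrightarrow> X" using X(2) unfolding closure_sequential by blast
    have "\<exists>z. z \<in> SUstar \<and> Y n = xi (gram z)" for n using Y(1)[of n] by blast
    then obtain z where z: "\<And>n. z n \<in> SUstar" "\<And>n. Y n = xi (gram (z n))" by metis
    have "Re (det (mat 1 + X)) > 0"
      using X(1) by (intro posdef_det_pos) (auto simp: cone_domain_def mat_1_add_qherm)
    moreover have "continuous_on {A :: 'n cmat. Re (det A) > 0} unimod"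
      by (intro Cinf_continuous[OF Cinf_unimod] open_det_pos Cinf_ident) auto
    ultimately have "isCont unimod (mat 1 + X)"
      using continuous_on_eq_continuous_at[OF open_det_pos] by blast
    then have "(\<lambda>n. unimod (mat 1 + Y n)) \<longlonglongrightarrow> unimod (mat 1 + X)"
      by (intro isCont_tendsto_compose[of _ unimod] tendsto_add tendsto_const Y)
    then have lim: "(\<lambda>n. gram (z n)) \<longlonglongrightarrow> unimod (mat 1 + X)"
      using z unimod_xi[OF gram_Pos[OF z(1)]] by simp
    then have "Bseq (\<lambda>n. gram (z n))" using convergentI convergent_imp_Bseq by blast
    then obtain K where K: "\<And>n. norm (gram (z n)) \<le> K" by (auto simp: Bseq_def)
    have "linear (\<lambda>A :: 'n cmat. Re (trace A))" by (auto simp: linear_iff tr_add tr_scale)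
    then obtain B where B: "B > 0" "\<And>A :: 'n cmat. norm (Re (trace A)) \<le> B * norm A" by (metis linear_bounded_pos)
    have "norm (z n) \<le> sqrt (B * K)" for n
    proof (rule real_le_rsqrt)
      have "norm (z n) ^ 2 = Re (trace (gram (z n)))" by (simp add: trace_gram)
      also have "\<dots> \<le> B * norm (gram (z n))" using B(2)[of "gram (z n)"] by simp
      also have "\<dots> \<le> B * K" using B K by simp
      finally show "norm (z n) ^ 2 \<le> B * K" .
    qed
    then have "\<And>n. z n \<in> cball 0 (sqrt (B * K)) \<inter> SUstar" using z by simp
    moreover have "seq_compact (cball 0 (sqrt (B * K)) \<inter> (SUstar :: 'n cmat set))"
      by (intro compact_imp_seq_compact compact_Int_closed compact_cball closed_SUstar)
    ultimately obtain l r where l: "l \<in> SUstar" "strict_mono r" "(z \<circ> r) \<longlonglongrightarrow> l"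
      unfolding seq_compact_def by (metis Int_iff)
    have "isCont gram l" using continuous_gram[of "UNIV :: 'n cmat set"] by (simp add: continuous_on_eq_continuous_at)
    then have "(\<lambda>n. gram ((z \<circ> r) n)) \<longlonglongrightarrow> gram l" using l(3) isCont_tendsto_compose by blast
    moreover have "(\<lambda>n. gram ((z \<circ> r) n)) \<longlonglongrightarrow> unimod (mat 1 + X)"
      using LIMSEQ_subseq_LIMSEQ[OF lim l(2)] by (simp add: o_def)
    ultimately have "gram l = unimod (mat 1 + X)" using LIMSEQ_unique by blast
    then have "xi (gram l) = X" using cone_unimod(2)[OF X(1)] by simp
    then show ?thesis using l(1) by blast
  qed
  have "?I = cone_domain \<inter> closure ?I"
  proof
    show "?I \<subseteq> cone_domain \<inter> closure ?I" by (rule Int_greatest[OF sub closure_subset])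
    show "cone_domain \<inter> closure ?I \<subseteq> ?I" by (rule subsetI, erule IntE, rule cl)
  qed
  moreover have "closedin (top_of_set cone_domain) (cone_domain \<inter> closure ?I)"
    by (rule closedin_closed_Int) (rule closed_closure)
  ultimately have "closedin (top_of_set cone_domain) ?I" by (simp only:)
  moreover have "openin (top_of_set cone_domain) ?I" by (rule op) (use sub in \<open>auto simp: cone_domain_def\<close>)
  ultimately have "?I = {} \<or> ?I = cone_domain"
    by (intro convex_connected[OF cone_convex, unfolded connected_clopen, rule_format] conjI)
  moreover have "?I \<noteq> {}" using SUstar_mat_1 by blast
  ultimately show eq: "?I = cone_domain" by (elim disjE) (rule notE)
  show "openin (top_of_set pspace) (cone_domain :: 'n cmat set)"
    using op[of pspace] sub unfolding eq by (auto simp: cone_domain_def)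
qed

lemma gram_surj: assumes P: "P \<in> Pos" obtains z where "z \<in> SUstar" "gram z = P"
proof -
  have "xi P \<in> (\<lambda>z. xi (gram z)) ` SUstar" unfolding xi_gram_image by (rule xi_cone[OF P])
  then obtain z where "z \<in> SUstar" "xi (gram z) = xi P" by auto
  then show ?thesis using that xi_inj[OF gram_Pos P] by blast
qed

section \<open>Charts of the quotient\<close>

lemma tangent_space_openin:
  assumes "openin (top_of_set A) B" "x \<in> B"
  shows "tangent_space B x = tangent_space A x"
proof
  obtain T where T: "open T" "B = A \<inter> T" using assms(1) openin_open by blast
  show "tangent_space B x \<subseteq> tangent_space A x" by (rule subsetI) (auto simp: tangent_space_def T(2))
  show "tangent_space A x \<subseteq> tangent_space B x"
  proof
    fix v assume "v \<in> tangent_space A x"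
    then obtain \<gamma> where \<gamma>: "\<And>t::real. \<gamma> t \<in> A" "\<gamma> 0 = x" "(\<gamma> has_vector_derivative v) (at 0)"
      unfolding tangent_space_def by blast
    have "isCont \<gamma> 0" using has_vector_derivative_continuous[OF \<gamma>(3)] .
    moreover have "\<gamma> 0 \<in> T" using assms(2) T \<gamma>(2) by simp
    then obtain d where d: "d > 0" "ball (\<gamma> 0) d \<subseteq> T" using T(1) open_contains_ball by blast
    ultimately obtain e where e: "e > 0" "\<And>t. dist t 0 < e \<Longrightarrow> dist (\<gamma> t) (\<gamma> 0) < d"
      unfolding continuous_at_eps_delta by blast
    have "\<gamma> t \<in> T" if "dist t 0 < e" for t
      using e(2)[OF that] d(2) by (auto simp: dist_commute)
    with e(1) show "v \<in> tangent_space B x"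
      using \<gamma> T by (intro tangent_spaceI[of e \<gamma>]) (auto simp: dist_real_def)
  qed
qed

definition coset_gram :: "'n::finite cmat set \<Rightarrow> 'n cmat" where
  "coset_gram S = gram (SOME z. z \<in> S)"

lemma coset_gram: "coset_gram (coset z) = gram z"
  unfolding coset_gram_def using someI[of "\<lambda>w. w \<in> coset z", OF coset_self] gram_coset by blast

text \<open>A single chart covering the whole quotient, with image
  \<open>cone_domain\<close>.\<close>

definition gchart :: "('n::finite cmat set, 'n cmat) chart" where
  "gchart = (coset ` SUstar, \<lambda>S. xi (coset_gram S))"

lemma Union_coset: "\<Union>(coset ` SUstar) = SUstar"
  using coset_subset coset_self by fastforce

lemma Cinf_xi_gram: "Cinf {z. Re (trace (gram z)) > 0} (\<lambda>z. xi (gram (z :: complex^'m^'m)))"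
  and open_trace_gram: "open {z :: complex^'m^'m. Re (trace (gram z)) > 0}"
proof -
  have "open ((\<lambda>z :: complex^'m^'m. gram z) -` {A. Re (trace A) > 0})"
    by (intro open_vimage open_trace_pos continuous_gram)
  then show o: "open {z :: complex^'m^'m. Re (trace (gram z)) > 0}" by (simp add: vimage_def)
  show "Cinf {z. Re (trace (gram z)) > 0} (\<lambda>z. xi (gram (z :: complex^'m^'m)))"
    by (intro Cinf_xi Cinf_gram o Cinf_ident) simp
qed

lemma SUstar_trace_gram: "z \<in> SUstar \<Longrightarrow> Re (trace (gram z)) > 0"
  using PosD(5)[OF gram_Pos] .

text \<open>The derivative is onto because a local section through z followed by the chart is the
  identity; openness of the image is \<open>openin_cone\<close>.\<close>

lemma gchart_in_quotient_charts: "(gchart :: ('n::finite cmat set, 'n cmat) chart) \<in> quotient_charts"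
proof -
  let ?x = "\<lambda>S :: 'n cmat set. xi (coset_gram S)"
  have comp: "?x \<circ> coset = (\<lambda>z. xi (gram z))" by (simp add: fun_eq_iff coset_gram)
  have img: "?x ` coset ` SUstar = cone_domain" using xi_gram_image by (simp add: image_image coset_gram)
  have "coset z = coset w" if "z \<in> SUstar" "w \<in> SUstar" "?x (coset z) = ?x (coset w)" for z w :: "'n cmat"
  proof -
    have "xi (gram z) = xi (gram w)" using that by (simp add: coset_gram)
    then have "gram z = gram w" using that xi_inj gram_Pos by blast
    then show ?thesis using that coset_eq_iff by blast
  qed
  then have inj: "inj_on ?x (coset ` SUstar)" unfolding inj_on_def by blast
  have sm: "smooth_on SUstar (\<lambda>z :: 'n cmat. xi (gram z))"
    by (rule smooth_onI[OF open_trace_gram _ Cinf_xi_gram]) (auto simp: SUstar_trace_gram)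
  have im: "deriv_on SUstar (\<lambda>z. xi (gram z)) z ` tangent_space SUstar z = pspace" if z: "z \<in> (SUstar :: 'n cmat set)" for z
  proof
    have d: "((\<lambda>z. xi (gram z)) has_derivative deriv_on SUstar (\<lambda>z. xi (gram z)) z) (at z within SUstar)"
      by (rule smooth_on_has_derivative[OF sm z])
    show "deriv_on SUstar (\<lambda>z. xi (gram z)) z ` tangent_space SUstar z \<subseteq> pspace"
    proof clarify
      fix V assume "V \<in> tangent_space SUstar z"
      then obtain \<gamma> where \<gamma>: "\<And>t::real. \<gamma> t \<in> SUstar" "\<gamma> 0 = z" "(\<gamma> has_vector_derivative V) (at 0)"
        unfolding tangent_space_def by blast
      show "deriv_on SUstar (\<lambda>z. xi (gram z)) z V \<in> pspace"
        using vector_derivative_in_subspace[OF subspace_pspace _ has_derivative_curve[OF d \<gamma>]] \<gamma>(1) xi_cone gram_Pos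
        by (auto simp: cone_domain_def)
    qed
    show "pspace \<subseteq> deriv_on SUstar (\<lambda>z. xi (gram z)) z ` tangent_space SUstar z"
    proof
      fix Y :: "'n cmat" assume Y: "Y \<in> pspace"
      let ?X = "xi (gram z)"
      obtain W s where W: "open W" "?X \<in> W" "Cinf W s" "s ?X = z"
        "\<And>X. X \<in> W \<Longrightarrow> X \<in> pspace \<Longrightarrow> s X \<in> SUstar \<and> xi (gram (s X)) = X"
        using local_section[OF z] by metis
      have Xp: "?X \<in> pspace" using xi_cone[OF gram_Pos[OF z]] by (simp add: cone_domain_def)
      have "Y \<in> tangent_space (pspace \<inter> W) ?X"
        using tangent_space_openin_subspace[OF subspace_pspace, of "pspace \<inter> W" ?X] W Xp Y by (auto simp: openin_open_Int)
      then obtain \<gamma> where \<gamma>: "\<And>t::real. \<gamma> t \<in> pspace \<inter> W" "\<gamma> 0 = ?X" "(\<gamma> has_vector_derivative Y) (at 0)"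
        unfolding tangent_space_def by blast
      have ds: "((\<lambda>t. s (\<gamma> t)) has_vector_derivative frechet_derivative s (at ?X) Y) (at 0)"
        by (rule has_derivative_curve[OF Cinf_has_derivative[OF W(3,2)] _ \<gamma>(2,3)]) simp
      have S: "s (\<gamma> t) \<in> SUstar" "xi (gram (s (\<gamma> t))) = \<gamma> t" for t using \<gamma>(1)[of t] W(5) by auto
      have "frechet_derivative s (at ?X) Y \<in> tangent_space SUstar z"
        unfolding tangent_space_def using S ds \<gamma>(2) W(4) by (intro CollectI exI[of _ "\<lambda>t. s (\<gamma> t)"]) auto
      moreover have "((\<lambda>t. xi (gram (s (\<gamma> t)))) has_vector_derivative deriv_on SUstar (\<lambda>z. xi (gram z)) z (frechet_derivative s (at ?X) Y)) (at 0)"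
        by (rule has_derivative_curve[OF d _ _ ds]) (use S W(4) \<gamma>(2) in auto)
      then have "deriv_on SUstar (\<lambda>z. xi (gram z)) z (frechet_derivative s (at ?X) Y) = Y"
        using S(2) \<gamma>(3) vector_derivative_unique_at by auto
      ultimately show "Y \<in> deriv_on SUstar (\<lambda>z. xi (gram z)) z ` tangent_space SUstar z" by (metis image_eqI)
    qed
  qed
  show ?thesis
    unfolding quotient_charts_def gchart_def horizontal_mat_1 mem_Collect_eq case_prod_conv Union_coset comp img
    by (intro conjI ballI inj sm im openin_cone) auto
qed

lemma chart_Union:
  assumes c: "(U, x) \<in> quotient_charts" and z: "z \<in> \<Union>U"
  shows "z \<in> SUstar \<and> coset z \<in> U"
proof -
  obtain S where "S \<in> U" "z \<in> S" using z by blast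
  moreover have "U \<subseteq> coset ` SUstar" using c unfolding quotient_charts_def by blast
  ultimately obtain w where w: "w \<in> SUstar" "S = coset w" by blast
  have "z \<in> coset w" using \<open>z \<in> S\<close> w(2) by simp
  then have "z \<in> SUstar" "coset z = S" using coset_subset[OF w(1)] coset_cong[OF w(1)] w(2) by auto
  then show ?thesis using \<open>S \<in> U\<close> by simp
qed

text \<open>Compares an arbitrary chart with the cone by smooth maps on open sets of matrices. The
  transition \<open>Tm\<close> from the coordinates \<open>xi\<close> to \<open>x\<close> is smooth,
  being locally \<open>x \<circ> coset\<close> after a local section. It is extended in normal
  directions to a map \<open>F\<close> with invertible derivatives; the inverse of \<open>F\<close>
  yields \<open>Pc\<close>, and \<open>F\<close> after \<open>xi\<close> yields
  \<open>crd\<close>.\<close>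

lemma chart_parametrization:
  fixes x :: "'n::finite cmat set \<Rightarrow> 'n cmat"
  assumes c: "(U, x) \<in> quotient_charts"
  obtains Om Pc Om' crd where "open Om" "Cinf Om Pc" "Om \<inter> pspace = x ` U" "\<And>u. u \<in> Om \<Longrightarrow> Pc u \<in> Pos"
    "\<And>z. z \<in> \<Union>U \<Longrightarrow> Pc (x (coset z)) = gram z"
    "open Om'" "Cinf Om' crd" "\<And>z. z \<in> \<Union>U \<Longrightarrow> gram z \<in> Om' \<and> crd (gram z) = x (coset z)"
    "\<And>P. P \<in> Om' \<Longrightarrow> P \<in> Pos \<Longrightarrow> \<exists>z\<in>\<Union>U. gram z = P"
proof -
  have U: "U \<subseteq> coset ` SUstar" "openin (top_of_set SUstar) (\<Union>U)" "inj_on x U" "openin (top_of_set pspace) (x ` U)"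
    "smooth_on (\<Union>U) (x \<circ> coset)"
    "\<And>z. z \<in> \<Union>U \<Longrightarrow> deriv_on SUstar (x \<circ> coset) z ` tangent_space SUstar z = pspace"
    using c unfolding quotient_charts_def horizontal_mat_1 mem_Collect_eq case_prod_conv by blast+
  note Z = chart_Union[OF c]
  obtain \<pi> :: "'n cmat \<Rightarrow> 'n cmat" where \<pi>: "linear \<pi>" "\<And>y. \<pi> y \<in> pspace" "\<And>y. y \<in> pspace \<Longrightarrow> \<pi> y = y"
    using orthogonal_projection[OF subspace_pspace] by metis
  have \<pi>add: "\<pi> (y + w) = \<pi> y + \<pi> w" and \<pi>diff: "\<pi> (y - w) = \<pi> y - \<pi> w" for y w
    using \<pi>(1) by (auto simp: linear_add linear_diff)
  have \<pi>c: "continuous_on A \<pi>" for A using \<pi>(1) linear_continuous_on linear_conv_bounded_linear by blast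
  let ?X = "\<lambda>z. xi (gram z)"
  have Xp: "?X z \<in> pspace" if "z \<in> SUstar" for z using xi_cone[OF gram_Pos[OF that]] by (simp add: cone_domain_def)
  obtain T where T: "open T" "\<Union>U = SUstar \<inter> T" using U(2) openin_open by blast
  define O0 where "O0 = ?X ` \<Union>U"
  define Tm where "Tm X = x (coset (SOME z. z \<in> SUstar \<and> ?X z = X))" for X
  have Tm: "Tm (?X z) = x (coset z)" if "z \<in> SUstar" for z
  proof -
    let ?w = "SOME w. w \<in> SUstar \<and> ?X w = ?X z"
    have w: "?w \<in> SUstar \<and> ?X ?w = ?X z" by (rule someI[of _ z]) (use that in simp)
    then have "gram ?w = gram z" using xi_inj gram_Pos that by blast
    then have "coset ?w = coset z" using coset_eq_iff w that by blast
    then show ?thesis unfolding Tm_def by (rule arg_cong)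
  qed
  have O0open: "\<exists>W s V' G. open W \<and> ?X z \<in> W \<and> Cinf W s \<and> open V' \<and> Cinf V' G \<and> s ` W \<subseteq> V' \<inter> T
      \<and> (\<forall>w\<in>V'. w \<in> \<Union>U \<longrightarrow> G w = x (coset w))
      \<and> (\<forall>X\<in>W. X \<in> pspace \<longrightarrow> s X \<in> SUstar \<and> ?X (s X) = X)" if z: "z \<in> \<Union>U" for z
  proof -
    obtain W s where W: "open W" "?X z \<in> W" "Cinf W s" "s (?X z) = z"
        "\<And>X. X \<in> W \<Longrightarrow> X \<in> pspace \<Longrightarrow> s X \<in> SUstar \<and> xi (gram (s X)) = X"
      using local_section[of z] Z[OF z] by metis
    obtain V' G where G: "open V'" "z \<in> V'" "Cinf V' G" "\<And>w. w \<in> V' \<Longrightarrow> w \<in> \<Union>U \<Longrightarrow> G w = (x \<circ> coset) w"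
      using smooth_onD[OF U(5) z] by metis
    let ?W = "W \<inter> s -` (V' \<inter> T)"
    have "open ?W" by (rule continuous_open_preimage[OF Cinf_continuous[OF W(3)] W(1)]) (use G T in auto)
    moreover have "?X z \<in> ?W" using W G z T by auto
    moreover have "Cinf ?W s" using Cinf_subset[OF W(3)] by blast
    ultimately show ?thesis using G(1,3,4) W(5)
      by (intro exI[of _ ?W] exI[of _ s] exI[of _ V'] exI[of _ G]) auto
  qed
  have inO0: "X \<in> O0" if "X \<in> W" "X \<in> pspace" "s ` W \<subseteq> V' \<inter> T" "\<forall>X\<in>W. X \<in> pspace \<longrightarrow> s X \<in> SUstar \<and> ?X (s X) = X" for X W s V'
  proof -
    have "s X \<in> \<Union>U" using that T by blast
    then show ?thesis unfolding O0_def using that by (metis imageI)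
  qed
  define \<Omega> where "\<Omega> = {y. \<pi> y \<in> O0}"
  \<comment> \<open>Normal components are carried along unchanged, so \<open>F\<close> acts on an
    open set although \<open>Tm\<close> concerns only points of \<open>pspace\<close>.\<close>
  define F where "F y = Tm (\<pi> y) + (y - \<pi> y)" for y
  have loc: "\<exists>N. open N \<and> y \<in> N \<and> N \<subseteq> \<Omega> \<and> Cinf N F" if y: "y \<in> \<Omega>" for y
  proof -
    obtain z where z: "z \<in> \<Union>U" "\<pi> y = ?X z" using y by (auto simp: \<Omega>_def O0_def)
    obtain W s V' G where W: "open W" "?X z \<in> W" "Cinf W s" "open V'" "Cinf V' G" "s ` W \<subseteq> V' \<inter> T"
      "\<And>w. w \<in> V' \<Longrightarrow> w \<in> \<Union>U \<Longrightarrow> G w = x (coset w)"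
      "\<And>X. X \<in> W \<Longrightarrow> X \<in> pspace \<Longrightarrow> s X \<in> SUstar \<and> ?X (s X) = X" using O0open[OF z(1)] by metis
    have N: "open (\<pi> -` W)" by (intro open_vimage W \<pi>c)
    have "Cinf (\<pi> -` W) (\<lambda>y. G (s (\<pi> y)) + (y - \<pi> y))"
    proof (intro Cinf_add Cinf_diff Cinf_ident N Cinf_linear[OF \<pi>(1)])
      have "Cinf W (\<lambda>X. G (s X))" by (rule Cinf_compose[OF W(1,4,5,3)]) (use W(6) in auto)
      then show "Cinf (\<pi> -` W) (\<lambda>y. G (s (\<pi> y)))"
        by (rule Cinf_compose[OF N W(1) _ Cinf_linear[OF \<pi>(1) N]]) auto
    qed
    moreover have "G (s (\<pi> y)) + (y - \<pi> y) = F y" if "y \<in> \<pi> -` W" for y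
    proof -
      have "s (\<pi> y) \<in> SUstar" "?X (s (\<pi> y)) = \<pi> y" "s (\<pi> y) \<in> V'" "s (\<pi> y) \<in> \<Union>U"
        using W(8)[of "\<pi> y"] W(6) \<pi>(2) that T by auto
      then show ?thesis using Tm[of "s (\<pi> y)"] W(7) by (simp add: F_def)
    qed
    ultimately have "Cinf (\<pi> -` W) F" by (intro Cinf_cong[OF N, of "\<lambda>y. G (s (\<pi> y)) + (y - \<pi> y)" F])
    moreover have "\<pi> -` W \<subseteq> \<Omega>"
      unfolding \<Omega>_def using inO0[OF _ \<pi>(2) W(6)] W(8) by blast
    moreover have "y \<in> \<pi> -` W" using z W by simp
    ultimately show ?thesis using N by blast
  qed
  have \<Omega>: "open \<Omega>" using loc by (subst open_subopen) blast
  have CF: "Cinf \<Omega> F" by (rule Cinf_local) (use loc in blast)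
  have xp: "x S \<in> pspace" if "S \<in> U" for S using U(4) that openin_subset by fastforce
  have TmU: "\<exists>z\<in>\<Union>U. \<pi> y = ?X z \<and> Tm (\<pi> y) = x (coset z)" if "y \<in> \<Omega>" for y
    using that Tm Z unfolding \<Omega>_def O0_def by (metis (no_types, lifting) imageE mem_Collect_eq)
  have \<pi>F: "\<pi> (F y) = Tm (\<pi> y)" if "y \<in> \<Omega>" for y
  proof -
    have "Tm (\<pi> y) \<in> pspace" using TmU[OF that] Z xp by metis
    then show ?thesis by (simp add: F_def \<pi>add \<pi>diff \<pi>)
  qed
  define G where "G y = ?X (SOME z. z \<in> \<Union>U \<and> x (coset z) = \<pi> y) + (y - \<pi> y)" for y
  have GF: "G (F y) = y" if y: "y \<in> \<Omega>" for y
  proof -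
    obtain z where z: "z \<in> \<Union>U" "\<pi> y = ?X z" "Tm (\<pi> y) = x (coset z)" using TmU[OF y] by blast
    let ?w = "SOME w. w \<in> \<Union>U \<and> x (coset w) = \<pi> (F y)"
    have w: "?w \<in> \<Union>U \<and> x (coset ?w) = \<pi> (F y)" by (rule someI[of _ z]) (use z \<pi>F[OF y] in simp)
    then have "x (coset ?w) = x (coset z)" using z(3) \<pi>F[OF y] by argo
    then have "coset ?w = coset z"
      by (rule inj_onD[OF U(3)]) (use Z w z(1) in blast)+
    then have "gram ?w = gram z" using coset_eq_iff[of ?w z] Z w z(1) by blast
    then show ?thesis using z(2,3) \<pi>F[OF y] unfolding G_def by (simp add: F_def)
  qed
  \<comment> \<open>Surjectivity is the accessible half: normal directions are fixed, and
    \<open>pspace\<close> is reached because \<open>x \<circ> coset\<close> is a submersion. Equal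
    dimensions give injectivity.\<close>
  have injD: "h = 0" if y: "y \<in> \<Omega>" and h0: "frechet_derivative F (at y) h = 0" for y h
  proof -
    let ?D = "frechet_derivative F (at y)"
    have D: "(F has_derivative ?D) (at y)" by (rule Cinf_has_derivative[OF CF y])
    obtain z where z: "z \<in> \<Union>U" "\<pi> y = ?X z" using TmU[OF y] by blast
    have sur1: "\<exists>k. ?D k = v" if v: "v \<in> pspace" for v
    proof -
      obtain V where V: "V \<in> tangent_space SUstar z" "v = deriv_on SUstar (x \<circ> coset) z V"
        using U(6)[OF z(1)] v by blast
      have "V \<in> tangent_space (\<Union>U) z" using V(1) tangent_space_openin[OF U(2) z(1)] by simp
      then obtain \<gamma> where \<gamma>: "\<And>t::real. \<gamma> t \<in> \<Union>U" "\<gamma> 0 = z" "(\<gamma> has_vector_derivative V) (at 0)"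
        unfolding tangent_space_def by blast
      have "((x \<circ> coset) has_derivative deriv_on (\<Union>U) (x \<circ> coset) z) (at z within SUstar)"
        using smooth_on_has_derivative[OF U(5) z(1)] at_within_openin[OF U(2) z(1)] by simp
      then have "((x \<circ> coset) has_derivative deriv_on SUstar (x \<circ> coset) z) (at z within SUstar)"
        using differentiableI frechet_derivative_works by blast
      then have dx: "((\<lambda>t. (x \<circ> coset) (\<gamma> t)) has_vector_derivative v) (at 0)"
        unfolding V(2) by (rule has_derivative_curve) (use \<gamma> Z in auto)
      have dX: "((\<lambda>t. ?X (\<gamma> t)) has_vector_derivative frechet_derivative ?X (at z) V) (at 0)"
        by (rule has_derivative_curve[OF Cinf_has_derivative[OF Cinf_xi_gram] _ \<gamma>(2,3)])
          (use Z[OF z(1)] SUstar_trace_gram in auto)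
      let ?k = "frechet_derivative ?X (at z) V"
      have k1: "((\<lambda>t. ?X (\<gamma> t) + (y - \<pi> y)) has_vector_derivative ?k) (at 0)"
        using has_vector_derivative_add[OF dX has_vector_derivative_const] by simp
      have "((\<lambda>t. F (?X (\<gamma> t) + (y - \<pi> y))) has_vector_derivative ?D ?k) (at 0)"
        by (rule has_derivative_curve[OF D _ _ k1]) (use \<gamma>(2) z(2) in auto)
      moreover have "F (?X (\<gamma> t) + (y - \<pi> y)) = (x \<circ> coset) (\<gamma> t) + (y - \<pi> y)" for t
      proof -
        have "\<pi> (?X (\<gamma> t) + (y - \<pi> y)) = ?X (\<gamma> t)"
          using \<pi>(3)[OF Xp[OF conjunct1[OF Z[OF \<gamma>(1)]]]] \<pi>(3)[OF \<pi>(2)] by (simp add: \<pi>add \<pi>diff)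
        then show ?thesis using Tm Z[OF \<gamma>(1)[of t]] by (simp add: F_def)
      qed
      ultimately have "((\<lambda>t. (x \<circ> coset) (\<gamma> t) + (y - \<pi> y)) has_vector_derivative ?D ?k) (at 0)" by simp
      moreover have "((\<lambda>t. (x \<circ> coset) (\<gamma> t) + (y - \<pi> y)) has_vector_derivative v) (at 0)"
        using has_vector_derivative_add[OF dx has_vector_derivative_const] by simp
      ultimately show ?thesis using vector_derivative_unique_at by blast
    qed
    have sur2: "?D w = w" if w: "\<pi> w = 0" for w
    proof -
      have "((\<lambda>t. F (y + t *\<^sub>R w)) has_vector_derivative ?D w) (at 0)"
        using has_derivative_curve[OF D _ _ has_vector_derivative_line[of y w 0]] by simp
      moreover have "F (y + t *\<^sub>R w) = F y + t *\<^sub>R w" for t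
        using w \<pi>(1) by (simp add: F_def \<pi>add linear_scale)
      ultimately show ?thesis using has_vector_derivative_line[of "F y" w 0] vector_derivative_unique_at by auto
    qed
    have lin: "linear ?D" using D has_derivative_linear by blast
    have "surj ?D"
      unfolding surj_def
    proof
      fix u
      obtain k where k: "?D k = \<pi> u" using sur1[OF \<pi>(2)] by blast
      have "\<pi> (u - \<pi> u) = 0" by (simp add: \<pi>diff \<pi>)
      then have "?D (k + (u - \<pi> u)) = u" using sur2 k lin by (simp add: linear_add)
      then show "\<exists>k. u = ?D k" by metis
    qed
    then have "inj ?D" using linear_surjective_imp_injective[OF lin] by simp
    then show "h = 0" using h0 linear_injective_0[OF lin] by blast
  qed
  have inv: "open (F ` \<Omega>)" "Cinf (F ` \<Omega>) G"
    by (rule Cinf_inverse[OF \<Omega> CF, of G]; use injD GF in blast)+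
  define Pc where "Pc u = unimod (mat 1 + \<pi> (G u))" for u
  have O0c: "O0 \<subseteq> cone_domain" unfolding O0_def using Z xi_cone gram_Pos by blast
  have Gc: "\<pi> (G u) \<in> cone_domain" if u: "u \<in> F ` \<Omega>" for u
  proof -
    obtain y where y: "y \<in> \<Omega>" "u = F y" using u by blast
    then show ?thesis using GF[OF y(1)] O0c by (simp add: \<Omega>_def subset_iff)
  qed
  have Pcpos: "Pc u \<in> Pos" if "u \<in> F ` \<Omega>" for u
    unfolding Pc_def by (rule cone_unimod(1)[OF Gc[OF that]])
  have FX: "F (?X z) = x (coset z)" "?X z \<in> \<Omega>" "G (x (coset z)) = ?X z" if "z \<in> \<Union>U" for z
  proof -
    have \<pi>X: "\<pi> (?X z) = ?X z" using Xp Z[OF that] \<pi>(3) by blast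
    then show 1: "F (?X z) = x (coset z)" using Tm Z[OF that] by (simp add: F_def)
    show 2: "?X z \<in> \<Omega>" using \<pi>X that by (auto simp: \<Omega>_def O0_def)
    show "G (x (coset z)) = ?X z" using GF[OF 2] 1 by simp
  qed
  show ?thesis
  proof (rule that[of "F ` \<Omega>" Pc "{P. Re (trace P) > 0} \<inter> xi -` \<Omega>" "\<lambda>P. F (xi P)"])
    show "open (F ` \<Omega>)" by (rule inv)
    show "Cinf (F ` \<Omega>) Pc" unfolding Pc_def
    proof (intro Cinf_unimod Cinf_add Cinf_const Cinf_linear_compose[OF \<pi>(1)] inv)
      fix u assume "u \<in> F ` \<Omega>"
      then have "\<pi> (G u) \<in> cone_domain" by (rule Gc)
      then show "Re (det (mat 1 + \<pi> (G u))) > 0"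
        by (intro posdef_det_pos) (auto simp: cone_domain_def mat_1_add_qherm)
    qed
    show "F ` \<Omega> \<inter> pspace = x ` U"
    proof (intro equalityI subsetI)
      fix u assume "u \<in> F ` \<Omega> \<inter> pspace"
      then obtain y where y: "y \<in> \<Omega>" "u = F y" "\<pi> u = u" using \<pi>(3) by blast
      then obtain z where "z \<in> \<Union>U" "u = x (coset z)" using TmU[OF y(1)] \<pi>F[OF y(1)] by metis
      then show "u \<in> x ` U" using Z by blast
    next
      fix u assume "u \<in> x ` U"
      then obtain S where S: "S \<in> U" "u = x S" by blast
      then obtain z where z: "z \<in> SUstar" "S = coset z" using U(1) by blast
      then have "z \<in> \<Union>U" using S coset_self by blast
      then show "u \<in> F ` \<Omega> \<inter> pspace" using FX z S xp by (metis IntI imageI)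
    qed
    show "Pc u \<in> Pos" if "u \<in> F ` \<Omega>" for u by (rule Pcpos[OF that])
    show "Pc (x (coset z)) = gram z" if "z \<in> \<Union>U" for z
      using FX(3)[OF that] \<pi>(3)[OF Xp[OF conjunct1[OF Z[OF that]]]] unimod_xi[OF gram_Pos[OF conjunct1[OF Z[OF that]]]]
      by (simp add: Pc_def)
    have Cx: "Cinf {P :: 'n cmat. Re (trace P) > 0} xi" by (intro Cinf_xi open_trace_pos Cinf_ident) simp
    show o: "open ({P. Re (trace P) > 0} \<inter> xi -` \<Omega>)"
      by (rule continuous_open_preimage[OF Cinf_continuous[OF Cx] open_trace_pos \<Omega>])
    show "Cinf ({P. Re (trace P) > 0} \<inter> xi -` \<Omega>) (\<lambda>P. F (xi P))"
      by (rule Cinf_compose[OF o \<Omega> CF Cinf_subset[OF Cx]]) auto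
    show "gram z \<in> {P. Re (trace P) > 0} \<inter> xi -` \<Omega> \<and> F (xi (gram z)) = x (coset z)" if "z \<in> \<Union>U" for z
      using FX[OF that] SUstar_trace_gram[OF conjunct1[OF Z[OF that]]] by simp
    fix P assume P: "P \<in> {P. Re (trace P) > 0} \<inter> xi -` \<Omega>" "P \<in> Pos"
    then have "\<pi> (xi P) = xi P" using xi_cone \<pi>(3) by (auto simp: cone_domain_def)
    then obtain z where z: "z \<in> \<Union>U" "xi P = ?X z" using TmU[of "xi P"] P(1) by auto
    then have "gram z = P" using xi_inj[OF P(2) gram_Pos] Z by metis
    then show "\<exists>z\<in>\<Union>U. gram z = P" using z by blast
  qed
qed

section \<open>The metric and the connection in a chart\<close>

text \<open>The affine-invariant metric on positive definite matrices. The factor 1/4 compensates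
  that a horizontal vector \<open>z ** X\<close> moves \<open>gram z\<close> by twice
  \<open>z ** X ** ctranspose z\<close>, so that the length of X is recovered.\<close>

definition pmetric :: "complex^'m^'m \<Rightarrow> complex^'m^'m \<Rightarrow> complex^'m^'m \<Rightarrow> real" where
  "pmetric P A B = Re (trace (matrix_inv P ** A ** matrix_inv P ** B)) / 4"

lemma matrix_inv_gram: "det z \<noteq> 0 \<Longrightarrow> matrix_inv (gram z) = matrix_inv (ctranspose z) ** matrix_inv z"
  by (rule matrix_inv_unique[symmetric])
    (simp add: gram_def matrix_mul_assoc matrix_inv_right' matrix_inv_right det_ctranspose)

lemma pmetric_sandwich:
  assumes z: "det z \<noteq> 0" and Y: "Y \<in> qherm"
  shows "pmetric (gram z) (2 *\<^sub>R (z ** X ** ctranspose z)) (2 *\<^sub>R (z ** Y ** ctranspose z)) = X \<bullet> Y"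
proof -
  have d: "det (ctranspose z) \<noteq> 0" using z by (simp add: det_ctranspose)
  have "matrix_inv (gram z) ** (z ** X ** ctranspose z) ** matrix_inv (gram z) ** (z ** Y ** ctranspose z)
     = matrix_inv (ctranspose z) ** (X ** Y ** ctranspose z)"
    by (simp add: matrix_inv_gram[OF z] matrix_mul_assoc matrix_inv_left'[OF z] matrix_inv_right'[OF d])
  then have "trace (matrix_inv (gram z) ** (z ** X ** ctranspose z) ** matrix_inv (gram z) ** (z ** Y ** ctranspose z)) = trace (X ** Y)"
    using trace_mul_sym[of "matrix_inv (ctranspose z)" "X ** Y ** ctranspose z"] by (simp add: matrix_inv_right'[OF d])
  moreover have "X \<bullet> Y = Re (trace (X ** Y))" using Y by (simp add: inner_matrix qherm_def)
  ultimately show ?thesis by (simp add: pmetric_def mm.scaleR_left mm.scaleR_right tr_scale)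
qed

text \<open>An arbitrary chart with the maps of \<open>chart_parametrization\<close>:
  \<open>Pc\<close> extends the point of the cone as a function of the coordinates,
  \<open>crd\<close> the coordinates as a function of the point. Being smooth on open sets they have
  genuine derivatives, whose values on tangent directions carry the geometry.\<close>

locale quotient_chart =
  fixes U :: "'n::finite cmat set set" and x :: "'n cmat set \<Rightarrow> 'n cmat"
    and Om :: "'n cmat set" and Pc :: "'n cmat \<Rightarrow> 'n cmat"
    and Om' :: "'n cmat set" and crd :: "'n cmat \<Rightarrow> 'n cmat"
  assumes chart: "(U, x) \<in> quotient_charts"
    and open_Om: "open Om" and Cinf_Pc: "Cinf Om Pc" and Om_pspace: "Om \<inter> pspace = x ` U"
    and Pc_Pos: "\<And>u. u \<in> Om \<Longrightarrow> Pc u \<in> Pos"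
    and Pc_x: "\<And>z. z \<in> \<Union>U \<Longrightarrow> Pc (x (coset z)) = gram z"
    and open_Om': "open Om'" and Cinf_crd: "Cinf Om' crd"
    and crd_gram: "\<And>z. z \<in> \<Union>U \<Longrightarrow> gram z \<in> Om' \<and> crd (gram z) = x (coset z)"
    and crd_dom: "\<And>P. P \<in> Om' \<Longrightarrow> P \<in> Pos \<Longrightarrow> \<exists>z\<in>\<Union>U. gram z = P"
begin

abbreviation DP :: "'n cmat \<Rightarrow> 'n cmat \<Rightarrow> 'n cmat" where "DP u \<equiv> frechet_derivative Pc (at u)"

abbreviation D2P :: "'n cmat \<Rightarrow> 'n cmat \<Rightarrow> 'n cmat \<Rightarrow> 'n cmat" where
  "D2P u v w \<equiv> frechet_derivative (\<lambda>u. DP u w) (at u) v"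

abbreviation dx :: "'n cmat \<Rightarrow> 'n cmat \<Rightarrow> 'n cmat" where "dx z \<equiv> deriv_on SUstar (x \<circ> coset) z"

section \<open>The differential of a chart, horizontal lifts and the metric\<close>

lemma chart_props:
  "U \<subseteq> coset ` SUstar" "openin (top_of_set SUstar) (\<Union>U)" "inj_on x U" "openin (top_of_set pspace) (x ` U)"
    "smooth_on (\<Union>U) (x \<circ> coset)"
    "\<And>z. z \<in> \<Union>U \<Longrightarrow> dx z ` tangent_space SUstar z = pspace"
  using chart unfolding quotient_charts_def horizontal_mat_1 mem_Collect_eq case_prod_conv by blast+

lemma Z: "z \<in> \<Union>U \<Longrightarrow> z \<in> SUstar" "z \<in> \<Union>U \<Longrightarrow> coset z \<in> U"
  using chart_Union[OF chart] by blast+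

lemma ZI: "z \<in> SUstar \<Longrightarrow> coset z \<in> U \<Longrightarrow> z \<in> \<Union>U"
  using coset_self by blast

lemma xU_cases: assumes "u \<in> x ` U" obtains z where "z \<in> \<Union>U" "u = x (coset z)"
proof -
  obtain S where S: "S \<in> U" "u = x S" using assms by blast
  then obtain w where "w \<in> SUstar" "S = coset w" using chart_props(1) by blast
  then show ?thesis using that S ZI by blast
qed

lemma xU_Om: "u \<in> x ` U \<Longrightarrow> u \<in> Om" and xU_pspace: "u \<in> x ` U \<Longrightarrow> u \<in> pspace"
  using Om_pspace by auto

lemma xZ: "z \<in> \<Union>U \<Longrightarrow> x (coset z) \<in> x ` U"
  using Z by blast

lemma Pc_has_derivative: "u \<in> Om \<Longrightarrow> (Pc has_derivative DP u) (at u)"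
  by (rule Cinf_has_derivative[OF Cinf_Pc])

lemma linear_DP: "u \<in> Om \<Longrightarrow> linear (DP u)"
  using Pc_has_derivative has_derivative_linear by blast

lemma x_has_derivative: "z \<in> \<Union>U \<Longrightarrow> ((x \<circ> coset) has_derivative dx z) (at z within SUstar)"
  using smooth_on_has_derivative[OF chart_props(5)] at_within_openin[OF chart_props(2)] by metis

lemma linear_dx: "z \<in> \<Union>U \<Longrightarrow> linear (dx z)"
  using x_has_derivative has_derivative_linear by blast

lemma tangent_Z_curve:
  assumes "z \<in> \<Union>U" "V \<in> tangent_space SUstar z"
  obtains \<gamma> where "\<And>t::real. \<gamma> t \<in> \<Union>U" "\<gamma> 0 = z" "(\<gamma> has_vector_derivative V) (at 0)"
proof -
  have "V \<in> tangent_space (\<Union>U) z" using tangent_space_openin[OF chart_props(2)] assms by metis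
  then show ?thesis using that unfolding tangent_space_def by blast
qed

lemma gram_curve:
  assumes \<gamma>: "(\<gamma> has_vector_derivative V) (at 0)"
  shows "((\<lambda>t. gram (\<gamma> t :: 'n cmat)) has_vector_derivative \<gamma> 0 ** ctranspose V + V ** ctranspose (\<gamma> 0)) (at 0)"
proof -
  have "((\<lambda>t. ctranspose (\<gamma> t)) has_vector_derivative ctranspose V) (at 0)"
    by (rule bounded_linear.has_vector_derivative[OF _ \<gamma>]) (use linear_ctranspose linear_conv_bounded_linear in blast)
  from mm.has_vector_derivative[OF \<gamma> this] show ?thesis by (simp add: gram_def)
qed

text \<open>Differentiates the relations \<open>Pc (x (coset z)) = gram z\<close> and
  \<open>crd (gram z) = x (coset z)\<close> along a curve in the group.\<close>

lemma dx_tangent: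
  assumes z: "z \<in> \<Union>U" and V: "V \<in> tangent_space SUstar z"
  shows "dx z V \<in> pspace" "DP (x (coset z)) (dx z V) = z ** ctranspose V + V ** ctranspose z"
    "frechet_derivative crd (at (gram z)) (z ** ctranspose V + V ** ctranspose z) = dx z V"
proof -
  show "dx z V \<in> pspace" using chart_props(6)[OF z] V by blast
  obtain \<gamma> where \<gamma>: "\<And>t::real. \<gamma> t \<in> \<Union>U" "\<gamma> 0 = z" "(\<gamma> has_vector_derivative V) (at 0)"
    using tangent_Z_curve[OF z V] by metis
  have d1: "((\<lambda>t. (x \<circ> coset) (\<gamma> t)) has_vector_derivative dx z V) (at 0)"
    by (rule has_derivative_curve[OF x_has_derivative[OF z] _ \<gamma>(2,3)]) (rule Z(1)[OF \<gamma>(1)])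
  have dg: "((\<lambda>t. gram (\<gamma> t)) has_vector_derivative z ** ctranspose V + V ** ctranspose z) (at 0)"
    using gram_curve[OF \<gamma>(3)] \<gamma>(2) by simp
  have "((\<lambda>t. Pc ((x \<circ> coset) (\<gamma> t))) has_vector_derivative DP (x (coset z)) (dx z V)) (at 0)"
    by (rule has_derivative_curve[OF Pc_has_derivative[OF xU_Om[OF xZ[OF z]]] _ _ d1]) (use \<gamma>(2) in auto)
  then have "((\<lambda>t. gram (\<gamma> t)) has_vector_derivative DP (x (coset z)) (dx z V)) (at 0)"
    using Pc_x[OF \<gamma>(1)] by simp
  then show "DP (x (coset z)) (dx z V) = z ** ctranspose V + V ** ctranspose z"
    using dg vector_derivative_unique_at by blast
  have "((\<lambda>t. crd (gram (\<gamma> t))) has_vector_derivative frechet_derivative crd (at (gram z)) (z ** ctranspose V + V ** ctranspose z)) (at 0)"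
    by (rule has_derivative_curve[OF Cinf_has_derivative[OF Cinf_crd] _ _ dg]) (use crd_gram[OF z] \<gamma>(2) in auto)
  then show "frechet_derivative crd (at (gram z)) (z ** ctranspose V + V ** ctranspose z) = dx z V"
    using crd_gram[OF \<gamma>(1)] d1 vector_derivative_unique_at by auto
qed

lemma tangent_pspace: "z \<in> SUstar \<Longrightarrow> X \<in> pspace \<Longrightarrow> z ** X \<in> tangent_space SUstar z"
  by (auto simp: tangent_SUstar pspace_def qherm_quat)

lemma dx_lift:
  assumes z: "z \<in> \<Union>U" and X: "X \<in> pspace"
  shows "dx z (z ** X) \<in> pspace" "DP (x (coset z)) (dx z (z ** X)) = 2 *\<^sub>R (z ** X ** ctranspose z)"
    "frechet_derivative crd (at (gram z)) (2 *\<^sub>R (z ** X ** ctranspose z)) = dx z (z ** X)"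
proof -
  have "z ** ctranspose (z ** X) + z ** X ** ctranspose z = 2 *\<^sub>R (z ** X ** ctranspose z)"
    using X by (simp add: ctranspose_mult matrix_mul_assoc pspace_def qherm_def scaleR_2)
  with dx_tangent[OF z tangent_pspace[OF Z(1)[OF z] X]]
  show "dx z (z ** X) \<in> pspace" "DP (x (coset z)) (dx z (z ** X)) = 2 *\<^sub>R (z ** X ** ctranspose z)"
    "frechet_derivative crd (at (gram z)) (2 *\<^sub>R (z ** X ** ctranspose z)) = dx z (z ** X)" by simp_all
qed

text \<open>The vector is the velocity of a curve in the fibre, along which
  \<open>x \<circ> coset\<close> is constant.\<close>

lemma dx_vertical:
  assumes z: "z \<in> \<Union>U" and Y: "Y \<in> qskew" shows "dx z (z ** Y) = 0"
proof -
  have "z ** Y \<in> tangent_space (coset z) z" using Y tangent_coset[OF Z(1)[OF z]] by blast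
  then obtain \<gamma> where \<gamma>: "\<And>t::real. \<gamma> t \<in> coset z" "\<gamma> 0 = z" "(\<gamma> has_vector_derivative z ** Y) (at 0)"
    unfolding tangent_space_def by blast
  have d: "((\<lambda>t. (x \<circ> coset) (\<gamma> t)) has_vector_derivative dx z (z ** Y)) (at 0)"
    by (rule has_derivative_curve[OF x_has_derivative[OF z] _ \<gamma>(2,3)]) (use \<gamma>(1) coset_subset[OF Z(1)[OF z]] in blast)
  have c: "(\<lambda>t. (x \<circ> coset) (\<gamma> t)) = (\<lambda>t. x (coset z))" using coset_cong[OF Z(1)[OF z] \<gamma>(1)] by simp
  show ?thesis by (rule vector_derivative_unique_at[OF d[unfolded c] has_vector_derivative_const])
qed

text \<open>The skew part of any preimage is vertical and is sent to zero; what remains is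
  horizontal.\<close>

lemma lift_exists:
  assumes z: "z \<in> \<Union>U" and v: "v \<in> pspace"
  obtains X where "X \<in> pspace" "dx z (z ** X) = v"
proof -
  obtain V where V: "V \<in> tangent_space SUstar z" "v = dx z V" using chart_props(6)[OF z] v by blast
  then obtain X where X: "X \<in> quat" "trace X = 0" "V = z ** X" using tangent_SUstar[OF Z(1)[OF z]] by blast
  define S K where "S = (1/2) *\<^sub>R (X + ctranspose X)" and "K = (1/2) *\<^sub>R (X - ctranspose X)"
  have SK: "S \<in> qherm" "K \<in> qskew"
    using X(1) unfolding S_def K_def qherm_def qskew_def
    by (auto simp: ct_add ct_diff ct_scale add.commute intro!: subspace_add[OF subspace_quat] subspace_diff[OF subspace_quat] subspace_scale[OF subspace_quat] quat_ctranspose)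
      (simp flip: scaleR_minus_right)
  have XSK: "X = S + K" unfolding S_def K_def by (simp add: vec_eq_iff complex_eq_iff field_simps)
  have "S \<in> pspace" using SK qskew_trace[OF SK(2)] X(2) XSK by (simp add: pspace_def tr_add)
  moreover have "dx z (z ** S) = v"
    unfolding V(2) X(3) XSK mm.add_right linear_add[OF linear_dx[OF z]] dx_vertical[OF z SK(2)] by simp
  ultimately show ?thesis using that by blast
qed

text \<open>On \<open>pspace\<close> the inverse of X \<mapsto> \<open>dx z (z ** X)\<close>: it
  moves coordinate vectors to the model space, where the metric is the plain inner product. The
  formula undoes the differential of \<open>gram\<close> in the direction
  \<open>z ** X\<close>.\<close>

definition Theta :: "'n cmat \<Rightarrow> 'n cmat \<Rightarrow> 'n cmat" where
  "Theta z v = (1/2) *\<^sub>R (matrix_inv z ** DP (x (coset z)) v ** matrix_inv (ctranspose z))"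

lemma linear_Theta: assumes z: "z \<in> \<Union>U" shows "linear (Theta z)"
  using linear_DP[OF xU_Om[OF xZ[OF z]]] unfolding linear_iff Theta_def
  by (simp add: mm.add_left mm.add_right mm.scaleR_left mm.scaleR_right scaleR_add_right)

lemma Theta_dx:
  assumes z: "z \<in> \<Union>U" and X: "X \<in> pspace" shows "Theta z (dx z (z ** X)) = X"
proof -
  have "det z \<noteq> 0" "det (ctranspose z) \<noteq> 0" using Z(1)[OF z] by (simp_all add: SUstar_det det_ctranspose)
  then show ?thesis unfolding Theta_def dx_lift(2)[OF z X]
    by (simp add: mm.scaleR_left mm.scaleR_right matrix_mul_assoc matrix_inv_left matrix_inv_right')
qed

lemma Theta:
  assumes z: "z \<in> \<Union>U" and v: "v \<in> pspace"
  shows "Theta z v \<in> pspace" "dx z (z ** Theta z v) = v"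
    "DP (x (coset z)) v = 2 *\<^sub>R (z ** Theta z v ** ctranspose z)"
    "frechet_derivative crd (at (gram z)) (DP (x (coset z)) v) = v"
proof -
  obtain X where X: "X \<in> pspace" "dx z (z ** X) = v" using lift_exists[OF z v] by blast
  have T: "Theta z v = X" using Theta_dx[OF z X(1)] X(2) by simp
  show "Theta z v \<in> pspace" "dx z (z ** Theta z v) = v" using T X by auto
  show D: "DP (x (coset z)) v = 2 *\<^sub>R (z ** Theta z v ** ctranspose z)" using dx_lift(2)[OF z X(1)] X(2) T by simp
  show "frechet_derivative crd (at (gram z)) (DP (x (coset z)) v) = v"
    unfolding D T using dx_lift(3)[OF z X(1)] X(2) by simp
qed

lemma Theta_image: "z \<in> \<Union>U \<Longrightarrow> Theta z ` pspace = pspace"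
  using Theta(1) Theta_dx dx_lift(1) by (auto simp: image_iff, metis)

lemma Theta_zero: "z \<in> \<Union>U \<Longrightarrow> v \<in> pspace \<Longrightarrow> Theta z v = 0 \<Longrightarrow> v = 0"
  using Theta(2)[of z v] linear_0[OF linear_dx[of z]] by (simp add: mm.zero_right)

lemma horizontal_lift_eq:
  assumes z: "z \<in> \<Union>U" and v: "v \<in> pspace"
  shows "horizontal_lift (U, x) z v = z ** Theta z v"
  unfolding horizontal_lift_def snd_conv
proof (rule the_equality)
  show "z ** Theta z v \<in> horizontal z \<and> dx z (z ** Theta z v) = v"
    using Theta[OF z v] horizontal_eq[OF Z(1)[OF z]] by blast
  fix V assume V: "V \<in> horizontal z \<and> dx z V = v"
  then obtain X where "X \<in> pspace" "V = z ** X" using horizontal_eq[OF Z(1)[OF z]] by blast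
  then show "V = z ** Theta z v" using V Theta_dx[OF z] by auto
qed

text \<open>\<open>quotient_metric\<close> selects some representative z. Evaluated there by
  \<open>Theta\<close>, it becomes an expression in \<open>gram z\<close> and the images under
  \<open>DP\<close>, in which the choice is no longer visible.\<close>

lemma metric_eq_pmetric:
  assumes u: "u \<in> x ` U" and vw: "v \<in> pspace" "w \<in> pspace"
  shows "quotient_metric (U, x) u v w = pmetric (Pc u) (DP u v) (DP u w)"
proof -
  obtain z0 where z0: "z0 \<in> \<Union>U" "u = x (coset z0)" using xU_cases[OF u] by blast
  have inv: "inv_into U x u = coset z0" unfolding z0(2) by (rule inv_into_f_f[OF chart_props(3) Z(2)[OF z0(1)]])
  define z where "z = (SOME z. z \<in> coset z0)"
  have zc: "z \<in> coset z0" unfolding z_def by (rule someI[of _ z0]) (rule coset_self)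
  have z: "z \<in> \<Union>U" "u = x (coset z)"
    using zc coset_cong[OF Z(1)[OF z0(1)] zc] Z(2)[OF z0(1)] z0(2) by auto
  have dz: "det z \<noteq> 0" using Z(1)[OF z(1)] by (simp add: SUstar_det)
  have "quotient_metric (U, x) u v w = Theta z v \<bullet> Theta z w"
    unfolding quotient_metric_def fst_conv snd_conv inv Let_def z_def[symmetric]
    by (simp add: horizontal_lift_eq[OF z(1)] vw gl_metric_mult[OF Z(1)[OF z(1)]])
  also have "\<dots> = pmetric (gram z) (2 *\<^sub>R (z ** Theta z v ** ctranspose z)) (2 *\<^sub>R (z ** Theta z w ** ctranspose z))"
    using pmetric_sandwich[OF dz pspace_qherm[OF Theta(1)[OF z(1) vw(2)]]] by simp
  also have "\<dots> = pmetric (Pc u) (DP u v) (DP u w)"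
    using Theta(3)[OF z(1) vw(1)] Theta(3)[OF z(1) vw(2)] Pc_x[OF z(1)] z(2) by simp
  finally show ?thesis .
qed

lemma metric_eq_Theta:
  assumes z: "z \<in> \<Union>U" and vw: "v \<in> pspace" "w \<in> pspace"
  shows "quotient_metric (U, x) (x (coset z)) v w = Theta z v \<bullet> Theta z w"
proof -
  have dz: "det z \<noteq> 0" using Z(1)[OF z(1)] by (simp add: SUstar_det)
  show ?thesis unfolding metric_eq_pmetric[OF xZ[OF z] vw] Pc_x[OF z] Theta(3)[OF z vw(1)] Theta(3)[OF z vw(2)]
    by (rule pmetric_sandwich[OF dz pspace_qherm[OF Theta(1)[OF z vw(2)]]])
qed

lemma DP_tangent:
  assumes u: "u \<in> x ` U" and v: "v \<in> pspace"
  shows "DP u v \<in> qherm" "trace (matrix_inv (Pc u) ** DP u v) = 0"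
proof -
  obtain z where z: "z \<in> \<Union>U" "u = x (coset z)" using xU_cases[OF u] by blast
  note T = Theta[OF z(1) v]
  have d: "det z \<noteq> 0" "det (ctranspose z) \<noteq> 0" using Z(1)[OF z(1)] by (simp_all add: SUstar_det det_ctranspose)
  show "DP u v \<in> qherm"
    unfolding z(2) T(3) by (intro subspace_scale[OF subspace_qherm] qherm_sandwich SUstar_in_quat Z(1)[OF z(1)] pspace_qherm T(1))
  have "matrix_inv (gram z) ** (z ** Theta z v ** ctranspose z) = matrix_inv (ctranspose z) ** (Theta z v ** ctranspose z)"
    using d by (simp add: matrix_inv_gram matrix_mul_assoc matrix_inv_left')
  then have "trace (matrix_inv (gram z) ** (z ** Theta z v ** ctranspose z)) = trace (Theta z v)"
    using trace_mul_sym[of "matrix_inv (ctranspose z)" "Theta z v ** ctranspose z"] d by (simp add: matrix_inv_right')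
  then show "trace (matrix_inv (Pc u) ** DP u v) = 0"
    unfolding z(2) Pc_x[OF z(1)] T(3) using T(1) by (simp add: mm.scaleR_right tr_scale pspace_def)
qed

text \<open>Together with \<open>DP_tangent\<close> this identifies the image of
  \<open>pspace\<close> under \<open>DP u\<close> with the tangent space of the cone at
  \<open>Pc u\<close>. A preimage is found by sandwiching A back to the identity.\<close>

lemma DP_surj:
  assumes u: "u \<in> x ` U" and A: "A \<in> qherm" "trace (matrix_inv (Pc u) ** A) = 0"
  obtains v where "v \<in> pspace" "DP u v = A"
proof -
  obtain z where z: "z \<in> \<Union>U" "u = x (coset z)" using xU_cases[OF u] by blast
  have d: "det z \<noteq> 0" "det (ctranspose z) \<noteq> 0" using Z(1)[OF z(1)] by (simp_all add: SUstar_det det_ctranspose)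
  define X where "X = (1/2) *\<^sub>R (matrix_inv z ** A ** ctranspose (matrix_inv z))"
  have "X \<in> qherm" unfolding X_def
    by (intro subspace_scale[OF subspace_qherm] qherm_sandwich A quat_matrix_inv SUstar_in_quat Z(1)[OF z(1)] d)
  moreover have "trace X = 0"
  proof -
    have "trace (matrix_inv z ** A ** ctranspose (matrix_inv z)) = trace (matrix_inv (Pc u) ** A)"
      unfolding z(2) Pc_x[OF z(1)] matrix_inv_gram[OF d(1)]
      using trace_mul_sym[of "matrix_inv z ** A" "matrix_inv (ctranspose z)"] d by (simp add: ctranspose_matrix_inv matrix_mul_assoc)
    then show ?thesis unfolding X_def using A(2) by (simp add: tr_scale)
  qed
  ultimately have X: "X \<in> pspace" by (simp add: pspace_def)
  have "2 *\<^sub>R (z ** X ** ctranspose z) = A"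
    unfolding X_def using d
    by (simp add: mm.scaleR_left mm.scaleR_right matrix_mul_assoc ctranspose_matrix_inv matrix_inv_right matrix_inv_left')
  then show ?thesis using that dx_lift[OF z(1) X] z(2) by simp
qed

lemma crd_derivative:
  assumes u: "u \<in> x ` U" and v: "v \<in> pspace"
  shows "frechet_derivative crd (at (Pc u)) (DP u v) = v" "Pc u \<in> Om'" "crd (Pc u) = u"
proof -
  obtain z where z: "z \<in> \<Union>U" "u = x (coset z)" using xU_cases[OF u] by blast
  show "frechet_derivative crd (at (Pc u)) (DP u v) = v" "Pc u \<in> Om'" "crd (Pc u) = u"
    using Theta(4)[OF z(1) v] crd_gram[OF z(1)] by (simp_all add: z(2) Pc_x[OF z(1)])
qed

section \<open>Derivatives in a chart and the Levi-Civita connection\<close>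

lemma xU_tangent: "u \<in> x ` U \<Longrightarrow> tangent_space (x ` U) u = pspace"
  by (rule tangent_space_openin_subspace[OF subspace_pspace chart_props(4)])

lemma deriv_on_model:
  assumes u: "u \<in> x ` U" and F: "(F has_derivative D) (at u)" and eq: "\<And>q. q \<in> x ` U \<Longrightarrow> F q = f q"
    and v: "v \<in> pspace"
  shows "deriv_on pspace f u v = D v"
proof -
  have "(f has_derivative D) (at u within pspace)"
    by (rule has_derivative_agree[OF F open_Om]) (use u eq Om_pspace in auto)
  then show ?thesis
    by (rule deriv_on_tangent) (use v tangent_space_subspace[OF subspace_pspace xU_pspace[OF u]] in simp)
qed

lemma Cinf_DP: "Cinf Om (\<lambda>u. DP u w)"
  by (rule Cinf_frechet[OF Cinf_Pc])

lemma D2P_symmetric: "u \<in> Om \<Longrightarrow> D2P u v w = D2P u w v"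
  by (rule second_derivative_symmetric[OF open_Om Cinf_Pc])

lemma Pc_det: "u \<in> Om \<Longrightarrow> det (Pc u) \<noteq> 0"
  using Pc_Pos PosD(4) by blast

lemma inv_Pc_has_derivative:
  assumes u: "u \<in> Om"
  shows "((\<lambda>u. matrix_inv (Pc u)) has_derivative (\<lambda>h. - (matrix_inv (Pc u) ** DP u h ** matrix_inv (Pc u)))) (at u)"
  using diff_chain_at[OF Pc_has_derivative[OF u] matrix_inv_has_derivative[OF Pc_det[OF u]]] by (simp add: o_def)

text \<open>Product rule; the two cubic terms come from the two inverses of P in
  \<open>pmetric\<close>.\<close>

lemma metric_derivative:
  assumes u: "u \<in> x ` U" and vwy: "v \<in> pspace" "w \<in> pspace" "y \<in> pspace"
  shows "deriv_on pspace (\<lambda>u'. quotient_metric (U, x) u' w y) u v =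
    (let I = matrix_inv (Pc u); A = DP u v; B = DP u w; C = DP u y in
     (Re (trace (I ** D2P u v w ** I ** C)) + Re (trace (I ** B ** I ** D2P u v y))
      - Re (trace (I ** A ** I ** B ** I ** C)) - Re (trace (I ** B ** I ** A ** I ** C))) / 4)"
proof -
  let ?I = "\<lambda>u. matrix_inv (Pc u)"
  have uO: "u \<in> Om" by (rule xU_Om[OF u])
  have dI: "(?I has_derivative (\<lambda>h. - (?I u ** DP u h ** ?I u))) (at u)" by (rule inv_Pc_has_derivative[OF uO])
  have dD: "((\<lambda>u. DP u w) has_derivative (\<lambda>h. D2P u h w)) (at u)" for w
    by (rule Cinf_has_derivative[OF Cinf_DP uO])
  define f' where "f' h = ?I u ** DP u w ** ?I u ** D2P u h y +
     (?I u ** DP u w ** - (?I u ** DP u h ** ?I u) + (?I u ** D2P u h w + - (?I u ** DP u h ** ?I u) ** DP u w) ** ?I u) ** DP u y" for h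
  have df: "((\<lambda>u. ?I u ** DP u w ** ?I u ** DP u y) has_derivative f') (at u)"
    unfolding f'_def by (intro mm.FDERIV dI dD)
  have "linear (\<lambda>A :: 'n cmat. Re (trace A) / 4)"
    by (auto simp: linear_iff tr_add tr_scale add_divide_distrib)
  then have bl: "bounded_linear (\<lambda>A :: 'n cmat. Re (trace A) / 4)" by (simp add: linear_conv_bounded_linear)
  have "((\<lambda>u. pmetric (Pc u) (DP u w) (DP u y)) has_derivative (\<lambda>h. Re (trace (f' h)) / 4)) (at u)"
    unfolding pmetric_def by (rule bounded_linear.has_derivative[OF bl df])
  then have "deriv_on pspace (\<lambda>u'. quotient_metric (U, x) u' w y) u v = Re (trace (f' v)) / 4"
    by (intro deriv_on_model[OF u]) (use metric_eq_pmetric vwy in auto)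
  then show ?thesis
    by (simp add: f'_def Let_def mm.add_left mm.add_right mm.diff_left mm.minus_left mm.minus_right tr_add tr_neg tr_diff matrix_mul_assoc)
qed

lemma metric_simps: "metric SUstar_mod_Sp = quotient_metric" "model SUstar_mod_Sp = pspace"
  "charts SUstar_mod_Sp = quotient_charts" "points SUstar_mod_Sp = coset ` SUstar"
  by (simp_all add: SUstar_mod_Sp_def horizontal_mat_1)

lemma metric_nondegenerate:
  assumes u: "u \<in> x ` U" and v: "v \<in> pspace" "v' \<in> pspace" and e: "\<And>y. y \<in> pspace \<Longrightarrow> quotient_metric (U, x) u v y = quotient_metric (U, x) u v' y"
  shows "v = v'"
proof -
  obtain z where z: "z \<in> \<Union>U" "u = x (coset z)" using xU_cases[OF u] by blast
  have y: "v - v' \<in> pspace" by (rule subspace_diff[OF subspace_pspace v])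
  have "Theta z v \<bullet> Theta z (v - v') = Theta z v' \<bullet> Theta z (v - v')"
    using e[OF y] metric_eq_Theta[OF z(1) v(1) y] metric_eq_Theta[OF z(1) v(2) y] z(2) by simp
  then have "Theta z (v - v') \<bullet> Theta z (v - v') = 0"
    using linear_diff[OF linear_Theta[OF z(1)]] by (simp add: inner_diff_left)
  then have "Theta z (v - v') = 0" by simp
  then have "v - v' = 0" by (rule Theta_zero[OF z(1) y])
  then show ?thesis by simp
qed

text \<open>The trace in \<open>DP_tangent\<close> vanishes throughout the chart, hence so does its
  derivative. This measures how far second derivatives of \<open>Pc\<close> leave the tangent space
  of the cone, and \<open>half_bracket\<close> has the same defect.\<close>

lemma trace_D2P:
  assumes u: "u \<in> x ` U" and vw: "v \<in> pspace" "w \<in> pspace"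
  shows "D2P u v w \<in> qherm"
    "trace (matrix_inv (Pc u) ** D2P u v w) = trace (matrix_inv (Pc u) ** DP u v ** matrix_inv (Pc u) ** DP u w)"
proof -
  have uO: "u \<in> Om" by (rule xU_Om[OF u])
  have "v \<in> tangent_space (x ` U) u" using xU_tangent[OF u] vw by simp
  then obtain \<gamma> where \<gamma>: "\<And>t::real. \<gamma> t \<in> x ` U" "\<gamma> 0 = u" "(\<gamma> has_vector_derivative v) (at 0)"
    unfolding tangent_space_def by blast
  have dD: "((\<lambda>u. DP u w) has_derivative (\<lambda>h. D2P u h w)) (at u)"
    by (rule Cinf_has_derivative[OF Cinf_DP uO])
  have "((\<lambda>t. DP (\<gamma> t) w) has_vector_derivative D2P u v w) (at 0)"
    by (rule has_derivative_curve[OF dD _ \<gamma>(2,3)]) simp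
  then show "D2P u v w \<in> qherm"
    by (rule vector_derivative_in_subspace[OF subspace_qherm, rotated]) (rule DP_tangent(1)[OF \<gamma>(1) vw(2)])
  have "((\<lambda>u. trace (matrix_inv (Pc u) ** DP u w)) has_derivative
    (\<lambda>h. trace (matrix_inv (Pc u) ** D2P u h w + - (matrix_inv (Pc u) ** DP u h ** matrix_inv (Pc u)) ** DP u w))) (at u)"
    by (rule bounded_linear.has_derivative[OF _ mm.FDERIV[OF inv_Pc_has_derivative[OF uO] dD]])
      (use linear_trace linear_conv_bounded_linear in blast)
  from has_derivative_curve[OF this _ \<gamma>(2,3)]
  have d: "((\<lambda>t. trace (matrix_inv (Pc (\<gamma> t)) ** DP (\<gamma> t) w)) has_vector_derivative
    trace (matrix_inv (Pc u) ** D2P u v w + - (matrix_inv (Pc u) ** DP u v ** matrix_inv (Pc u)) ** DP u w)) (at 0)" by simp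
  have c: "(\<lambda>t. trace (matrix_inv (Pc (\<gamma> t)) ** DP (\<gamma> t) w)) = (\<lambda>t. 0)"
    by (rule ext) (rule DP_tangent(2)[OF \<gamma>(1) vw(2)])
  have "trace (matrix_inv (Pc u) ** D2P u v w + - (matrix_inv (Pc u) ** DP u v ** matrix_inv (Pc u)) ** DP u w) = 0"
    by (rule vector_derivative_unique_at[OF d[unfolded c] has_vector_derivative_const])
  then show "trace (matrix_inv (Pc u) ** D2P u v w) = trace (matrix_inv (Pc u) ** DP u v ** matrix_inv (Pc u) ** DP u w)"
    by (simp add: tr_add tr_diff mm.minus_left tr_neg)
qed

text \<open>The product A P^-1 B, symmetrised: up to sign the Christoffel term of the
  affine-invariant metric in matrix coordinates.\<close>

definition half_bracket :: "'n cmat \<Rightarrow> 'n cmat \<Rightarrow> 'n cmat \<Rightarrow> 'n cmat" where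
  "half_bracket P A B = (1/2) *\<^sub>R (A ** matrix_inv P ** B + B ** matrix_inv P ** A)"

lemma half_bracket_qherm:
  assumes P: "P \<in> qherm" "det P \<noteq> 0" and A: "A \<in> qherm" and B: "B \<in> qherm"
  shows "half_bracket P A B \<in> qherm"
proof -
  have I: "matrix_inv P \<in> qherm" by (rule qherm_matrix_inv[OF P])
  have "A ** matrix_inv P ** B + B ** matrix_inv P ** A \<in> quat"
    by (intro subspace_add[OF subspace_quat] quat_mult qherm_quat A B I)
  moreover have "ctranspose (A ** matrix_inv P ** B + B ** matrix_inv P ** A) = A ** matrix_inv P ** B + B ** matrix_inv P ** A"
    using A B I by (simp add: ct_add ctranspose_mult qherm_def matrix_mul_assoc add.commute)
  ultimately have "A ** matrix_inv P ** B + B ** matrix_inv P ** A \<in> qherm" by (simp add: qherm_def)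
  then show ?thesis unfolding half_bracket_def by (rule subspace_scale[OF subspace_qherm])
qed

lemma trace_cycle: "trace (I ** A ** I ** B ** I ** C) = trace (I ** C ** I ** A ** I ** (B :: 'n cmat))"
  using trace_mul_sym[of "I ** A ** I ** B" "I ** C"] by (simp add: matrix_mul_assoc)

lemma trace_cycle2: "trace (I ** A ** I ** B) = trace (I ** B ** I ** (A :: 'n cmat))"
  using trace_mul_sym[of "I ** A" "I ** B"] by (simp add: matrix_mul_assoc)

text \<open>The right-hand side is tangent to the cone by \<open>trace_D2P\<close>, hence of the
  form \<open>DP u k\<close>. In the Koszul formula the second derivatives of \<open>Pc\<close>
  reduce to a single kind by symmetry, and the cubic traces combine by cyclicity to the symmetrised
  product, so \<open>k\<close> solves it. Nondegeneracy of the metric makes the solution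
  unique.\<close>

lemma christoffel_eq:
  assumes u: "u \<in> x ` U" and vw: "v \<in> pspace" "w \<in> pspace"
  shows "christoffel SUstar_mod_Sp (U, x) u v w \<in> pspace"
    "DP u (christoffel SUstar_mod_Sp (U, x) u v w) = D2P u v w - half_bracket (Pc u) (DP u v) (DP u w)"
proof -
  let ?I = "matrix_inv (Pc u)" and ?A = "DP u v" and ?B = "DP u w"
  have uO: "u \<in> Om" by (rule xU_Om[OF u])
  let ?R = "D2P u v w - half_bracket (Pc u) ?A ?B"
  have Rq: "?R \<in> qherm"
    by (intro subspace_diff[OF subspace_qherm] trace_D2P u vw half_bracket_qherm PosD(1)[OF Pc_Pos[OF uO]] Pc_det[OF uO] DP_tangent)
  have Rt: "trace (?I ** ?R) = 0"
    using trace_D2P(2)[OF u vw] trace_cycle2[of ?I ?A ?B]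
    by (simp add: mm.diff_right tr_diff half_bracket_def mm.scaleR_right tr_scale mm.add_right tr_add matrix_mul_assoc)
  obtain k where k: "k \<in> pspace" "DP u k = ?R" using DP_surj[OF u Rq Rt] by blast
  let ?K = "\<lambda>k. k \<in> pspace \<and> (\<forall>y\<in>pspace. 2 * quotient_metric (U, x) u k y =
         deriv_on pspace (\<lambda>u'. quotient_metric (U, x) u' w y) u v
       + deriv_on pspace (\<lambda>u'. quotient_metric (U, x) u' v y) u w
       - deriv_on pspace (\<lambda>u'. quotient_metric (U, x) u' v w) u y)"
  have K: "?K k"
  proof (intro conjI ballI k)
    fix y :: "'n cmat" assume y: "y \<in> pspace"
    let ?C = "DP u y" and ?t = "\<lambda>X. Re (trace X)"
    have m: "2 * quotient_metric (U, x) u k y = (2 * ?t (?I ** D2P u v w ** ?I ** ?C) - ?t (?I ** ?A ** ?I ** ?B ** ?I ** ?C) - ?t (?I ** ?B ** ?I ** ?A ** ?I ** ?C)) / 4"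
      unfolding metric_eq_pmetric[OF u k(1) y] k(2) pmetric_def half_bracket_def
      by (simp add: mm.diff_right mm.diff_left tr_diff mm.scaleR_right mm.scaleR_left tr_scale mm.add_right mm.add_left tr_add matrix_mul_assoc field_simps)
    show "2 * quotient_metric (U, x) u k y =
         deriv_on pspace (\<lambda>u'. quotient_metric (U, x) u' w y) u v
       + deriv_on pspace (\<lambda>u'. quotient_metric (U, x) u' v y) u w
       - deriv_on pspace (\<lambda>u'. quotient_metric (U, x) u' v w) u y"
      unfolding m metric_derivative[OF u vw(1) vw(2) y] metric_derivative[OF u vw(2) vw(1) y] metric_derivative[OF u y vw] Let_def
        D2P_symmetric[OF uO, of w v] D2P_symmetric[OF uO, of y v] D2P_symmetric[OF uO, of y w]
        trace_cycle2[of ?I "D2P u y v" ?B] trace_cycle[of ?I ?A ?B ?C] trace_cycle[of ?I ?A ?C ?B]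
      by (simp add: field_simps)
  qed
  have "(THE k. ?K k) = k"
  proof (rule the_equality)
    show "?K k" by (rule K)
    fix k' assume k': "?K k'"
    show "k' = k"
    proof (rule metric_nondegenerate[OF u _ k(1)])
      show "k' \<in> pspace" using k' by blast
      fix y :: "'n cmat" assume y: "y \<in> pspace"
      have "2 * quotient_metric (U, x) u k' y = 2 * quotient_metric (U, x) u k y"
        by (rule trans[OF bspec[OF conjunct2[OF k'] y] bspec[OF conjunct2[OF K] y, symmetric]])
      then show "quotient_metric (U, x) u k' y = quotient_metric (U, x) u k y" by simp
    qed
  qed
  then have "christoffel SUstar_mod_Sp (U, x) u v w = k" unfolding christoffel_def metric_simps .
  then show "christoffel SUstar_mod_Sp (U, x) u v w \<in> pspace"
    "DP u (christoffel SUstar_mod_Sp (U, x) u v w) = D2P u v w - half_bracket (Pc u) (DP u v) (DP u w)"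
    using k by auto
qed

lemma D2P_sum: 
  assumes u: "u \<in> Om" shows "D2P u v w = (\<Sum>e\<in>Basis. (w \<bullet> e) *\<^sub>R D2P u v e)"
proof -
  have "((\<lambda>u. \<Sum>e\<in>Basis. (w \<bullet> e) *\<^sub>R DP u e) has_derivative (\<lambda>h. \<Sum>e\<in>Basis. (w \<bullet> e) *\<^sub>R D2P u h e)) (at u)"
    by (intro has_derivative_sum has_derivative_scaleR_right Cinf_has_derivative[OF Cinf_DP u])
  then have "((\<lambda>u. DP u w) has_derivative (\<lambda>h. \<Sum>e\<in>Basis. (w \<bullet> e) *\<^sub>R D2P u h e)) (at u)"
    by (rule has_derivative_transform_within_open[OF _ open_Om u])
      (rule frechet_derivative_sum_Basis[OF Pc_has_derivative, symmetric])
  then show ?thesis by (simp add: frechet_derivative_at[symmetric])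
qed

text \<open>Product rule for the derivative of \<open>Pc\<close> at a moving point in a moving
  direction, by expanding the direction in \<open>Basis\<close>.\<close>

lemma DP_field_curve:
  assumes u: "u \<in> Om" and \<gamma>: "\<And>t::real. \<gamma> t \<in> Om" "\<gamma> 0 = u" "(\<gamma> has_vector_derivative v) (at 0)"
    and Y: "((\<lambda>t. Y (\<gamma> t)) has_vector_derivative y') (at 0)"
  shows "((\<lambda>t. DP (\<gamma> t) (Y (\<gamma> t))) has_vector_derivative D2P u v (Y u) + DP u y') (at 0)"
proof -
  have dD: "((\<lambda>t. DP (\<gamma> t) e) has_vector_derivative D2P u v e) (at 0)" for e
    by (rule has_derivative_curve[OF Cinf_has_derivative[OF Cinf_DP u] _ \<gamma>(2,3)]) simp
  have Ye: "((\<lambda>t. Y (\<gamma> t) \<bullet> e) has_vector_derivative y' \<bullet> e) (at 0)" for e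
    by (rule bounded_linear.has_vector_derivative[OF bounded_linear_inner_left Y])
  have "((\<lambda>t. \<Sum>e\<in>Basis. (Y (\<gamma> t) \<bullet> e) *\<^sub>R DP (\<gamma> t) e) has_vector_derivative
     (\<Sum>e\<in>Basis. (Y (\<gamma> 0) \<bullet> e) *\<^sub>R D2P u v e + (y' \<bullet> e) *\<^sub>R DP (\<gamma> 0) e)) (at 0)"
    by (intro has_vector_derivative_sum has_vector_derivative_scaleR dD)
      (use Ye in \<open>simp add: has_real_derivative_iff_has_vector_derivative\<close>)
  moreover have "(\<Sum>e\<in>Basis. (Y (\<gamma> 0) \<bullet> e) *\<^sub>R D2P u v e + (y' \<bullet> e) *\<^sub>R DP (\<gamma> 0) e) = D2P u v (Y u) + DP u y'"
    unfolding sum.distrib \<gamma>(2) D2P_sum[OF u, where v=v and w="Y u"] frechet_derivative_sum_Basis[OF Pc_has_derivative[OF u], of y'] ..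
  moreover have "(\<lambda>t. \<Sum>e\<in>Basis. (Y (\<gamma> t) \<bullet> e) *\<^sub>R DP (\<gamma> t) e) = (\<lambda>t. DP (\<gamma> t) (Y (\<gamma> t)))"
    by (rule ext) (rule frechet_derivative_sum_Basis[OF Pc_has_derivative[OF \<gamma>(1)], symmetric])
  ultimately show ?thesis by simp
qed

text \<open>Second derivatives of \<open>Pc\<close> cancel between the derivative of the field and
  the Christoffel term. Hence coordinates disappear: the velocity E of the field pushed to the cone
  and \<open>half_bracket\<close> determine the covariant derivative.\<close>

lemma DP_cov_deriv:
  assumes Y: "(Y has_derivative D) (at u within A)" and \<gamma>: "\<And>t::real. \<gamma> t \<in> A" "\<And>t. \<gamma> t \<in> x ` U" "\<gamma> 0 = u" "(\<gamma> has_vector_derivative v) (at 0)"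
    and Yp: "\<And>t. Y (\<gamma> t) \<in> pspace"
    and E: "((\<lambda>t. DP (\<gamma> t) (Y (\<gamma> t))) has_vector_derivative E) (at 0)"
  shows "cov_deriv SUstar_mod_Sp (U, x) A Y u v \<in> pspace"
    "DP u (cov_deriv SUstar_mod_Sp (U, x) A Y u v) = E - half_bracket (Pc u) (DP u v) (DP u (Y u))"
proof -
  have u: "u \<in> x ` U" using \<gamma>(2,3) by metis
  have v: "v \<in> pspace" by (rule vector_derivative_in_subspace[OF subspace_pspace _ \<gamma>(4)]) (rule xU_pspace[OF \<gamma>(2)])
  have Yu: "Y u \<in> pspace" using Yp[of 0] \<gamma>(3) by simp
  have "v \<in> tangent_space A u" unfolding tangent_space_def using \<gamma> by blast
  then have dY: "deriv_on A Y u v = D v" by (rule deriv_on_tangent[OF Y])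
  have dc: "((\<lambda>t. Y (\<gamma> t)) has_vector_derivative D v) (at 0)" by (rule has_derivative_curve[OF Y \<gamma>(1,3,4)])
  have Dv: "D v \<in> pspace" by (rule vector_derivative_in_subspace[OF subspace_pspace Yp dc])
  have "E = D2P u v (Y u) + DP u (D v)"
    by (rule vector_derivative_unique_at[OF E DP_field_curve[OF xU_Om[OF u] xU_Om[OF \<gamma>(2)] \<gamma>(3,4) dc]])
  then show "DP u (cov_deriv SUstar_mod_Sp (U, x) A Y u v) = E - half_bracket (Pc u) (DP u v) (DP u (Y u))"
    unfolding cov_deriv_def dY linear_add[OF linear_DP[OF xU_Om[OF u]]] christoffel_eq(2)[OF u v Yu] by simp
  show "cov_deriv SUstar_mod_Sp (U, x) A Y u v \<in> pspace"
    unfolding cov_deriv_def dY by (intro subspace_add[OF subspace_pspace] Dv christoffel_eq(1)[OF u v Yu])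
qed

end

section \<open>Laplacian and conformality operator of linear functions\<close>

lemma orthonormal_basis_exists:
  fixes S :: "'a::euclidean_space set"
  assumes S: "subspace S" obtains B where "orthonormal_basis inner S B"
proof -
  obtain B where B: "B \<subseteq> S" "pairwise orthogonal B" "\<And>x. x \<in> B \<Longrightarrow> norm x = 1" "independent B" "span B = S"
    using orthonormal_basis_subspace[OF S] by metis
  have "orthonormal_basis inner S B"
    unfolding orthonormal_basis_def
    using B independent_imp_finite by (auto simp: pairwise_def orthogonal_def dot_square_norm)
  then show ?thesis using that by blast
qed

lemma orthonormal_basis_parseval:
  assumes B: "orthonormal_basis inner F B" and x: "x \<in> F"
  shows "(\<Sum>b\<in>B. (x \<bullet> b) * (y \<bullet> b)) = x \<bullet> y"
proof -
  have "(\<Sum>b\<in>B. (x \<bullet> b) *\<^sub>R b) \<bullet> y = (\<Sum>b\<in>B. (x \<bullet> b) * (y \<bullet> b))"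
    by (simp add: inner_sum_left inner_commute[of y])
  then show ?thesis using orthonormal_basis_expansion[OF B x] by simp
qed

lemma qherm_representation:
  obtains R :: "'n::finite cmat" where "R \<in> qherm" "\<And>P. P \<in> qherm \<Longrightarrow> P \<bullet> R = P \<bullet> W"
proof -
  obtain \<pi> :: "'n cmat \<Rightarrow> 'n cmat" where \<pi>: "\<And>y. \<pi> y \<in> qherm" "\<And>y s. s \<in> qherm \<Longrightarrow> (y - \<pi> y) \<bullet> s = 0"
    using orthogonal_projection[OF subspace_qherm] by metis
  have "P \<bullet> \<pi> W = P \<bullet> W" if "P \<in> qherm" for P
    using \<pi>(2)[OF that, of W] by (simp add: inner_diff_left inner_commute[of P])
  then show ?thesis using that \<pi>(1) by blast
qed

context quotient_chart
begin

lemma Theta_inj: "z \<in> \<Union>U \<Longrightarrow> inj_on (Theta z) pspace"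
  using Theta(2) by (intro inj_on_inverseI[where g="\<lambda>X. dx z (z ** X)"]) auto

lemma orthonormal_basis_Theta:
  assumes z: "z \<in> \<Union>U" and F: "F \<subseteq> pspace" and B: "orthonormal_basis (quotient_metric (U, x) (x (coset z))) F B"
  shows "orthonormal_basis inner (Theta z ` F) (Theta z ` B)" "inj_on (Theta z) B"
proof -
  have BF: "finite B" "B \<subseteq> F" "F \<subseteq> span B" using B by (auto simp: orthonormal_basis_def)
  show inj: "inj_on (Theta z) B" using Theta_inj[OF z] BF F inj_on_subset by blast
  have "Theta z ` F \<subseteq> span (Theta z ` B)"
    using linear_span_image[OF linear_Theta[OF z], of B] BF(3) by auto
  moreover have "Theta z b \<bullet> Theta z b' = (if Theta z b = Theta z b' then 1 else 0)" if "b \<in> B" "b' \<in> B" for b b'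
  proof -
    have "Theta z b \<bullet> Theta z b' = quotient_metric (U, x) (x (coset z)) b b'"
      using that BF(2) F by (intro metric_eq_Theta[OF z, symmetric]) auto
    also have "\<dots> = (if b = b' then 1 else 0)" using B that by (auto simp: orthonormal_basis_def)
    finally show ?thesis using inj_on_eq_iff[OF inj that] by simp
  qed
  ultimately show "orthonormal_basis inner (Theta z ` F) (Theta z ` B)"
    using BF unfolding orthonormal_basis_def by blast
qed

text \<open>\<open>metric_trace\<close> sums over a basis chosen by \<open>SOME\<close>, so
  existence comes first and is pulled back along the isometry \<open>Theta z\<close>. Whatever basis
  is then selected, \<open>Theta z\<close> carries it to an orthonormal basis for the standard inner
  product.\<close>

lemma metric_trace_Theta:
  assumes z: "z \<in> \<Union>U" and F: "subspace F" "F \<subseteq> pspace"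
  obtains B where "orthonormal_basis inner (Theta z ` F) (Theta z ` B)" "inj_on (Theta z) B" "B \<subseteq> F" "finite B"
    "\<And>h. metric_trace (quotient_metric (U, x) (x (coset z))) F h = (\<Sum>b\<in>B. h b b :: 'r::real_vector)"
proof -
  let ?q = "quotient_metric (U, x) (x (coset z))"
  have "subspace (Theta z ` F)" by (rule linear_subspace_image[OF linear_Theta[OF z] F(1)])
  then obtain C where C: "orthonormal_basis inner (Theta z ` F) C" by (rule orthonormal_basis_exists)
  then have C': "finite C" "C \<subseteq> Theta z ` F" "Theta z ` F \<subseteq> span C" "\<And>b b'. b \<in> C \<Longrightarrow> b' \<in> C \<Longrightarrow> b \<bullet> b' = (if b = b' then 1 else 0)"
    by (auto simp: orthonormal_basis_def)
  define B where "B = {b \<in> F. Theta z b \<in> C}"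
  have TB: "Theta z ` B = C" using C'(2) by (auto simp: B_def)
  have injF: "inj_on (Theta z) F" using Theta_inj[OF z] F(2) inj_on_subset by blast
  have injB: "inj_on (Theta z) B" by (rule inj_on_subset[OF injF]) (auto simp: B_def)
  have "orthonormal_basis ?q F B"
    unfolding orthonormal_basis_def
  proof (intro conjI ballI subsetI)
    show "finite B" using C'(1) TB injB finite_imageD by metis
    show "b \<in> F" if "b \<in> B" for b using that by (simp add: B_def)
    show "v \<in> span B" if v: "v \<in> F" for v
    proof -
      have "Theta z v \<in> span (Theta z ` B)" using C'(3) v TB by auto
      then obtain w where w: "w \<in> span B" "Theta z v = Theta z w"
        using linear_span_image[OF linear_Theta[OF z], of B] by auto
      moreover have "w \<in> F" using w(1) span_minimal[of B F] F(1) by (auto simp: B_def)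
      ultimately show ?thesis using injF v by (auto dest: inj_onD)
    qed
    show "?q b b' = (if b = b' then 1 else 0)" if "b \<in> B" "b' \<in> B" for b b'
    proof -
      have "?q b b' = Theta z b \<bullet> Theta z b'" using that F(2) by (intro metric_eq_Theta[OF z]) (auto simp: B_def)
      also have "\<dots> = (if Theta z b = Theta z b' then 1 else 0)" using that C'(4) by (simp add: B_def)
      finally show ?thesis using inj_on_eq_iff[OF injB that] by simp
    qed
  qed
  then have B': "orthonormal_basis ?q F (SOME B. orthonormal_basis ?q F B)" by (rule someI[of _ B])
  define B0 where "B0 = (SOME B. orthonormal_basis ?q F B)"
  have "B0 \<subseteq> F" "finite B0" using B' unfolding B0_def[symmetric] by (auto simp: orthonormal_basis_def)
  moreover have "metric_trace ?q F h = (\<Sum>b\<in>B0. h b b)" for h :: "'n cmat \<Rightarrow> 'n cmat \<Rightarrow> 'r"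
    unfolding metric_trace_def B0_def ..
  ultimately show ?thesis using that[of B0] orthonormal_basis_Theta[OF z F(2) B'[folded B0_def]] by blast
qed

lemma in_chart_eq:
  assumes u: "z \<in> \<Union>U" shows "in_chart (U, x) f (x (coset z)) = f (coset z)"
  unfolding in_chart_def fst_conv snd_conv using inv_into_f_f[OF chart_props(3) Z(2)[OF u]] by simp

text \<open>The Riemannian gradient on the cone of the function P \<mapsto> P \<bullet> L. The
  factor 4 cancels the 1/4 of \<open>pmetric\<close>, and the multiple of P makes the field tangent
  to the level set of the determinant.\<close>

definition grad_field :: "'n cmat \<Rightarrow> 'n cmat \<Rightarrow> 'n cmat" where
  "grad_field L P = 4 *\<^sub>R (P ** L ** P - ((P \<bullet> L) / real CARD('n + 'n)) *\<^sub>R P)"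

lemma grad_field:
  assumes L: "L \<in> qherm" and u: "u \<in> x ` U"
  shows "grad_field L (Pc u) \<in> qherm" "trace (matrix_inv (Pc u) ** grad_field L (Pc u)) = 0"
proof -
  have P: "Pc u \<in> qherm" "det (Pc u) \<noteq> 0" using PosD[OF Pc_Pos[OF xU_Om[OF u]]] by auto
  have "Pc u ** L ** Pc u \<in> qherm"
    using qherm_sandwich[OF qherm_quat[OF P(1)] L] P(1) by (simp add: qherm_def)
  then show "grad_field L (Pc u) \<in> qherm" unfolding grad_field_def
    by (intro subspace_scale[OF subspace_qherm] subspace_diff[OF subspace_qherm] P)
  show "trace (matrix_inv (Pc u) ** grad_field L (Pc u)) = 0"
    using P(2) qherm_trace_mult[OF L P(1)] CARD_pos[where 'm="'n + 'n"]
    by (simp add: grad_field_def mm.scaleR_right mm.diff_right tr_scale tr_diff matrix_mul_assoc matrix_inv_left trace_mat inner_commute)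
      (simp add: scaleR_conv_of_real)
qed

lemma grad_vector:
  assumes L: "L \<in> qherm" and u: "u \<in> x ` U"
  defines "w \<equiv> frechet_derivative crd (at (Pc u)) (grad_field L (Pc u))"
  shows "w \<in> pspace" "DP u w = grad_field L (Pc u)"
proof -
  obtain w' where "w' \<in> pspace" "DP u w' = grad_field L (Pc u)" using DP_surj[OF u grad_field[OF L u]] by blast
  then show "w \<in> pspace" "DP u w = grad_field L (Pc u)" using crd_derivative(1)[OF u, of w'] by (auto simp: w_def)
qed

lemma inner_qherm: "L \<in> qherm \<Longrightarrow> A \<bullet> L = Re (trace (A ** L))"
  by (simp add: inner_matrix qherm_def)

context
  fixes f :: "'n cmat set \<Rightarrow> real" and L :: "'n cmat"
  assumes f: "\<And>z. z \<in> SUstar \<Longrightarrow> f (coset z) = gram z \<bullet> L" and L: "L \<in> qherm"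
begin

lemma in_chart_linear: "u \<in> x ` U \<Longrightarrow> in_chart (U, x) f u = Pc u \<bullet> L"
proof -
  assume "u \<in> x ` U"
  then obtain z where z: "z \<in> \<Union>U" "u = x (coset z)" using xU_cases by blast
  then show ?thesis by (simp add: in_chart_eq[OF z(1)] f[OF Z(1)[OF z(1)]] Pc_x[OF z(1)])
qed

lemma deriv_in_chart:
  assumes u: "u \<in> x ` U" and v: "v \<in> pspace"
  shows "deriv_on pspace (in_chart (U, x) f) u v = DP u v \<bullet> L"
  by (rule deriv_on_model[OF u has_derivative_inner_left[OF Pc_has_derivative[OF xU_Om[OF u]]] _ v])
    (simp add: in_chart_linear)

lemma gradient_eq:
  assumes u: "u \<in> x ` U"
  shows "gradient SUstar_mod_Sp (U, x) f u = frechet_derivative crd (at (Pc u)) (grad_field L (Pc u))"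
proof -
  define w where "w = frechet_derivative crd (at (Pc u)) (grad_field L (Pc u))"
  note W = grad_vector[OF L u, folded w_def]
  have P: "Pc u \<in> qherm" "det (Pc u) \<noteq> 0" using PosD[OF Pc_Pos[OF xU_Om[OF u]]] by auto
  let ?K = "\<lambda>w. w \<in> pspace \<and> (\<forall>v\<in>pspace. quotient_metric (U, x) u w v = deriv_on pspace (in_chart (U, x) f) u v)"
  have K: "?K w"
  proof (intro conjI ballI W(1))
    fix v :: "'n cmat" assume v: "v \<in> pspace"
    show "quotient_metric (U, x) u w v = deriv_on pspace (in_chart (U, x) f) u v"
      unfolding metric_eq_pmetric[OF u W(1) v] W(2) deriv_in_chart[OF u v] pmetric_def grad_field_def inner_qherm[OF L, of "DP u v"]
      using P(2) DP_tangent(2)[OF u v] trace_mul_sym[of L "DP u v"]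
      by (simp add: mm.scaleR_left mm.scaleR_right mm.diff_left mm.diff_right tr_scale tr_diff matrix_mul_assoc matrix_inv_left matrix_inv_right')
  qed
  have "(THE w. ?K w) = w"
  proof (rule the_equality)
    show "?K w" by (rule K)
    fix k assume k: "?K k"
    show "k = w"
    proof (rule metric_nondegenerate[OF u conjunct1[OF k] W(1)])
      fix y :: "'n cmat" assume y: "y \<in> pspace"
      show "quotient_metric (U, x) u k y = quotient_metric (U, x) u w y"
        by (rule trans[OF bspec[OF conjunct2[OF k] y] bspec[OF conjunct2[OF K] y, symmetric]])
    qed
  qed
  then show ?thesis unfolding gradient_def metric_simps w_def .
qed

lemma metric_gradient:
  assumes u: "u \<in> x ` U" and v: "v \<in> pspace"
  shows "gradient SUstar_mod_Sp (U, x) f u \<in> pspace"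
    "DP u (gradient SUstar_mod_Sp (U, x) f u) = grad_field L (Pc u)"
    "quotient_metric (U, x) u (gradient SUstar_mod_Sp (U, x) f u) v = DP u v \<bullet> L"
proof -
  show p: "gradient SUstar_mod_Sp (U, x) f u \<in> pspace" and D: "DP u (gradient SUstar_mod_Sp (U, x) f u) = grad_field L (Pc u)"
    unfolding gradient_eq[OF u] by (rule grad_vector[OF L u])+
  have P: "det (Pc u) \<noteq> 0" by (rule Pc_det[OF xU_Om[OF u]])
  show "quotient_metric (U, x) u (gradient SUstar_mod_Sp (U, x) f u) v = DP u v \<bullet> L"
    unfolding metric_eq_pmetric[OF u p v] D pmetric_def grad_field_def inner_qherm[OF L, of "DP u v"]
    using P DP_tangent(2)[OF u v] trace_mul_sym[of L "DP u v"]
    by (simp add: mm.scaleR_left mm.scaleR_right mm.diff_left mm.diff_right tr_scale tr_diff matrix_mul_assoc matrix_inv_left matrix_inv_right')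
qed

text \<open>\<open>cov_deriv\<close> differentiates the gradient field, which is regular because it
  is an explicit smooth matrix field transported by the derivative of \<open>crd\<close>.\<close>

lemma gradient_has_derivative:
  assumes u: "u \<in> x ` U"
  shows "\<exists>D. (gradient SUstar_mod_Sp (U, x) f has_derivative D) (at u within pspace)"
proof -
  let ?V = "Om \<inter> Pc -` Om'"
  have V: "open ?V" by (rule continuous_open_preimage[OF Cinf_continuous[OF Cinf_Pc] open_Om open_Om'])
  have CP: "Cinf ?V Pc" by (rule Cinf_subset[OF Cinf_Pc]) auto
  have "Cinf ?V (\<lambda>u. grad_field L (Pc u))"
    unfolding grad_field_def divide_inverse
    by (intro Cinf_scaleR[OF V] Cinf_const Cinf_diff Cinf_matrix_mult CP V Cinf_bilinear[OF V bounded_bilinear_inner] Cinf_bilinear[OF V bounded_bilinear_mult])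
  then have "Cinf ?V (\<lambda>u. frechet_derivative crd (at (Pc u)) (grad_field L (Pc u)))"
    by (intro Cinf_frechet_apply[OF V open_Om' Cinf_crd CP]) auto
  moreover have uV: "u \<in> ?V" using xU_Om[OF u] crd_derivative(2)[OF u] subspace_0[OF subspace_pspace] by blast
  ultimately obtain D where D: "((\<lambda>u. frechet_derivative crd (at (Pc u)) (grad_field L (Pc u))) has_derivative D) (at u)"
    using Cinf_has_derivative by blast
  have "(gradient SUstar_mod_Sp (U, x) f has_derivative D) (at u within pspace)"
    by (rule has_derivative_agree[OF D V uV xU_pspace[OF u]]) (rule gradient_eq[symmetric], use Om_pspace in blast)
  then show ?thesis by blast
qed

text \<open>A linear function has no second derivative in matrix coordinates, so its Hessian is the
  connection term alone: minus the Christoffel term, that is plus \<open>half_bracket\<close>,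
  paired with L.\<close>

lemma hessian_diagonal:
  assumes u: "u \<in> x ` U" and v: "v \<in> pspace"
  shows "quotient_metric (U, x) u (cov_deriv SUstar_mod_Sp (U, x) pspace (gradient SUstar_mod_Sp (U, x) f) u v) v
    = (DP u v ** matrix_inv (Pc u) ** DP u v) \<bullet> L"
proof -
  let ?G = "gradient SUstar_mod_Sp (U, x) f"
  let ?P = "Pc u" and ?I = "matrix_inv (Pc u)" and ?A = "DP u v" and ?N = "real CARD('n + 'n)"
  have uO: "u \<in> Om" by (rule xU_Om[OF u])
  have P: "?P \<in> qherm" "det ?P \<noteq> 0" using PosD[OF Pc_Pos[OF uO]] by auto
  obtain D where D: "(?G has_derivative D) (at u within pspace)" using gradient_has_derivative[OF u] by blast
  have "v \<in> tangent_space (x ` U) u" using xU_tangent[OF u] v by simp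
  then obtain \<gamma> where \<gamma>: "\<And>t::real. \<gamma> t \<in> x ` U" "\<gamma> 0 = u" "(\<gamma> has_vector_derivative v) (at 0)"
    unfolding tangent_space_def by blast
  have dP: "((\<lambda>t. Pc (\<gamma> t)) has_vector_derivative ?A) (at 0)"
    by (rule has_derivative_curve[OF Pc_has_derivative[OF uO] _ \<gamma>(2,3)]) simp
  define E where "E = 4 *\<^sub>R ((?P ** L ** ?A + ?A ** L ** ?P) - (((?P \<bullet> L) / ?N) *\<^sub>R ?A + ((?A \<bullet> L) / ?N) *\<^sub>R ?P))"
  have "((\<lambda>t. Pc (\<gamma> t) ** L ** Pc (\<gamma> t)) has_vector_derivative Pc (\<gamma> 0) ** L ** ?A + ?A ** L ** Pc (\<gamma> 0)) (at 0)"
    by (intro mm.has_vector_derivative dP bounded_linear.has_vector_derivative[OF mm.bounded_linear_left])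
  moreover have "((\<lambda>t. (Pc (\<gamma> t) \<bullet> L) / ?N) has_vector_derivative (?A \<bullet> L) / ?N) (at 0)"
    by (intro has_vector_derivative_divide bounded_linear.has_vector_derivative[OF bounded_linear_inner_left dP])
  then have "((\<lambda>t. ((Pc (\<gamma> t) \<bullet> L) / ?N) *\<^sub>R Pc (\<gamma> t)) has_vector_derivative ((Pc (\<gamma> 0) \<bullet> L) / ?N) *\<^sub>R ?A + ((?A \<bullet> L) / ?N) *\<^sub>R Pc (\<gamma> 0)) (at 0)"
    by (intro has_vector_derivative_scaleR dP) (simp add: has_real_derivative_iff_has_vector_derivative)
  ultimately have dg: "((\<lambda>t. grad_field L (Pc (\<gamma> t))) has_vector_derivative E) (at 0)"
    unfolding grad_field_def E_def \<gamma>(2)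
    by (intro bounded_linear.has_vector_derivative[OF bounded_linear_scaleR_right] has_vector_derivative_diff)
  have DG: "DP (\<gamma> t) (?G (\<gamma> t)) = grad_field L (Pc (\<gamma> t))" for t by (rule metric_gradient(2)[OF \<gamma>(1) v])
  let ?c = "cov_deriv SUstar_mod_Sp (U, x) pspace ?G u v"
  have c: "?c \<in> pspace" "DP u ?c = E - half_bracket ?P ?A (DP u (?G u))"
    by (rule DP_cov_deriv[OF D xU_pspace[OF \<gamma>(1)] \<gamma> metric_gradient(1)[OF \<gamma>(1) v]], use dg DG in simp)+
  have 1: "half_bracket ?P ?A (grad_field L ?P) = 2 *\<^sub>R (?A ** L ** ?P + ?P ** L ** ?A) - (4 * ((?P \<bullet> L) / ?N)) *\<^sub>R ?A"
    using P(2) by (simp add: half_bracket_def grad_field_def mm.scaleR_left mm.scaleR_right mm.diff_left mm.diff_right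
        matrix_mul_assoc matrix_inv_left' matrix_inv_right' matrix_inv_right) (simp add: vec_eq_iff complex_eq_iff field_simps)
  \<comment> \<open>The remaining multiple of P drops out of the final pairing, because P is
    orthogonal under \<open>pmetric\<close> to the tangent vectors of the cone.\<close>
  have 2: "DP u ?c = 2 *\<^sub>R (?A ** L ** ?P + ?P ** L ** ?A) - (4 * ((?A \<bullet> L) / ?N)) *\<^sub>R ?P"
    unfolding c(2) metric_gradient(2)[OF u v] 1 E_def by (simp add: algebra_simps flip: scaleR_add_left)
  have t1: "trace (?I ** ?A ** L ** ?A) = trace (?A ** ?I ** ?A ** L)"
    using trace_mul_sym[of "?I ** ?A ** L" ?A] by (simp add: matrix_mul_assoc)
  have t2: "trace (L ** ?A ** ?I ** ?A) = trace (?A ** ?I ** ?A ** L)"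
    using trace_mul_sym[of L "?A ** ?I ** ?A"] by (simp add: matrix_mul_assoc)
  show ?thesis
    unfolding metric_eq_pmetric[OF u c(1) v] 2 pmetric_def inner_qherm[OF L, of "?A ** ?I ** ?A"]
    using P(2) DP_tangent(2)[OF u v] t1 t2
    by (simp add: mm.scaleR_left mm.scaleR_right mm.diff_left mm.diff_right mm.add_left mm.add_right tr_add tr_scale tr_diff
        matrix_mul_assoc matrix_inv_left matrix_inv_right')
qed

text \<open>A tangent vector at \<open>gram z\<close> is twice z X ctranspose z, so the Hessian
  pairs L with 4 times z X^2 ctranspose z, and the sum over a basis is
  \<open>sum_squares_pspace\<close>.\<close>

lemma divergence_gradient:
  assumes z: "z \<in> \<Union>U"
  shows "divergence SUstar_mod_Sp (U, x) (gradient SUstar_mod_Sp (U, x) f) (x (coset z)) =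
    4 * ((real CARD('n + 'n) - 1) / 2 - 1 / real CARD('n + 'n)) * (gram z \<bullet> L)"
proof -
  let ?u = "x (coset z)" and ?k = "(real CARD('n + 'n) - 1) / 2 - 1 / real CARD('n + 'n)"
  have u: "?u \<in> x ` U" by (rule xZ[OF z])
  obtain B where B: "orthonormal_basis inner (Theta z ` pspace) (Theta z ` B)" "inj_on (Theta z) B" "B \<subseteq> pspace" "finite B"
    "\<And>h. metric_trace (quotient_metric (U, x) ?u) pspace h = (\<Sum>b\<in>B. h b b :: real)"
    using metric_trace_Theta[OF z subspace_pspace order_refl] by blast
  have d: "det z \<noteq> 0" "det (ctranspose z) \<noteq> 0" using Z(1)[OF z] by (simp_all add: SUstar_det det_ctranspose)
  have "divergence SUstar_mod_Sp (U, x) (gradient SUstar_mod_Sp (U, x) f) ?u = (\<Sum>b\<in>B. (DP ?u b ** matrix_inv (Pc ?u) ** DP ?u b) \<bullet> L)"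
    unfolding divergence_def metric_simps B(5) using hessian_diagonal[OF u] B(3) by (intro sum.cong) auto
  also have "\<dots> = (\<Sum>b\<in>B. (4 *\<^sub>R (z ** (Theta z b ** Theta z b) ** ctranspose z)) \<bullet> L)"
  proof (intro sum.cong refl arg_cong[where f="\<lambda>A. A \<bullet> L"])
    fix b assume "b \<in> B"
    then have "b \<in> pspace" using B by blast
    then show "DP ?u b ** matrix_inv (Pc ?u) ** DP ?u b = 4 *\<^sub>R (z ** (Theta z b ** Theta z b) ** ctranspose z)"
      unfolding Theta(3)[OF z \<open>b \<in> pspace\<close>] Pc_x[OF z] matrix_inv_gram[OF d(1)]
      using d by (simp add: mm.scaleR_left mm.scaleR_right matrix_mul_assoc matrix_inv_right' matrix_inv_left')
  qed
  also have "\<dots> = (4 *\<^sub>R (z ** (\<Sum>b\<in>B. Theta z b ** Theta z b) ** ctranspose z)) \<bullet> L"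
    by (simp add: mm.sum_left mm.sum_right inner_sum_left scaleR_sum_right)
  also have "(\<Sum>b\<in>B. Theta z b ** Theta z b) = (\<Sum>X\<in>Theta z ` B. X ** X)" using B(2) by (simp add: sum.reindex)
  also have "\<dots> = ?k *\<^sub>R mat 1" by (rule sum_squares_pspace[OF B(1)[unfolded Theta_image[OF z]]])
  also have "(4 *\<^sub>R (z ** (?k *\<^sub>R mat 1) ** ctranspose z)) \<bullet> L = 4 * ?k * (gram z \<bullet> L)"
    by (simp add: mm.scaleR_left mm.scaleR_right gram_def)
  finally show ?thesis .
qed

end

lemma smooth_on_linear_function:
  fixes \<phi> :: "'n cmat set \<Rightarrow> complex"
  assumes \<phi>: "\<And>z. z \<in> SUstar \<Longrightarrow> \<phi> (coset z) = trace (gram z ** L0)"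
  shows "smooth_on (x ` U) (in_chart (U, x) \<phi>)"
proof (rule smooth_onI[OF open_Om])
  show "x ` U \<subseteq> Om" using xU_Om by blast
  show "Cinf Om (\<lambda>u. trace (Pc u ** L0))"
    by (intro Cinf_trace Cinf_matrix_mult open_Om Cinf_Pc Cinf_const)
  fix u assume "u \<in> x ` U"
  then obtain z where z: "z \<in> \<Union>U" "u = x (coset z)" using xU_cases by blast
  then show "trace (Pc u ** L0) = in_chart (U, x) \<phi> u" by (simp add: in_chart_eq[OF z(1)] \<phi>[OF Z(1)[OF z(1)]] Pc_x[OF z(1)])
qed

text \<open>Under \<open>Theta z\<close> the component of a gradient along X is twice the functional
  evaluated at \<open>z ** X ** ctranspose z\<close>. Parseval turns the product of two gradients
  into the sum, and the two factors 2 give the 4.\<close>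

lemma conformality_linear:
  assumes f: "\<And>z. z \<in> SUstar \<Longrightarrow> f (coset z) = gram z \<bullet> L" "L \<in> qherm"
    and g: "\<And>z. z \<in> SUstar \<Longrightarrow> g (coset z) = gram z \<bullet> R" "R \<in> qherm"
    and z: "z \<in> \<Union>U" and B: "orthonormal_basis inner pspace B"
  shows "quotient_metric (U, x) (x (coset z)) (gradient SUstar_mod_Sp (U, x) f (x (coset z))) (gradient SUstar_mod_Sp (U, x) g (x (coset z)))
    = 4 * (\<Sum>X\<in>B. ((z ** X ** ctranspose z) \<bullet> L) * ((z ** X ** ctranspose z) \<bullet> R))"
proof -
  let ?u = "x (coset z)" and ?gf = "gradient SUstar_mod_Sp (U, x) f (x (coset z))" and ?gg = "gradient SUstar_mod_Sp (U, x) g (x (coset z))"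
  have u: "?u \<in> x ` U" by (rule xZ[OF z])
  have p: "?gf \<in> pspace" "?gg \<in> pspace"
    using metric_gradient(1)[OF f u subspace_0[OF subspace_pspace]] metric_gradient(1)[OF g u subspace_0[OF subspace_pspace]] by auto
  have c: "Theta z (gradient SUstar_mod_Sp (U, x) h ?u) \<bullet> X = 2 * ((z ** X ** ctranspose z) \<bullet> S)"
    if h: "\<And>z. z \<in> SUstar \<Longrightarrow> h (coset z) = gram z \<bullet> S" "S \<in> qherm" and X: "X \<in> pspace" for h S X
  proof -
    let ?v = "dx z (z ** X)"
    have v: "?v \<in> pspace" by (rule dx_lift(1)[OF z X])
    have hp: "gradient SUstar_mod_Sp (U, x) h ?u \<in> pspace" by (rule metric_gradient(1)[OF h u v])
    have "Theta z (gradient SUstar_mod_Sp (U, x) h ?u) \<bullet> X = quotient_metric (U, x) ?u (gradient SUstar_mod_Sp (U, x) h ?u) ?v"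
      using metric_eq_Theta[OF z hp v] Theta_dx[OF z X] by simp
    also have "\<dots> = DP ?u ?v \<bullet> S" by (rule metric_gradient(3)[OF h u v])
    finally show ?thesis unfolding dx_lift(2)[OF z X] by simp
  qed
  have BP: "X \<in> pspace" if "X \<in> B" for X using B that by (auto simp: orthonormal_basis_def)
  have "quotient_metric (U, x) ?u ?gf ?gg = Theta z ?gf \<bullet> Theta z ?gg" by (rule metric_eq_Theta[OF z p])
  also have "\<dots> = (\<Sum>X\<in>B. (Theta z ?gf \<bullet> X) * (Theta z ?gg \<bullet> X))"
    using orthonormal_basis_parseval[OF B Theta(1)[OF z p(1)]] by simp
  also have "\<dots> = (\<Sum>X\<in>B. 4 * (((z ** X ** ctranspose z) \<bullet> L) * ((z ** X ** ctranspose z) \<bullet> R)))"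
    by (intro sum.cong refl) (simp add: c[OF f BP] c[OF g BP])
  finally show ?thesis by (simp add: sum_distrib_left)
qed

end

text \<open>Real and imaginary part are real functionals on \<open>qherm\<close> and are therefore
  represented there by inner products. Multiplying \<open>L0\<close> by -i turns the imaginary part
  into a real part.\<close>

lemma trace_form_real_parts:
  fixes L0 :: "'n::finite cmat"
  obtains R1 R2 where "R1 \<in> qherm" "R2 \<in> qherm" "\<And>P. P \<in> qherm \<Longrightarrow> trace (P ** L0) = Complex (P \<bullet> R1) (P \<bullet> R2)"
proof -
  obtain R1 where R1: "R1 \<in> qherm" "\<And>P. P \<in> qherm \<Longrightarrow> P \<bullet> R1 = P \<bullet> ctranspose L0"
    using qherm_representation[of "ctranspose L0"] by blast
  obtain R2 where R2: "R2 \<in> qherm" "\<And>P. P \<in> qherm \<Longrightarrow> P \<bullet> R2 = P \<bullet> ctranspose (mat (- \<i>) ** L0)"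
    using qherm_representation[of "ctranspose (mat (- \<i>) ** L0)"] by blast
  have "trace (P ** L0) = Complex (P \<bullet> R1) (P \<bullet> R2)" if "P \<in> qherm" for P
  proof -
    have "P \<bullet> R2 = Re (trace (mat (- \<i>) ** (P ** L0)))"
      using R2(2)[OF that] by (simp add: inner_matrix matrix_mul_assoc mat_commute)
    then show ?thesis using R1(2)[OF that] by (simp add: inner_matrix trace_mat_mult complex_eq_iff)
  qed
  then show ?thesis using that R1(1) R2(1) by blast
qed

lemma quotient_chart_exists:
  assumes c: "(U, x) \<in> quotient_charts"
  shows "\<exists>Om Pc Om' crd. quotient_chart U x Om Pc Om' crd"
proof (rule chart_parametrization[OF c])
  fix Om Pc Om' crd
  assume "open Om" "Cinf Om Pc" "Om \<inter> pspace = x ` U" "\<And>u. u \<in> Om \<Longrightarrow> Pc u \<in> Pos"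
    "\<And>z. z \<in> \<Union>U \<Longrightarrow> Pc (x (coset z)) = gram z"
    "open Om'" "Cinf Om' crd" "\<And>z. z \<in> \<Union>U \<Longrightarrow> gram z \<in> Om' \<and> crd (gram z) = x (coset z)"
    "\<And>P. P \<in> Om' \<Longrightarrow> P \<in> Pos \<Longrightarrow> \<exists>z\<in>\<Union>U. gram z = P"
  then have "quotient_chart U x Om Pc Om' crd" by (intro quotient_chart.intro c)
  then show ?thesis by blast
qed

lemma chart_at_coset:
  fixes z :: "'n::finite cmat"
  assumes z: "z \<in> SUstar"
  obtains U x Om Pc Om' crd where "chart_at SUstar_mod_Sp (coset z) = (U, x)" "quotient_chart U x Om Pc Om' crd" "z \<in> \<Union>U"
proof -
  have "\<exists>c. c \<in> quotient_charts \<and> coset z \<in> fst c"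
    using gchart_in_quotient_charts z by (intro exI[of _ gchart]) (auto simp: gchart_def)
  from someI_ex[OF this] have c: "chart_at SUstar_mod_Sp (coset z) \<in> quotient_charts" "coset z \<in> fst (chart_at SUstar_mod_Sp (coset z))"
    unfolding chart_at_def SUstar_mod_Sp_def by auto
  obtain U x where Ux: "chart_at SUstar_mod_Sp (coset z) = (U, x)" by fastforce
  then have UC: "(U, x) \<in> quotient_charts" "coset z \<in> U" using c by auto
  then have zU: "z \<in> \<Union>U" using coset_self by blast
  show ?thesis
    using quotient_chart_exists[OF UC(1)] that[OF Ux _ zU] by blast
qed

text \<open>The Laplace equation comes from the scalar sum of squares, the conformality equation
  from rank one through \<open>sum_trace_squared\<close>. The latter is applied to
  \<open>ctranspose z ** L0 ** z\<close>, whose trace is the value of the function at the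
  point.\<close>

theorem linear_eigenfunction:
  fixes \<phi> :: "'n::finite cmat set \<Rightarrow> complex"
  assumes \<phi>: "\<And>z. z \<in> SUstar \<Longrightarrow> \<phi> (coset z) = trace (gram z ** L0)"
    and L0: "\<And>z. z \<in> SUstar \<Longrightarrow> \<exists>c e. ctranspose z ** L0 ** z = outer c e"
  shows "eigenfunction SUstar_mod_Sp \<phi>"
proof -
  obtain R1 R2 where R: "R1 \<in> qherm" "R2 \<in> qherm" "\<And>P. P \<in> qherm \<Longrightarrow> trace (P ** L0) = Complex (P \<bullet> R1) (P \<bullet> R2)"
    using trace_form_real_parts[of L0] by blast
  have gq: "gram z \<in> qherm" if "z \<in> SUstar" for z :: "'n cmat" using PosD(1)[OF gram_Pos[OF that]] .
  have f1: "Re (\<phi> (coset z)) = gram z \<bullet> R1" and f2: "Im (\<phi> (coset z)) = gram z \<bullet> R2" if "z \<in> SUstar" for z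
    using \<phi>[OF that] R(3)[OF gq[OF that]] by auto
  \<comment> \<open>With N = 2n the eigenvalues are 2(n-1)(2n+1)/n for the Laplacian and 2(n-1)/n
    for the conformality operator.\<close>
  let ?k = "4 * ((real CARD('n + 'n) - 1) / 2 - 1 / real CARD('n + 'n))"
  let ?m = "4 * (1/2 - 1 / of_nat CARD('n + 'n)) :: complex"
  have "smooth_function SUstar_mod_Sp \<phi>"
    unfolding smooth_function_def SUstar_mod_Sp_def
  proof (simp, intro ballI)
    fix c :: "('n cmat set, 'n cmat) chart" assume c: "c \<in> quotient_charts"
    obtain U x where Ux: "c = (U, x)" by fastforce
    obtain Om Pc Om' crd where "quotient_chart U x Om Pc Om' crd"
      using quotient_chart_exists c Ux by blast
    then have "smooth_on (x ` U) (in_chart (U, x) \<phi>)"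
      by (rule quotient_chart.smooth_on_linear_function) (rule \<phi>)
    then show "smooth_on (snd c ` fst c) (in_chart c \<phi>)" using Ux by simp
  qed
  moreover have "laplacian SUstar_mod_Sp \<phi> p = of_real ?k * \<phi> p \<and> conformality SUstar_mod_Sp \<phi> \<phi> p = ?m * (\<phi> p)\<^sup>2"
    if p: "p \<in> points SUstar_mod_Sp" for p
  proof -
    obtain z where z: "z \<in> SUstar" "p = coset z" using p by (auto simp: SUstar_mod_Sp_def)
    obtain U x Om Pc Om' crd where c: "chart_at SUstar_mod_Sp (coset z) = (U, x)" "quotient_chart U x Om Pc Om' crd" "z \<in> \<Union>U"
      by (rule chart_at_coset[OF z(1)])
    interpret quotient_chart U x Om Pc Om' crd by (rule c(2))
    have "laplacian_real SUstar_mod_Sp (\<lambda>q. Re (\<phi> q)) p = ?k * (gram z \<bullet> R1)"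
      "laplacian_real SUstar_mod_Sp (\<lambda>q. Im (\<phi> q)) p = ?k * (gram z \<bullet> R2)"
      unfolding laplacian_real_def z(2) c(1) Let_def snd_conv
      by (rule divergence_gradient[OF f1 R(1) c(3)], assumption) (rule divergence_gradient[OF f2 R(2) c(3)], assumption)
    then have l: "laplacian SUstar_mod_Sp \<phi> p = of_real ?k * \<phi> p"
      using f1[OF z(1)] f2[OF z(1)] z(2) by (simp add: laplacian_def complex_eq_iff)
    obtain B where B: "orthonormal_basis inner (pspace :: 'n cmat set) B"
      using orthonormal_basis_exists[OF subspace_pspace] by blast
    let ?s = "\<lambda>L R. \<Sum>X\<in>B. ((z ** X ** ctranspose z) \<bullet> L) * ((z ** X ** ctranspose z) \<bullet> R)"
    note cr = conformality_real_def c(1) z(2) Let_def snd_conv metric_simps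
    have k: "conformality_real SUstar_mod_Sp (\<lambda>q. Re (\<phi> q)) (\<lambda>q. Re (\<phi> q)) p = 4 * ?s R1 R1"
      "conformality_real SUstar_mod_Sp (\<lambda>q. Re (\<phi> q)) (\<lambda>q. Im (\<phi> q)) p = 4 * ?s R1 R2"
      "conformality_real SUstar_mod_Sp (\<lambda>q. Im (\<phi> q)) (\<lambda>q. Re (\<phi> q)) p = 4 * ?s R2 R1"
      "conformality_real SUstar_mod_Sp (\<lambda>q. Im (\<phi> q)) (\<lambda>q. Im (\<phi> q)) p = 4 * ?s R2 R2"
      unfolding cr using conformality_linear[OF f1 R(1) f1 R(1) c(3) B] conformality_linear[OF f1 R(1) f2 R(2) c(3) B]
        conformality_linear[OF f2 R(2) f1 R(1) c(3) B] conformality_linear[OF f2 R(2) f2 R(2) c(3) B] by blast+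
    obtain c' e where M: "ctranspose z ** L0 ** z = outer c' e" using L0[OF z(1)] by blast
    have tX: "trace (ctranspose z ** L0 ** z ** X) = Complex ((z ** X ** ctranspose z) \<bullet> R1) ((z ** X ** ctranspose z) \<bullet> R2)"
      if "X \<in> qherm" for X
    proof -
      have "trace (ctranspose z ** L0 ** z ** X) = trace (z ** X ** ctranspose z ** L0)"
        using trace_mul_sym[of "ctranspose z ** L0" "z ** X"] by (simp add: matrix_mul_assoc)
      then show ?thesis using R(3)[OF qherm_sandwich[OF SUstar_in_quat[OF z(1)] that]] by simp
    qed
    have BP: "X \<in> qherm" if "X \<in> B" for X using B that by (auto simp: orthonormal_basis_def pspace_def)
    have "conformality SUstar_mod_Sp \<phi> \<phi> p = 4 * (\<Sum>X\<in>B. (trace (ctranspose z ** L0 ** z ** X))\<^sup>2)"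
    proof -
      have "(\<Sum>X\<in>B. (trace (ctranspose z ** L0 ** z ** X))\<^sup>2) = (\<Sum>X\<in>B. (Complex ((z ** X ** ctranspose z) \<bullet> R1) ((z ** X ** ctranspose z) \<bullet> R2))\<^sup>2)"
        by (intro sum.cong refl) (simp add: tX BP)
      also have "\<dots> = Complex (?s R1 R1 - ?s R2 R2) (?s R1 R2 + ?s R2 R1)"
        by (simp add: complex_eq_iff power2_eq_square sum_subtractf sum.distrib mult.commute flip: sum_distrib_left)
      finally show ?thesis
        unfolding conformality_def Let_def k by (simp add: complex_eq_iff)
    qed
    also have "\<dots> = ?m * (trace (ctranspose z ** L0 ** z))\<^sup>2" unfolding sum_trace_squared[OF B M] by simp
    also have "trace (ctranspose z ** L0 ** z) = \<phi> p"
      using trace_mul_sym[of "ctranspose z ** L0" z] trace_mul_sym[of "z ** ctranspose z" L0] \<phi>[OF z(1)] z(2)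
      by (simp add: gram_def matrix_mul_assoc)
    finally show ?thesis using l by blast
  qed
  ultimately show ?thesis unfolding eigenfunction_def by blast
qed

section \<open>The zero set of a linear function on the cone\<close>

text \<open>Read off from the relative openness of \<open>cone_domain\<close>: the line is
  normalised by \<open>xi\<close> and then rescaled back.\<close>

lemma posdef_line:
  fixes P A :: "'n::finite cmat"
  assumes P: "P \<in> Pos" and A: "A \<in> qherm"
  obtains e where "e > 0" "\<And>t. \<bar>t\<bar> < e \<Longrightarrow> posdef (P + t *\<^sub>R A)"
proof -
  obtain T :: "'n cmat set" where T: "open T" "cone_domain = pspace \<inter> T" using openin_cone openin_open by blast
  let ?V = "{B :: 'n cmat. Re (trace B) > 0}"
  have "continuous_on ?V xi" by (intro Cinf_continuous[OF Cinf_xi] open_trace_pos Cinf_ident) simp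
  then have "open (?V \<inter> xi -` T)" by (rule continuous_open_preimage[OF _ open_trace_pos T(1)])
  then have "open ((\<lambda>t. P + t *\<^sub>R A) -` (?V \<inter> xi -` T))" by (intro open_vimage continuous_intros)
  moreover have "xi P \<in> T" using xi_cone[OF P] unfolding T(2) by blast
  then have "0 \<in> (\<lambda>t. P + t *\<^sub>R A) -` (?V \<inter> xi -` T)" using PosD(5)[OF P] by simp
  ultimately obtain e where e: "e > 0" "ball 0 e \<subseteq> (\<lambda>t. P + t *\<^sub>R A) -` (?V \<inter> xi -` T)"
    using open_contains_ball by blast
  have "posdef (P + t *\<^sub>R A)" if t: "\<bar>t\<bar> < e" for t
  proof -
    let ?B = "P + t *\<^sub>R A"
    have B: "Re (trace ?B) > 0" "xi ?B \<in> T" using e(2) t by (auto simp: subset_iff)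
    have "?B \<in> qherm" by (intro subspace_add[OF subspace_qherm] subspace_scale[OF subspace_qherm] A PosD(1)[OF P])
    then have "xi ?B \<in> cone_domain" using T(2) B xi_pspace by blast
    then have "posdef (mat 1 + xi ?B)" by (simp add: cone_domain_def)
    moreover define c where "c = real CARD('n + 'n) / Re (trace ?B)"
    ultimately have pc: "posdef (c *\<^sub>R ?B)" unfolding mat_1_add_xi by simp
    have c: "c > 0" unfolding c_def by (intro divide_pos_pos CARD_pos B)
    have "posdef (inverse c *\<^sub>R (c *\<^sub>R ?B))" by (rule posdef_scaleR[OF _ pc]) (use c in simp)
    then show ?thesis using c by simp
  qed
  then show ?thesis using that e(1) by blast
qed

lemma Pos_line:
  fixes P A :: "'n::finite cmat"
  assumes P: "P \<in> Pos" and A: "A \<in> qherm" "trace (matrix_inv P ** A) = 0"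
  obtains e where "e > 0" "\<And>t. \<bar>t\<bar> < e \<Longrightarrow> unimod (P + t *\<^sub>R A) \<in> Pos"
    "((\<lambda>t. unimod (P + t *\<^sub>R A)) has_vector_derivative A) (at 0)"
proof -
  obtain e where e: "e > 0" "\<And>t. \<bar>t\<bar> < e \<Longrightarrow> posdef (P + t *\<^sub>R A)" using posdef_line[OF P A(1)] by blast
  have "unimod (P + t *\<^sub>R A) \<in> Pos" if t: "\<bar>t\<bar> < e" for t
  proof -
    have q: "P + t *\<^sub>R A \<in> qherm" by (intro subspace_add[OF subspace_qherm] subspace_scale[OF subspace_qherm] A PosD(1)[OF P])
    have d: "Re (det (P + t *\<^sub>R A)) > 0" by (rule posdef_det_pos[OF q e(2)[OF t]])
    have "unimod (P + t *\<^sub>R A) \<in> qherm" unfolding unimod_def by (rule subspace_scale[OF subspace_qherm q])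
    moreover have "posdef (unimod (P + t *\<^sub>R A))" unfolding unimod_def by (rule posdef_scaleR[OF _ e(2)[OF t]]) (use d in simp)
    ultimately show ?thesis unfolding Pos_def using det_unimod[OF qherm_quat[OF q] d] by blast
  qed
  moreover have "((\<lambda>t. unimod (P + t *\<^sub>R A)) has_vector_derivative A) (at 0)"
    by (rule unimod_curve(1)[OF PosD(3)[OF P]]) (simp add: A)
  ultimately show ?thesis using that e(1) by blast
qed

text \<open>The added assumption makes 0 a regular value: at every zero the sandwiched form has rank
  one, and its projection to the complexified model space does not vanish.\<close>

locale zero_set_chart = quotient_chart U x Om Pc Om' crd
  for U :: "'n::finite cmat set set" and x Om Pc Om' crd +
  fixes L0 :: "'n cmat"
  assumes nondegenerate: "\<And>z. z \<in> SUstar \<Longrightarrow> trace (gram z ** L0) = 0 \<Longrightarrow>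
      \<exists>c e. ctranspose z ** L0 ** z = outer c e \<and> pproj (outer c e) \<noteq> 0"
begin

definition slice :: "'n cmat set" where
  "slice = {u \<in> x ` U. trace (Pc u ** L0) = 0}"

definition slice_tangent :: "'n cmat \<Rightarrow> 'n cmat set" where
  "slice_tangent u = {v \<in> pspace. trace (DP u v ** L0) = 0}"

lemma slice_xU: "u \<in> slice \<Longrightarrow> u \<in> x ` U" by (simp add: slice_def)

lemma slice_tangent_pspace: "v \<in> slice_tangent u \<Longrightarrow> v \<in> pspace" by (simp add: slice_tangent_def)

lemma subspace_slice_tangent: "u \<in> x ` U \<Longrightarrow> subspace (slice_tangent u)"
  using linear_DP[OF xU_Om] subspace_pspace unfolding subspace_def slice_tangent_def
  by (auto simp: linear_0 linear_add linear_scale mm.zero_left mm.add_left mm.scaleR_left tr_0 tr_add tr_scale)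

text \<open>For the inclusion from right to left, the line through \<open>Pc u\<close> stays in the
  linear zero set, and rescaling to determinant one neither leaves that set nor changes the
  velocity. The curve is brought back to coordinates by \<open>crd\<close>.\<close>

lemma tangent_space_slice:
  assumes u: "u \<in> slice" shows "tangent_space slice u = slice_tangent u"
proof (intro equalityI subsetI)
  fix v assume "v \<in> tangent_space slice u"
  then obtain \<gamma> where \<gamma>: "\<And>t::real. \<gamma> t \<in> slice" "\<gamma> 0 = u" "(\<gamma> has_vector_derivative v) (at 0)"
    unfolding tangent_space_def by blast
  have v: "v \<in> pspace"
    by (rule vector_derivative_in_subspace[OF subspace_pspace _ \<gamma>(3)]) (rule xU_pspace[OF slice_xU[OF \<gamma>(1)]])
  have "((\<lambda>t. Pc (\<gamma> t)) has_vector_derivative DP u v) (at 0)"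
    by (rule has_derivative_curve[OF Pc_has_derivative[OF xU_Om[OF slice_xU[OF u]]] _ \<gamma>(2,3)]) simp
  from bounded_linear.has_vector_derivative[OF bounded_linear_trace_mult this]
  have d: "((\<lambda>t. trace (Pc (\<gamma> t) ** L0)) has_vector_derivative trace (DP u v ** L0)) (at 0)" .
  have c: "(\<lambda>t. trace (Pc (\<gamma> t) ** L0)) = (\<lambda>t. 0)" using \<gamma>(1) by (simp add: slice_def)
  have "trace (DP u v ** L0) = 0"
    by (rule vector_derivative_unique_at[OF d[unfolded c] has_vector_derivative_const])
  then show "v \<in> slice_tangent u" using v by (simp add: slice_tangent_def)
next
  fix v assume v: "v \<in> slice_tangent u"
  have ux: "u \<in> x ` U" by (rule slice_xU[OF u])
  have vp: "v \<in> pspace" by (rule slice_tangent_pspace[OF v])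
  have PP: "Pc u \<in> Pos" by (rule Pc_Pos[OF xU_Om[OF ux]])
  let ?A = "DP u v"
  define Q where "Q t = unimod (Pc u + t *\<^sub>R ?A)" for t
  obtain e where e: "e > 0" "\<And>t. \<bar>t\<bar> < e \<Longrightarrow> Q t \<in> Pos" "(Q has_vector_derivative ?A) (at 0)"
    using Pos_line[OF PP DP_tangent[OF ux vp]] unfolding Q_def by blast
  have Q0: "Q 0 = Pc u" by (simp add: Q_def unimod_eq PosD(3)[OF PP])
  have cu: "Pc u \<in> Om'" "crd (Pc u) = u" using crd_derivative[OF ux vp] by auto
  obtain d where d: "d > 0" "ball (Pc u) d \<subseteq> Om'" using open_Om' cu(1) open_contains_ball by blast
  obtain e' where e': "e' > 0" "\<And>t. dist t 0 < e' \<Longrightarrow> dist (Q t) (Q 0) < d"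
    using has_vector_derivative_continuous[OF e(3)] d(1) unfolding continuous_at_eps_delta by blast
  have QS: "crd (Q t) \<in> slice" if t: "\<bar>t\<bar> < min e e'" for t
  proof -
    have "dist (Q t) (Pc u) < d" using e'(2)[of t] t Q0 by (simp add: dist_real_def)
    then have Qt: "Q t \<in> Om'" using d(2) by (auto simp: dist_commute)
    have "Q t \<in> Pos" using e(2)[of t] t by simp
    then obtain z where z: "z \<in> \<Union>U" "gram z = Q t" using crd_dom[OF Qt] by blast
    have "trace (Q t ** L0) = 0"
      using u v unfolding Q_def unimod_def
      by (simp add: mm.scaleR_left mm.add_left tr_scale tr_add slice_def slice_tangent_def)
    then show ?thesis using crd_gram[OF z(1)] xZ[OF z(1)] Pc_x[OF z(1)] z(2) by (simp add: slice_def)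
  qed
  have "((\<lambda>t. crd (Q t)) has_vector_derivative frechet_derivative crd (at (Pc u)) ?A) (at 0)"
    by (rule has_derivative_curve[OF Cinf_has_derivative[OF Cinf_crd cu(1)] _ Q0 e(3)]) simp
  then have "((\<lambda>t. crd (Q t)) has_vector_derivative v) (at 0)" using crd_derivative(1)[OF ux vp] by simp
  then show "v \<in> tangent_space slice u"
    using QS e(1) e'(1) cu(2) Q0 by (intro tangent_spaceI[of "min e e'" "\<lambda>t. crd (Q t)"]) auto
qed

text \<open>Moves the tangent space of the slice to the model space, in the shape of the kernel that
  \<open>sum_squares_kernel\<close> treats.\<close>

lemma Theta_slice_tangent:
  assumes z: "z \<in> \<Union>U"
  shows "Theta z ` slice_tangent (x (coset z)) = {X \<in> pspace. trace (ctranspose z ** L0 ** z ** X) = 0}"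
proof -
  have t: "trace (DP (x (coset z)) v ** L0) = 2 *\<^sub>R trace (ctranspose z ** L0 ** z ** Theta z v)" if "v \<in> pspace" for v
    unfolding Theta(3)[OF z that] using trace_mul_sym[of "ctranspose z ** L0" "z ** Theta z v"]
    by (simp add: mm.scaleR_left tr_scale matrix_mul_assoc)
  show ?thesis
  proof (intro equalityI subsetI)
    fix X assume "X \<in> Theta z ` slice_tangent (x (coset z))"
    then show "X \<in> {X \<in> pspace. trace (ctranspose z ** L0 ** z ** X) = 0}"
      using t Theta(1)[OF z] by (auto simp: slice_tangent_def)
  next
    fix X assume X: "X \<in> {X \<in> pspace. trace (ctranspose z ** L0 ** z ** X) = 0}"
    then have v: "dx z (z ** X) \<in> pspace" "Theta z (dx z (z ** X)) = X" using dx_lift(1)[OF z] Theta_dx[OF z] by auto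
    then have "dx z (z ** X) \<in> slice_tangent (x (coset z))" using t[OF v(1)] X by (simp add: slice_tangent_def)
    then show "X \<in> Theta z ` slice_tangent (x (coset z))" using v(2) by (metis imageI)
  qed
qed

text \<open>A vector that is both normal and tangent vanishes. Normal vectors are thus determined by
  the trace of their image against \<open>L0\<close>, which is how the second fundamental form and
  the mean curvature are identified.\<close>

lemma normal_unique:
  assumes u: "u \<in> x ` U" and n: "n \<in> pspace" "\<And>y. y \<in> slice_tangent u \<Longrightarrow> quotient_metric (U, x) u n y = 0"
    and t: "trace (DP u n ** L0) = 0"
  shows "n = 0"
proof -
  obtain z where z: "z \<in> \<Union>U" "u = x (coset z)" using xU_cases[OF u] by blast
  have "n \<in> slice_tangent u" using n t by (simp add: slice_tangent_def)
  then have "Theta z n \<bullet> Theta z n = 0" using n metric_eq_Theta[OF z(1) n(1) n(1)] z(2) by simp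
  then show ?thesis using Theta_zero[OF z(1) n(1)] by simp
qed

text \<open>The function whose zero set is considered is linear in \<open>P\<close>. Along a tangent field its second
  derivative therefore only sees the Christoffel correction \<open>half_bracket\<close>, and this determines
  the normal part of the covariant derivative.\<close>

lemma slice_cov_deriv:
  assumes u: "u \<in> slice" and V: "open V" "u \<in> V" and Y: "smooth_on (V \<inter> slice) Y"
    and YT: "\<And>q. q \<in> V \<inter> slice \<Longrightarrow> Y q \<in> tangent_space slice q" and v: "v \<in> slice_tangent u"
  shows "cov_deriv SUstar_mod_Sp (U, x) slice Y u v \<in> pspace"
    "trace (DP u (cov_deriv SUstar_mod_Sp (U, x) slice Y u v) ** L0) = - trace (half_bracket (Pc u) (DP u v) (DP u (Y u)) ** L0)"
proof -
  have op: "openin (top_of_set slice) (V \<inter> slice)" by (subst Int_commute) (rule openin_open_Int[OF V(1)])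
  have uV: "u \<in> V \<inter> slice" using u V by blast
  have uO: "u \<in> Om" by (rule xU_Om[OF slice_xU[OF u]])
  have YT': "Y q \<in> slice_tangent q" if "q \<in> V \<inter> slice" for q using YT[OF that] tangent_space_slice that by blast
  obtain D where D: "(Y has_derivative D) (at u within slice)"
    using smooth_on_has_derivative[OF Y uV] at_within_openin[OF op uV] by auto
  have "v \<in> tangent_space (V \<inter> slice) u" using tangent_space_openin[OF op uV] tangent_space_slice[OF u] v by simp
  then obtain \<gamma> where \<gamma>: "\<And>t::real. \<gamma> t \<in> V \<inter> slice" "\<gamma> 0 = u" "(\<gamma> has_vector_derivative v) (at 0)"
    unfolding tangent_space_def by blast
  have \<gamma>s: "\<gamma> t \<in> slice" "\<gamma> t \<in> x ` U" for t using \<gamma>(1)[of t] slice_xU by auto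
  have dY: "((\<lambda>t. Y (\<gamma> t)) has_vector_derivative D v) (at 0)" by (rule has_derivative_curve[OF D \<gamma>s(1) \<gamma>(2,3)])
  define E where "E = D2P u v (Y u) + DP u (D v)"
  have E: "((\<lambda>t. DP (\<gamma> t) (Y (\<gamma> t))) has_vector_derivative E) (at 0)"
    unfolding E_def by (rule DP_field_curve[OF uO xU_Om[OF \<gamma>s(2)] \<gamma>(2,3) dY])
  note cd = DP_cov_deriv[OF D \<gamma>s(1) \<gamma>s(2) \<gamma>(2,3) slice_tangent_pspace[OF YT'[OF \<gamma>(1)]] E]
  show "cov_deriv SUstar_mod_Sp (U, x) slice Y u v \<in> pspace" by (rule cd(1))
  have d: "((\<lambda>t. trace (DP (\<gamma> t) (Y (\<gamma> t)) ** L0)) has_vector_derivative trace (E ** L0)) (at 0)"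
    by (rule bounded_linear.has_vector_derivative[OF bounded_linear_trace_mult E])
  have c: "(\<lambda>t. trace (DP (\<gamma> t) (Y (\<gamma> t)) ** L0)) = (\<lambda>t. 0)"
    using YT'[OF \<gamma>(1)] by (simp add: slice_tangent_def)
  have "trace (E ** L0) = 0"
    by (rule vector_derivative_unique_at[OF d[unfolded c] has_vector_derivative_const])
  then show "trace (DP u (cov_deriv SUstar_mod_Sp (U, x) slice Y u v) ** L0) = - trace (half_bracket (Pc u) (DP u v) (DP u (Y u)) ** L0)"
    unfolding cd(2) by (simp add: mm.diff_left tr_diff)
qed

text \<open>The second fundamental form calls for an extension of w to a tangent field. The constant
  matrix \<open>W0\<close> nearly serves: subtracting a multiple of P makes it tangent to
  determinant one, and this keeps it tangent to the slice because \<open>trace (P ** L0)\<close> is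
  zero there.\<close>

lemma tangent_field_exists:
  assumes u: "u \<in> slice" and w: "w \<in> slice_tangent u"
  obtains Y where "smooth_on slice Y" "\<And>q. q \<in> slice \<Longrightarrow> Y q \<in> tangent_space slice q" "Y u = w"
proof -
  let ?N = "real CARD('n + 'n)"
  define W0 where "W0 = DP u w"
  have wp: "w \<in> pspace" by (rule slice_tangent_pspace[OF w])
  have W0: "W0 \<in> qherm" "trace (matrix_inv (Pc u) ** W0) = 0" "trace (W0 ** L0) = 0"
    using DP_tangent[OF slice_xU[OF u] wp] w by (auto simp: W0_def slice_tangent_def)
  define W where "W P = W0 - (Re (trace (matrix_inv P ** W0)) / ?N) *\<^sub>R P" for P
  define Y where "Y q = frechet_derivative crd (at (Pc q)) (W (Pc q))" for q
  let ?V = "Om \<inter> Pc -` Om'"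
  have V: "open ?V" by (rule continuous_open_preimage[OF Cinf_continuous[OF Cinf_Pc] open_Om open_Om'])
  have CP: "Cinf ?V Pc" by (rule Cinf_subset[OF Cinf_Pc]) auto
  have "Cinf ?V (\<lambda>q. W (Pc q))"
    unfolding W_def divide_inverse
    by (intro Cinf_diff Cinf_scaleR[OF V] Cinf_const CP V Cinf_bilinear[OF V bounded_bilinear_mult] Cinf_Re Cinf_trace Cinf_matrix_mult Cinf_matrix_inv)
      (use Pc_det in auto)
  then have CY: "Cinf ?V Y" unfolding Y_def by (intro Cinf_frechet_apply[OF V open_Om' Cinf_crd CP]) auto
  have sV: "slice \<subseteq> ?V"
    using slice_xU xU_Om crd_derivative(2)[OF _ wp] by blast
  have "smooth_on slice Y" by (rule smooth_onI[OF V sV CY]) simp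
  moreover have "Y q \<in> tangent_space slice q" if q: "q \<in> slice" for q
  proof -
    have qx: "q \<in> x ` U" by (rule slice_xU[OF q])
    have P: "Pc q \<in> qherm" "det (Pc q) \<noteq> 0" using PosD[OF Pc_Pos[OF xU_Om[OF qx]]] by auto
    have Wq: "W (Pc q) \<in> qherm" unfolding W_def by (intro subspace_diff[OF subspace_qherm] subspace_scale[OF subspace_qherm] W0 P)
    have "trace (matrix_inv (Pc q) ** W0) = of_real (Re (trace (matrix_inv (Pc q) ** W0)))"
      using qherm_trace_mult[OF qherm_matrix_inv[OF P] W0(1)] by simp
    then have Wt: "trace (matrix_inv (Pc q) ** W (Pc q)) = 0"
      using CARD_pos[where 'm="'n + 'n"] unfolding W_def
      by (simp add: mm.diff_right mm.scaleR_right tr_diff tr_scale matrix_inv_left[OF P(2)] trace_mat) (simp add: scaleR_conv_of_real)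
    obtain v where v: "v \<in> pspace" "DP q v = W (Pc q)" using DP_surj[OF qx Wq Wt] by blast
    have "Y q = v" unfolding Y_def v(2)[symmetric] by (rule crd_derivative(1)[OF qx v(1)])
    moreover have "trace (W (Pc q) ** L0) = 0"
      unfolding W_def using W0(3) q by (simp add: mm.diff_left mm.scaleR_left tr_diff tr_scale slice_def)
    ultimately show ?thesis unfolding tangent_space_slice[OF q] using v by (simp add: slice_tangent_def)
  qed
  moreover have "Y u = w"
    unfolding Y_def W_def W0(2) unfolding W0_def using crd_derivative(1)[OF slice_xU[OF u] wp] by simp
  ultimately show ?thesis using that by blast
qed

lemma normal_part:
  assumes u: "u \<in> x ` U" and k: "k \<in> pspace"
  obtains n where "n \<in> pspace" "\<And>y. y \<in> slice_tangent u \<Longrightarrow> quotient_metric (U, x) u n y = 0" "k - n \<in> slice_tangent u"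
proof -
  obtain z where z: "z \<in> \<Union>U" "u = x (coset z)" using xU_cases[OF u] by blast
  let ?F = "Theta z ` slice_tangent u"
  have sub: "subspace (slice_tangent u)" by (rule subspace_slice_tangent[OF u])
  obtain \<pi> :: "'n cmat \<Rightarrow> 'n cmat" where \<pi>: "\<And>y. \<pi> y \<in> ?F" "\<And>y s. s \<in> ?F \<Longrightarrow> (y - \<pi> y) \<bullet> s = 0"
    using orthogonal_projection[OF linear_subspace_image[OF linear_Theta[OF z(1)] sub]] by metis
  obtain t where t: "t \<in> slice_tangent u" "\<pi> (Theta z k) = Theta z t" using \<pi>(1)[of "Theta z k"] by blast
  have n: "k - t \<in> pspace" by (rule subspace_diff[OF subspace_pspace k slice_tangent_pspace[OF t(1)]])
  have "quotient_metric (U, x) u (k - t) y = 0" if y: "y \<in> slice_tangent u" for y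
  proof -
    have "quotient_metric (U, x) u (k - t) y = Theta z (k - t) \<bullet> Theta z y"
      unfolding z(2) by (rule metric_eq_Theta[OF z(1) n slice_tangent_pspace[OF y]])
    also have "Theta z (k - t) = Theta z k - \<pi> (Theta z k)" unfolding t(2) by (rule linear_diff[OF linear_Theta[OF z(1)]])
    finally show ?thesis using \<pi>(2) y by simp
  qed
  then show ?thesis using that[of "k - t"] n t(1) by simp
qed

text \<open>The \<open>THE\<close> of the definition is justified by \<open>slice_cov_deriv\<close>:
  the trace of the normal part against \<open>L0\<close> depends on v and w and not on the chosen
  field, and by \<open>normal_unique\<close> this fixes the normal part.\<close>

lemma second_fundamental_form_eq:
  assumes u: "u \<in> slice" and vw: "v \<in> slice_tangent u" "w \<in> slice_tangent u"
    and S: "x ` (U \<inter> S) = slice" and c: "chart_at SUstar_mod_Sp p = (U, x)" and p: "x p = u"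
  defines "n \<equiv> second_fundamental_form SUstar_mod_Sp S p v w"
  shows "n \<in> pspace" "\<And>y. y \<in> slice_tangent u \<Longrightarrow> quotient_metric (U, x) u n y = 0"
    "trace (DP u n ** L0) = - trace (half_bracket (Pc u) (DP u v) (DP u w) ** L0)"
proof -
  let ?cov = "\<lambda>Y. cov_deriv SUstar_mod_Sp (U, x) slice Y u v"
  let ?N = "\<lambda>n. n \<in> pspace \<and> (\<forall>y\<in>slice_tangent u. quotient_metric (U, x) u n y = 0) \<and>
        (\<exists>V Y. open V \<and> u \<in> V \<and> smooth_on (V \<inter> slice) Y \<and>
           (\<forall>q\<in>V \<inter> slice. Y q \<in> tangent_space slice q) \<and> Y u = w \<and> ?cov Y - n \<in> slice_tangent u)"
  have ux: "u \<in> x ` U" by (rule slice_xU[OF u])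
  have tr: "trace (DP u n ** L0) = - trace (half_bracket (Pc u) (DP u v) (DP u w) ** L0)" if n: "?N n" for n
  proof -
    obtain V Y where Y: "open V" "u \<in> V" "smooth_on (V \<inter> slice) Y" "\<And>q. q \<in> V \<inter> slice \<Longrightarrow> Y q \<in> tangent_space slice q"
      "Y u = w" "?cov Y - n \<in> slice_tangent u" using n by blast
    note sc = slice_cov_deriv[OF u Y(1-4) vw(1)]
    have "trace (DP u (?cov Y) ** L0) - trace (DP u n ** L0) = 0"
      using Y(6) linear_diff[OF linear_DP[OF xU_Om[OF ux]], of "?cov Y" n]
      by (simp add: slice_tangent_def mm.diff_left tr_diff)
    then show ?thesis using sc(2) Y(5) by simp
  qed
  obtain Y where Y: "smooth_on slice Y" "\<And>q. q \<in> slice \<Longrightarrow> Y q \<in> tangent_space slice q" "Y u = w"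
    using tangent_field_exists[OF u vw(2)] by blast
  have "?cov Y \<in> pspace" by (rule slice_cov_deriv(1)[OF u open_UNIV _ _ _ vw(1)]) (use Y in auto)
  then obtain n0 where n0: "n0 \<in> pspace" "\<And>y. y \<in> slice_tangent u \<Longrightarrow> quotient_metric (U, x) u n0 y = 0" "?cov Y - n0 \<in> slice_tangent u"
    using normal_part[OF ux] by blast
  have N0: "?N n0" using n0 Y by (intro conjI exI[of _ UNIV] exI[of _ Y]) auto
  have the: "(THE n. ?N n) = n0"
  proof (rule the_equality)
    show "?N n0" by (rule N0)
    fix k assume k: "?N k"
    have kp: "k \<in> pspace" using k by blast
    have dp: "k - n0 \<in> pspace" by (rule subspace_diff[OF subspace_pspace kp n0(1)])
    have "k - n0 = 0"
    proof (rule normal_unique[OF ux dp])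
      fix y assume y: "y \<in> slice_tangent u"
      obtain z where z: "z \<in> \<Union>U" "u = x (coset z)" using xU_cases[OF ux] by blast
      note m = metric_eq_Theta[OF z(1) _ slice_tangent_pspace[OF y], folded z(2)]
      have "quotient_metric (U, x) u (k - n0) y = quotient_metric (U, x) u k y - quotient_metric (U, x) u n0 y"
        unfolding m[OF dp] m[OF kp] m[OF n0(1)] linear_diff[OF linear_Theta[OF z(1)]] by (rule inner_diff_left)
      then show "quotient_metric (U, x) u (k - n0) y = 0" using k n0(2)[OF y] y by simp
    next
      show "trace (DP u (k - n0) ** L0) = 0"
        unfolding linear_diff[OF linear_DP[OF xU_Om[OF ux]]] using tr[OF k] tr[OF N0] by (simp add: mm.diff_left tr_diff)
    qed
    then show "k = n0" by simp
  qed
  have "n = n0"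
    unfolding n_def second_fundamental_form_def c Let_def fst_conv snd_conv S p metric_simps tangent_space_slice[OF u] by (rule the)
  then show "n \<in> pspace" "\<And>y. y \<in> slice_tangent u \<Longrightarrow> quotient_metric (U, x) u n y = 0"
    "trace (DP u n ** L0) = - trace (half_bracket (Pc u) (DP u v) (DP u w) ** L0)"
    using n0 tr[OF N0] by auto
qed

text \<open>The mean curvature vector is normal, so by \<open>normal_unique\<close> its trace
  against \<open>L0\<close> decides. That trace is -4 times the sum of squares of an orthonormal
  basis of the kernel, paired with the sandwiched form, and \<open>sum_squares_kernel\<close> makes
  it vanish.\<close>

lemma mean_curvature_zero:
  assumes z: "z \<in> \<Union>U" "trace (gram z ** L0) = 0"
    and S: "x ` (U \<inter> S) = slice" and c: "chart_at SUstar_mod_Sp (coset z) = (U, x)"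
  shows "mean_curvature SUstar_mod_Sp S (coset z) = 0"
proof -
  let ?u = "x (coset z)" and ?B = "second_fundamental_form SUstar_mod_Sp S (coset z)"
  have ux: "?u \<in> x ` U" by (rule xZ[OF z(1)])
  have u: "?u \<in> slice" using ux z Pc_x[OF z(1)] by (simp add: slice_def)
  have sub: "slice_tangent ?u \<subseteq> pspace" using slice_tangent_pspace by blast
  obtain B where B: "orthonormal_basis inner (Theta z ` slice_tangent ?u) (Theta z ` B)" "inj_on (Theta z) B" "B \<subseteq> slice_tangent ?u" "finite B"
    "\<And>h. metric_trace (quotient_metric (U, x) ?u) (slice_tangent ?u) h = (\<Sum>b\<in>B. h b b :: 'n cmat)"
    using metric_trace_Theta[OF z(1) subspace_slice_tangent[OF ux] sub] by blast
  note sff = second_fundamental_form_eq[OF u _ _ S c refl]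
  have "mean_curvature SUstar_mod_Sp S (coset z) = (\<Sum>b\<in>B. ?B b b)"
    unfolding mean_curvature_def c Let_def fst_conv snd_conv S metric_simps tangent_space_slice[OF u] by (rule B(5))
  moreover have "(\<Sum>b\<in>B. ?B b b) = 0"
  proof (rule normal_unique[OF ux])
    have bT: "b \<in> slice_tangent ?u" if "b \<in> B" for b using that B(3) by blast
    show H: "(\<Sum>b\<in>B. ?B b b) \<in> pspace" using sff(1) bT by (intro subspace_sum[OF subspace_pspace]) auto
    show "quotient_metric (U, x) ?u (\<Sum>b\<in>B. ?B b b) y = 0" if y: "y \<in> slice_tangent ?u" for y
    proof -
      note m = metric_eq_Theta[OF z(1) _ slice_tangent_pspace[OF y]]
      have "quotient_metric (U, x) ?u (\<Sum>b\<in>B. ?B b b) y = (\<Sum>b\<in>B. Theta z (?B b b) \<bullet> Theta z y)"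
        unfolding m[OF H] linear_sum[OF linear_Theta[OF z(1)]] by (rule inner_sum_left)
      also have "\<dots> = (\<Sum>b\<in>B. quotient_metric (U, x) ?u (?B b b) y)"
        using m sff(1) bT by (intro sum.cong) auto
      also have "\<dots> = 0" using sff(2)[OF bT bT y] by simp
      finally show ?thesis .
    qed
    have d: "det z \<noteq> 0" "det (ctranspose z) \<noteq> 0" using Z(1)[OF z(1)] by (simp_all add: SUstar_det det_ctranspose)
    let ?M = "ctranspose z ** L0 ** z"
    have hb: "trace (half_bracket (Pc ?u) (DP ?u b) (DP ?u b) ** L0) = 4 *\<^sub>R trace (?M ** (Theta z b ** Theta z b))" if b: "b \<in> B" for b
    proof -
      have "half_bracket (Pc ?u) (DP ?u b) (DP ?u b) = 4 *\<^sub>R (z ** (Theta z b ** Theta z b) ** ctranspose z)"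
        unfolding half_bracket_def Theta(3)[OF z(1) slice_tangent_pspace[OF bT[OF b]]] Pc_x[OF z(1)] matrix_inv_gram[OF d(1)]
        using d by (simp add: mm.scaleR_left mm.scaleR_right matrix_mul_assoc matrix_inv_right' matrix_inv_left' scaleR_2[symmetric])
      moreover have "trace (z ** (Theta z b ** Theta z b) ** ctranspose z ** L0) = trace (?M ** (Theta z b ** Theta z b))"
        using trace_mul_sym[of "z ** (Theta z b ** Theta z b)" "ctranspose z ** L0"] by (simp add: matrix_mul_assoc)
      ultimately show ?thesis by (simp add: mm.scaleR_left tr_scale)
    qed
    obtain c' e where M: "?M = outer c' e" "pproj (outer c' e) \<noteq> 0" using nondegenerate[OF Z(1)[OF z(1)] z(2)] by blast
    have tM: "trace ?M = 0" using trace_mul_sym[of "ctranspose z ** L0" z] trace_mul_sym[of "gram z" L0] trace_mul_sym[of "z ** ctranspose z" L0] z(2)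
      by (simp add: gram_def matrix_mul_assoc)
    have "(\<Sum>X\<in>Theta z ` B. trace (?M ** (X ** X))) = 0"
      by (rule sum_squares_kernel[OF M(1) tM]) (use M B(1) Theta_slice_tangent[OF z(1)] in simp_all)
    then have s0: "(\<Sum>b\<in>B. trace (?M ** (Theta z b ** Theta z b))) = 0" using B(2) by (simp add: sum.reindex)
    have "trace (DP ?u (\<Sum>b\<in>B. ?B b b) ** L0) = (\<Sum>b\<in>B. trace (DP ?u (?B b b) ** L0))"
      by (simp add: linear_sum[OF linear_DP[OF xU_Om[OF ux]]] mm.sum_left tr_sum)
    also have "\<dots> = (\<Sum>b\<in>B. - (4 *\<^sub>R trace (?M ** (Theta z b ** Theta z b))))"
      by (intro sum.cong refl) (simp only: sff(3)[OF bT bT] hb)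
    also have "\<dots> = 0" using s0 by (simp add: sum_negf flip: scaleR_sum_right)
    finally show "trace (DP ?u (\<Sum>b\<in>B. ?B b b) ** L0) = 0" .
  qed
  ultimately show ?thesis by simp
qed

end

text \<open>The mean curvature is computed in whatever chart \<open>chart_at\<close> selects,
  whereas \<open>gchart\<close> is a slice chart at every point: since \<open>trace L0 = 0\<close>,
  the function is proportional to its linear counterpart on \<open>xi\<close>, so the zero set
  becomes a linear slice.\<close>

theorem linear_minimal_submanifold:
  fixes \<phi> :: "'n::finite cmat set \<Rightarrow> complex"
  assumes \<phi>: "\<And>z. z \<in> SUstar \<Longrightarrow> \<phi> (coset z) = trace (gram z ** L0)"
    and L0: "\<And>z. z \<in> SUstar \<Longrightarrow> trace (gram z ** L0) = 0 \<Longrightarrow>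
      \<exists>c e. ctranspose z ** L0 ** z = outer c e \<and> pproj (outer c e) \<noteq> 0"
    and tr0: "trace L0 = 0"
  shows "minimal_submanifold SUstar_mod_Sp {p \<in> points SUstar_mod_Sp. \<phi> p = 0} 2"
proof -
  let ?S = "{p \<in> points SUstar_mod_Sp. \<phi> p = 0}"
  have "mean_curvature SUstar_mod_Sp ?S p = 0" if p: "p \<in> ?S" for p
  proof -
    obtain z where z: "z \<in> SUstar" "p = coset z" "\<phi> p = 0" using p by (auto simp: SUstar_mod_Sp_def)
    obtain U x Om Pc Om' crd where c: "chart_at SUstar_mod_Sp (coset z) = (U, x)" "quotient_chart U x Om Pc Om' crd" "z \<in> \<Union>U"
      by (rule chart_at_coset[OF z(1)])
    interpret zero_set_chart U x Om Pc Om' crd L0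
      by (intro zero_set_chart.intro zero_set_chart_axioms.intro c(2) L0)
    have "x ` (U \<inter> ?S) = slice"
    proof (intro equalityI subsetI)
      fix u assume "u \<in> x ` (U \<inter> ?S)"
      then obtain q where q: "q \<in> U" "u = x q" "\<phi> q = 0" by blast
      then have "u \<in> x ` U" by blast
      then obtain w where w: "w \<in> \<Union>U" "u = x (coset w)" using xU_cases by blast
      have "q = coset w" using inj_onD[OF chart_props(3), of q "coset w"] q w Z(2)[OF w(1)] by simp
      then show "u \<in> slice" using q \<phi>[OF Z(1)[OF w(1)]] Pc_x[OF w(1)] xZ[OF w(1)] w(2) by (simp add: slice_def)
    next
      fix u assume u: "u \<in> slice"
      then obtain w where w: "w \<in> \<Union>U" "u = x (coset w)" using xU_cases[OF slice_xU[OF u]] by blast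
      have "\<phi> (coset w) = 0" using u \<phi>[OF Z(1)[OF w(1)]] Pc_x[OF w(1)] w(2) by (simp add: slice_def)
      then have "coset w \<in> U \<inter> ?S" using Z[OF w(1)] by (auto simp: SUstar_mod_Sp_def)
      then show "u \<in> x ` (U \<inter> ?S)" using w(2) by blast
    qed
    then show ?thesis unfolding z(2) using \<phi>[OF z(1)] z by (intro mean_curvature_zero[OF c(3)] c(1)) auto
  qed
  moreover have "submanifold SUstar_mod_Sp ?S 2"
    unfolding submanifold_def
  proof (intro conjI ballI)
    show "?S \<subseteq> points SUstar_mod_Sp" by blast
    fix p assume p: "p \<in> ?S"
    let ?M = "SUstar_mod_Sp :: ('n cmat set, 'n cmat) riemannian"
    let ?F = "{X \<in> pspace. trace (L0 ** X) = 0}"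
    let ?x = "\<lambda>S :: 'n cmat set. xi (coset_gram S)"
    have F: "subspace ?F" using subspace_pspace unfolding subspace_def
      by (auto simp: mm.zero_right mm.add_right mm.scaleR_right tr_0 tr_add tr_scale)
    have dimF: "dim ?F + 2 = dim (pspace :: 'n cmat set)"
    proof -
      \<comment> \<open>The identity is a zero of the function, and nondegeneracy at this one point
        gives the codimension of the linear slice.\<close>
      have "trace (gram (mat 1) ** L0) = 0" using tr0 by (simp add: gram_def)
      then obtain c e where "L0 = outer c e" "pproj L0 \<noteq> 0" using L0[OF SUstar_mat_1] by force
      then show ?thesis using dim_kernel[of L0 c e] tr0 by blast
    qed
    have z0: "trace (gram z ** L0) = 0 \<longleftrightarrow> trace (L0 ** xi (gram z)) = 0" if z: "z \<in> SUstar" for z :: "'n cmat"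
    proof -
      have "Re (trace (gram z)) > 0" using PosD(5)[OF gram_Pos[OF z]] .
      moreover have "trace (L0 ** xi (gram z)) = (real CARD('n + 'n) / Re (trace (gram z))) *\<^sub>R trace (gram z ** L0)"
        unfolding xi_def using tr0 trace_mul_sym[of L0 "gram z"] by (simp add: mm.diff_right mm.scaleR_right tr_diff tr_scale)
      ultimately show ?thesis by auto
    qed
    have img: "?x ` (coset ` SUstar \<inter> ?S) = ?x ` coset ` SUstar \<inter> ?F"
    proof (intro equalityI subsetI)
      fix X assume "X \<in> ?x ` (coset ` SUstar \<inter> ?S)"
      then obtain z where z: "z \<in> SUstar" "\<phi> (coset z) = 0" "X = ?x (coset z)" by blast
      have "X = xi (gram z)" unfolding z(3) coset_gram ..
      then have "X \<in> ?F" using z0[OF z(1)] \<phi>[OF z(1)] z(2) xi_cone[OF gram_Pos[OF z(1)]] by (simp add: cone_domain_def)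
      then show "X \<in> ?x ` coset ` SUstar \<inter> ?F" using z by blast
    next
      fix X assume X: "X \<in> ?x ` coset ` SUstar \<inter> ?F"
      then obtain z where z: "z \<in> SUstar" "X = ?x (coset z)" by blast
      have "X = xi (gram z)" unfolding z(2) coset_gram ..
      then have "\<phi> (coset z) = 0" using z0[OF z(1)] \<phi>[OF z(1)] X by simp
      then have "coset z \<in> coset ` SUstar \<inter> ?S" using z(1) by (simp add: SUstar_mod_Sp_def)
      then show "X \<in> ?x ` (coset ` SUstar \<inter> ?S)" unfolding z(2) by (rule imageI)
    qed
    show "\<exists>(U, x)\<in>charts SUstar_mod_Sp. p \<in> U \<and>
        (\<exists>F. subspace F \<and> F \<subseteq> model ?M \<and> dim F + 2 = dim (model ?M) \<and> x ` (U \<inter> ?S) = x ` U \<inter> F)"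
    proof (rule bexI[of _ "(coset ` SUstar, ?x)"])
      show "(coset ` SUstar, ?x) \<in> charts SUstar_mod_Sp"
        using gchart_in_quotient_charts by (simp add: SUstar_mod_Sp_def gchart_def)
      have pm: "p \<in> coset ` SUstar" using p by (simp add: SUstar_mod_Sp_def)
      have m: "?F \<subseteq> model ?M" "dim ?F + 2 = dim (model ?M)"
        using dimF by (auto simp: SUstar_mod_Sp_def horizontal_mat_1)
      show "case (coset ` SUstar, ?x) of (U, x) \<Rightarrow> p \<in> U \<and>
        (\<exists>F. subspace F \<and> F \<subseteq> model ?M \<and> dim F + 2 = dim (model ?M) \<and> x ` (U \<inter> ?S) = x ` U \<inter> F)"
        unfolding case_prod_conv by (intro conjI exI[of _ ?F] pm F m img)
    qed
  qed
  ultimately show ?thesis unfolding minimal_submanifold_def by blast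
qed

section \<open>Length of curves\<close>

lemma has_vector_derivative_compose:
  assumes "(\<gamma> has_vector_derivative v) (at t within T)" "(F has_derivative D) (at (\<gamma> t))"
  shows "((\<lambda>s. F (\<gamma> s)) has_vector_derivative D v) (at t within T)"
proof -
  have "(F \<circ> \<gamma> has_derivative D \<circ> (\<lambda>h. h *\<^sub>R v)) (at t within T)"
    using assms has_derivative_at_withinI diff_chain_within unfolding has_vector_derivative_def by blast
  then show ?thesis
    unfolding has_vector_derivative_def using linear_scale[OF has_derivative_linear[OF assms(2)]] by (simp add: o_def)
qed

lemma derivative_in_subspace_interval:
  fixes S :: "'a::euclidean_space set" and f :: "real \<Rightarrow> 'a"
  assumes S: "subspace S" and d: "(f has_vector_derivative v) (at t within {0..1})" and t: "t \<in> {0..1}"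
    and f: "\<And>s. s \<in> {0..1} \<Longrightarrow> f s \<in> S"
  shows "v \<in> S"
proof -
  obtain \<pi> where \<pi>: "linear \<pi>" "\<And>y. \<pi> y \<in> S" "\<And>y. y \<in> S \<Longrightarrow> \<pi> y = y"
    using orthogonal_projection[OF S] by metis
  have "((\<lambda>t. \<pi> (f t)) has_vector_derivative \<pi> v) (at t within {0..1})"
    using \<pi>(1) d by (simp add: linear_conv_bounded_linear bounded_linear.has_vector_derivative)
  then have "(f has_vector_derivative \<pi> v) (at t within {0..1})"
    by (rule has_vector_derivative_transform_within[of _ _ _ _ 1]) (use t f \<pi>(3) in auto)
  then have "v = \<pi> v" using vector_derivative_unique_within_closed_interval[of 0 1 t f v "\<pi> v"] d t by simp
  then show ?thesis using \<pi>(2) by metis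
qed

lemma coset_gram_inj:
  assumes "S \<in> coset ` SUstar" "S' \<in> coset ` SUstar" "coset_gram S = coset_gram S'" shows "S = S'"
proof -
  obtain z z' where z: "z \<in> SUstar" "S = coset z" "z' \<in> SUstar" "S' = coset z'" using assms by blast
  then have "gram z = gram z'" using assms(3) by (simp add: coset_gram)
  then show ?thesis using coset_eq_iff z by blast
qed

lemma coset_gram_Pos: "S \<in> coset ` SUstar \<Longrightarrow> coset_gram S \<in> Pos"
  using gram_Pos by (auto simp: coset_gram)

lemma Pos_curve_tangent:
  fixes p :: "real \<Rightarrow> 'n::finite cmat"
  assumes p: "\<And>s. s \<in> {0..1} \<Longrightarrow> p s \<in> Pos" and t: "t \<in> {0..1}"
    and d: "(p has_vector_derivative A) (at t within {0..1})"
  shows "A \<in> qherm" "trace (matrix_inv (p t) ** A) = 0"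
proof -
  show "A \<in> qherm" by (rule derivative_in_subspace_interval[OF subspace_qherm d t]) (rule PosD(1)[OF p])
  have "((\<lambda>s. det (p s)) has_vector_derivative det (p t) * trace (matrix_inv (p t) ** A)) (at t within {0..1})"
    by (rule has_vector_derivative_compose[OF d det_has_derivative[OF PosD(4)[OF p[OF t]]]])
  then have "((\<lambda>s. 1) has_vector_derivative trace (matrix_inv (p t) ** A)) (at t within {0..1})"
    unfolding PosD(3)[OF p[OF t]] mult_1_left
    by (rule has_vector_derivative_transform_within[of _ _ _ _ 1]) (use PosD(3)[OF p] t in simp_all)
  then show "trace (matrix_inv (p t) ** A) = 0"
    using vector_derivative_unique_within_closed_interval[of 0 1 t "\<lambda>s. 1 :: complex" "trace (matrix_inv (p t) ** A)" 0] t
    by (simp add: has_vector_derivative_const)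
qed

context quotient_chart
begin

text \<open>Lets the preimage of a chart domain under a curve be computed as the preimage of the
  open set \<open>Om'\<close> under the curve of Gram matrices.\<close>

lemma in_U_iff:
  assumes S: "S \<in> coset ` SUstar" shows "S \<in> U \<longleftrightarrow> coset_gram S \<in> Om'" and "S \<in> U \<Longrightarrow> x S = crd (coset_gram S)"
proof -
  obtain w where w: "w \<in> SUstar" "S = coset w" using S by blast
  have 1: "coset_gram S \<in> Om' \<and> x S = crd (coset_gram S)" if SU: "S \<in> U"
    using crd_gram[OF ZI[OF w(1)]] SU unfolding w(2) coset_gram by auto
  then show "S \<in> U \<Longrightarrow> x S = crd (coset_gram S)" by blast
  have "S \<in> U" if m: "coset_gram S \<in> Om'"
  proof -
    obtain z where z: "z \<in> \<Union>U" "gram z = coset_gram S" using crd_dom[OF m coset_gram_Pos[OF S]] by blast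
    then have "coset z = S" using coset_gram_inj[OF _ S, of "coset z"] Z(1)[OF z(1)] by (simp add: coset_gram)
    then show ?thesis using Z(2)[OF z(1)] by simp
  qed
  then show "S \<in> U \<longleftrightarrow> coset_gram S \<in> Om'" using 1 by blast
qed

text \<open>Near t the coordinate curve is \<open>crd\<close> applied to the matrix curve, so its
  velocity is the image of A under the derivative of \<open>crd\<close>, and the metric turns this
  back into \<open>pmetric\<close>.\<close>

lemma chart_curve:
  assumes \<gamma>: "\<And>s. s \<in> {0..1} \<Longrightarrow> \<gamma> s \<in> coset ` SUstar" and t: "t \<in> {0..1}" "\<gamma> t \<in> U"
    and d: "((\<lambda>s. coset_gram (\<gamma> s)) has_vector_derivative A) (at t within {0..1})"
  shows "quotient_metric (U, x) (x (\<gamma> t)) (vector_derivative (x \<circ> \<gamma>) (at t within {0..1})) (vector_derivative (x \<circ> \<gamma>) (at t within {0..1}))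
     = pmetric (coset_gram (\<gamma> t)) A A"
proof -
  let ?p = "\<lambda>s. coset_gram (\<gamma> s)"
  have pO: "?p t \<in> Om'" "x (\<gamma> t) = crd (?p t)" using in_U_iff[OF \<gamma>[OF t(1)]] t(2) by auto
  obtain r where r: "r > 0" "ball (?p t) r \<subseteq> Om'" using open_Om' pO(1) open_contains_ball by blast
  obtain d' where d': "d' > 0" "\<And>s. s \<in> {0..1} \<Longrightarrow> dist s t < d' \<Longrightarrow> dist (?p s) (?p t) < r"
    using has_vector_derivative_continuous[OF d] r(1) unfolding continuous_within_eps_delta by blast
  have eq: "crd (?p s) = (x \<circ> \<gamma>) s" if s: "s \<in> {0..1}" "dist s t < d'" for s
  proof -
    have "?p s \<in> Om'" using d'(2)[OF s] r(2) by (auto simp: dist_commute)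
    then show ?thesis using in_U_iff[OF \<gamma>[OF s(1)]] by simp
  qed
  let ?w = "frechet_derivative crd (at (?p t)) A"
  have "((\<lambda>s. crd (?p s)) has_vector_derivative ?w) (at t within {0..1})"
    by (rule has_vector_derivative_compose[OF d Cinf_has_derivative[OF Cinf_crd pO(1)]])
  then have "((x \<circ> \<gamma>) has_vector_derivative ?w) (at t within {0..1})"
    by (rule has_vector_derivative_transform_within[OF _ d'(1) t(1)]) (rule eq)
  then have w: "vector_derivative (x \<circ> \<gamma>) (at t within {0..1}) = ?w"
    using vector_derivative_within_closed_interval[of 0 1 t] t(1) by simp
  have u: "x (\<gamma> t) \<in> x ` U" using t(2) by blast
  obtain z where z: "z \<in> \<Union>U" "x (\<gamma> t) = x (coset z)" using xU_cases[OF u] by blast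
  have "\<gamma> t = coset z" using inj_onD[OF chart_props(3) z(2) t(2) Z(2)[OF z(1)]] .
  then have P: "Pc (x (\<gamma> t)) = ?p t" using Pc_x[OF z(1)] by (simp add: coset_gram)
  note A = Pos_curve_tangent[OF coset_gram_Pos[OF \<gamma>] t(1) d]
  obtain v where v: "v \<in> pspace" "DP (x (\<gamma> t)) v = A" using DP_surj[OF u A(1)] A(2) P by auto
  have "?w = v" using crd_derivative(1)[OF u v(1)] unfolding v(2) P .
  then show ?thesis unfolding w using metric_eq_pmetric[OF u v(1) v(1)] v(2) P by simp
qed

end

text \<open>\<open>speed\<close> may use a different chart at each time. The expression through the
  matrix curve is free of charts and makes the speed one function on the whole interval.\<close>

lemma speed_eq:
  fixes \<gamma> :: "real \<Rightarrow> 'n::finite cmat set"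
  assumes \<gamma>: "\<And>s. s \<in> {0..1} \<Longrightarrow> \<gamma> s \<in> coset ` SUstar" and t: "t \<in> {0..1}"
    and d: "((\<lambda>s. coset_gram (\<gamma> s)) has_vector_derivative A) (at t within {0..1})"
  shows "speed SUstar_mod_Sp \<gamma> t = sqrt (pmetric (coset_gram (\<gamma> t)) A A)"
proof -
  obtain z where z: "z \<in> SUstar" "\<gamma> t = coset z" using \<gamma>[OF t] by blast
  obtain U x Om Pc Om' crd where c: "chart_at SUstar_mod_Sp (coset z) = (U, x)" "quotient_chart U x Om Pc Om' crd" "z \<in> \<Union>U"
    by (rule chart_at_coset[OF z(1)])
  interpret quotient_chart U x Om Pc Om' crd by (rule c(2))
  have tU: "\<gamma> t \<in> U" using Z(2)[OF c(3)] z(2) by simp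
  show ?thesis
    unfolding speed_def z(2) c(1) Let_def snd_conv metric_simps
    using chart_curve[OF \<gamma> t tU d] unfolding z(2) by simp
qed

text \<open>In the global chart the curve is smooth, and \<open>unimod\<close> recovers the matrices
  from it. Continuity of the velocity later makes the speed integrable.\<close>

lemma smooth_curve_gram:
  fixes \<gamma> :: "real \<Rightarrow> 'n::finite cmat set"
  assumes \<gamma>: "smooth_curve SUstar_mod_Sp S \<gamma>" and S: "S \<subseteq> coset ` SUstar"
  obtains p' where "continuous_on {0..1} p'"
    "\<And>t. t \<in> {0..1} \<Longrightarrow> ((\<lambda>s. coset_gram (\<gamma> s)) has_vector_derivative p' t) (at t within {0..1})"
proof -
  let ?p = "\<lambda>s. coset_gram (\<gamma> s)"
  have pts: "\<gamma> s \<in> coset ` SUstar" if "s \<in> {0..1}" for s using \<gamma> S that unfolding smooth_curve_def by blast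
  have "{0..1} \<inter> \<gamma> -` (coset ` SUstar) = {0..1}" using pts by blast
  moreover have "gchart \<in> charts SUstar_mod_Sp" by (simp add: SUstar_mod_Sp_def gchart_in_quotient_charts)
  ultimately have sm: "smooth_on {0..1} (\<lambda>s. xi (?p s))"
    using \<gamma> unfolding smooth_curve_def gchart_def by (fastforce simp: o_def)
  define p' where "p' t = vector_derivative ?p (at t within {0..1})" for t
  have loc: "\<exists>N G. open N \<and> t \<in> N \<and> Cinf N G \<and> (\<forall>s\<in>N \<inter> {0..1}. ?p s = G s)" if t: "t \<in> {0..1}" for t
  proof -
    obtain V F where F: "open V" "t \<in> V" "Cinf V F" "\<And>s. s \<in> V \<Longrightarrow> s \<in> {0..1} \<Longrightarrow> F s = xi (?p s)"
      using smooth_onD[OF sm t] by metis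
    let ?N = "V \<inter> (\<lambda>s. mat 1 + F s) -` {A. Re (det A) > 0}"
    have "continuous_on V (\<lambda>s. mat 1 + F s)" by (intro continuous_intros Cinf_continuous[OF F(3)])
    then have N: "open ?N" by (rule continuous_open_preimage[OF _ F(1) open_det_pos])
    have FP: "F s \<in> cone_domain \<and> unimod (mat 1 + F s) = ?p s" if "s \<in> V" "s \<in> {0..1}" for s
      using F(4)[OF that] xi_cone unimod_xi coset_gram_Pos[OF pts[OF that(2)]] by auto
    have "t \<in> ?N" using F(2) FP[OF F(2) t] posdef_det_pos mat_1_add_qherm by (auto simp: cone_domain_def)
    moreover have "Cinf ?N (\<lambda>s. unimod (mat 1 + F s))"
      by (intro Cinf_unimod N Cinf_add Cinf_const Cinf_subset[OF F(3)]) auto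
    ultimately show ?thesis using N FP by (intro exI[of _ ?N] exI[of _ "\<lambda>s. unimod (mat 1 + F s)"]) auto
  qed
  have der: "(?p has_vector_derivative frechet_derivative G (at s) 1) (at s within {0..1})"
    if G: "open N" "Cinf N G" "\<forall>s\<in>N \<inter> {0..1}. ?p s = G s" and s: "s \<in> N" "s \<in> {0..1}" for N G s
  proof -
    have "(G has_derivative frechet_derivative G (at s)) (at s)" by (rule Cinf_has_derivative[OF G(2) s(1)])
    then have "(?p has_derivative frechet_derivative G (at s)) (at s within {0..1})"
      by (rule has_derivative_agree[OF _ G(1) s]) (use G(3) in auto)
    moreover have "frechet_derivative G (at s) = (\<lambda>h. h *\<^sub>R frechet_derivative G (at s) 1)"
    proof
      fix h :: real
      show "frechet_derivative G (at s) h = h *\<^sub>R frechet_derivative G (at s) 1"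
        using linear_scale[OF has_derivative_linear[OF Cinf_has_derivative[OF G(2) s(1)]], of h 1] by (simp only: real_scaleR_def mult_1_right)
    qed
    ultimately show ?thesis unfolding has_vector_derivative_def by simp
  qed
  have p'eq: "p' s = frechet_derivative G (at s) 1"
    if G: "open N" "Cinf N G" "\<forall>s\<in>N \<inter> {0..1}. ?p s = G s" and s: "s \<in> N" "s \<in> {0..1}" for N G s
    unfolding p'_def by (rule vector_derivative_within_closed_interval[OF _ s(2) der[OF G s]]) simp
  have "continuous (at t within {0..1}) p'" if t: "t \<in> {0..1}" for t
  proof -
    obtain N G where G: "open N" "t \<in> N" "Cinf N G" "\<forall>s\<in>N \<inter> {0..1}. ?p s = G s" using loc[OF t] by blast
    have "continuous_on (N \<inter> {0..1}) (\<lambda>s. frechet_derivative G (at s) 1)"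
      using Cinf_continuous[OF Cinf_frechet[OF G(3)]] continuous_on_subset by blast
    then have "continuous_on (N \<inter> {0..1}) p'"
      by (rule continuous_on_eq) (use p'eq[OF G(1,3,4)] in auto)
    then have "continuous (at t within N \<inter> {0..1}) p'" using G(2) t by (simp add: continuous_on_eq_continuous_within)
    moreover have "at t within N \<inter> {0..1} = at t within {0..1}" by (rule at_within_nhd[OF G(2,1)]) blast
    ultimately show ?thesis by simp
  qed
  then have "continuous_on {0..1} p'" by (simp add: continuous_on_eq_continuous_within)
  moreover have "(?p has_vector_derivative p' t) (at t within {0..1})" if t: "t \<in> {0..1}" for t
  proof -
    obtain N G where G: "open N" "t \<in> N" "Cinf N G" "\<forall>s\<in>N \<inter> {0..1}. ?p s = G s" using loc[OF t] by blast
    show ?thesis unfolding p'eq[OF G(1,3,4,2) t] by (rule der[OF G(1,3,4,2) t])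
  qed
  ultimately show ?thesis using that by blast
qed

section \<open>Completeness\<close>

lemma norm_outer: "norm (outer v (cnj_vec v)) = norm v ^ 2"
proof -
  have "norm (outer v (cnj_vec v)) ^ 2 = (\<Sum>i\<in>UNIV. \<Sum>j\<in>UNIV. norm (v $ i) ^ 2 * norm (v $ j) ^ 2)"
    unfolding power2_norm_eq_inner[of "outer v (cnj_vec v)"] inner_vec_def
    by (simp add: outer_def cnj_vec_def dot_square_norm norm_mult power_mult_distrib)
  also have "\<dots> = (\<Sum>i\<in>UNIV. norm (v $ i) ^ 2) * (\<Sum>j\<in>UNIV. norm (v $ j) ^ 2)" by (simp add: sum_product)
  also have "(\<Sum>i\<in>UNIV. norm (v $ i) ^ 2) = norm v ^ 2"
    by (simp add: power2_norm_eq_inner inner_vec_def)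
  finally have "norm (outer v (cnj_vec v)) ^ 2 = (norm v ^ 2) ^ 2" by (simp only: power2_eq_square)
  then show ?thesis by (rule power2_eq_imp_eq) simp_all
qed

text \<open>The form is the real inner product of X with the rank-one matrix of v, whose norm is the
  squared norm of v.\<close>

lemma qform_bound: "\<bar>qform X v\<bar> \<le> norm X * norm v ^ 2"
proof -
  have "qform X v = X \<bullet> outer v (cnj_vec v)"
    by (simp add: qform_def hermitian_inner_def matrix_vector_mult_def inner_vec_def outer_def cnj_vec_def
        inner_complex_def sum_distrib_left sum_distrib_right algebra_simps)
  then show ?thesis using Cauchy_Schwarz_ineq2[of X "outer v (cnj_vec v)"] norm_outer[of v] by simp
qed

lemma qform_sandwich: "qform (z ** X ** ctranspose z) v = qform X (ctranspose z *v v)"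
  by (simp add: qform_def hermitian_inner_adjoint flip: matrix_vector_mul_assoc)

text \<open>Writing A as twice z X ctranspose z, the root of \<open>pmetric\<close> is the norm of
  X, while the forms of A and P at v become those of 2X and the identity at
  \<open>ctranspose z *v v\<close>. So the logarithmic derivative of \<open>qform P v\<close> is at
  most twice the speed.\<close>

lemma qform_speed_bound:
  fixes P A :: "'n::finite cmat"
  assumes P: "P \<in> Pos" and A: "A \<in> qherm"
  shows "\<bar>qform A v\<bar> \<le> 2 * sqrt (pmetric P A A) * qform P v"
proof -
  obtain z where z: "z \<in> SUstar" "gram z = P" using gram_surj[OF P] by blast
  have d: "det z \<noteq> 0" "det (ctranspose z) \<noteq> 0" using z(1) by (simp_all add: SUstar_det det_ctranspose)
  define X where "X = (1/2) *\<^sub>R (matrix_inv z ** A ** ctranspose (matrix_inv z))"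
  have X: "X \<in> qherm" unfolding X_def
    by (intro subspace_scale[OF subspace_qherm] qherm_sandwich A quat_matrix_inv SUstar_in_quat z(1) d)
  have A': "A = 2 *\<^sub>R (z ** X ** ctranspose z)"
    unfolding X_def using d
    by (simp add: mm.scaleR_left mm.scaleR_right matrix_mul_assoc ctranspose_matrix_inv matrix_inv_right matrix_inv_left')
  have "pmetric P A A = X \<bullet> X" unfolding A' z(2)[symmetric] by (rule pmetric_sandwich[OF d(1) X])
  then have n: "sqrt (pmetric P A A) = norm X" by (simp add: norm_eq_sqrt_inner)
  have "\<bar>qform A v\<bar> = 2 * \<bar>qform X (ctranspose z *v v)\<bar>" unfolding A' by (simp add: qform_scaleR qform_sandwich abs_mult)
  also have "\<dots> \<le> 2 * (norm X * norm (ctranspose z *v v) ^ 2)" using qform_bound by simp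
  also have "\<dots> = 2 * sqrt (pmetric P A A) * qform P v"
    using qform_gram[of z v] z(2) n by (simp add: gram_def)
  finally show ?thesis .
qed

lemma continuous_on_trace: "continuous_on A f \<Longrightarrow> continuous_on A (\<lambda>t. trace (f t :: complex^'m^'m))"
  using linear_trace linear_conv_bounded_linear bounded_linear.continuous_on by blast

lemma continuous_on_pmetric:
  assumes p: "continuous_on T p" and det: "\<And>t. t \<in> T \<Longrightarrow> det (p t :: complex^'m^'m) \<noteq> 0" and f: "continuous_on T f" and g: "continuous_on T g"
  shows "continuous_on T (\<lambda>t. pmetric (p t) (f t) (g t))"
proof -
  have "continuous_on T (\<lambda>t. matrix_inv (p t))"
    by (rule continuous_on_compose2[OF Cinf_continuous[OF Cinf_matrix_inv'] p]) (use det in auto)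
  then show ?thesis unfolding pmetric_def
    by (intro continuous_on_divide continuous_on_Re continuous_on_trace mm.continuous_on f g continuous_on_const) auto
qed

text \<open>Integrates \<open>qform_speed_bound\<close> along the curve. Length thereby controls the
  point of the cone in every direction v.\<close>

lemma curve_length_bounds:
  fixes \<gamma> :: "real \<Rightarrow> 'n::finite cmat set"
  assumes \<gamma>: "smooth_curve SUstar_mod_Sp S \<gamma>" and S: "S \<subseteq> coset ` SUstar"
  shows "curve_length SUstar_mod_Sp \<gamma> \<ge> 0"
    "v \<noteq> 0 \<Longrightarrow> \<bar>ln (qform (coset_gram (\<gamma> 1)) v) - ln (qform (coset_gram (\<gamma> 0)) v)\<bar> \<le> 2 * curve_length SUstar_mod_Sp \<gamma>"
proof -
  let ?p = "\<lambda>s. coset_gram (\<gamma> s)"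
  have pts: "\<gamma> s \<in> coset ` SUstar" if "s \<in> {0..1}" for s using \<gamma> S that unfolding smooth_curve_def by blast
  note P = coset_gram_Pos[OF pts]
  obtain p' where p': "continuous_on {0..1} p'" "\<And>t. t \<in> {0..1} \<Longrightarrow> (?p has_vector_derivative p' t) (at t within {0..1})"
    using smooth_curve_gram[OF \<gamma> S] by blast
  have cp: "continuous_on {0..1} ?p"
    unfolding continuous_on_eq_continuous_within by (intro ballI) (rule has_vector_derivative_continuous[OF p'(2)])
  let ?s = "\<lambda>t. sqrt (pmetric (?p t) (p' t) (p' t))"
  have sp: "speed SUstar_mod_Sp \<gamma> t = ?s t" if "t \<in> {0..1}" for t by (rule speed_eq[OF pts that p'(2)[OF that]])
  have cs: "continuous_on {0..1} ?s"
    by (intro continuous_on_real_sqrt continuous_on_pmetric cp p'(1)) (rule PosD(4)[OF P])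
  then have si: "?s integrable_on {0..1}" by (rule integrable_continuous_interval)
  have len: "curve_length SUstar_mod_Sp \<gamma> = integral {0..1} ?s"
    unfolding curve_length_def by (rule integral_cong) (rule sp)
  have A: "p' t \<in> qherm" if "t \<in> {0..1}" for t by (rule Pos_curve_tangent(1)[OF P that p'(2)[OF that]])
  have s0: "?s t \<ge> 0" if t: "t \<in> {0..1}" for t
  proof -
    \<comment> \<open>\<open>axis undefined 1\<close> serves as some nonzero vector; the speed bound
      at this vector reveals the sign of the square root.\<close>
    have "0 \<le> 2 * ?s t * qform (?p t) (axis undefined 1)"
      using qform_speed_bound[OF P[OF t] A[OF t]] by (meson abs_ge_zero order_trans)
    moreover have "qform (?p t) (axis undefined 1) > 0" using PosD(2)[OF P[OF t]] by (auto simp: posdef_def)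
    ultimately show ?thesis by (simp add: zero_le_mult_iff)
  qed
  show "curve_length SUstar_mod_Sp \<gamma> \<ge> 0" unfolding len by (rule integral_nonneg[OF si s0])
  assume v: "v \<noteq> 0"
  let ?f = "\<lambda>t. ln (qform (?p t) v)" and ?f' = "\<lambda>t. qform (p' t) v / qform (?p t) v"
  have q0: "qform (?p t) v > 0" if t: "t \<in> {0..1}" for t using PosD(2)[OF P[OF t]] v by (auto simp: posdef_def)
  have bl: "bounded_linear (\<lambda>P :: 'n cmat. qform P v)" using linear_qform linear_conv_bounded_linear by blast
  have df: "(?f has_vector_derivative ?f' t) (at t within {0..1})" if t: "t \<in> {0..1}" for t
  proof -
    have "((\<lambda>t. qform (?p t) v) has_vector_derivative qform (p' t) v) (at t within {0..1})"
      by (rule bounded_linear.has_vector_derivative[OF bl p'(2)[OF t]])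
    moreover have "(ln has_derivative (\<lambda>h. h / qform (?p t) v)) (at (qform (?p t) v))"
      using DERIV_ln_divide[OF q0[OF t]] by (simp add: has_field_derivative_def divide_inverse mult_commute_abs)
    ultimately show ?thesis using has_vector_derivative_compose[of "\<lambda>t. qform (?p t) v"] by fast
  qed
  have FT: "(?f' has_integral ?f 1 - ?f 0) {0..1}" by (rule fundamental_theorem_of_calculus[OF _ df]) simp
  have "norm (integral {0..1} ?f') \<le> integral {0..1} (\<lambda>t. 2 * ?s t)"
  proof (rule integral_norm_bound_integral)
    show "?f' integrable_on {0..1}" using FT by blast
    show "(\<lambda>t. 2 * ?s t) integrable_on {0..1}" by (rule integrable_continuous_interval) (intro continuous_intros cs)
    show "norm (?f' t) \<le> 2 * ?s t" if t: "t \<in> {0..1}" for t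
      using qform_speed_bound[OF P[OF t] A[OF t], of v] q0[OF t] by (simp add: abs_divide pos_divide_le_eq)
  qed
  then show "\<bar>ln (qform (coset_gram (\<gamma> 1)) v) - ln (qform (coset_gram (\<gamma> 0)) v)\<bar> \<le> 2 * curve_length SUstar_mod_Sp \<gamma>"
    using integral_unique[OF FT] len by simp
qed

lemma induced_dist_less_imp:
  fixes S :: "'n::finite cmat set set"
  assumes S: "S \<subseteq> coset ` SUstar" and d: "induced_dist SUstar_mod_Sp S p q < ereal e" and v: "v \<noteq> 0"
  shows "\<bar>ln (qform (coset_gram q) v) - ln (qform (coset_gram p) v)\<bar> < 2 * e"
proof -
  obtain \<gamma> where "smooth_curve SUstar_mod_Sp S \<gamma>" "\<gamma> 0 = p" "\<gamma> 1 = q" "curve_length SUstar_mod_Sp \<gamma> < e"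
    using d unfolding induced_dist_def INF_less_iff by auto
  then show ?thesis using curve_length_bounds(2)[OF _ S v, of \<gamma>] by force
qed

lemma induced_dist_nonneg:
  assumes S: "S \<subseteq> coset ` SUstar" shows "induced_dist SUstar_mod_Sp S p q \<ge> 0"
  unfolding induced_dist_def using curve_length_bounds(1)[OF _ S] by (intro INF_greatest) auto

section \<open>Limits of Cauchy sequences in the cone\<close>

lemma qform_polarisation:
  assumes P: "ctranspose P = P"
  shows "(P *v v) \<bullet> w = (qform P (v + w) - qform P v - qform P w) / 2"
proof -
  have in_herm: "v \<bullet> w = Re (hermitian_inner v w)" for v w :: "complex^'a"
    by (simp add: hermitian_inner_def inner_vec_def inner_complex_def)
  have "(P *v w) \<bullet> v = (P *v v) \<bullet> w"
  proof -
    have "(P *v w) \<bullet> v = w \<bullet> (P *v v)" unfolding in_herm hermitian_inner_adjoint P ..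
    then show ?thesis by (simp add: inner_commute)
  qed
  then show ?thesis
    by (simp add: qform_inner matrix_vector_right_distrib inner_add_left inner_add_right)
qed

text \<open>By polarisation the quadratic forms determine all real inner products, and testing
  against \<open>axis i 1\<close> and \<open>axis i \<i>\<close> isolates the real and imaginary
  part of each entry.\<close>

lemma hermitian_convergence:
  fixes P :: "nat \<Rightarrow> complex^'m^'m"
  assumes P: "\<And>n. ctranspose (P n) = P n" and c: "\<And>v. convergent (\<lambda>n. qform (P n) v)"
  shows "convergent P"
proof -
  have 1: "convergent (\<lambda>n. (P n *v v) \<bullet> w)" for v w
    unfolding qform_polarisation[OF P] divide_inverse
    by (intro convergent_mult convergent_diff c convergent_const)
  have 2: "convergent (\<lambda>n. Re (P n $ i $ j))" for i j
    using 1[of "axis j 1" "axis i 1"] by (simp add: inner_axis mult_axis_nth inner_complex_def)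
  have 3: "convergent (\<lambda>n. Im (P n $ i $ j))" for i j
    using 1[of "axis j 1" "axis i \<i>"] by (simp add: inner_axis mult_axis_nth inner_complex_def)
  obtain R I where RI: "\<And>i j. (\<lambda>n. Re (P n $ i $ j)) \<longlonglongrightarrow> R i j" "\<And>i j. (\<lambda>n. Im (P n $ i $ j)) \<longlonglongrightarrow> I i j"
    using 2 3 unfolding convergent_def by metis
  have "P \<longlonglongrightarrow> (\<chi> i j. Complex (R i j) (I i j))"
    by (intro vec_tendstoI) (simp add: tendsto_complex_iff RI)
  then show ?thesis unfolding convergent_def by blast
qed

text \<open>By \<open>induced_dist_less_imp\<close> the logarithms of \<open>qform\<close> are
  Cauchy, so the values converge to positive numbers. The logarithm is what prevents degeneration:
  the limit is again positive definite, and the other conditions are closed.\<close>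

lemma Cauchy_limit_Pos:
  fixes X :: "nat \<Rightarrow> 'n::finite cmat set"
  assumes S: "S \<subseteq> coset ` SUstar" and X: "\<And>n. X n \<in> S"
    and C: "\<And>e. e > 0 \<Longrightarrow> \<exists>N. \<forall>m\<ge>N. \<forall>n\<ge>N. induced_dist SUstar_mod_Sp S (X m) (X n) < ereal e"
  obtains P where "P \<in> Pos" "(\<lambda>n. coset_gram (X n)) \<longlonglongrightarrow> P"
proof -
  let ?P = "\<lambda>n. coset_gram (X n)"
  have PP: "?P n \<in> Pos" for n using coset_gram_Pos X S by blast
  have ex: "\<exists>l>0. (\<lambda>n. qform (?P n) v) \<longlonglongrightarrow> l" if v: "v \<noteq> 0" for v
  proof -
    have q0: "qform (?P n) v > 0" for n using PosD(2)[OF PP] v by (auto simp: posdef_def)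
    have "Cauchy (\<lambda>n. ln (qform (?P n) v))"
    proof (rule metric_CauchyI)
      fix e :: real assume "e > 0"
      then obtain N where N: "\<forall>m\<ge>N. \<forall>n\<ge>N. induced_dist SUstar_mod_Sp S (X m) (X n) < ereal (e / 2)" using C[of "e / 2"] by auto
      show "\<exists>M. \<forall>m\<ge>M. \<forall>n\<ge>M. dist (ln (qform (?P m) v)) (ln (qform (?P n) v)) < e"
        using induced_dist_less_imp[OF S _ v] N by (intro exI[of _ N]) (force simp: dist_real_def abs_minus_commute)
    qed
    then obtain l where "(\<lambda>n. ln (qform (?P n) v)) \<longlonglongrightarrow> l" using Cauchy_convergent convergent_def by blast
    then have "(\<lambda>n. exp (ln (qform (?P n) v))) \<longlonglongrightarrow> exp l" by (intro tendsto_exp)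
    then show ?thesis using q0 by (intro exI[of _ "exp l"]) simp
  qed
  have "convergent (\<lambda>n. qform (?P n) v)" for v
  proof (cases "v = 0")
    case True
    then show ?thesis by (simp add: qform_inner convergent_const)
  next
    case False
    then show ?thesis using ex convergent_def by blast
  qed
  then obtain P where P: "?P \<longlonglongrightarrow> P"
    using hermitian_convergence[of ?P] PosD(1)[OF PP] unfolding convergent_def qherm_def by blast
  have "P \<in> qherm"
    by (rule Lim_in_closed_set[OF closed_subspace[OF subspace_qherm] _ _ P]) (use PosD(1)[OF PP] in auto)
  moreover have "det P = 1"
  proof -
    have "continuous_on (UNIV :: 'n cmat set) det" by (intro Cinf_continuous[OF Cinf_det] open_UNIV Cinf_ident)
    then have "isCont det P" using continuous_on_eq_continuous_at[OF open_UNIV] by blast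
    then have "(\<lambda>n. det (?P n)) \<longlonglongrightarrow> det P" by (rule isCont_tendsto_compose[OF _ P])
    then have "(\<lambda>n. 1) \<longlonglongrightarrow> det P" unfolding PosD(3)[OF PP] .
    then show ?thesis using LIMSEQ_unique[OF _ tendsto_const] by blast
  qed
  moreover have "posdef P" unfolding posdef_def
  proof (intro allI impI)
    fix v :: "complex^('n + 'n)" assume v: "v \<noteq> 0"
    have "bounded_linear (\<lambda>P :: 'n cmat. qform P v)" using linear_qform linear_conv_bounded_linear by blast
    then have "(\<lambda>n. qform (?P n) v) \<longlonglongrightarrow> qform P v" by (rule bounded_linear.tendsto[OF _ P])
    then show "qform P v > 0" using ex[OF v] LIMSEQ_unique by metis
  qed
  ultimately have "P \<in> Pos" by (simp add: Pos_def)
  then show ?thesis using that P by blast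
qed

text \<open>In the cone model the zero set is the intersection of the convex cone with a linear subspace,
  so nearby points are joined by segments, whose length is controlled by continuity of the metric.\<close>

lemma segment_curve:
  fixes \<phi> :: "'n::finite cmat set \<Rightarrow> complex"
  assumes \<phi>: "\<And>z. z \<in> SUstar \<Longrightarrow> \<phi> (coset z) = trace (gram z ** L0)" and tr0: "trace L0 = 0"
    and p: "p \<in> coset ` SUstar" "\<phi> p = 0" and q: "q \<in> coset ` SUstar" "\<phi> q = 0"
  defines "\<xi> \<equiv> xi (coset_gram p)" and "\<eta> \<equiv> xi (coset_gram q)"
  defines "Y \<equiv> \<lambda>t. mat 1 + (\<xi> + t *\<^sub>R (\<eta> - \<xi>))"
  obtains \<gamma> where "smooth_curve SUstar_mod_Sp {p \<in> points SUstar_mod_Sp. \<phi> p = 0} \<gamma>" "\<gamma> 0 = p" "\<gamma> 1 = q"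
    "\<And>t. t \<in> {0..1} \<Longrightarrow> Re (det (Y t)) > 0"
    "\<And>t. t \<in> {0..1} \<Longrightarrow> speed SUstar_mod_Sp \<gamma> t =
       sqrt (pmetric (unimod (Y t)) (frechet_derivative unimod (at (Y t)) (\<eta> - \<xi>)) (frechet_derivative unimod (at (Y t)) (\<eta> - \<xi>)))"
proof -
  have tr: "trace (coset_gram S ** L0) = \<phi> S" if "S \<in> coset ` SUstar" for S using \<phi> that by (auto simp: coset_gram)
  have cone: "\<xi> \<in> cone_domain" "\<eta> \<in> cone_domain" unfolding \<xi>_def \<eta>_def using p q by (auto intro!: xi_cone coset_gram_Pos)
  have tx: "trace (\<xi> ** L0) = 0" "trace (\<eta> ** L0) = 0"
    unfolding \<xi>_def \<eta>_def xi_def using tr p q tr0 by (simp_all add: mm.diff_left mm.scaleR_left tr_diff tr_scale)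
  define \<sigma> where "\<sigma> t = \<xi> + t *\<^sub>R (\<eta> - \<xi>)" for t
  have Y: "Y t = mat 1 + \<sigma> t" for t by (simp add: Y_def \<sigma>_def)
  have \<sigma>c: "\<sigma> t \<in> cone_domain" if "t \<in> {0..1}" for t
  proof -
    have "\<sigma> t = (1 - t) *\<^sub>R \<xi> + t *\<^sub>R \<eta>" unfolding \<sigma>_def by (simp add: algebra_simps)
    then show ?thesis using convexD[OF cone_convex cone, of "1 - t" t] that by simp
  qed
  \<comment> \<open>\<open>trace L0 = 0\<close> removes the identity, so the segment between two
    zeros stays in the linear zero set.\<close>
  have Yt: "trace (Y t ** L0) = 0" for t
    unfolding Y_def by (simp add: mm.add_left mm.diff_left mm.scaleR_left tr_add tr_diff tr_scale tr0 tx)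
  have dY: "Re (det (Y t)) > 0" if "t \<in> {0..1}" for t
    using \<sigma>c[OF that] unfolding Y by (intro posdef_det_pos) (auto simp: cone_domain_def mat_1_add_qherm)
  define P where "P t = unimod (Y t)" for t
  have PP: "P t \<in> Pos" if "t \<in> {0..1}" for t unfolding P_def Y by (rule cone_unimod(1)[OF \<sigma>c[OF that]])
  have Pt: "trace (P t ** L0) = 0" for t unfolding P_def unimod_def using Yt by (simp add: mm.scaleR_left tr_scale)
  define \<gamma> where "\<gamma> t = coset (SOME w. w \<in> SUstar \<and> gram w = P t)" for t
  have \<gamma>P: "\<gamma> t \<in> coset ` SUstar \<and> coset_gram (\<gamma> t) = P t" if t: "t \<in> {0..1}" for t
  proof -
    obtain w where w: "w \<in> SUstar \<and> gram w = P t" using gram_surj[OF PP[OF t]] by blast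
    have "(SOME w. w \<in> SUstar \<and> gram w = P t) \<in> SUstar \<and> gram (SOME w. w \<in> SUstar \<and> gram w = P t) = P t"
      by (rule someI[of "\<lambda>w. w \<in> SUstar \<and> gram w = P t", OF w])
    then show ?thesis unfolding \<gamma>_def coset_gram by blast
  qed
  have ends: "\<gamma> 0 = p" "\<gamma> 1 = q"
  proof -
    have "P 0 = coset_gram p" "P 1 = coset_gram q"
      unfolding P_def Y_def \<xi>_def \<eta>_def using p q by (simp_all add: unimod_xi coset_gram_Pos)
    then show "\<gamma> 0 = p" "\<gamma> 1 = q" using \<gamma>P[of 0] \<gamma>P[of 1] coset_gram_inj p(1) q(1) by auto
  qed
  have CY: "Cinf UNIV Y"
    unfolding Y_def by (intro Cinf_add Cinf_const open_UNIV Cinf_linear) (auto simp: linear_iff scaleR_add_left)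
  let ?N = "Y -` {A. Re (det A) > 0}"
  have N: "open ?N" by (rule open_vimage[OF open_det_pos Cinf_continuous[OF CY]])
  have CP: "Cinf ?N P" unfolding P_def by (intro Cinf_unimod N Cinf_subset[OF CY]) auto
  have inN: "{0..1} \<subseteq> ?N" using dY by auto
  have "smooth_curve SUstar_mod_Sp {p \<in> points SUstar_mod_Sp. \<phi> p = 0} \<gamma>"
    unfolding smooth_curve_def
  proof (intro conjI ballI)
    show "\<gamma> ` {0..1} \<subseteq> {p \<in> points SUstar_mod_Sp. \<phi> p = 0}"
      using \<gamma>P tr Pt by (fastforce simp: SUstar_mod_Sp_def)
    fix c :: "('n cmat set, 'n cmat) chart" assume c: "c \<in> charts SUstar_mod_Sp"
    obtain U x where Ux: "c = (U, x)" by fastforce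
    have "(U, x) \<in> quotient_charts" using c Ux by (simp add: SUstar_mod_Sp_def)
    then obtain Om Pc Om' crd where "quotient_chart U x Om Pc Om' crd" using quotient_chart_exists by blast
    then interpret quotient_chart U x Om Pc Om' crd .
    have eq: "{0..1} \<inter> \<gamma> -` U = {0..1} \<inter> (?N \<inter> P -` Om')"
      using in_U_iff(1) \<gamma>P inN by (auto 4 3)
    have o: "open (?N \<inter> P -` Om')" by (rule continuous_open_preimage[OF Cinf_continuous[OF CP] N open_Om'])
    have "openin (top_of_set {0..1}) ({0..1} \<inter> \<gamma> -` U)" unfolding eq by (rule openin_open_Int[OF o])
    moreover have "smooth_on ({0..1} \<inter> \<gamma> -` U) (x \<circ> \<gamma>)"
    proof (rule smooth_onI[OF o])
      show "{0..1} \<inter> \<gamma> -` U \<subseteq> ?N \<inter> P -` Om'" using eq by blast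
      show "Cinf (?N \<inter> P -` Om') (\<lambda>t. crd (P t))"
        by (rule Cinf_compose[OF o open_Om' Cinf_crd Cinf_subset[OF CP]]) auto
      show "crd (P t) = (x \<circ> \<gamma>) t" if "t \<in> {0..1} \<inter> \<gamma> -` U" for t
        using in_U_iff(2)[of "\<gamma> t"] \<gamma>P[of t] that by simp
    qed
    ultimately show "case c of (U, x) \<Rightarrow> openin (top_of_set {0..1}) ({0..1} \<inter> \<gamma> -` U) \<and> smooth_on ({0..1} \<inter> \<gamma> -` U) (x \<circ> \<gamma>)"
      unfolding Ux by simp
  qed
  moreover have "speed SUstar_mod_Sp \<gamma> t =
       sqrt (pmetric (unimod (Y t)) (frechet_derivative unimod (at (Y t)) (\<eta> - \<xi>)) (frechet_derivative unimod (at (Y t)) (\<eta> - \<xi>)))"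
    if t: "t \<in> {0..1}" for t
  proof -
    let ?A = "frechet_derivative unimod (at (Y t)) (\<eta> - \<xi>)"
    have "Cinf {A :: 'n cmat. Re (det A) > 0} unimod" by (intro Cinf_unimod open_det_pos Cinf_ident) auto
    then have du: "(unimod has_derivative frechet_derivative unimod (at (Y t))) (at (Y t))"
      by (rule Cinf_has_derivative) (use dY[OF t] in simp)
    have "(Y has_vector_derivative \<eta> - \<xi>) (at t within {0..1})"
      unfolding Y_def has_vector_derivative_def by (auto intro!: derivative_eq_intros)
    then have "(P has_vector_derivative ?A) (at t within {0..1})"
      unfolding P_def by (rule has_vector_derivative_compose[of Y _ t _ unimod, OF _ du])
    then have "((\<lambda>s. coset_gram (\<gamma> s)) has_vector_derivative ?A) (at t within {0..1})"
      by (rule has_vector_derivative_transform_within[of _ _ _ _ 1]) (use t \<gamma>P in auto)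
    from speed_eq[OF _ t this] \<gamma>P show ?thesis using t by (simp add: P_def)
  qed
  ultimately show ?thesis using that ends dY by blast
qed

text \<open>The limit of the matrices must also be a limit for the induced distance. Late terms are
  joined to it by segments inside the zero set; their speed tends to zero uniformly, since it
  depends continuously on position and direction and vanishes for direction zero.\<close>

lemma linear_complete_submanifold:
  fixes \<phi> :: "'n::finite cmat set \<Rightarrow> complex"
  assumes \<phi>: "\<And>z. z \<in> SUstar \<Longrightarrow> \<phi> (coset z) = trace (gram z ** L0)" and tr0: "trace L0 = 0"
  shows "complete_submanifold SUstar_mod_Sp {p \<in> points SUstar_mod_Sp. \<phi> p = 0}"
proof -
  let ?M = "SUstar_mod_Sp :: ('n cmat set, 'n cmat) riemannian" and ?S = "{p \<in> points SUstar_mod_Sp. \<phi> p = 0}"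
  have S: "?S \<subseteq> coset ` SUstar" by (auto simp: SUstar_mod_Sp_def)
  have tr: "trace (coset_gram S ** L0) = \<phi> S" if "S \<in> coset ` SUstar" for S using \<phi> that by (auto simp: coset_gram)
  have "\<exists>l\<in>?S. (\<lambda>n. induced_dist ?M ?S (X n) l) \<longlonglongrightarrow> 0"
    if X: "\<And>n::nat. X n \<in> ?S" and C: "\<And>e. e > 0 \<Longrightarrow> \<exists>N. \<forall>m\<ge>N. \<forall>n\<ge>N. induced_dist ?M ?S (X m) (X n) < ereal e" for X
  proof -
    obtain P where P: "P \<in> Pos" "(\<lambda>n. coset_gram (X n)) \<longlonglongrightarrow> P"
      using Cauchy_limit_Pos[OF S X C] by blast
    obtain z where z: "z \<in> SUstar" "gram z = P" using gram_surj[OF P(1)] by blast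
    have XS: "X n \<in> coset ` SUstar" "\<phi> (X n) = 0" for n using X S by auto
    have "(\<lambda>n. trace (coset_gram (X n) ** L0)) \<longlonglongrightarrow> trace (P ** L0)"
      by (rule bounded_linear.tendsto[OF bounded_linear_trace_mult P(2)])
    then have "(\<lambda>n. 0) \<longlonglongrightarrow> trace (P ** L0)" using tr[OF XS(1)] XS(2) by simp
    then have "trace (P ** L0) = 0" using LIMSEQ_unique tendsto_const by blast
    then have \<phi>l: "\<phi> (coset z) = 0" using \<phi>[OF z(1)] z(2) by simp
    have lS: "coset z \<in> ?S" using z(1) \<phi>l by (auto simp: SUstar_mod_Sp_def)
    define \<eta> where "\<eta> = xi P"
    have \<eta>: "\<eta> = xi (coset_gram (coset z))" by (simp add: \<eta>_def coset_gram z(2))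
    define \<xi> where "\<xi> n = xi (coset_gram (X n))" for n
    have "continuous_on {B :: 'n cmat. Re (trace B) > 0} xi" by (intro Cinf_continuous[OF Cinf_xi] open_trace_pos Cinf_ident) simp
    then have "isCont xi P" using PosD(5)[OF P(1)] continuous_on_eq_continuous_at[OF open_trace_pos] by blast
    then have lim: "\<xi> \<longlonglongrightarrow> \<eta>" unfolding \<xi>_def \<eta>_def by (rule isCont_tendsto_compose[OF _ P(2)])
    \<comment> \<open>The quantity under the root in the speed of a segment, as a function of
      position and direction; by continuity it is below \<open>e\<^sup>2\<close> near
      \<open>(mat 1 + \<eta>, 0)\<close>.\<close>
    define K where "K q = pmetric (unimod (fst q)) (frechet_derivative unimod (at (fst q)) (snd q)) (frechet_derivative unimod (at (fst q)) (snd q))" for q :: "'n cmat \<times> 'n cmat"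
    let ?D = "{A :: 'n cmat. Re (det A) > 0}"
    have CU: "Cinf ?D unimod" by (intro Cinf_unimod open_det_pos Cinf_ident) auto
    have oD: "open (?D \<times> (UNIV :: 'n cmat set))" by (intro open_Times open_det_pos open_UNIV)
    have c1: "Cinf (?D \<times> (UNIV :: 'n cmat set)) (\<lambda>q. fst q)" "Cinf (?D \<times> (UNIV :: 'n cmat set)) (\<lambda>q. snd q)"
      by (rule Cinf_linear[OF _ oD], simp add: linear_iff)+
    have "continuous_on (?D \<times> (UNIV :: 'n cmat set)) (\<lambda>q. unimod (fst q))"
      by (rule Cinf_continuous[OF Cinf_compose[OF oD open_det_pos CU c1(1)]]) auto
    moreover have "continuous_on (?D \<times> (UNIV :: 'n cmat set)) (\<lambda>q. frechet_derivative unimod (at (fst q)) (snd q))"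
      by (rule Cinf_continuous[OF Cinf_frechet_apply[OF oD open_det_pos CU c1(1) _ c1(2)]]) auto
    moreover have "det (unimod (fst q)) \<noteq> 0" if "q \<in> ?D \<times> UNIV" for q :: "'n cmat \<times> 'n cmat"
      using that by (auto simp: unimod_def det_scaleR)
    ultimately have cK: "continuous_on (?D \<times> UNIV) K" unfolding K_def by (intro continuous_on_pmetric)
    have d1: "Re (det (mat 1 + \<eta>)) > 0"
      using xi_cone[OF P(1)] unfolding \<eta>_def by (intro posdef_det_pos) (auto simp: cone_domain_def mat_1_add_qherm)
    then have iK: "isCont K (mat 1 + \<eta>, 0)" using cK continuous_on_eq_continuous_at[OF oD] by blast
    have "(unimod has_derivative frechet_derivative unimod (at (mat 1 + \<eta>))) (at (mat 1 + \<eta>))"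
      by (rule Cinf_has_derivative[OF CU]) (use d1 in simp)
    then have "frechet_derivative unimod (at (mat 1 + \<eta>)) 0 = 0"
      using linear_0 has_derivative_linear by blast
    then have K0: "K (mat 1 + \<eta>, 0) = 0"
      by (simp add: K_def pmetric_def tr_0 mm.zero_left mm.zero_right)
    have small: "\<forall>\<^sub>F n in sequentially. induced_dist ?M ?S (X n) (coset z) \<le> ereal e" if e: "e > 0" for e
    proof -
      obtain d where d: "d > 0" "\<And>q. dist q (mat 1 + \<eta>, 0) < d \<Longrightarrow> dist (K q) (K (mat 1 + \<eta>, 0)) < e\<^sup>2"
        using iK e unfolding continuous_at_eps_delta by (metis zero_less_power)
      have "\<forall>\<^sub>F n in sequentially. dist (\<xi> n) \<eta> < d / 2" using tendstoD[OF lim, of "d / 2"] d(1) by simp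
      then show ?thesis
      proof eventually_elim
        fix n assume n: "dist (\<xi> n) \<eta> < d / 2"
        let ?Y = "\<lambda>t. mat 1 + (\<xi> n + t *\<^sub>R (\<eta> - \<xi> n))"
        have zS: "coset z \<in> coset ` SUstar" using z(1) by blast
        obtain \<gamma> where \<gamma>: "smooth_curve ?M ?S \<gamma>" "\<gamma> 0 = X n" "\<gamma> 1 = coset z"
          "\<And>t. t \<in> {0..1} \<Longrightarrow> Re (det (?Y t)) > 0"
          "\<And>t. t \<in> {0..1} \<Longrightarrow> speed ?M \<gamma> t = sqrt (pmetric (unimod (?Y t))
            (frechet_derivative unimod (at (?Y t)) (\<eta> - \<xi> n)) (frechet_derivative unimod (at (?Y t)) (\<eta> - \<xi> n)))"
          by (rule segment_curve[OF \<phi> tr0 XS(1)[of n] XS(2)[of n] zS \<phi>l, folded \<eta> \<xi>_def])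
            (assumption, rule that, assumption, assumption, assumption, blast+)
        have \<gamma>s: "speed ?M \<gamma> t = sqrt (K (?Y t, \<eta> - \<xi> n))" if "t \<in> {0..1}" for t
          unfolding K_def fst_conv snd_conv by (rule \<gamma>(5)[OF that])
        have sp: "speed ?M \<gamma> t \<le> e" if t: "t \<in> {0..1}" for t
        proof -
          have "dist (?Y t) (mat 1 + \<eta>) = norm ((1 - t) *\<^sub>R (\<xi> n - \<eta>))"
            by (simp add: dist_norm algebra_simps)
          also have "\<dots> \<le> 1 * norm (\<xi> n - \<eta>)" unfolding norm_scaleR by (rule mult_right_mono) (use t in auto)
          finally have "dist (?Y t) (mat 1 + \<eta>) < d / 2" using n by (simp add: dist_norm)
          moreover have "dist (\<eta> - \<xi> n) 0 < d / 2" using n by (simp add: dist_norm norm_minus_commute)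
          ultimately have "dist (?Y t, \<eta> - \<xi> n) (mat 1 + \<eta>, 0) < d"
            using sqrt_sum_squares_le_sum[of "dist (?Y t) (mat 1 + \<eta>)" "dist (\<eta> - \<xi> n) 0"] by (simp add: dist_Pair_Pair)
          then have "K (?Y t, \<eta> - \<xi> n) < e\<^sup>2" using d(2) K0 by (fastforce simp: dist_real_def)
          then show ?thesis unfolding \<gamma>s[OF t] using e real_le_lsqrt[of e "K (?Y t, \<eta> - \<xi> n)"] real_sqrt_le_mono[of "K (?Y t, \<eta> - \<xi> n)" "e\<^sup>2"] by simp
        qed
        have "curve_length ?M \<gamma> \<le> e"
        proof (cases "speed ?M \<gamma> integrable_on {0..1}")
          case True
          have "integral {0..1} (speed ?M \<gamma>) \<le> integral {0..1} (\<lambda>t::real. e)" by (rule integral_le[OF True integrable_const_ivl sp])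
          then show ?thesis by (simp add: curve_length_def)
        next
          \<comment> \<open>A non-integrable function has integral 0 by convention, so the bound
            holds here as well.\<close>
          case False
          then show ?thesis using e by (simp add: curve_length_def not_integrable_integral)
        qed
        then show "induced_dist ?M ?S (X n) (coset z) \<le> ereal e"
          unfolding induced_dist_def using \<gamma>(1-3) by (intro INF_lower2[of \<gamma>]) auto
      qed
    qed
    have "(\<lambda>n. induced_dist ?M ?S (X n) (coset z)) \<longlonglongrightarrow> 0"
    proof (rule order_tendstoI)
      fix a :: ereal assume "a < 0"
      then show "\<forall>\<^sub>F n in sequentially. a < induced_dist ?M ?S (X n) (coset z)"
        using induced_dist_nonneg[OF S] less_le_trans by (intro always_eventually) blast
    next
      fix a :: ereal assume "0 < a"
      then obtain e where e: "0 < ereal e" "ereal e < a" using ereal_dense2 by blast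
      then have "\<forall>\<^sub>F n in sequentially. induced_dist ?M ?S (X n) (coset z) \<le> ereal e" by (intro small) simp
      then show "\<forall>\<^sub>F n in sequentially. induced_dist ?M ?S (X n) (coset z) < a"
        by eventually_elim (rule order.strict_trans1[OF _ e(2)])
    qed
    then show ?thesis using lS by blast
  qed
  then show ?thesis unfolding complete_submanifold_def by blast
qed

text \<open>For quaternionic z, \<open>J ** transpose z\<close> equals
  \<open>ctranspose z ** J\<close>, which assembles \<open>gram z\<close>; the rest is cyclicity of
  the trace.\<close>

lemma trace_form_conv:
  fixes a b :: "'n::finite cvec"
  assumes z: "z \<in> SUstar"
  shows "trace (outer a b ** z ** J ** transpose z) = trace (gram z ** (J ** outer a b))"
proof -
  have "outer a b ** z ** J ** transpose z = outer a b ** (gram z ** J)"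
    using quat_ctranspose_J[OF SUstar_in_quat[OF z]] by (simp add: gram_def matrix_mul_assoc[symmetric])
  then show ?thesis using trace_mul_sym[of "outer a b" "gram z ** J"] by (simp add: matrix_mul_assoc)
qed

text \<open>Moving J past \<open>ctranspose z\<close> leaves \<open>transpose z\<close> acting on
  both vectors, so rank one and independence persist at every point of the group.\<close>

lemma sandwich_outer:
  fixes a b :: "'n::finite cvec"
  assumes z: "z \<in> SUstar"
  shows "ctranspose z ** (J ** outer a b) ** z = outer (J *v (transpose z *v a)) (transpose z *v b)"
proof -
  have "ctranspose z ** (J ** outer a b) ** z = J ** (transpose z ** outer a b ** z)"
    using quat_ctranspose_J[OF SUstar_in_quat[OF z]] by (simp add: matrix_mul_assoc)
  then show ?thesis unfolding mult_outer outer_mult .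
qed

theorem theorem2p4:
  fixes a b :: "'n::finite cvec"
    and \<phi> :: "'n cmat set \<Rightarrow> complex"
  assumes "CARD('n) \<ge> 2"
    and "a \<noteq> b" and "vec.independent {a, b}"
    and "hermitian_inner (J *v cnj_vec a) b = 0"
    and "\<And>z. z \<in> SUstar \<Longrightarrow> \<phi> (coset z) = trace (outer a b ** z ** J ** transpose z)"
  shows "eigenfunction SUstar_mod_Sp \<phi> \<and>
    minimal_submanifold SUstar_mod_Sp {p \<in> points SUstar_mod_Sp. \<phi> p = 0} 2 \<and>
    complete_submanifold SUstar_mod_Sp {p \<in> points SUstar_mod_Sp. \<phi> p = 0}"
proof -
  let ?L = "J ** outer a b"
  have \<phi>: "\<phi> (coset z) = trace (gram z ** ?L)" if "z \<in> SUstar" for z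
    using assms(5)[OF that] trace_form_conv[OF that] by simp
  \<comment> \<open>The orthogonality hypothesis in another form: J is real, so conjugating the
    Hermitian product of \<open>J *v cnj_vec a\<close> and b gives the bilinear pairing of
    \<open>J *v a\<close> with b, which is the trace of \<open>J ** outer a b\<close>.\<close>
  have tr0: "trace ?L = 0"
  proof -
    have "cnj (J $ i $ j) = J $ i $ j" for i j :: "'n + 'n"
    proof -
      have "map_matrix cnj J $ i $ j = J $ i $ j" by (simp only: map_cnj_J)
      then show ?thesis by (simp add: map_matrix_def del: map_cnj_J)
    qed
    then have "cnj (hermitian_inner (J *v cnj_vec a) b) = dot (J *v a) b"
      by (simp add: hermitian_inner_def dot_def matrix_vector_mult_def cnj_vec_def)
    then show ?thesis using assms(4) by (simp add: mult_outer trace_outer)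
  qed
  have "eigenfunction SUstar_mod_Sp \<phi>"
    by (rule linear_eigenfunction[OF \<phi>]) (use sandwich_outer in blast)+
  moreover have "minimal_submanifold SUstar_mod_Sp {p \<in> points SUstar_mod_Sp. \<phi> p = 0} 2"
  proof (rule linear_minimal_submanifold[OF \<phi> _ tr0])
    fix z :: "'n cmat" assume z: "z \<in> SUstar" "trace (gram z ** ?L) = 0"
    let ?c = "J *v (transpose z *v a)" and ?e = "transpose z *v b"
    have "trace (ctranspose z ** ?L ** z) = 0"
      using trace_mul_sym[of "ctranspose z ** ?L" z] trace_mul_sym[of "gram z" ?L] trace_mul_sym[of "z ** ctranspose z" ?L] z(2)
      by (simp add: gram_def matrix_mul_assoc)
    then have "dot ?c ?e = 0" unfolding sandwich_outer[OF z(1)] trace_outer .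
    then have "pproj (outer ?c ?e) \<noteq> 0"
      using pproj_outer_nonzero[OF assms(2,3) SUstar_det(2)[OF z(1)] refl refl] by blast
    then show "\<exists>c e. ctranspose z ** ?L ** z = outer c e \<and> pproj (outer c e) \<noteq> 0" using sandwich_outer[OF z(1)] by blast
  qed
  moreover have "complete_submanifold SUstar_mod_Sp {p \<in> points SUstar_mod_Sp. \<phi> p = 0}"
    by (rule linear_complete_submanifold[OF \<phi> tr0])
  ultimately show ?thesis by blast
qed

end
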